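(* Assume that there exist constants $0<\nu_1<\nu_2$ and $0<\mu_1<\mu_2$ such that $$\nu_1|\xi|^2\le a^{ij}(x)\xi_i\xi_j\le\nu_2|\xi|^2,\qquad \mu_1|\xi|^2\le \hat a^{ij}(x)\xi_i\xi_j\le\mu_2|\xi|^2\qquad\text{for all }x,\xi\in\mathbb{R}^N,$$ and that there exists a smooth function $W_0:\mathbb{R}^N\to\mathbb{R}$ such that $$\tfrac12 D_i(a^{ij}D_jW_0)+\tfrac12\hat a^{ij}D_iW_0D_jW_0+b\cdot\nabla W_0+V\to-\infty\quad\text{as }|x|\to\infty .$$ Let $(W,\Lambda)$, with $W:\mathbb{R}^N\to\mathbb{R}$ smooth and $\Lambda\in\mathbb{R}$, satisfy $$\tfrac12 D_i(a^{ij}D_jW)+\tfrac12\hat a^{ij}D_iWD_jW+b\cdot\nabla W+V=\Lambda\quad\text{in }\mathbb{R}^N ,$$ and let $\{X_t\}$ be the diffusion process (up to its explosion time) solving $$dX_t=(\tilde b(X_t)+\hat a\nabla W(X_t))\,dt+\sigma(X_t)\,dB_t,\qquad X_0=x .$$ If $\Lambda>\Lambda^*$, then $\{X_t\}$ is transient.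
   Context: $D_i=\partial/\partial x_i$, and repeated indices are summed over $1,\dots,N$. $a(x)=[a^{ij}(x)]$ and $\hat a(x)=[\hat a^{ij}(x)]$ are symmetric $N\times N$ matrix-valued functions on $\mathbb{R}^N$, $b:\mathbb{R}^N\to\mathbb{R}^N$, $V:\mathbb{R}^N\to\mathbb{R}$. Standing assumption: $a^{ij},\hat a^{ij},b,V$ are sufficiently smooth (this may be read as $C^\infty$). $\tilde b^i(x)=b^i(x)+\tfrac12D_ja^{ij}(x)$, $\sigma(x)=a(x)^{1/2}$, and $\{B_t\}$ is an $N$-dimensional Brownian motion on a filtered probability space. $\Lambda^*$ denotes the smallest $\Lambda\in\mathbb{R}$ for which $\tfrac12 D_i(a^{ij}D_jW)+\tfrac12\hat a^{ij}D_iWD_jW+b\cdot\nabla W+V=\Lambda$ has a smooth solution $W$ on $\mathbb{R}^N$; under the stated hypotheses it exists and is finite. The process may explode in finite time; transience is in the usual sense for nondegenerate diffusions (possibly with explosion): almost surely the process eventually leaves every compact set for good as $t$ tends to its lifetime. *)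

theory Defs
  imports "HOL-Probability.Probability"
begin

section \<open>Smooth functions and the differential operator\<close>

definition pd :: "'n::finite \<Rightarrow> (real^'n \<Rightarrow> real) \<Rightarrow> real^'n \<Rightarrow> real" where
  "pd i f x = frechet_derivative f (at x) (axis i 1)"

definition grad :: "(real^'n::finite \<Rightarrow> real) \<Rightarrow> real^'n \<Rightarrow> real^'n" where
  "grad f x = (\<chi> i. pd i f x)"

primrec Ck :: "nat \<Rightarrow> (real^'n::finite \<Rightarrow> real) \<Rightarrow> bool" where
  "Ck 0 = (\<lambda>f. continuous_on UNIV f)"
| "Ck (Suc k) = (\<lambda>f. (\<forall>x. f differentiable (at x)) \<and> (\<forall>i. Ck k (pd i f)))"

definition smooth :: "(real^'n::finite \<Rightarrow> real) \<Rightarrow> bool" where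
  "smooth f \<longleftrightarrow> (\<forall>k. Ck k f)"

text \<open>The value at \<open>x\<close> of
  \<open>1/2 D_i (a^ij D_j W) + 1/2 ah^ij D_i W D_j W + b . grad W + V\<close>;
  here \<open>ah\<close> stands for the matrix field written a-hat.\<close>

definition ergodic_op ::
  "(real^'n::finite \<Rightarrow> real^'n^'n) \<Rightarrow> (real^'n \<Rightarrow> real^'n^'n) \<Rightarrow> (real^'n \<Rightarrow> real^'n)
    \<Rightarrow> (real^'n \<Rightarrow> real) \<Rightarrow> (real^'n \<Rightarrow> real) \<Rightarrow> real^'n \<Rightarrow> real" where
  "ergodic_op a ah b V W x =
     (1/2) * (\<Sum>i\<in>UNIV. pd i (\<lambda>y. \<Sum>j\<in>UNIV. a y $ i $ j * pd j W y) x)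
   + (1/2) * (\<Sum>i\<in>UNIV. \<Sum>j\<in>UNIV. ah x $ i $ j * pd i W x * pd j W x)
   + b x \<bullet> grad W x + V x"

definition ergodic_solution ::
  "(real^'n::finite \<Rightarrow> real^'n^'n) \<Rightarrow> (real^'n \<Rightarrow> real^'n^'n) \<Rightarrow> (real^'n \<Rightarrow> real^'n)
    \<Rightarrow> (real^'n \<Rightarrow> real) \<Rightarrow> (real^'n \<Rightarrow> real) \<Rightarrow> real \<Rightarrow> bool" where
  "ergodic_solution a ah b V W L \<longleftrightarrow> smooth W \<and> (\<forall>x. ergodic_op a ah b V W x = L)"

definition is_critical_value ::
  "(real^'n::finite \<Rightarrow> real^'n^'n) \<Rightarrow> (real^'n \<Rightarrow> real^'n^'n) \<Rightarrow> (real^'n \<Rightarrow> real^'n)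
    \<Rightarrow> (real^'n \<Rightarrow> real) \<Rightarrow> real \<Rightarrow> bool" where
  "is_critical_value a ah b V Ls \<longleftrightarrow>
     (\<exists>W. ergodic_solution a ah b V W Ls) \<and>
     (\<forall>L. (\<exists>W. ergodic_solution a ah b V W L) \<longrightarrow> Ls \<le> L)"

definition btilde ::
  "(real^'n::finite \<Rightarrow> real^'n^'n) \<Rightarrow> (real^'n \<Rightarrow> real^'n) \<Rightarrow> real^'n \<Rightarrow> real^'n" where
  "btilde a b x = (\<chi> i. b x $ i + (1/2) * (\<Sum>j\<in>UNIV. pd j (\<lambda>y. a y $ i $ j) x))"

definition is_psd_sqrt :: "real^'n::finite^'n \<Rightarrow> real^'n^'n \<Rightarrow> bool" where
  "is_psd_sqrt A S \<longleftrightarrow> transpose S = S \<and> (\<forall>\<xi>. 0 \<le> \<xi> \<bullet> (S *v \<xi>)) \<and> S ** S = A"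


section \<open>Brownian motion and the Ito integral\<close>

text \<open>Time is a real number and only \<open>t \<ge> 0\<close> matters; a filtration indexed by
  \<open>[0,\<infinity>)\<close> is extended to negative times by \<open>F t = F 0\<close>.\<close>

definition filtered_prob_space :: "'w measure \<Rightarrow> (real \<Rightarrow> 'w measure) \<Rightarrow> bool" where
  "filtered_prob_space M F \<longleftrightarrow>
     prob_space M \<and> filtration (space M) F \<and> (\<forall>t. subalgebra M (F t))"

definition brownian_motion ::
  "'w measure \<Rightarrow> (real \<Rightarrow> 'w measure) \<Rightarrow> (real \<Rightarrow> 'w \<Rightarrow> real^'n::finite) \<Rightarrow> bool" where
  "brownian_motion M F B \<longleftrightarrow>
     (\<forall>t\<ge>0. B t \<in> borel_measurable (F t)) \<and>
     (AE \<omega> in M. B 0 \<omega> = 0) \<and>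
     (AE \<omega> in M. continuous_on {0..} (\<lambda>t. B t \<omega>)) \<and>
     (\<forall>s t. 0 \<le> s \<longrightarrow> s < t \<longrightarrow>
        prob_space.indep_set M (sets (F s))
          {(\<lambda>\<omega>. B t \<omega> - B s \<omega>) -` A \<inter> space M | A. A \<in> sets borel} \<and>
        distributed M lborel (\<lambda>\<omega>. B t \<omega> - B s \<omega>)
          (\<lambda>y. ennreal (\<Prod>i\<in>UNIV. normal_density 0 (sqrt (t - s)) (y $ i))))"

definition progressive_upto ::
  "(real \<Rightarrow> 'w measure) \<Rightarrow> real \<Rightarrow> (real \<Rightarrow> 'w \<Rightarrow> 'b::topological_space) \<Rightarrow> bool" where
  "progressive_upto F T H \<longleftrightarrow>
     (\<forall>t\<in>{0..T}. (\<lambda>(s, \<omega>). H s \<omega>) \<in> borel_measurable (restrict_space borel {0..t} \<Otimes>\<^sub>M F t))"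

definition tends_to_0_in_prob :: "'w measure \<Rightarrow> (nat \<Rightarrow> 'w \<Rightarrow> ennreal) \<Rightarrow> bool" where
  "tends_to_0_in_prob M Z \<longleftrightarrow>
     (\<forall>k. Z k \<in> borel_measurable M) \<and>
     (\<forall>\<epsilon>>0. (\<lambda>k. measure M {\<omega> \<in> space M. ennreal \<epsilon> < Z k \<omega>}) \<longlonglongrightarrow> 0)"

text \<open>A triple \<open>m, p, \<eta>\<close> encodes the simple integrand
  \<open>\<Sum>i<m. 1_(p i, p (i+1)] \<eta> i\<close>.\<close>

definition simple_integrand ::
  "(real \<Rightarrow> 'w measure) \<Rightarrow> nat \<Rightarrow> (nat \<Rightarrow> real) \<Rightarrow> (nat \<Rightarrow> 'w \<Rightarrow> real^'n::finite^'n) \<Rightarrow> bool" where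
  "simple_integrand F m p \<eta> \<longleftrightarrow> 0 \<le> p 0 \<and>
     (\<forall>i<m. p i \<le> p (Suc i) \<and> \<eta> i \<in> borel_measurable (F (p i)) \<and>
        (\<exists>C. \<forall>\<omega>\<in>space (F (p i)). norm (\<eta> i \<omega>) \<le> C))"

definition simple_value ::
  "nat \<Rightarrow> (nat \<Rightarrow> real) \<Rightarrow> (nat \<Rightarrow> 'w \<Rightarrow> real^'n::finite^'n) \<Rightarrow> real \<Rightarrow> 'w \<Rightarrow> real^'n^'n" where
  "simple_value m p \<eta> s \<omega> = (\<Sum>i<m. indicator {p i<..p (Suc i)} s *\<^sub>R \<eta> i \<omega>)"

definition simple_integral ::
  "nat \<Rightarrow> (nat \<Rightarrow> real) \<Rightarrow> (nat \<Rightarrow> 'w \<Rightarrow> real^'n::finite^'n)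
    \<Rightarrow> (real \<Rightarrow> 'w \<Rightarrow> real^'n) \<Rightarrow> real \<Rightarrow> 'w \<Rightarrow> real^'n" where
  "simple_integral m p \<eta> B t \<omega> =
     (\<Sum>i<m. \<eta> i \<omega> *v (B (min (p (Suc i)) t) \<omega> - B (min (p i) t) \<omega>))"

text \<open>\<open>has_ito_integral M F B H t Y\<close>: the Ito integral of the progressively measurable
  integrand \<open>H\<close> over \<open>[0,t]\<close> exists and equals \<open>Y\<close> almost surely. This is the extension
  of the integral from simple integrands to integrands that are almost surely
  square integrable in time.\<close>

definition has_ito_integral ::
  "'w measure \<Rightarrow> (real \<Rightarrow> 'w measure) \<Rightarrow> (real \<Rightarrow> 'w \<Rightarrow> real^'n::finite)
    \<Rightarrow> (real \<Rightarrow> 'w \<Rightarrow> real^'n^'n) \<Rightarrow> real \<Rightarrow> ('w \<Rightarrow> real^'n) \<Rightarrow> bool" where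
  "has_ito_integral M F B H t Y \<longleftrightarrow>
     progressive_upto F t H \<and> Y \<in> borel_measurable M \<and>
     (\<exists>m p \<eta>. (\<forall>k. simple_integrand F (m k) (p k) (\<eta> k)) \<and>
        tends_to_0_in_prob M (\<lambda>k \<omega>. \<integral>\<^sup>+s\<in>{0..t}.
           ennreal ((norm (simple_value (m k) (p k) (\<eta> k) s \<omega> - H s \<omega>))\<^sup>2) \<partial>lborel) \<and>
        tends_to_0_in_prob M (\<lambda>k \<omega>.
           ennreal (norm (simple_integral (m k) (p k) (\<eta> k) B t \<omega> - Y \<omega>))))"


section \<open>Diffusions up to explosion\<close>

text \<open>A process with lifetime \<open>\<zeta>\<close> is a total function \<open>X\<close> whose values \<open>X t \<omega>\<close> with
  \<open>t \<ge> \<zeta> \<omega>\<close> are irrelevant. The exit time from the open ball of radius \<open>n\<close> is \<open>\<infinity>\<close>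
  when the ball is not left before the lifetime.\<close>

definition exit_time ::
  "(real \<Rightarrow> 'w \<Rightarrow> real^'n::finite) \<Rightarrow> ('w \<Rightarrow> ereal) \<Rightarrow> nat \<Rightarrow> 'w \<Rightarrow> ereal" where
  "exit_time X \<zeta> n \<omega> = Inf {ereal t | t. 0 \<le> t \<and> ereal t < \<zeta> \<omega> \<and> real n \<le> norm (X t \<omega>)}"

text \<open>The condition \<open>\<zeta> = (SUP n. exit_time X \<zeta> n)\<close> makes \<open>\<zeta>\<close> the explosion time: it forces
  \<open>\<zeta> > 0\<close> and, when \<open>\<zeta>\<close> is finite, unboundedness of the path on \<open>[0,\<zeta>)\<close>; it holds
  automatically when \<open>\<zeta> = \<infinity>\<close>. The equation is imposed up to each exit time \<open>S n\<close>:
  \<open>X (t \<and> S n) = x + \<integral>_0^(t \<and> S n) \<beta>(X s) ds + \<integral>_0^t 1_{s \<le> S n} \<sigma>(X s) dB s\<close>.\<close>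

definition sde_solution ::
  "'w measure \<Rightarrow> (real \<Rightarrow> 'w measure) \<Rightarrow> (real \<Rightarrow> 'w \<Rightarrow> real^'n::finite)
    \<Rightarrow> (real^'n \<Rightarrow> real^'n) \<Rightarrow> (real^'n \<Rightarrow> real^'n^'n) \<Rightarrow> real^'n
    \<Rightarrow> (real \<Rightarrow> 'w \<Rightarrow> real^'n) \<Rightarrow> ('w \<Rightarrow> ereal) \<Rightarrow> bool" where
  "sde_solution M F B \<beta> \<sigma> x X \<zeta> \<longleftrightarrow>
     (\<forall>t\<ge>0. \<forall>A\<in>sets borel. {\<omega> \<in> space M. ereal t < \<zeta> \<omega> \<and> X t \<omega> \<in> A} \<in> sets (F t)) \<and>
     (\<forall>\<omega>\<in>space M. continuous_on {t. 0 \<le> t \<and> ereal t < \<zeta> \<omega>} (\<lambda>t. X t \<omega>)) \<and>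
     (\<forall>\<omega>\<in>space M. \<zeta> \<omega> = (SUP n. exit_time X \<zeta> n \<omega>)) \<and>
     (AE \<omega> in M. X 0 \<omega> = x) \<and>
     (\<forall>n. \<forall>t\<ge>0. has_ito_integral M F B
        (\<lambda>s \<omega>. if ereal s \<le> exit_time X \<zeta> n \<omega> then \<sigma> (X s \<omega>) else 0) t
        (\<lambda>\<omega>. let u = real_of_ereal (min (ereal t) (exit_time X \<zeta> n \<omega>))
              in X u \<omega> - x - (LINT s:{0..u}|lborel. \<beta> (X s \<omega>))))"

definition transient ::
  "'w measure \<Rightarrow> (real \<Rightarrow> 'w \<Rightarrow> real^'n::finite) \<Rightarrow> ('w \<Rightarrow> ereal) \<Rightarrow> bool" where
  "transient M X \<zeta> \<longleftrightarrow>
     (AE \<omega> in M. \<forall>K. compact K \<longrightarrow>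
        (\<exists>T\<ge>0. ereal T < \<zeta> \<omega> \<and> (\<forall>t\<ge>T. ereal t < \<zeta> \<omega> \<longrightarrow> X t \<omega> \<notin> K)))"

end

theory Submission
  imports Defs
begin

text \<open>Let \<open>W'\<close> solve the equation with the critical constant \<open>\<Lambda>'\<close>, put \<open>\<phi> = W' - W\<close> and let \<open>L\<close> be the generator of
  \<open>X\<close>. Subtracting the two equations gives \<open>L \<phi> + 1/2 ah(\<nabla>\<phi>, \<nabla>\<phi>) = -(\<Lambda> - \<Lambda>')\<close>, so with \<open>c = \<mu>1 / \<nu>2\<close>
  the positive function \<open>u = exp (c \<phi>)\<close> satisfies \<open>L u \<le> - \<kappa> u\<close>, \<open>\<kappa> = c (\<Lambda> - \<Lambda>') > 0\<close>.
  By Dynkin's formula the expectation of \<open>\<integral> \<kappa> u(X) dt\<close> over the lifetime is at most \<open>u x\<close>; hence a path of infinite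
  lifetime cannot stay in a bounded set. A bump function \<open>f\<close> supported in a ball has \<open>L f \<le> q \<kappa> u\<close> for large \<open>q\<close>,
  so \<open>f(X) + q u(X)\<close> and \<open>q u(X)\<close> are nonnegative supermartingales and \<open>f(X)\<close> upcrosses a given interval only
  finitely often almost surely. A path that keeps returning to a smaller ball would therefore end up trapped in the
  support of \<open>f\<close>, thus have infinite lifetime and infinite occupation integral.\<close>

section \<open>Gaussian moments and Brownian increments\<close>

text \<open>\<open>X\<close> is given only through integrals that are limits in probability, with no
  bounds or moments at hand. Everything is therefore done for the path stopped at its exit from a
  ball: there the drift is bounded, the stochastic integral upgrades to mean square, and increments
  get explicit conditional first and second moments. A second-order Taylor expansion along ever
  finer grids uses nothing else, so Dynkin's formula is reached without a pathwise Ito formula. The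
  resulting bounds do not see the radius of the ball: \<open>u\<close> is positive and starts at
  \<open>u x\<close>, so Fatou's lemma carries them up to the lifetime, whether finite or not. The
  decay of \<open>u\<close> forbids a path to stay in a ball forever, but says nothing directly
  about infinitely many returns from outside; these are handled by the bump function. Since
  \<open>L f\<close> has no definite sign, \<open>f(X)\<close> alone is no supermartingale, and a
  multiple of \<open>u\<close> pays for the positive part of \<open>L f\<close>. Doob's upcrossing
  argument then has to be run for a difference of two supermartingales.\<close>

lemma integral_prod_vec:
  fixes f :: "'n::finite \<Rightarrow> real \<Rightarrow> real"
  assumes f: "\<And>i. integrable lborel (f i)"
  shows "integrable lborel (\<lambda>y::real^'n. \<Prod>i\<in>UNIV. f i (y $ i))"
    and "integral\<^sup>L lborel (\<lambda>y::real^'n. \<Prod>i\<in>UNIV. f i (y $ i)) = (\<Prod>i\<in>UNIV. integral\<^sup>L lborel (f i))"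
proof -
  interpret product_sigma_finite "\<lambda>b::real^'n. lborel :: real measure"
    by standard
  define T :: "(real^'n \<Rightarrow> real) \<Rightarrow> real^'n" where "T g = (\<Sum>b\<in>Basis. g b *\<^sub>R b)" for g
  \<comment> \<open>\<open>lborel_eq\<close> indexes the product measure by basis vectors instead of
    coordinates; the choice operator turns a basis vector back into its coordinate, so
    \<open>h\<close> is \<open>f\<close> reindexed.\<close>
  define h where "h b = f (SOME i. b = axis i 1)" for b :: "real^'n"
  have h: "h (axis i 1) = f i" for i
  proof -
    have "(SOME j. (axis i 1 :: real^'n) = axis j 1) = i"
      by (rule some_equality) (auto simp: axis_eq_axis)
    then show ?thesis by (simp add: h_def)
  qed
  have B: "(Basis :: (real^'n) set) = (\<lambda>i. axis i 1) ` UNIV"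
    by (auto simp: Basis_vec_def)
  have inj: "inj (\<lambda>i::'n. axis i (1::real))"
    by (auto simp: inj_on_def axis_eq_axis)
  have [measurable]: "T \<in> measurable (\<Pi>\<^sub>M b\<in>Basis. lborel) borel"
    unfolding T_def by measurable
  have [measurable]: "f i \<in> borel_measurable borel" for i using f[of i] by auto
  have L: "(lborel :: (real^'n) measure) = distr (\<Pi>\<^sub>M b\<in>Basis. lborel) borel T"
    unfolding T_def by (rule lborel_eq)
  have Tc: "(\<Prod>i\<in>UNIV. f i (T g $ i)) = (\<Prod>b\<in>Basis. h b (g b))" for g
  proof -
    have "T g $ i = g (axis i 1)" for i
    proof -
      have "T g $ i = T g \<bullet> axis i 1" by (simp add: inner_axis)
      also have "\<dots> = (\<Sum>b\<in>Basis. g b *\<^sub>R b) \<bullet> axis i 1" by (simp add: T_def)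
      also have "\<dots> = g (axis i 1)"
        by (rule inner_sum_left_Basis) (auto simp: B)
      finally show ?thesis .
    qed
    then show ?thesis
      by (simp add: B prod.reindex[OF inj] h)
  qed
  have hi: "b \<in> Basis \<Longrightarrow> integrable lborel (h b)" for b
    using f by (auto simp: h B)
  show "integrable lborel (\<lambda>y::real^'n. \<Prod>i\<in>UNIV. f i (y $ i))"
    unfolding L by (subst integrable_distr_eq) (auto simp: Tc intro!: product_integrable_prod hi)
  have "integral\<^sup>L lborel (\<lambda>y::real^'n. \<Prod>i\<in>UNIV. f i (y $ i)) = integral\<^sup>L (\<Pi>\<^sub>M b\<in>Basis. lborel) (\<lambda>g. \<Prod>b\<in>Basis. h b (g b))"
    unfolding L by (subst integral_distr) (auto simp: Tc)
  also have "\<dots> = (\<Prod>b\<in>Basis. integral\<^sup>L lborel (h b))"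
    by (rule product_integral_prod) (auto intro: hi)
  also have "\<dots> = (\<Prod>i\<in>UNIV. integral\<^sup>L lborel (f i))"
    by (simp add: B prod.reindex[OF inj] h)
  finally show "integral\<^sup>L lborel (\<lambda>y::real^'n. \<Prod>i\<in>UNIV. f i (y $ i)) = (\<Prod>i\<in>UNIV. integral\<^sup>L lborel (f i))" .
qed

text \<open>The density is a product, so every moment factorises into one-dimensional Gaussian
  moments; a factor with an odd power contributes 0, which kills the mean and the off-diagonal
  covariances.\<close>

lemma gaussian_moments_vec:
  fixes D :: "'w \<Rightarrow> real^'n::finite"
  assumes D: "distributed M lborel D (\<lambda>y. ennreal (\<Prod>i\<in>UNIV. normal_density 0 r (y $ i)))" and r: "0 < r"
  shows "integrable M (\<lambda>\<omega>. D \<omega> $ k)" "(LINT \<omega>|M. D \<omega> $ k) = 0"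
    "integrable M (\<lambda>\<omega>. D \<omega> $ k * D \<omega> $ l)"
    "(LINT \<omega>|M. D \<omega> $ k * D \<omega> $ l) = (if k = l then r\<^sup>2 else 0)"
proof -
  let ?\<phi> = "normal_density 0 r"
  have p: "integrable lborel (\<lambda>x. ?\<phi> x * x ^ q)" for q
    using integrable_normal_moment[OF r, of 0 q] by simp
  have m0: "(LINT x|lborel. ?\<phi> x) = 1" using r by simp
  have m1: "(LINT x|lborel. ?\<phi> x * x) = 0"
    using integral_normal_moment_nz_1[OF r, of 0] by simp
  have m2: "(LINT x|lborel. ?\<phi> x * x\<^sup>2) = r\<^sup>2"
    using integral_normal_moment_even[OF r, of 0 1] by (simp add: fact_2)
  have nn: "0 \<le> (\<Prod>i\<in>UNIV. ?\<phi> (y $ i))" for y :: "real^'n" by (intro prod_nonneg) auto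
  \<comment> \<open>The monomial is written as a product over all coordinates with exponent 0 or 1,
    the form that \<open>integral_prod_vec\<close> can integrate; \<open>split2\<close> adds two
    such exponents, so that \<open>k = l\<close> gives exponent 2.\<close>
  have split1: "(\<Prod>i\<in>UNIV. ?\<phi> (y $ i)) * y $ k = (\<Prod>i\<in>UNIV. ?\<phi> (y $ i) * (y $ i) ^ (if i = k then 1 else 0))" for y :: "real^'n" and k
  proof -
    have "(\<Prod>i\<in>UNIV. (y $ i) ^ (if i = k then 1 else 0)) = (\<Prod>i\<in>UNIV. (if i = k then y $ i else 1))"
      by (intro prod.cong) auto
    also have "\<dots> = y $ k" by simp
    finally show ?thesis by (simp add: prod.distrib)
  qed
  have split2: "(\<Prod>i\<in>UNIV. ?\<phi> (y $ i)) * (y $ k * y $ l)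
      = (\<Prod>i\<in>UNIV. ?\<phi> (y $ i) * (y $ i) ^ ((if i = k then 1 else 0) + (if i = l then 1 else 0)))" for y :: "real^'n"
    using split1[of y k] split1[of y l]
  proof -
    have e: "(\<Prod>i\<in>UNIV. (y $ i) ^ (if i = k then 1 else 0)) = y $ k" for k
    proof -
      have "(\<Prod>i\<in>UNIV. (y $ i) ^ (if i = k then 1 else 0)) = (\<Prod>i\<in>UNIV. (if i = k then y $ i else 1))"
        by (intro prod.cong) auto
      also have "\<dots> = y $ k" by simp
      finally show ?thesis .
    qed
    show ?thesis by (simp add: power_add prod.distrib e)
  qed
  have i1: "integrable lborel (\<lambda>y. (\<Prod>i\<in>UNIV. ?\<phi> (y $ i)) * y $ k)"
    unfolding split1 by (rule integral_prod_vec(1)[OF p])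
  have "(LINT y|lborel. (\<Prod>i\<in>UNIV. ?\<phi> (y $ i)) * y $ k) = (\<Prod>i\<in>UNIV. LINT x|lborel. ?\<phi> x * x ^ (if i = k then 1 else 0))"
    unfolding split1 by (rule integral_prod_vec(2)[OF p])
  also have "\<dots> = (\<Prod>i\<in>UNIV. if i = k then 0 else 1)"
    by (intro prod.cong) (auto simp: m0 m1)
  also have "\<dots> = 0" by (simp add: prod_zero_iff)
  finally have v1: "(LINT y|lborel. (\<Prod>i\<in>UNIV. ?\<phi> (y $ i)) * y $ k) = 0" .
  have i2: "integrable lborel (\<lambda>y. (\<Prod>i\<in>UNIV. ?\<phi> (y $ i)) * (y $ k * y $ l))"
    unfolding split2 by (rule integral_prod_vec(1)[OF p])
  have "(LINT y|lborel. (\<Prod>i\<in>UNIV. ?\<phi> (y $ i)) * (y $ k * y $ l)) = (\<Prod>i\<in>UNIV. LINT x|lborel. ?\<phi> x * x ^ ((if i = k then 1 else 0) + (if i = l then 1 else 0)))"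
    unfolding split2 by (rule integral_prod_vec(2)[OF p])
  also have "\<dots> = (if k = l then r\<^sup>2 else 0)"
  proof (cases "k = l")
    case True
    have "(\<Prod>i\<in>UNIV. LINT x|lborel. ?\<phi> x * x ^ ((if i = k then 1 else 0) + (if i = l then 1 else 0))) = (\<Prod>i\<in>UNIV. if i = k then r\<^sup>2 else 1)"
      using True by (intro prod.cong) (auto simp: m0 m2 numeral_2_eq_2[symmetric])
    then show ?thesis using True by simp
  next
    case False
    have "(\<Prod>i\<in>UNIV. LINT x|lborel. ?\<phi> x * x ^ ((if i = k then 1 else 0) + (if i = l then 1 else 0))) = 0"
      using False by (intro prod_zero) (auto simp: m1 intro!: bexI[of _ k])
    then show ?thesis using False by simp
  qed
  finally have v2: "(LINT y|lborel. (\<Prod>i\<in>UNIV. ?\<phi> (y $ i)) * (y $ k * y $ l)) = (if k = l then r\<^sup>2 else 0)" .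
  show "integrable M (\<lambda>\<omega>. D \<omega> $ k)"
    using i1 distributed_integrable[OF D, of "\<lambda>y. y $ k"] nn by simp
  show "(LINT \<omega>|M. D \<omega> $ k) = 0"
    using v1 distributed_integral[OF D, of "\<lambda>y. y $ k"] nn by simp
  show "integrable M (\<lambda>\<omega>. D \<omega> $ k * D \<omega> $ l)"
    using i2 distributed_integrable[OF D, of "\<lambda>y. y $ k * y $ l"] nn by simp
  show "(LINT \<omega>|M. D \<omega> $ k * D \<omega> $ l) = (if k = l then r\<^sup>2 else 0)"
    using v2 distributed_integral[OF D, of "\<lambda>y. y $ k * y $ l"] nn by simp
qed

locale bm_space = prob_space M for M :: "'w measure" +
  fixes F :: "real \<Rightarrow> 'w measure" and B :: "real \<Rightarrow> 'w \<Rightarrow> real^'n::finite"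
  assumes filt: "filtered_prob_space M F" and bm: "brownian_motion M F B"
begin

lemma space_F [simp]: "space (F t) = space M"
  using filt by (simp add: filtered_prob_space_def filtration_def)

lemma sets_F: "A \<in> sets (F t) \<Longrightarrow> A \<in> sets M"
  using filt by (auto simp: filtered_prob_space_def subalgebra_def)

lemma sets_F_mono: "s \<le> t \<Longrightarrow> A \<in> sets (F s) \<Longrightarrow> A \<in> sets (F t)"
  using filt by (auto simp: filtered_prob_space_def filtration_def)

lemma subalg_F: "subalgebra M (F t)"
  using filt by (simp add: filtered_prob_space_def)

lemma meas_F: "f \<in> measurable (F t) N \<Longrightarrow> f \<in> measurable M N"
  by (rule measurable_from_subalg[OF subalg_F])

lemma meas_F_mono: "f \<in> measurable (F s) N \<Longrightarrow> s \<le> t \<Longrightarrow> f \<in> measurable (F t) N"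
  by (rule measurable_from_subalg[of "F t" "F s"]) (auto simp: subalgebra_def sets_F_mono)

lemma B_meas: "0 \<le> t \<Longrightarrow> B t \<in> borel_measurable (F t)"
  using bm by (simp add: brownian_motion_def)

lemma B_meas_M: "0 \<le> t \<Longrightarrow> B t \<in> borel_measurable M"
  using B_meas meas_F by blast

lemma
  assumes "0 \<le> s" "s \<le> t"
  shows increment_integrable: "integrable M (\<lambda>\<omega>. (B t \<omega> - B s \<omega>) $ k)"
    and increment_mean: "(LINT \<omega>|M. (B t \<omega> - B s \<omega>) $ k) = 0"
    and increment_integrable2: "integrable M (\<lambda>\<omega>. (B t \<omega> - B s \<omega>) $ k * (B t \<omega> - B s \<omega>) $ l)"
    and increment_cov: "(LINT \<omega>|M. (B t \<omega> - B s \<omega>) $ k * (B t \<omega> - B s \<omega>) $ l) = (if k = l then t - s else 0)"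
proof -
  have *: "integrable M (\<lambda>\<omega>. (B t \<omega> - B s \<omega>) $ k) \<and> (LINT \<omega>|M. (B t \<omega> - B s \<omega>) $ k) = 0 \<and>
    integrable M (\<lambda>\<omega>. (B t \<omega> - B s \<omega>) $ k * (B t \<omega> - B s \<omega>) $ l) \<and>
    (LINT \<omega>|M. (B t \<omega> - B s \<omega>) $ k * (B t \<omega> - B s \<omega>) $ l) = (if k = l then t - s else 0)"
  proof (cases "s = t")
    case False
    then have "distributed M lborel (\<lambda>\<omega>. B t \<omega> - B s \<omega>)
          (\<lambda>y. ennreal (\<Prod>i\<in>UNIV. normal_density 0 (sqrt (t - s)) (y $ i)))" "0 < sqrt (t - s)"
      using assms bm by (auto simp: brownian_motion_def)
    from gaussian_moments_vec(1,2)[OF this, of k] gaussian_moments_vec(3,4)[OF this, of k l] False assms show ?thesis by simp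
  qed simp
  then show "integrable M (\<lambda>\<omega>. (B t \<omega> - B s \<omega>) $ k)" "(LINT \<omega>|M. (B t \<omega> - B s \<omega>) $ k) = 0"
    "integrable M (\<lambda>\<omega>. (B t \<omega> - B s \<omega>) $ k * (B t \<omega> - B s \<omega>) $ l)"
    "(LINT \<omega>|M. (B t \<omega> - B s \<omega>) $ k * (B t \<omega> - B s \<omega>) $ l) = (if k = l then t - s else 0)" by auto
qed

text \<open>Independence of \<open>F s\<close> from the later increment, recast as a product rule
  for expectations; the moment computations with random weights rest on it. The case
  \<open>s = t\<close> is separate because \<open>brownian_motion\<close> speaks of
  \<open>s < t\<close> only.\<close>

lemma increment_indep:
  fixes \<xi> :: "'w \<Rightarrow> real" and \<phi> :: "real^'n \<Rightarrow> real"
  assumes st: "0 \<le> s" "s \<le> t" and \<xi>: "\<xi> \<in> borel_measurable (F s)" "integrable M \<xi>"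
    and [measurable]: "\<phi> \<in> borel_measurable borel" and i: "integrable M (\<lambda>\<omega>. \<phi> (B t \<omega> - B s \<omega>))"
  shows "integrable M (\<lambda>\<omega>. \<xi> \<omega> * \<phi> (B t \<omega> - B s \<omega>))"
    and "(LINT \<omega>|M. \<xi> \<omega> * \<phi> (B t \<omega> - B s \<omega>)) = (LINT \<omega>|M. \<xi> \<omega>) * (LINT \<omega>|M. \<phi> (B t \<omega> - B s \<omega>))"
proof -
  have "integrable M (\<lambda>\<omega>. \<xi> \<omega> * \<phi> (B t \<omega> - B s \<omega>)) \<and>
    (LINT \<omega>|M. \<xi> \<omega> * \<phi> (B t \<omega> - B s \<omega>)) = (LINT \<omega>|M. \<xi> \<omega>) * (LINT \<omega>|M. \<phi> (B t \<omega> - B s \<omega>))"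
  proof (cases "s = t")
    case True
    then show ?thesis using \<xi> by (simp add: prob_space)
  next
    case False
    let ?D = "\<lambda>\<omega>. B t \<omega> - B s \<omega>"
    let ?S = "{?D -` A \<inter> space M | A. A \<in> sets borel}"
    have ind: "indep_set (sets (F s)) ?S"
      using False st bm by (auto simp: brownian_motion_def)
    have [measurable]: "\<xi> \<in> borel_measurable M" using \<xi> by auto
    have [measurable]: "?D \<in> borel_measurable M" using B_meas_M st by auto
    have "indep_var borel \<xi> borel (\<lambda>\<omega>. \<phi> (?D \<omega>))"
      unfolding indep_var_eq
    proof (intro conjI)
      have 1: "sigma_sets (space M) {\<xi> -` A \<inter> space M |A. A \<in> sets borel} \<subseteq> sets (F s)"
        using measurable_sets[OF \<xi>(1)] sets.sigma_sets_subset[of "{\<xi> -` A \<inter> space M |A. A \<in> sets borel}" "F s"] by auto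
      \<comment> \<open>The preimages of Borel sets under the increment already form a
        \<sigma>-algebra, so the \<sigma>-algebra generated by \<open>\<phi>\<close> of the
        increment stays inside \<open>?S\<close>, the system whose independence is assumed.\<close>
      have V: "?S = sets (vimage_algebra (space M) ?D borel)"
        by (subst sets_vimage_algebra2) auto
      have "{(\<lambda>\<omega>. \<phi> (?D \<omega>)) -` A \<inter> space M |A. A \<in> sets borel} \<subseteq> ?S"
      proof clarify
        fix A :: "real set" assume "A \<in> sets borel"
        then have "\<phi> -` A \<in> sets borel" using measurable_sets[of \<phi> borel borel A] by simp
        moreover have "(\<lambda>\<omega>. \<phi> (?D \<omega>)) -` A \<inter> space M = ?D -` (\<phi> -` A) \<inter> space M" by auto
        ultimately show "\<exists>Aa. (\<lambda>\<omega>. \<phi> (?D \<omega>)) -` A \<inter> space M = ?D -` Aa \<inter> space M \<and> Aa \<in> sets borel" by blast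
      qed
      then have 2: "sigma_sets (space M) {(\<lambda>\<omega>. \<phi> (?D \<omega>)) -` A \<inter> space M |A. A \<in> sets borel} \<subseteq> ?S"
        using sets.sigma_sets_subset[of "{(\<lambda>\<omega>. \<phi> (?D \<omega>)) -` A \<inter> space M |A. A \<in> sets borel}" "vimage_algebra (space M) ?D borel"]
        unfolding V by simp
      show "indep_set (sigma_sets (space M) {\<xi> -` A \<inter> space M |A. A \<in> sets borel})
         (sigma_sets (space M) {(\<lambda>\<omega>. \<phi> (?D \<omega>)) -` A \<inter> space M |A. A \<in> sets borel})"
        using ind 1 2 unfolding indep_set_def
        by (elim indep_sets_mono_sets) (auto split: bool.split)
    qed auto
    from indep_var_integrable[OF this \<xi>(2) i] indep_var_lebesgue_integral[OF this \<xi>(2) i]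
    show ?thesis by simp
  qed
  then show "integrable M (\<lambda>\<omega>. \<xi> \<omega> * \<phi> (B t \<omega> - B s \<omega>))"
    and "(LINT \<omega>|M. \<xi> \<omega> * \<phi> (B t \<omega> - B s \<omega>)) = (LINT \<omega>|M. \<xi> \<omega>) * (LINT \<omega>|M. \<phi> (B t \<omega> - B s \<omega>))" by auto
qed

end

section \<open>Convergence in mean square\<close>

text \<open>One notion for two spaces: random variables on \<open>M\<close>, and integrands on the
  product of \<open>M\<close> with Lebesgue time. The Ito isometry compares the two.\<close>

definition l2 :: "'a measure \<Rightarrow> ('a \<Rightarrow> 'b::euclidean_space) \<Rightarrow> bool" where
  "l2 N f \<longleftrightarrow> f \<in> borel_measurable N \<and> integrable N (\<lambda>x. (norm (f x))\<^sup>2)"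

lemma borel_measurable_vec_nth [measurable (raw)]:
  fixes f :: "'a \<Rightarrow> real^'n::finite"
  assumes "f \<in> borel_measurable N" shows "(\<lambda>x. f x $ k) \<in> borel_measurable N"
  using borel_measurable_inner[OF assms borel_measurable_const, of "axis k 1"] by (simp add: inner_axis)

lemma integral_sum_sum:
  fixes f :: "'i \<Rightarrow> 'j \<Rightarrow> 'a \<Rightarrow> real"
  assumes "\<And>k l. integrable N (f k l)"
  shows "(LINT x|N. (\<Sum>k\<in>A. \<Sum>l\<in>A'. f k l x)) = (\<Sum>k\<in>A. \<Sum>l\<in>A'. LINT x|N. f k l x)"
  using assms by simp

lemma l2_measurable: "l2 N f \<Longrightarrow> f \<in> borel_measurable N"
  by (simp add: l2_def)

lemma l2_dominated:
  fixes f :: "'a \<Rightarrow> 'b::euclidean_space" and g :: "'a \<Rightarrow> real"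
  assumes [measurable]: "f \<in> borel_measurable N" and g: "integrable N g"
    and le: "AE x in N. (norm (f x))\<^sup>2 \<le> g x"
  shows "l2 N f"
  unfolding l2_def
proof
  show "integrable N (\<lambda>x. (norm (f x))\<^sup>2)"
    by (rule Bochner_Integration.integrable_bound[OF g]) (use le in auto)
qed simp

lemma l2_inner:
  assumes "l2 N f" "l2 N g"
  shows "integrable N (\<lambda>x. f x \<bullet> g x)"
proof -
  have [measurable]: "f \<in> borel_measurable N" "g \<in> borel_measurable N" using assms by (auto simp: l2_def)
  have "integrable N (\<lambda>x. (norm (f x))\<^sup>2 + (norm (g x))\<^sup>2)" using assms by (auto simp: l2_def)
  then show ?thesis
  proof (rule Bochner_Integration.integrable_bound)
    show "AE x in N. norm (f x \<bullet> g x) \<le> norm ((norm (f x))\<^sup>2 + (norm (g x))\<^sup>2)"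
    proof (intro AE_I2)
      fix x
      have "\<bar>f x \<bullet> g x\<bar> \<le> norm (f x) * norm (g x)" by (rule Cauchy_Schwarz_ineq2)
      also have "\<dots> \<le> (norm (f x))\<^sup>2 + (norm (g x))\<^sup>2"
        using sum_squares_bound[of "norm (f x)" "norm (g x)"] zero_le_power2[of "norm (f x)"] zero_le_power2[of "norm (g x)"]
          mult_nonneg_nonneg[OF norm_ge_zero norm_ge_zero, of "f x" "g x"] by linarith
      finally show "norm (f x \<bullet> g x) \<le> norm ((norm (f x))\<^sup>2 + (norm (g x))\<^sup>2)" by simp
    qed
  qed simp
qed

lemma l2_add:
  assumes "l2 N f" "l2 N g" shows "l2 N (\<lambda>x. f x + g x)"
proof -
  have [measurable]: "f \<in> borel_measurable N" "g \<in> borel_measurable N" using assms by (auto simp: l2_def)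
  have "integrable N (\<lambda>x. (norm (f x))\<^sup>2 + 2 * (f x \<bullet> g x) + (norm (g x))\<^sup>2)"
    using assms l2_inner[OF assms] by (auto simp: l2_def)
  then show ?thesis
    by (rule l2_dominated[rotated]) (auto simp: power2_norm_eq_inner inner_add_left inner_add_right inner_commute)
qed

lemma l2_scaleR:
  assumes "l2 N f" and [measurable]: "c \<in> borel_measurable N" and "AE x in N. \<bar>c x\<bar> \<le> C"
  shows "l2 N (\<lambda>x. c x *\<^sub>R f x)"
proof -
  have [measurable]: "f \<in> borel_measurable N" using assms by (auto simp: l2_def)
  have "integrable N (\<lambda>x. C\<^sup>2 * (norm (f x))\<^sup>2)" using assms by (auto simp: l2_def)
  then show ?thesis
  proof (rule l2_dominated[rotated])
    show "AE x in N. (norm (c x *\<^sub>R f x))\<^sup>2 \<le> C\<^sup>2 * (norm (f x))\<^sup>2"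
      using assms(3) by eventually_elim (auto simp: power_mult_distrib intro!: mult_right_mono abs_le_square_iff[THEN iffD1])
  qed simp
qed

lemma l2_minus: "l2 N f \<Longrightarrow> l2 N (\<lambda>x. - f x)"
  by (simp add: l2_def)

lemma l2_diff: "l2 N f \<Longrightarrow> l2 N g \<Longrightarrow> l2 N (\<lambda>x. f x - g x)"
  using l2_add[OF _ l2_minus, of N f g] by simp

lemma l2_norm: "l2 N f \<Longrightarrow> integrable N (\<lambda>x. (norm (f x))\<^sup>2)"
  by (simp add: l2_def)

text \<open>The mean of the squared norm of \<open>f + t g\<close> is a nonnegative quadratic
  polynomial in \<open>t\<close>, so its discriminant is not positive.\<close>

lemma l2_Cauchy_Schwarz:
  assumes f: "l2 N f" and g: "l2 N g"
  shows "\<bar>LINT x|N. f x \<bullet> g x\<bar> \<le> sqrt (LINT x|N. (norm (f x))\<^sup>2) * sqrt (LINT x|N. (norm (g x))\<^sup>2)"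
proof -
  define A where "A = (LINT x|N. (norm (f x))\<^sup>2)"
  define C where "C = (LINT x|N. (norm (g x))\<^sup>2)"
  define b where "b = (LINT x|N. f x \<bullet> g x)"
  have C0: "0 \<le> C" unfolding C_def by auto
  have q: "0 \<le> A + 2 * t * b + t\<^sup>2 * C" for t
  proof -
    have "0 \<le> (LINT x|N. (norm (f x + t *\<^sub>R g x))\<^sup>2)" by simp
    also have "\<dots> = (LINT x|N. (norm (f x))\<^sup>2 + 2 * t * (f x \<bullet> g x) + t\<^sup>2 * (norm (g x))\<^sup>2)"
      by (intro Bochner_Integration.integral_cong refl) (simp add: power2_norm_eq_inner inner_add_left inner_add_right inner_commute algebra_simps power2_eq_square[of t])
    also have "\<dots> = A + 2 * t * b + t\<^sup>2 * C"
      using l2_norm[OF f] l2_norm[OF g] l2_inner[OF f g] by (simp add: A_def b_def C_def)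
    finally show ?thesis .
  qed
  have "b\<^sup>2 \<le> A * C"
  proof (cases "C = 0")
    case True
    have "b = 0"
    proof (rule ccontr)
      assume "b \<noteq> 0"
      \<comment> \<open>With \<open>C = 0\<close> the polynomial is affine, and this
        \<open>t\<close> would give it the value -1.\<close>
      with q[of "- (A + 1) / (2 * b)"] True show False by (simp add: field_simps)
    qed
    then show ?thesis using True by simp
  next
    case False
    then have "0 < C" using C0 by simp
    \<comment> \<open>The minimiser of the quadratic polynomial.\<close>
    with q[of "- b / C"] have "0 \<le> A - b\<^sup>2 / C" by (simp add: power2_eq_square)
    with \<open>0 < C\<close> show ?thesis by (simp add: field_simps)
  qed
  then have "\<bar>b\<bar> \<le> sqrt (A * C)"
    using real_le_rsqrt real_sqrt_le_mono by fastforce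
  then show ?thesis by (simp add: A_def C_def b_def real_sqrt_mult)
qed

definition l2lim :: "'a measure \<Rightarrow> (nat \<Rightarrow> 'a \<Rightarrow> 'b::euclidean_space) \<Rightarrow> ('a \<Rightarrow> 'b) \<Rightarrow> bool" where
  "l2lim N f g \<longleftrightarrow> (\<forall>k. l2 N (f k)) \<and> l2 N g \<and> (\<lambda>k. LINT x|N. (norm (f k x - g x))\<^sup>2) \<longlonglongrightarrow> 0"

text \<open>This is what lets the isometry pass to the limit. The error splits into one product of
  two small terms and two products of a small term with a fixed one, each controlled by
  Cauchy-Schwarz.\<close>

lemma l2lim_inner:
  assumes f: "l2lim N f f'" and g: "l2lim N g g'"
  shows "(\<lambda>k. LINT x|N. f k x \<bullet> g k x) \<longlonglongrightarrow> (LINT x|N. f' x \<bullet> g' x)"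
proof -
  have l: "l2 N (f k)" "l2 N f'" "l2 N (g k)" "l2 N g'" for k using f g by (auto simp: l2lim_def)
  let ?a = "\<lambda>k. LINT x|N. (norm (f k x - f' x))\<^sup>2"
  let ?b = "\<lambda>k. LINT x|N. (norm (g k x - g' x))\<^sup>2"
  let ?A = "LINT x|N. (norm (f' x))\<^sup>2"
  let ?B = "LINT x|N. (norm (g' x))\<^sup>2"
  have lim: "?a \<longlonglongrightarrow> 0" "?b \<longlonglongrightarrow> 0" using f g by (auto simp: l2lim_def)
  have "(\<lambda>k. (LINT x|N. f k x \<bullet> g k x) - (LINT x|N. f' x \<bullet> g' x)) \<longlonglongrightarrow> 0"
  proof (rule Lim_null_comparison)
    show "\<forall>\<^sub>F k in sequentially. norm ((LINT x|N. f k x \<bullet> g k x) - (LINT x|N. f' x \<bullet> g' x))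
      \<le> sqrt (?a k) * sqrt (?b k) + sqrt (?a k) * sqrt ?B + sqrt ?A * sqrt (?b k)"
    proof (intro always_eventually allI)
      fix k
      note d = l2_diff[OF l(1)[of k] l(2)] l2_diff[OF l(3)[of k] l(4)]
      have "(LINT x|N. f k x \<bullet> g k x) - (LINT x|N. f' x \<bullet> g' x) = (LINT x|N. f k x \<bullet> g k x - f' x \<bullet> g' x)"
        by (intro Bochner_Integration.integral_diff[symmetric] l2_inner l)
      also have "\<dots> = (LINT x|N. (f k x - f' x) \<bullet> (g k x - g' x) + (f k x - f' x) \<bullet> g' x + f' x \<bullet> (g k x - g' x))"
        by (intro Bochner_Integration.integral_cong refl) (simp add: algebra_simps)
      also have "\<dots> = (LINT x|N. (f k x - f' x) \<bullet> (g k x - g' x)) + (LINT x|N. (f k x - f' x) \<bullet> g' x) + (LINT x|N. f' x \<bullet> (g k x - g' x))"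
        by (subst Bochner_Integration.integral_add | intro Bochner_Integration.integrable_add l2_inner l d refl)+
      finally show "norm ((LINT x|N. f k x \<bullet> g k x) - (LINT x|N. f' x \<bullet> g' x))
        \<le> sqrt (?a k) * sqrt (?b k) + sqrt (?a k) * sqrt ?B + sqrt ?A * sqrt (?b k)"
        using l2_Cauchy_Schwarz[OF d] l2_Cauchy_Schwarz[OF d(1) l(4)] l2_Cauchy_Schwarz[OF l(2) d(2)] by simp
    qed
    have s: "(\<lambda>k. sqrt (?a k)) \<longlonglongrightarrow> 0" "(\<lambda>k. sqrt (?b k)) \<longlonglongrightarrow> 0"
      using tendsto_real_sqrt[OF lim(1)] tendsto_real_sqrt[OF lim(2)] by auto
    have "(\<lambda>k. sqrt (?a k) * sqrt (?b k) + sqrt (?a k) * sqrt ?B + sqrt ?A * sqrt (?b k)) \<longlonglongrightarrow> 0 * 0 + 0 * sqrt ?B + sqrt ?A * 0"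
      by (intro tendsto_intros s)
    then show "(\<lambda>k. sqrt (?a k) * sqrt (?b k) + sqrt (?a k) * sqrt ?B + sqrt ?A * sqrt (?b k)) \<longlonglongrightarrow> 0" by simp
  qed
  then show ?thesis by (simp add: LIM_zero_iff)
qed

lemma power2_norm_add_le: "(norm (a + b))\<^sup>2 \<le> 2 * (norm a)\<^sup>2 + 2 * (norm (b::'b::real_inner))\<^sup>2"
proof -
  have "0 \<le> (norm (a - b))\<^sup>2" by simp
  then show ?thesis by (simp add: power2_norm_eq_inner algebra_simps inner_commute)
qed

text \<open>Allows a convergent sequence to be exchanged for another one at vanishing distance, in
  particular for a truncated version of itself.\<close>

lemma l2lim_by_dist:
  fixes f :: "nat \<Rightarrow> 'a \<Rightarrow> 'b::euclidean_space"
  assumes f: "l2lim N f f'" and g: "\<And>k. l2 N (g k)" and d: "(\<lambda>k. LINT x|N. (norm (g k x - f k x))\<^sup>2) \<longlonglongrightarrow> 0"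
  shows "l2lim N g f'"
  unfolding l2lim_def
proof (intro conjI allI g)
  show "l2 N f'" using f by (simp add: l2lim_def)
  have l: "l2 N (f k)" for k using f by (simp add: l2lim_def)
  show "(\<lambda>k. LINT x|N. (norm (g k x - f' x))\<^sup>2) \<longlonglongrightarrow> 0"
  proof (rule Lim_null_comparison)
    let ?u = "\<lambda>k. 2 * (LINT x|N. (norm (g k x - f k x))\<^sup>2) + 2 * (LINT x|N. (norm (f k x - f' x))\<^sup>2)"
    show "\<forall>\<^sub>F k in sequentially. norm (LINT x|N. (norm (g k x - f' x))\<^sup>2) \<le> ?u k"
    proof (intro always_eventually allI)
      fix k
      note i = l2_norm[OF l2_diff[OF g[of k] \<open>l2 N f'\<close>]] l2_norm[OF l2_diff[OF g[of k] l[of k]]] l2_norm[OF l2_diff[OF l[of k] \<open>l2 N f'\<close>]]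
      have "(LINT x|N. (norm (g k x - f' x))\<^sup>2) \<le> (LINT x|N. 2 * (norm (g k x - f k x))\<^sup>2 + 2 * (norm (f k x - f' x))\<^sup>2)"
      proof (rule integral_mono)
        fix x show "(norm (g k x - f' x))\<^sup>2 \<le> 2 * (norm (g k x - f k x))\<^sup>2 + 2 * (norm (f k x - f' x))\<^sup>2"
          using power2_norm_add_le[of "g k x - f k x" "f k x - f' x"] by simp
      qed (use i in auto)
      also have "\<dots> = ?u k" using i by simp
      finally show "norm (LINT x|N. (norm (g k x - f' x))\<^sup>2) \<le> ?u k" by simp
    qed
    have "?u \<longlonglongrightarrow> 2 * 0 + 2 * 0"
      by (intro tendsto_intros d) (use f in \<open>simp add: l2lim_def\<close>)
    then show "?u \<longlonglongrightarrow> 0" by simp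
  qed
qed

lemma l2lim_diff:
  fixes f :: "nat \<Rightarrow> 'a \<Rightarrow> 'b::euclidean_space"
  assumes f: "l2lim N f f'" and g: "l2lim N g g'"
  shows "l2lim N (\<lambda>k x. f k x - g k x) (\<lambda>x. f' x - g' x)"
proof -
  have l: "l2 N (f k)" "l2 N f'" "l2 N (g k)" "l2 N g'" for k using f g by (auto simp: l2lim_def)
  have "l2lim N (\<lambda>k x. f k x - g' x) (\<lambda>x. f' x - g' x)"
    using f l by (auto simp: l2lim_def intro!: l2_diff)
  then show ?thesis
  proof (rule l2lim_by_dist)
    show "(\<lambda>k. LINT x|N. (norm (f k x - g k x - (f k x - g' x)))\<^sup>2) \<longlonglongrightarrow> 0"
      using g by (simp add: l2lim_def norm_minus_commute)
  qed (auto intro!: l2_diff l)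
qed

lemma l2lim_scaleR:
  fixes f :: "nat \<Rightarrow> 'a \<Rightarrow> 'b::euclidean_space"
  assumes f: "l2lim N f f'" and [measurable]: "c \<in> borel_measurable N" and C: "\<And>x. x \<in> space N \<Longrightarrow> \<bar>c x\<bar> \<le> C"
  shows "l2lim N (\<lambda>k x. c x *\<^sub>R f k x) (\<lambda>x. c x *\<^sub>R f' x)"
proof -
  have l: "l2 N (f k)" "l2 N f'" for k using f by (auto simp: l2lim_def)
  have C': "AE x in N. \<bar>c x\<bar> \<le> C" using C by auto
  have cl: "l2 N (\<lambda>x. c x *\<^sub>R f k x)" "l2 N (\<lambda>x. c x *\<^sub>R f' x)" for k
    by (auto intro!: l2_scaleR[OF _ _ C'] l)
  have "(\<lambda>k. LINT x|N. (norm (c x *\<^sub>R f k x - c x *\<^sub>R f' x))\<^sup>2) \<longlonglongrightarrow> 0"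
  proof (rule Lim_null_comparison)
    show "\<forall>\<^sub>F k in sequentially. norm (LINT x|N. (norm (c x *\<^sub>R f k x - c x *\<^sub>R f' x))\<^sup>2) \<le> C\<^sup>2 * (LINT x|N. (norm (f k x - f' x))\<^sup>2)"
    proof (intro always_eventually allI)
      fix k
      have "(LINT x|N. (norm (c x *\<^sub>R f k x - c x *\<^sub>R f' x))\<^sup>2) \<le> (LINT x|N. C\<^sup>2 * (norm (f k x - f' x))\<^sup>2)"
      proof (rule integral_mono)
        show "integrable N (\<lambda>x. (norm (c x *\<^sub>R f k x - c x *\<^sub>R f' x))\<^sup>2)"
          by (rule l2_norm[OF l2_diff[OF cl]])
        show "integrable N (\<lambda>x. C\<^sup>2 * (norm (f k x - f' x))\<^sup>2)"
          using l2_norm[OF l2_diff[OF l(1)[of k] l(2)]] by auto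
        fix x assume "x \<in> space N"
        then have "\<bar>c x\<bar>\<^sup>2 \<le> C\<^sup>2" using C[of x] by (intro power_mono) auto
        then show "(norm (c x *\<^sub>R f k x - c x *\<^sub>R f' x))\<^sup>2 \<le> C\<^sup>2 * (norm (f k x - f' x))\<^sup>2"
          by (simp add: scaleR_diff_right[symmetric] power_mult_distrib mult_right_mono)
      qed
      then show "norm (LINT x|N. (norm (c x *\<^sub>R f k x - c x *\<^sub>R f' x))\<^sup>2) \<le> C\<^sup>2 * (LINT x|N. (norm (f k x - f' x))\<^sup>2)" by simp
    qed
    have "(\<lambda>k. C\<^sup>2 * (LINT x|N. (norm (f k x - f' x))\<^sup>2)) \<longlonglongrightarrow> C\<^sup>2 * 0"
      by (intro tendsto_intros) (use f in \<open>simp add: l2lim_def\<close>)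
    then show "(\<lambda>k. C\<^sup>2 * (LINT x|N. (norm (f k x - f' x))\<^sup>2)) \<longlonglongrightarrow> 0" by simp
  qed
  then show ?thesis using cl by (simp add: l2lim_def)
qed

lemma l2lim_AE_cong:
  assumes "l2lim N f g" "AE x in N. g x = g' x" and [measurable]: "g' \<in> borel_measurable N"
  shows "l2lim N f g'"
proof -
  have [measurable]: "g \<in> borel_measurable N" "\<And>k. f k \<in> borel_measurable N" using assms by (auto simp: l2lim_def l2_def)
  have "integrable N (\<lambda>x. (norm (g' x))\<^sup>2)"
    using assms by (subst integrable_cong_AE[where g="\<lambda>x. (norm (g x))\<^sup>2"]) (auto simp: l2lim_def l2_def)
  moreover have "(LINT x|N. (norm (f k x - g' x))\<^sup>2) = (LINT x|N. (norm (f k x - g x))\<^sup>2)" for k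
    using assms(2) by (intro integral_cong_AE) auto
  ultimately show ?thesis using assms by (simp add: l2lim_def l2_def)
qed

section \<open>The Ito isometry for elementary integrals\<close>

context bm_space begin

abbreviation Q :: "('w \<times> real) measure" where "Q \<equiv> M \<Otimes>\<^sub>M lborel"

sublocale MQ: pair_sigma_finite M lborel
  by standard

section \<open>Single steps: orthogonality and covariance of weighted Brownian increments\<close>

definition step_ok :: "real \<Rightarrow> real \<Rightarrow> ('w \<Rightarrow> real^'n) \<Rightarrow> bool" where
  "step_ok p q \<eta> \<longleftrightarrow> 0 \<le> p \<and> p \<le> q \<and> \<eta> \<in> borel_measurable (F p) \<and> (\<exists>C. \<forall>\<omega>\<in>space M. norm (\<eta> \<omega>) \<le> C)"

text \<open>Each \<open>Y * w $ k\<close> is an integrable factor known at time \<open>s\<close>,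
  and each coordinate of the later increment is independent of it with mean zero: the martingale
  property of Brownian motion, tested with a random weight.\<close>

lemma increment_inner_orth:
  assumes st: "0 \<le> s" "s \<le> t" and Y: "Y \<in> borel_measurable (F s)" "integrable M Y"
    and w: "w \<in> borel_measurable (F s)" "\<And>\<omega>. \<omega> \<in> space M \<Longrightarrow> norm (w \<omega>) \<le> C"
  shows "(LINT \<omega>|M. Y \<omega> * (w \<omega> \<bullet> (B t \<omega> - B s \<omega>))) = 0"
    and "integrable M (\<lambda>\<omega>. Y \<omega> * (w \<omega> \<bullet> (B t \<omega> - B s \<omega>)))"
proof -
  note [measurable] = Y(1) w(1)
  have Ym [measurable]: "Y \<in> borel_measurable M" "w \<in> borel_measurable M" using meas_F[OF Y(1)] meas_F[OF w(1)] by auto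
  have m: "(\<lambda>\<omega>. Y \<omega> * w \<omega> $ k) \<in> borel_measurable (F s)" for k
    by measurable
  have i: "integrable M (\<lambda>\<omega>. Y \<omega> * w \<omega> $ k)" for k
  proof (rule Bochner_Integration.integrable_bound[where f="\<lambda>\<omega>. C * Y \<omega>"])
    show "AE \<omega> in M. norm (Y \<omega> * w \<omega> $ k) \<le> norm (C * Y \<omega>)"
    proof (intro AE_I2)
      fix \<omega> assume "\<omega> \<in> space M"
      then have "\<bar>w \<omega> $ k\<bar> \<le> \<bar>C\<bar>" using component_le_norm_cart[of "w \<omega>" k] w(2)[of \<omega>] by linarith
      then show "norm (Y \<omega> * w \<omega> $ k) \<le> norm (C * Y \<omega>)"
        using mult_right_mono[OF _ abs_ge_zero, of "\<bar>w \<omega> $ k\<bar>" "\<bar>C\<bar>" "Y \<omega>"] by (simp add: abs_mult mult.commute)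
    qed
  qed (use Y in auto)
  have e: "Y \<omega> * (w \<omega> \<bullet> (B t \<omega> - B s \<omega>)) = (\<Sum>k\<in>UNIV. (Y \<omega> * w \<omega> $ k) * ((B t \<omega> - B s \<omega>) $ k))" for \<omega>
    by (simp add: inner_vec_def sum_distrib_left mult.assoc)
  note I = increment_indep[OF st m i, of "\<lambda>y. y $ k" k for k]
  have ik: "integrable M (\<lambda>\<omega>. (Y \<omega> * w \<omega> $ k) * ((B t \<omega> - B s \<omega>) $ k))"
    "(LINT \<omega>|M. (Y \<omega> * w \<omega> $ k) * ((B t \<omega> - B s \<omega>) $ k)) = 0" for k
    using I(1)[of k] I(2)[of k] increment_integrable[OF st, of k] increment_mean[OF st, of k] by auto
  show "integrable M (\<lambda>\<omega>. Y \<omega> * (w \<omega> \<bullet> (B t \<omega> - B s \<omega>)))"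
    unfolding e by (intro Bochner_Integration.integrable_sum ik)
  show "(LINT \<omega>|M. Y \<omega> * (w \<omega> \<bullet> (B t \<omega> - B s \<omega>))) = 0"
    unfolding e by (subst Bochner_Integration.integral_sum) (use ik in auto)
qed

lemma
  assumes st: "0 \<le> s" "s \<le> t"
    and w: "w \<in> borel_measurable (F s)" "\<And>\<omega>. \<omega> \<in> space M \<Longrightarrow> norm (w \<omega>) \<le> C"
  shows increment_inner_mean: "(LINT \<omega>|M. w \<omega> \<bullet> (B t \<omega> - B s \<omega>)) = 0"
    and increment_inner_integrable: "integrable M (\<lambda>\<omega>. w \<omega> \<bullet> (B t \<omega> - B s \<omega>))"
proof -
  have *: "(\<lambda>_. 1::real) \<in> borel_measurable (F s)" "integrable M (\<lambda>_. 1::real)" by auto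
  show "(LINT \<omega>|M. w \<omega> \<bullet> (B t \<omega> - B s \<omega>)) = 0" "integrable M (\<lambda>\<omega>. w \<omega> \<bullet> (B t \<omega> - B s \<omega>))"
    using increment_inner_orth[OF st * w] by simp_all
qed

text \<open>The coordinates of the increment are uncorrelated with variance \<open>t - s\<close>, so
  the double sum over coordinates collapses to its diagonal, which is the inner product of the
  weights.\<close>

lemma increment_inner_cov:
  assumes st: "0 \<le> s" "s \<le> t" and v: "v \<in> borel_measurable (F s)" "\<And>\<omega>. \<omega> \<in> space M \<Longrightarrow> norm (v \<omega>) \<le> C'"
    and w: "w \<in> borel_measurable (F s)" "\<And>\<omega>. \<omega> \<in> space M \<Longrightarrow> norm (w \<omega>) \<le> C"
  shows "(LINT \<omega>|M. (v \<omega> \<bullet> (B t \<omega> - B s \<omega>)) * (w \<omega> \<bullet> (B t \<omega> - B s \<omega>))) = (t - s) * (LINT \<omega>|M. v \<omega> \<bullet> w \<omega>)"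
    and "integrable M (\<lambda>\<omega>. (v \<omega> \<bullet> (B t \<omega> - B s \<omega>)) * (w \<omega> \<bullet> (B t \<omega> - B s \<omega>)))"
proof -
  note [measurable] = v(1) w(1)
  have Ym [measurable]: "v \<in> borel_measurable M" "w \<in> borel_measurable M" using meas_F[OF v(1)] meas_F[OF w(1)] by auto
  have m: "(\<lambda>\<omega>. v \<omega> $ k * w \<omega> $ l) \<in> borel_measurable (F s)" for k l
    by measurable
  have i: "integrable M (\<lambda>\<omega>. v \<omega> $ k * w \<omega> $ l)" for k l
  proof (rule integrable_const_bound[where B="C' * C"])
    show "AE \<omega> in M. norm (v \<omega> $ k * w \<omega> $ l) \<le> C' * C"
    proof (intro AE_I2)
      fix \<omega> assume "\<omega> \<in> space M"
      then show "norm (v \<omega> $ k * w \<omega> $ l) \<le> C' * C"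
        using component_le_norm_cart[of "w \<omega>" l] w(2)[of \<omega>] component_le_norm_cart[of "v \<omega>" k] v(2)[of \<omega>]
        by (auto simp: abs_mult intro!: mult_mono)
    qed
  qed auto
  have e: "(v \<omega> \<bullet> (B t \<omega> - B s \<omega>)) * (w \<omega> \<bullet> (B t \<omega> - B s \<omega>)) =
    (\<Sum>k\<in>UNIV. \<Sum>l\<in>UNIV. (v \<omega> $ k * w \<omega> $ l) * ((B t \<omega> - B s \<omega>) $ k * (B t \<omega> - B s \<omega>) $ l))" for \<omega>
    by (simp add: inner_vec_def sum_product mult_ac)
  have ik: "integrable M (\<lambda>\<omega>. (v \<omega> $ k * w \<omega> $ l) * ((B t \<omega> - B s \<omega>) $ k * (B t \<omega> - B s \<omega>) $ l))"
    "(LINT \<omega>|M. (v \<omega> $ k * w \<omega> $ l) * ((B t \<omega> - B s \<omega>) $ k * (B t \<omega> - B s \<omega>) $ l)) = (if k = l then (t - s) * (LINT \<omega>|M. v \<omega> $ k * w \<omega> $ l) else 0)" for k l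
    using increment_indep[OF st m i, of "\<lambda>y. y $ k * y $ l" k l] increment_integrable2[OF st, of k l] increment_cov[OF st, of k l] by auto
  show "integrable M (\<lambda>\<omega>. (v \<omega> \<bullet> (B t \<omega> - B s \<omega>)) * (w \<omega> \<bullet> (B t \<omega> - B s \<omega>)))"
    unfolding e by (intro Bochner_Integration.integrable_sum ik)
  have "(LINT \<omega>|M. (v \<omega> \<bullet> (B t \<omega> - B s \<omega>)) * (w \<omega> \<bullet> (B t \<omega> - B s \<omega>))) = (\<Sum>k\<in>UNIV. \<Sum>l\<in>UNIV. (if k = l then (t - s) * (LINT \<omega>|M. v \<omega> $ k * w \<omega> $ l) else 0))"
    unfolding e by (subst integral_sum_sum[OF ik(1)]) (simp only: ik(2))
  also have "\<dots> = (t - s) * (\<Sum>k\<in>UNIV. (LINT \<omega>|M. v \<omega> $ k * w \<omega> $ k))"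
    by (simp add: sum_distrib_left)
  also have "(\<Sum>k\<in>UNIV. (LINT \<omega>|M. v \<omega> $ k * w \<omega> $ k)) = (LINT \<omega>|M. v \<omega> \<bullet> w \<omega>)"
    by (simp add: inner_vec_def Bochner_Integration.integral_sum i)
  finally show "(LINT \<omega>|M. (v \<omega> \<bullet> (B t \<omega> - B s \<omega>)) * (w \<omega> \<bullet> (B t \<omega> - B s \<omega>))) = (t - s) * (LINT \<omega>|M. v \<omega> \<bullet> w \<omega>)" .
qed

text \<open>The first increment is cut at \<open>p'\<close>. What precedes \<open>p'\<close> is
  known there and is orthogonal to the second increment. The rest starts together with the second
  increment; up to the earlier of the two end points the covariance formula applies, and beyond it
  only one of the two runs on and is orthogonal to the past.\<close>

lemma step_cross_ordered:
  assumes 1: "step_ok p q \<eta>" and 2: "step_ok p' q' \<eta>'" and le: "p \<le> p'"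
  shows "(LINT \<omega>|M. (\<eta> \<omega> \<bullet> (B q \<omega> - B p \<omega>)) * (\<eta>' \<omega> \<bullet> (B q' \<omega> - B p' \<omega>)))
    = max 0 (min q q' - max p p') * (LINT \<omega>|M. \<eta> \<omega> \<bullet> \<eta>' \<omega>)"
proof -
  from 1 obtain C where C: "\<And>\<omega>. \<omega> \<in> space M \<Longrightarrow> norm (\<eta> \<omega>) \<le> C" and p: "0 \<le> p" "p \<le> q" and \<eta>: "\<eta> \<in> borel_measurable (F p)"
    by (auto simp: step_ok_def)
  from 2 obtain C' where C': "\<And>\<omega>. \<omega> \<in> space M \<Longrightarrow> norm (\<eta>' \<omega>) \<le> C'" and p': "0 \<le> p'" "p' \<le> q'" and \<eta>': "\<eta>' \<in> borel_measurable (F p')"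
    by (auto simp: step_ok_def)
  have \<eta>p': "\<eta> \<in> borel_measurable (F p')" using meas_F_mono[OF \<eta> le] .
  \<comment> \<open>If the first interval ends before \<open>p'\<close>, then \<open>r = p'\<close>
    and the second piece is 0, so the same splitting covers disjoint and overlapping
    intervals.\<close>
  define r where "r = max q p'"
  define u where "u = min q p'"
  have u: "p \<le> u" "u \<le> p'" and r: "p' \<le> r" using le p by (auto simp: u_def r_def)
  have split: "\<eta> \<omega> \<bullet> (B q \<omega> - B p \<omega>) = \<eta> \<omega> \<bullet> (B u \<omega> - B p \<omega>) + \<eta> \<omega> \<bullet> (B r \<omega> - B p' \<omega>)" for \<omega>
    by (cases "q \<le> p'") (auto simp: u_def r_def min_def max_def inner_diff_right)
  have bm_at: "B z \<in> borel_measurable (F p')" if "0 \<le> z" "z \<le> p'" for z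
    using meas_F_mono[OF B_meas] that by blast
  note [measurable] = \<eta>p' \<eta>'
  have Y1: "(\<lambda>\<omega>. \<eta> \<omega> \<bullet> (B u \<omega> - B p \<omega>)) \<in> borel_measurable (F p')"
  proof -
    have [measurable]: "B u \<in> borel_measurable (F p')" "B p \<in> borel_measurable (F p')" using bm_at p u by auto
    show ?thesis by measurable
  qed
  have Y2: "integrable M (\<lambda>\<omega>. \<eta> \<omega> \<bullet> (B u \<omega> - B p \<omega>))"
    by (rule increment_inner_integrable[OF p(1) u(1) \<eta> C])
  note o1 = increment_inner_orth[OF p' Y1 Y2 \<eta>' C']
  \<comment> \<open>The earlier end of the two pieces that start at \<open>p'\<close>; thus
    \<open>m - p'\<close> is the length of the overlap.\<close>
  define m where "m = min r q'"
  have m: "p' \<le> m" "m \<le> r" "m \<le> q'" using r p' by (auto simp: m_def)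
  have second: "(LINT \<omega>|M. (\<eta> \<omega> \<bullet> (B r \<omega> - B p' \<omega>)) * (\<eta>' \<omega> \<bullet> (B q' \<omega> - B p' \<omega>))) = (m - p') * (LINT \<omega>|M. \<eta> \<omega> \<bullet> \<eta>' \<omega>)"
    "integrable M (\<lambda>\<omega>. (\<eta> \<omega> \<bullet> (B r \<omega> - B p' \<omega>)) * (\<eta>' \<omega> \<bullet> (B q' \<omega> - B p' \<omega>)))"
  proof -
    have m0: "0 \<le> m" using m p' by simp
    have F1: "(\<lambda>\<omega>. v \<omega> \<bullet> (B m \<omega> - B p' \<omega>)) \<in> borel_measurable (F m)" if "v \<in> borel_measurable (F p')" for v
    proof -
      have [measurable]: "v \<in> borel_measurable (F m)" "B m \<in> borel_measurable (F m)" "B p' \<in> borel_measurable (F m)"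
        using meas_F_mono[OF that m(1)] B_meas[OF m0] meas_F_mono[OF B_meas[OF p'(1)] m(1)] by auto
      show ?thesis by measurable
    qed
    have F2: "integrable M (\<lambda>\<omega>. v \<omega> \<bullet> (B m \<omega> - B p' \<omega>))" if "v \<in> borel_measurable (F p')" "\<And>\<omega>. \<omega> \<in> space M \<Longrightarrow> norm (v \<omega>) \<le> K" for v K
      by (rule increment_inner_integrable[OF p'(1) m(1) that])
    note cov = increment_inner_cov[OF p'(1) m(1) \<eta>p' C \<eta>' C']
    have "(LINT \<omega>|M. (\<eta> \<omega> \<bullet> (B r \<omega> - B p' \<omega>)) * (\<eta>' \<omega> \<bullet> (B q' \<omega> - B p' \<omega>))) = (m - p') * (LINT \<omega>|M. \<eta> \<omega> \<bullet> \<eta>' \<omega>) \<and>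
      integrable M (\<lambda>\<omega>. (\<eta> \<omega> \<bullet> (B r \<omega> - B p' \<omega>)) * (\<eta>' \<omega> \<bullet> (B q' \<omega> - B p' \<omega>)))"
    proof (cases "r \<le> q'")
      case True
      then have mr: "m = r" by (simp add: m_def)
      have e: "(\<eta> \<omega> \<bullet> (B r \<omega> - B p' \<omega>)) * (\<eta>' \<omega> \<bullet> (B q' \<omega> - B p' \<omega>)) =
        (\<eta> \<omega> \<bullet> (B m \<omega> - B p' \<omega>)) * (\<eta>' \<omega> \<bullet> (B m \<omega> - B p' \<omega>)) + (\<eta> \<omega> \<bullet> (B m \<omega> - B p' \<omega>)) * (\<eta>' \<omega> \<bullet> (B q' \<omega> - B m \<omega>))" for \<omega>
        by (simp add: mr inner_diff_right algebra_simps)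
      note o = increment_inner_orth[OF m0 m(3) F1[OF \<eta>p'] F2[OF \<eta>p' C] meas_F_mono[OF \<eta>' m(1)] C']
      show ?thesis unfolding e using o cov by simp
    next
      case False
      then have mr: "m = q'" by (simp add: m_def)
      have e: "(\<eta> \<omega> \<bullet> (B r \<omega> - B p' \<omega>)) * (\<eta>' \<omega> \<bullet> (B q' \<omega> - B p' \<omega>)) =
        (\<eta> \<omega> \<bullet> (B m \<omega> - B p' \<omega>)) * (\<eta>' \<omega> \<bullet> (B m \<omega> - B p' \<omega>)) + (\<eta>' \<omega> \<bullet> (B m \<omega> - B p' \<omega>)) * (\<eta> \<omega> \<bullet> (B r \<omega> - B m \<omega>))" for \<omega>
        by (simp add: mr inner_diff_right algebra_simps)
      note o = increment_inner_orth[OF m0 m(2) F1[OF \<eta>'] F2[OF \<eta>' C'] meas_F_mono[OF \<eta>p' m(1)] C]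
      show ?thesis unfolding e using o cov by simp
    qed
    then show "(LINT \<omega>|M. (\<eta> \<omega> \<bullet> (B r \<omega> - B p' \<omega>)) * (\<eta>' \<omega> \<bullet> (B q' \<omega> - B p' \<omega>))) = (m - p') * (LINT \<omega>|M. \<eta> \<omega> \<bullet> \<eta>' \<omega>)"
    "integrable M (\<lambda>\<omega>. (\<eta> \<omega> \<bullet> (B r \<omega> - B p' \<omega>)) * (\<eta>' \<omega> \<bullet> (B q' \<omega> - B p' \<omega>)))" by auto
  qed
  have len: "max 0 (min q q' - max p p') = m - p'"
    using le p p' by (auto simp: m_def r_def min_def max_def)
  have "(LINT \<omega>|M. (\<eta> \<omega> \<bullet> (B q \<omega> - B p \<omega>)) * (\<eta>' \<omega> \<bullet> (B q' \<omega> - B p' \<omega>))) =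
    (LINT \<omega>|M. (\<eta> \<omega> \<bullet> (B u \<omega> - B p \<omega>)) * (\<eta>' \<omega> \<bullet> (B q' \<omega> - B p' \<omega>)) + (\<eta> \<omega> \<bullet> (B r \<omega> - B p' \<omega>)) * (\<eta>' \<omega> \<bullet> (B q' \<omega> - B p' \<omega>)))"
    by (simp add: split distrib_right)
  also have "\<dots> = (m - p') * (LINT \<omega>|M. \<eta> \<omega> \<bullet> \<eta>' \<omega>)"
    using o1 second by simp
  finally show ?thesis by (simp add: len)
qed

lemma step_cross:
  assumes 1: "step_ok p q \<eta>" and 2: "step_ok p' q' \<eta>'"
  shows "(LINT \<omega>|M. (\<eta> \<omega> \<bullet> (B q \<omega> - B p \<omega>)) * (\<eta>' \<omega> \<bullet> (B q' \<omega> - B p' \<omega>)))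
    = max 0 (min q q' - max p p') * (LINT \<omega>|M. \<eta> \<omega> \<bullet> \<eta>' \<omega>)"
proof (cases "p \<le> p'")
  case True then show ?thesis using step_cross_ordered[OF 1 2] by simp
next
  case False
  then show ?thesis using step_cross_ordered[OF 2 1] by (simp add: mult.commute inner_commute min.commute max.commute)
qed

lemma step_l2_integral:
  assumes "step_ok p q \<eta>"
  shows "l2 M (\<lambda>\<omega>. \<eta> \<omega> \<bullet> (B q \<omega> - B p \<omega>))"
proof -
  from assms obtain C where C: "\<And>\<omega>. \<omega> \<in> space M \<Longrightarrow> norm (\<eta> \<omega>) \<le> C" and p: "0 \<le> p" "p \<le> q" and \<eta>: "\<eta> \<in> borel_measurable (F p)"
    by (auto simp: step_ok_def)
  have [measurable]: "\<eta> \<in> borel_measurable M" "B p \<in> borel_measurable M" "B q \<in> borel_measurable M"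
    using meas_F[OF \<eta>] B_meas_M p by auto
  show ?thesis
    using increment_inner_cov(2)[OF p \<eta> C \<eta> C] by (auto simp: l2_def power2_eq_square)
qed

lemma step_l2_value:
  assumes "step_ok p q \<eta>"
  shows "l2 Q (\<lambda>z. indicator {p<..q} (snd z) *\<^sub>R \<eta> (fst z))"
proof -
  from assms obtain C where C: "\<And>\<omega>. \<omega> \<in> space M \<Longrightarrow> norm (\<eta> \<omega>) \<le> C" and p: "0 \<le> p" "p \<le> q" and \<eta>: "\<eta> \<in> borel_measurable (F p)"
    by (auto simp: step_ok_def)
  have [measurable]: "\<eta> \<in> borel_measurable M" using meas_F[OF \<eta>] by auto
  show ?thesis
  proof (rule l2_dominated[where g="\<lambda>z. C\<^sup>2 * indicator (space M \<times> {p<..q}) z"])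
    show "integrable Q (\<lambda>z. C\<^sup>2 * indicator (space M \<times> {p<..q}) z)"
      using p by (intro integrable_mult_right integrable_real_indicator)
        (auto simp: lborel.emeasure_pair_measure_Times emeasure_space_1)
    show "AE z in Q. (norm (indicator {p<..q} (snd z) *\<^sub>R \<eta> (fst z)))\<^sup>2 \<le> C\<^sup>2 * indicator (space M \<times> {p<..q}) z"
      using C by (intro AE_I2) (auto simp: space_pair_measure indicator_def intro!: power_mono)
  qed measurable
qed

text \<open>The intersection of the two time intervals is \<open>{max p p'<..min q q'}\<close>,
  possibly empty, which is why its length carries the \<open>max 0\<close>. The right side is that
  of \<open>step_cross\<close>: this agreement is the isometry for single steps.\<close>

lemma step_value_inner:
  assumes 1: "step_ok p q \<eta>" and 2: "step_ok p' q' \<eta>'"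
  shows "(LINT z|Q. (indicator {p<..q} (snd z) *\<^sub>R \<eta> (fst z)) \<bullet> (indicator {p'<..q'} (snd z) *\<^sub>R \<eta>' (fst z)))
    = max 0 (min q q' - max p p') * (LINT \<omega>|M. \<eta> \<omega> \<bullet> \<eta>' \<omega>)"
proof -
  have "(LINT z|Q. (indicator {p<..q} (snd z) *\<^sub>R \<eta> (fst z)) \<bullet> (indicator {p'<..q'} (snd z) *\<^sub>R \<eta>' (fst z)))
    = (LINT \<omega>|M. LINT s|lborel. (indicator {p<..q} s *\<^sub>R \<eta> \<omega>) \<bullet> (indicator {p'<..q'} s *\<^sub>R \<eta>' \<omega>))"
    by (subst MQ.integral_fst'[symmetric, OF l2_inner[OF step_l2_value[OF 1] step_l2_value[OF 2]]]) simp
  also have "\<dots> = (LINT \<omega>|M. max 0 (min q q' - max p p') * (\<eta> \<omega> \<bullet> \<eta>' \<omega>))"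
  proof (intro Bochner_Integration.integral_cong refl)
    fix \<omega>
    have "(indicator {p<..q} s *\<^sub>R \<eta> \<omega>) \<bullet> (indicator {p'<..q'} s *\<^sub>R \<eta>' \<omega>) = (\<eta> \<omega> \<bullet> \<eta>' \<omega>) * indicator {max p p'<..min q q'} s" for s
      by (auto simp: indicator_def)
    then have "(LINT s|lborel. (indicator {p<..q} s *\<^sub>R \<eta> \<omega>) \<bullet> (indicator {p'<..q'} s *\<^sub>R \<eta>' \<omega>)) = (LINT s|lborel. (\<eta> \<omega> \<bullet> \<eta>' \<omega>) * indicator {max p p'<..min q q'} s)"
      by (simp only:)
    also have "\<dots> = max 0 (min q q' - max p p') * (\<eta> \<omega> \<bullet> \<eta>' \<omega>)"
    proof -
      have "measure lborel {max p p'<..min q q'} = max 0 (min q q' - max p p')"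
      proof (cases "max p p' \<le> min q q'")
        case True
        then show ?thesis by (subst measure_lborel_Ioc) auto
      next
        case False
        then have "{max p p'<..min q q'} = {}" by auto
        then show ?thesis using False by (simp only: measure_empty)
      qed
      moreover have "(LINT s|lborel. (\<eta> \<omega> \<bullet> \<eta>' \<omega>) * indicator {max p p'<..min q q'} s) = (\<eta> \<omega> \<bullet> \<eta>' \<omega>) * measure lborel {max p p'<..min q q'}"
        by simp
      ultimately show ?thesis by (simp only: mult.commute)
    qed
    finally show "(LINT s|lborel. (indicator {p<..q} s *\<^sub>R \<eta> \<omega>) \<bullet> (indicator {p'<..q'} s *\<^sub>R \<eta>' \<omega>)) = max 0 (min q q' - max p p') * (\<eta> \<omega> \<bullet> \<eta>' \<omega>)" .
  qed
  finally show ?thesis by simp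
qed

text \<open>Integrand and integral are generated together, as a finite list of steps. The intervals
  may overlap, since \<open>step_cross\<close> covers every position of two intervals; a sum is then
  a mere concatenation of lists instead of a common refinement of partitions. Values are vectors
  paired with the increment, so the integral is scalar.\<close>

inductive elem :: "(real \<Rightarrow> 'w \<Rightarrow> real^'n) \<Rightarrow> ('w \<Rightarrow> real) \<Rightarrow> bool" where
  elem_zero: "elem (\<lambda>s \<omega>. 0) (\<lambda>\<omega>. 0)"
| elem_step: "elem G I \<Longrightarrow> step_ok p q \<eta> \<Longrightarrow>
    elem (\<lambda>s \<omega>. indicator {p<..q} s *\<^sub>R \<eta> \<omega> + G s \<omega>) (\<lambda>\<omega>. \<eta> \<omega> \<bullet> (B q \<omega> - B p \<omega>) + I \<omega>)"

lemma elem_l2: "elem G I \<Longrightarrow> l2 M I \<and> l2 Q (\<lambda>z. G (snd z) (fst z))"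
  by (induction rule: elem.induct) (auto intro!: l2_add step_l2_integral step_l2_value simp: l2_def[of _ "\<lambda>_. 0"])

lemma elem_isometry_step:
  assumes "elem G I" "step_ok p q \<eta>"
  shows "(LINT \<omega>|M. (\<eta> \<omega> \<bullet> (B q \<omega> - B p \<omega>)) * I \<omega>) = (LINT z|Q. (indicator {p<..q} (snd z) *\<^sub>R \<eta> (fst z)) \<bullet> G (snd z) (fst z))"
  using assms
proof (induction rule: elem.induct)
  case (elem_step G I p' q' \<eta>')
  note l = elem_l2[OF elem_step(1)]
  note a = l2_inner[OF step_l2_integral[OF elem_step(4)] step_l2_integral[OF elem_step(2)]]
    l2_inner[OF step_l2_integral[OF elem_step(4)] l[THEN conjunct1]]
    l2_inner[OF step_l2_value[OF elem_step(4)] step_l2_value[OF elem_step(2)]]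
    l2_inner[OF step_l2_value[OF elem_step(4)] l[THEN conjunct2]]
  show ?case
    using a elem_step.IH[OF elem_step(4)] step_cross[OF elem_step(4,2)] step_value_inner[OF elem_step(4,2)]
    by (simp add: distrib_left inner_add_right del: inner_scaleR_left inner_scaleR_right)
qed simp

lemma elem_isometry:
  assumes "elem G I" "elem G' I'"
  shows "(LINT \<omega>|M. I \<omega> * I' \<omega>) = (LINT z|Q. G (snd z) (fst z) \<bullet> G' (snd z) (fst z))"
  using assms
proof (induction rule: elem.induct)
  case (elem_step G I p q \<eta>)
  note l = elem_l2[OF elem_step(1)] and l' = elem_l2[OF elem_step(4)]
  note a = l2_inner[OF step_l2_integral[OF elem_step(2)] l'[THEN conjunct1]]
    l2_inner[OF l[THEN conjunct1] l'[THEN conjunct1]]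
    l2_inner[OF step_l2_value[OF elem_step(2)] l'[THEN conjunct2]]
    l2_inner[OF l[THEN conjunct2] l'[THEN conjunct2]]
  show ?case
    using a elem_step.IH[OF elem_step(4)] elem_isometry_step[OF elem_step(4,2)]
    by (simp add: distrib_right inner_add_left del: inner_scaleR_left inner_scaleR_right)
qed simp

lemma l2_one: "l2 M (\<lambda>_. 1::real)"
  by (simp add: l2_def)

lemma elem_mean: "elem G I \<Longrightarrow> (LINT \<omega>|M. I \<omega>) = 0"
proof (induction rule: elem.induct)
  case (elem_step G I p q \<eta>)
  from elem_step(2) obtain C where C: "\<And>\<omega>. \<omega> \<in> space M \<Longrightarrow> norm (\<eta> \<omega>) \<le> C" and p: "0 \<le> p" "p \<le> q" and \<eta>: "\<eta> \<in> borel_measurable (F p)"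
    by (auto simp: step_ok_def)
  have "integrable M I" using l2_inner[OF elem_l2[OF elem_step(1), THEN conjunct1] l2_one] by simp
  then show ?case
    using increment_inner_integrable[OF p \<eta> C] increment_inner_mean[OF p \<eta> C] elem_step.IH by simp
qed simp

lemma elem_add:
  assumes "elem G I" "elem G' I'"
  shows "elem (\<lambda>s \<omega>. G s \<omega> + G' s \<omega>) (\<lambda>\<omega>. I \<omega> + I' \<omega>)"
  using assms by (induction rule: elem.induct) (auto simp: add.assoc intro: elem.intros)

text \<open>A step over (p, q] cut at \<open>s\<close> becomes one over (max p s, max q s], whose
  left end point is at least \<open>s\<close>, so that \<open>\<xi>\<close> may be absorbed into the
  value. The same \<open>J\<close> in both conclusions says that a factor known at time
  \<open>s\<close> can be pulled out of an integral over later times.\<close>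

lemma elem_restrict_mult:
  assumes s: "0 \<le> s" and \<xi>: "\<xi> \<in> borel_measurable (F s)" "\<And>\<omega>. \<omega> \<in> space M \<Longrightarrow> \<bar>\<xi> \<omega>\<bar> \<le> K" and G: "elem G I"
  shows "\<exists>J. elem (\<lambda>r \<omega>. indicator {s<..} r *\<^sub>R G r \<omega>) J \<and> elem (\<lambda>r \<omega>. \<xi> \<omega> *\<^sub>R indicator {s<..} r *\<^sub>R G r \<omega>) (\<lambda>\<omega>. \<xi> \<omega> * J \<omega>)"
  using G
proof (induction rule: elem.induct)
  case (elem_step G I p q \<eta>)
  then obtain J where J: "elem (\<lambda>r \<omega>. indicator {s<..} r *\<^sub>R G r \<omega>) J"
    "elem (\<lambda>r \<omega>. \<xi> \<omega> *\<^sub>R indicator {s<..} r *\<^sub>R G r \<omega>) (\<lambda>\<omega>. \<xi> \<omega> * J \<omega>)" by blast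
  from elem_step(2) obtain C where C: "\<And>\<omega>. \<omega> \<in> space M \<Longrightarrow> norm (\<eta> \<omega>) \<le> C" and p: "0 \<le> p" "p \<le> q" and \<eta>: "\<eta> \<in> borel_measurable (F p)"
    by (auto simp: step_ok_def)
  let ?p = "max p s" let ?q = "max q s"
  have \<eta>': "\<eta> \<in> borel_measurable (F ?p)" "\<xi> \<in> borel_measurable (F ?p)"
    using meas_F_mono[OF \<eta>, of ?p] meas_F_mono[OF \<xi>(1), of ?p] by auto
  have ok1: "step_ok ?p ?q \<eta>" using C p \<eta>' by (auto simp: step_ok_def)
  have "norm (\<xi> \<omega> *\<^sub>R \<eta> \<omega>) \<le> K * C" if "\<omega> \<in> space M" for \<omega>
    using \<xi>(2)[OF that] C[OF that] by (auto intro!: mult_mono)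
  then have ok2: "step_ok ?p ?q (\<lambda>\<omega>. \<xi> \<omega> *\<^sub>R \<eta> \<omega>)" using p \<eta>' unfolding step_ok_def by (auto intro!: borel_measurable_scaleR)
  have i: "indicator {?p<..?q} r = indicator {s<..} r * (indicator {p<..q} r :: real)" for r
    by (auto simp: indicator_def)
  show ?case
  proof (intro exI conjI)
    show "elem (\<lambda>r \<omega>. indicator {s<..} r *\<^sub>R (indicator {p<..q} r *\<^sub>R \<eta> \<omega> + G r \<omega>)) (\<lambda>\<omega>. \<eta> \<omega> \<bullet> (B ?q \<omega> - B ?p \<omega>) + J \<omega>)"
      using elem.elem_step[OF J(1) ok1] by (simp add: i scaleR_add_right)
    show "elem (\<lambda>r \<omega>. \<xi> \<omega> *\<^sub>R indicator {s<..} r *\<^sub>R (indicator {p<..q} r *\<^sub>R \<eta> \<omega> + G r \<omega>)) (\<lambda>\<omega>. \<xi> \<omega> * (\<eta> \<omega> \<bullet> (B ?q \<omega> - B ?p \<omega>) + J \<omega>))"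
      using elem.elem_step[OF J(2) ok2] by (simp add: i scaleR_add_right distrib_left mult_ac)
  qed
qed (auto intro!: exI[of _ "\<lambda>_. 0"] elem_zero)

lemma elem_minus: "elem G I \<Longrightarrow> elem (\<lambda>s \<omega>. - G s \<omega>) (\<lambda>\<omega>. - I \<omega>)"
proof (induction rule: elem.induct)
  case (elem_step G I p q \<eta>)
  then have "step_ok p q (\<lambda>\<omega>. - \<eta> \<omega>)" by (auto simp: step_ok_def)
  from elem.elem_step[OF elem_step.IH this] show ?case by simp
qed (auto intro: elem_zero)

lemma elem_diff: "elem G I \<Longrightarrow> elem G' I' \<Longrightarrow> elem (\<lambda>s \<omega>. G s \<omega> - G' s \<omega>) (\<lambda>\<omega>. I \<omega> - I' \<omega>)"
  using elem_add[OF _ elem_minus, of G I G' I'] by simp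

text \<open>The mean-square closure of the graph of the elementary integral. It is a relation
  instead of an operator: limits have to be recognised, not constructed.\<close>

definition ito :: "(real \<Rightarrow> 'w \<Rightarrow> real^'n) \<Rightarrow> ('w \<Rightarrow> real) \<Rightarrow> bool" where
  "ito h N \<longleftrightarrow> (\<exists>G I. (\<forall>k. elem (G k) (I k)) \<and>
     l2lim Q (\<lambda>k z. G k (snd z) (fst z)) (\<lambda>z. h (snd z) (fst z)) \<and> l2lim M I N)"

lemma ito_isometry:
  assumes "ito h N" "ito h' N'"
  shows "(LINT \<omega>|M. N \<omega> * N' \<omega>) = (LINT z|Q. h (snd z) (fst z) \<bullet> h' (snd z) (fst z))"
proof -
  obtain G I where 1: "\<And>k. elem (G k) (I k)" "l2lim Q (\<lambda>k z. G k (snd z) (fst z)) (\<lambda>z. h (snd z) (fst z))" "l2lim M I N"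
    using assms(1) by (auto simp: ito_def)
  obtain G' I' where 2: "\<And>k. elem (G' k) (I' k)" "l2lim Q (\<lambda>k z. G' k (snd z) (fst z)) (\<lambda>z. h' (snd z) (fst z))" "l2lim M I' N'"
    using assms(2) by (auto simp: ito_def)
  have "(\<lambda>k. LINT \<omega>|M. I k \<omega> * I' k \<omega>) \<longlonglongrightarrow> (LINT \<omega>|M. N \<omega> * N' \<omega>)"
    using l2lim_inner[OF 1(3) 2(3)] by simp
  moreover have "(\<lambda>k. LINT \<omega>|M. I k \<omega> * I' k \<omega>) \<longlonglongrightarrow> (LINT z|Q. h (snd z) (fst z) \<bullet> h' (snd z) (fst z))"
    using l2lim_inner[OF 1(2) 2(2)] by (simp add: elem_isometry[OF 1(1) 2(1)])
  ultimately show ?thesis by (rule LIMSEQ_unique)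
qed

lemma ito_l2: "ito h N \<Longrightarrow> l2 M N" "ito h N \<Longrightarrow> l2 Q (\<lambda>z. h (snd z) (fst z))"
  by (auto simp: ito_def l2lim_def)

lemma ito_mean:
  assumes "ito h N" shows "(LINT \<omega>|M. N \<omega>) = 0"
proof -
  obtain G I where 1: "\<And>k. elem (G k) (I k)" "l2lim M I N"
    using assms(1) by (auto simp: ito_def)
  have "l2lim M (\<lambda>k. \<lambda>_. 1::real) (\<lambda>_. 1)" by (simp add: l2lim_def l2_def)
  from l2lim_inner[OF 1(2) this] show ?thesis
    by (simp add: elem_mean[OF 1(1)] LIMSEQ_const_iff)
qed

lemma ito_diff:
  assumes "ito h N" "ito h' N'"
  shows "ito (\<lambda>s \<omega>. h s \<omega> - h' s \<omega>) (\<lambda>\<omega>. N \<omega> - N' \<omega>)"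
proof -
  obtain G I where 1: "\<And>k. elem (G k) (I k)" "l2lim Q (\<lambda>k z. G k (snd z) (fst z)) (\<lambda>z. h (snd z) (fst z))" "l2lim M I N"
    using assms(1) by (auto simp: ito_def)
  obtain G' I' where 2: "\<And>k. elem (G' k) (I' k)" "l2lim Q (\<lambda>k z. G' k (snd z) (fst z)) (\<lambda>z. h' (snd z) (fst z))" "l2lim M I' N'"
    using assms(2) by (auto simp: ito_def)
  show ?thesis unfolding ito_def
    by (intro exI[of _ "\<lambda>k s \<omega>. G k s \<omega> - G' k s \<omega>"] exI[of _ "\<lambda>k \<omega>. I k \<omega> - I' k \<omega>"] conjI allI elem_diff 1 2 l2lim_diff)
qed

text \<open>The vanishing of \<open>h\<close> up to time \<open>s\<close> makes the weight
  admissible. The approximations of \<open>h\<close> may fail to vanish there, so they are first cut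
  at \<open>s\<close>.\<close>

lemma ito_mult:
  assumes s: "0 \<le> s" and \<xi>: "\<xi> \<in> borel_measurable (F s)" "\<And>\<omega>. \<omega> \<in> space M \<Longrightarrow> \<bar>\<xi> \<omega>\<bar> \<le> K"
    and h: "ito h N" and h0: "\<And>r \<omega>. r \<le> s \<Longrightarrow> h r \<omega> = 0"
  shows "ito (\<lambda>r \<omega>. \<xi> \<omega> *\<^sub>R h r \<omega>) (\<lambda>\<omega>. \<xi> \<omega> * N \<omega>)"
proof -
  obtain G I where 1: "\<And>k. elem (G k) (I k)" "l2lim Q (\<lambda>k z. G k (snd z) (fst z)) (\<lambda>z. h (snd z) (fst z))" "l2lim M I N"
    using h by (auto simp: ito_def)
  have "\<forall>k. \<exists>J. elem (\<lambda>r \<omega>. indicator {s<..} r *\<^sub>R G k r \<omega>) J \<and> elem (\<lambda>r \<omega>. \<xi> \<omega> *\<^sub>R indicator {s<..} r *\<^sub>R G k r \<omega>) (\<lambda>\<omega>. \<xi> \<omega> * J \<omega>)"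
    by (intro allI elem_restrict_mult[OF s \<xi> 1(1)])
  then have "\<exists>J. \<forall>k. elem (\<lambda>r \<omega>. indicator {s<..} r *\<^sub>R G k r \<omega>) (J k) \<and> elem (\<lambda>r \<omega>. \<xi> \<omega> *\<^sub>R indicator {s<..} r *\<^sub>R G k r \<omega>) (\<lambda>\<omega>. \<xi> \<omega> * J k \<omega>)"
    by (rule choice)
  then obtain J where J: "\<And>k. elem (\<lambda>r \<omega>. indicator {s<..} r *\<^sub>R G k r \<omega>) (J k)"
     "\<And>k. elem (\<lambda>r \<omega>. \<xi> \<omega> *\<^sub>R indicator {s<..} r *\<^sub>R G k r \<omega>) (\<lambda>\<omega>. \<xi> \<omega> * J k \<omega>)" by blast
  have [measurable]: "\<xi> \<in> borel_measurable M" using meas_F[OF \<xi>(1)] .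
  have lG: "l2 Q (\<lambda>z. G k (snd z) (fst z))" for k using elem_l2[OF 1(1)] by blast
  have lh: "l2 Q (\<lambda>z. h (snd z) (fst z))" using ito_l2(2)[OF h] .
  note ld = l2_norm[OF l2_diff[OF lG lh]]
  have d: "(\<lambda>k. LINT z|Q. (norm (G k (snd z) (fst z) - h (snd z) (fst z)))\<^sup>2) \<longlonglongrightarrow> 0"
    using 1(2) by (simp add: l2lim_def)
  have lR: "l2 Q (\<lambda>z. indicator {s<..} (snd z) *\<^sub>R G k (snd z) (fst z))" for k
    using elem_l2[OF J(1)] by blast
  have ldR: "integrable Q (\<lambda>z. (norm (indicator {s<..} (snd z) *\<^sub>R G k (snd z) (fst z) - G k (snd z) (fst z)))\<^sup>2)" for k
    by (rule l2_norm[OF l2_diff[OF lR lG]])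
  \<comment> \<open>Where the cut changes \<open>G k\<close>, the limit \<open>h\<close> is 0; the
    change is therefore at most the distance from \<open>G k\<close> to \<open>h\<close>.\<close>
  have bd: "(LINT z|Q. (norm (indicator {s<..} (snd z) *\<^sub>R G k (snd z) (fst z) - G k (snd z) (fst z)))\<^sup>2)
     \<le> (LINT z|Q. (norm (G k (snd z) (fst z) - h (snd z) (fst z)))\<^sup>2)" for k
    by (rule integral_mono[OF ldR ld]) (auto simp: indicator_def h0)
  have dR: "(\<lambda>k. LINT z|Q. (norm (indicator {s<..} (snd z) *\<^sub>R G k (snd z) (fst z) - G k (snd z) (fst z)))\<^sup>2) \<longlonglongrightarrow> 0"
    by (rule Lim_null_comparison[OF _ d]) (use bd in auto)
  have R: "l2lim Q (\<lambda>k z. indicator {s<..} (snd z) *\<^sub>R G k (snd z) (fst z)) (\<lambda>z. h (snd z) (fst z))"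
    by (rule l2lim_by_dist[OF 1(2) lR dR])
  have JN: "l2lim M J N"
  proof (rule l2lim_by_dist[OF 1(3)])
    show "l2 M (J k)" for k using elem_l2[OF J(1)] by blast
    \<comment> \<open>The isometry for the difference of the cut and the uncut integrand: the
      integrals \<open>J k\<close> and \<open>I k\<close> come together as well, so \<open>J\<close>
      has the same limit \<open>N\<close>.\<close>
    have "(LINT \<omega>|M. (norm (J k \<omega> - I k \<omega>))\<^sup>2) = (LINT z|Q. (norm (indicator {s<..} (snd z) *\<^sub>R G k (snd z) (fst z) - G k (snd z) (fst z)))\<^sup>2)" for k
      using elem_isometry[OF elem_diff[OF J(1)[of k] 1(1)[of k]] elem_diff[OF J(1)[of k] 1(1)[of k]]]
      by (simp add: power2_norm_eq_inner power2_eq_square[symmetric])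
    then show "(\<lambda>k. LINT \<omega>|M. (norm (J k \<omega> - I k \<omega>))\<^sup>2) \<longlonglongrightarrow> 0" using dR by simp
  qed
  have "l2lim Q (\<lambda>k z. \<xi> (fst z) *\<^sub>R indicator {s<..} (snd z) *\<^sub>R G k (snd z) (fst z)) (\<lambda>z. \<xi> (fst z) *\<^sub>R h (snd z) (fst z))"
    using \<xi>(2) by (intro l2lim_scaleR[OF R]) (auto simp: space_pair_measure)
  moreover have "l2lim M (\<lambda>k \<omega>. \<xi> \<omega> * J k \<omega>) (\<lambda>\<omega>. \<xi> \<omega> * N \<omega>)"
    using l2lim_scaleR[OF JN _ \<xi>(2)] by simp
  ultimately show ?thesis unfolding ito_def using J(2)
    by (intro exI[of _ "\<lambda>k r \<omega>. \<xi> \<omega> *\<^sub>R indicator {s<..} r *\<^sub>R G k r \<omega>"] exI[of _ "\<lambda>k \<omega>. \<xi> \<omega> * J k \<omega>"]) auto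
qed

lemma ito_AE_cong:
  assumes "ito h N" "AE \<omega> in M. N \<omega> = N' \<omega>" "N' \<in> borel_measurable M"
  shows "ito h N'"
  using assms l2lim_AE_cong[of M _ N N'] unfolding ito_def by blast

end

section \<open>From integrals in probability to mean square\<close>

text \<open>Shaped for convergence in probability: the tolerance \<open>e\<close> is fixed first,
  and the null sequence \<open>b\<close>, typically the probability of exceeding a level, may depend
  on it.\<close>

lemma ennreal_tendsto_0I:
  assumes "\<And>e::real. 0 < e \<Longrightarrow> \<exists>b. b \<longlonglongrightarrow> 0 \<and> (\<forall>k. f k \<le> ennreal (e + b k))"
  shows "f \<longlonglongrightarrow> (0::ennreal)"
proof (rule order_tendstoI)
  fix a :: ennreal assume "0 < a"
  then obtain e where e: "0 < e" "ennreal e < a"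
    using ennreal_rat_dense[OF \<open>0 < a\<close>] by (metis ennreal_0 ennreal_less_zero_iff linorder_not_le ennreal_neg)
  obtain b where b: "b \<longlonglongrightarrow> 0" "\<And>k. f k \<le> ennreal (e/2 + b k)" using assms[of "e/2"] e by auto
  have "\<forall>\<^sub>F k in sequentially. b k < e/2" using b(1) e by (intro order_tendstoD(2)) auto
  then show "\<forall>\<^sub>F k in sequentially. f k < a"
  proof eventually_elim
    case (elim k)
    then have "ennreal (e/2 + b k) \<le> ennreal e" by (intro ennreal_leI) simp
    with b(2)[of k] e show ?case by (meson le_less_trans order_trans)
  qed
qed simp

text \<open>Below the level \<epsilon> the integrand is at most \<epsilon>; above it the cap
  \<open>K\<close> bounds it, and this happens with vanishing probability.\<close>

lemma tends_to_0_in_prob_nn_integral_min: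
  assumes "prob_space M" and Z: "tends_to_0_in_prob M Z" and K: "0 \<le> K"
  shows "(\<lambda>k. \<integral>\<^sup>+\<omega>. min (Z k \<omega>) (ennreal K) \<partial>M) \<longlonglongrightarrow> 0"
proof (rule ennreal_tendsto_0I)
  interpret prob_space M by fact
  fix \<epsilon> :: real assume "0 < \<epsilon>"
  have [measurable]: "Z k \<in> borel_measurable M" for k using Z by (simp add: tends_to_0_in_prob_def)
  have bd: "(\<integral>\<^sup>+\<omega>. min (Z k \<omega>) (ennreal K) \<partial>M) \<le> ennreal (\<epsilon> + K * measure M {\<omega> \<in> space M. ennreal \<epsilon> < Z k \<omega>})" for k
  proof -
    have "(\<integral>\<^sup>+\<omega>. min (Z k \<omega>) (ennreal K) \<partial>M) \<le> (\<integral>\<^sup>+\<omega>. ennreal \<epsilon> + ennreal K * indicator {\<omega> \<in> space M. ennreal \<epsilon> < Z k \<omega>} \<omega> \<partial>M)"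
    proof (rule nn_integral_mono)
      fix \<omega> assume "\<omega> \<in> space M"
      then show "min (Z k \<omega>) (ennreal K) \<le> ennreal \<epsilon> + ennreal K * indicator {\<omega> \<in> space M. ennreal \<epsilon> < Z k \<omega>} \<omega>"
        by (cases "ennreal \<epsilon> < Z k \<omega>") (auto simp: min_le_iff_disj add_increasing not_less)
    qed
    also have "\<dots> = ennreal \<epsilon> + ennreal K * emeasure M {\<omega> \<in> space M. ennreal \<epsilon> < Z k \<omega>}"
      by (subst nn_integral_add) (auto simp: nn_integral_cmult emeasure_space_1)
    also have "\<dots> = ennreal (\<epsilon> + K * measure M {\<omega> \<in> space M. ennreal \<epsilon> < Z k \<omega>})"
      using \<open>0 < \<epsilon>\<close> K by (simp add: emeasure_eq_measure ennreal_mult ennreal_plus)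
    finally show ?thesis .
  qed
  have "(\<lambda>k. K * measure M {\<omega> \<in> space M. ennreal \<epsilon> < Z k \<omega>}) \<longlonglongrightarrow> K * 0"
    using Z \<open>0 < \<epsilon>\<close> by (intro tendsto_intros) (simp add: tends_to_0_in_prob_def)
  then show "\<exists>b. b \<longlonglongrightarrow> 0 \<and> (\<forall>k. (\<integral>\<^sup>+\<omega>. min (Z k \<omega>) (ennreal K) \<partial>M) \<le> ennreal (\<epsilon> + b k))"
    using bd by auto
qed

text \<open>The half-open intervals of a monotone partition are disjoint, so a single summand
  survives; repeated partition points only give empty intervals.\<close>

lemma sum_indicator_partition:
  fixes P :: "nat \<Rightarrow> real" and x :: "nat \<Rightarrow> 'b::real_vector"
  assumes P: "\<And>j. j < m \<Longrightarrow> P j \<le> P (Suc j)" and j: "j < m" "P j < s" "s \<le> P (Suc j)"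
  shows "(\<Sum>l<m. indicator {P l<..P (Suc l)} s *\<^sub>R x l) = x j"
proof -
  have mono: "P a \<le> P b" if "a \<le> b" "b \<le> m" for a b
    using that by (induction b rule: dec_induct) (auto intro: order_trans[OF _ P])
  have "(\<Sum>l<m. indicator {P l<..P (Suc l)} s *\<^sub>R x l) = (\<Sum>l<m. if l = j then x j else 0)"
  proof (rule sum.cong[OF refl])
    fix l assume l: "l \<in> {..<m}"
    show "indicator {P l<..P (Suc l)} s *\<^sub>R x l = (if l = j then x j else 0)"
    proof (cases "l = j")
      case True then show ?thesis using j by simp
    next
      case False
      then consider "Suc l \<le> j" | "Suc j \<le> l" by linarith
      then have "s \<notin> {P l<..P (Suc l)}"
      proof cases
        case 1 then show ?thesis using mono[of "Suc l" j] j by auto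
      next
        case 2 then show ?thesis using mono[of "Suc j" l] j l by auto
      qed
      then show ?thesis using False by simp
    qed
  qed
  also have "\<dots> = x j" using j by simp
  finally show ?thesis .
qed

context bm_space begin

text \<open>Integrands along one ordered partition. Unlike general members of \<open>elem\<close>,
  their steps do not overlap, so values and energies can be computed interval by interval.\<close>

definition part_val :: "(nat \<Rightarrow> real) \<Rightarrow> (nat \<Rightarrow> 'w \<Rightarrow> real^'n) \<Rightarrow> nat \<Rightarrow> real \<Rightarrow> 'w \<Rightarrow> real^'n" where
  "part_val P g m s \<omega> = (\<Sum>j<m. indicator {P j<..P (Suc j)} s *\<^sub>R g j \<omega>)"

definition part_int :: "(nat \<Rightarrow> real) \<Rightarrow> (nat \<Rightarrow> 'w \<Rightarrow> real^'n) \<Rightarrow> nat \<Rightarrow> 'w \<Rightarrow> real" where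
  "part_int P g m \<omega> = (\<Sum>j<m. g j \<omega> \<bullet> (B (P (Suc j)) \<omega> - B (P j) \<omega>))"

lemma part_elem:
  "(\<And>j. j < m \<Longrightarrow> step_ok (P j) (P (Suc j)) (g j)) \<Longrightarrow> elem (part_val P g m) (part_int P g m)"
proof (induction m)
  case 0
  have "part_val P g 0 = (\<lambda>s \<omega>. 0)" "part_int P g 0 = (\<lambda>\<omega>. 0)"
    by (auto simp: part_val_def part_int_def fun_eq_iff)
  then show ?case using elem_zero by simp
next
  case (Suc m)
  have "elem (part_val P g m) (part_int P g m)" using Suc by simp
  from elem_step[OF this Suc.prems[of m]]
  have "elem (\<lambda>s \<omega>. indicator {P m<..P (Suc m)} s *\<^sub>R g m \<omega> + part_val P g m s \<omega>)
    (\<lambda>\<omega>. g m \<omega> \<bullet> (B (P (Suc m)) \<omega> - B (P m) \<omega>) + part_int P g m \<omega>)" by simp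
  moreover have "(\<lambda>s \<omega>. indicator {P m<..P (Suc m)} s *\<^sub>R g m \<omega> + part_val P g m s \<omega>) = part_val P g (Suc m)"
    "(\<lambda>\<omega>. g m \<omega> \<bullet> (B (P (Suc m)) \<omega> - B (P m) \<omega>) + part_int P g m \<omega>) = part_int P g (Suc m)"
    by (auto simp: part_val_def part_int_def fun_eq_iff add.commute)
  ultimately show ?case by simp
qed

lemma part_isometry:
  assumes ok: "\<And>j. j < m \<Longrightarrow> step_ok (P j) (P (Suc j)) (g j)"
  shows "(LINT \<omega>|M. (part_int P g m \<omega>)\<^sup>2) = (\<Sum>j<m. (P (Suc j) - P j) * (LINT \<omega>|M. (norm (g j \<omega>))\<^sup>2))"
proof -
  let ?a = "\<lambda>j \<omega>. g j \<omega> \<bullet> (B (P (Suc j)) \<omega> - B (P j) \<omega>)"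
  have P: "\<And>j. j < m \<Longrightarrow> P j \<le> P (Suc j)" using ok by (simp add: step_ok_def)
  have mono: "P a \<le> P b" if "a \<le> b" "b \<le> m" for a b
    using that by (induction b rule: dec_induct) (auto intro: order_trans[OF _ P])
  have i: "integrable M (\<lambda>\<omega>. ?a j \<omega> * ?a l \<omega>)" if "j < m" "l < m" for j l
    using l2_inner[OF step_l2_integral[OF ok[OF that(1)]] step_l2_integral[OF ok[OF that(2)]]] by simp
  have "(LINT \<omega>|M. (part_int P g m \<omega>)\<^sup>2) = (LINT \<omega>|M. (\<Sum>j<m. \<Sum>l<m. ?a j \<omega> * ?a l \<omega>))"
    by (simp add: part_int_def power2_eq_square sum_product)
  also have "\<dots> = (\<Sum>j<m. LINT \<omega>|M. (\<Sum>l<m. ?a j \<omega> * ?a l \<omega>))"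
    by (rule Bochner_Integration.integral_sum) (auto intro!: Bochner_Integration.integrable_sum i)
  also have "\<dots> = (\<Sum>j<m. \<Sum>l<m. LINT \<omega>|M. ?a j \<omega> * ?a l \<omega>)"
    by (intro sum.cong refl Bochner_Integration.integral_sum i) auto
  also have "\<dots> = (\<Sum>j<m. \<Sum>l<m. if l = j then (P (Suc j) - P j) * (LINT \<omega>|M. (norm (g j \<omega>))\<^sup>2) else 0)"
  proof (intro sum.cong refl)
    fix j l assume jl: "j \<in> {..<m}" "l \<in> {..<m}"
    then have c: "(LINT \<omega>|M. ?a j \<omega> * ?a l \<omega>) = max 0 (min (P (Suc j)) (P (Suc l)) - max (P j) (P l)) * (LINT \<omega>|M. g j \<omega> \<bullet> g l \<omega>)"
      by (intro step_cross ok) auto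
    show "(LINT \<omega>|M. ?a j \<omega> * ?a l \<omega>) = (if l = j then (P (Suc j) - P j) * (LINT \<omega>|M. (norm (g j \<omega>))\<^sup>2) else 0)"
    proof (cases "l = j")
      case True
      then show ?thesis using c P[of j] jl by (simp add: power2_norm_eq_inner)
    next
      case False
      then consider "Suc l \<le> j" | "Suc j \<le> l" by linarith
      then have "min (P (Suc j)) (P (Suc l)) - max (P j) (P l) \<le> 0"
      proof cases
        case 1 then show ?thesis using mono[of "Suc l" j] jl by auto
      next
        case 2 then show ?thesis using mono[of "Suc j" l] jl by auto
      qed
      then show ?thesis using c False by (simp add: max_absorb1)
    qed
  qed
  also have "\<dots> = (\<Sum>j<m. (P (Suc j) - P j) * (LINT \<omega>|M. (norm (g j \<omega>))\<^sup>2))"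
    by simp
  finally show ?thesis .
qed

text \<open>The integrand is switched off once its accumulated energy exceeds \<open>\<delta>\<close>; since the grid is
  deterministic, this decision is already known at the left end point of each interval.\<close>

lemma part_int_in_prob:
  assumes ok: "\<And>j. j < m \<Longrightarrow> step_ok (P j) (P (Suc j)) (g j)" and \<delta>: "0 < \<delta>"
  shows "(\<integral>\<^sup>+\<omega>. min (ennreal \<bar>part_int P g m \<omega>\<bar>) 1 \<partial>M)
    \<le> ennreal (sqrt \<delta> + measure M {\<omega> \<in> space M. \<delta> < (\<Sum>j<m. (norm (g j \<omega>))\<^sup>2 * (P (Suc j) - P j))})"
proof -
  have P: "\<And>j. j < m \<Longrightarrow> P j \<le> P (Suc j)" using ok by (simp add: step_ok_def)
  have mono: "P a \<le> P b" if "a \<le> b" "b \<le> m" for a b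
    using that by (induction b rule: dec_induct) (auto intro: order_trans[OF _ P])
  have gm: "g j \<in> borel_measurable (F (P j))" if "j < m" for j using ok[OF that] by (simp add: step_ok_def)
  have [measurable]: "g j \<in> borel_measurable M" if "j < m" for j using meas_F[OF gm[OF that]] .
  define E where "E n \<omega> = (\<Sum>j<n. (norm (g j \<omega>))\<^sup>2 * (P (Suc j) - P j))" for n \<omega>
  have Emono: "E a \<omega> \<le> E b \<omega>" if "a \<le> b" "b \<le> m" for a b \<omega>
    using that
  proof (induction b rule: dec_induct)
    case (step n)
    then show ?case using P[of n] by (auto simp: E_def intro: order_trans)
  qed simp
  \<comment> \<open>\<open>E (Suc j)\<close> already contains the energy of interval
    \<open>j\<close> itself, so the accumulated energy of \<open>g'\<close> never overshoots
    \<delta>.\<close>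
  define g' where "g' j \<omega> = (if E (Suc j) \<omega> \<le> \<delta> then g j \<omega> else 0)" for j \<omega>
  have ok': "step_ok (P j) (P (Suc j)) (g' j)" if j: "j < m" for j
  proof -
    have gl: "g l \<in> borel_measurable (F (P j))" if "l < Suc j" for l
      using meas_F_mono[OF gm[of l] mono[of l j]] that j by simp
    have [measurable]: "E (Suc j) \<in> borel_measurable (F (P j))"
      unfolding E_def
    proof (rule borel_measurable_sum)
      fix l assume "l \<in> {..<Suc j}"
      then have [measurable]: "g l \<in> borel_measurable (F (P j))" using gl by simp
      show "(\<lambda>\<omega>. (norm (g l \<omega>))\<^sup>2 * (P (Suc l) - P l)) \<in> borel_measurable (F (P j))" by measurable
    qed
    have [measurable]: "g j \<in> borel_measurable (F (P j))" using gm[OF j] .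
    have "g' j \<in> borel_measurable (F (P j))"
      unfolding g'_def by measurable
    moreover obtain C where C: "\<And>\<omega>. \<omega> \<in> space M \<Longrightarrow> norm (g j \<omega>) \<le> C" using ok[OF j] by (auto simp: step_ok_def)
    have "norm (g' j \<omega>) \<le> max 0 C" if "\<omega> \<in> space M" for \<omega>
      using C[OF that] norm_ge_zero[of "g j \<omega>"] by (simp add: g'_def le_max_iff_disj)
    ultimately show ?thesis using ok[OF j] by (auto simp: step_ok_def)
  qed
  have l2': "l2 M (part_int P g' m)" using elem_l2[OF part_elem[where P=P and g=g' and m=m, OF ok']] by blast
  have [measurable]: "part_int P g' m \<in> borel_measurable M" using l2_measurable[OF l2'] .
  have E'n: "(\<Sum>j<n. (norm (g' j \<omega>))\<^sup>2 * (P (Suc j) - P j)) \<le> min \<delta> (E n \<omega>)" if "n \<le> m" for n \<omega>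
    using that
  proof (induction n)
    case (Suc n)
    then have IH: "(\<Sum>j<n. (norm (g' j \<omega>))\<^sup>2 * (P (Suc j) - P j)) \<le> min \<delta> (E n \<omega>)" by simp
    have le: "E n \<omega> \<le> E (Suc n) \<omega>" using Emono[of n "Suc n" \<omega>] Suc by simp
    show ?case
    proof (cases "E (Suc n) \<omega> \<le> \<delta>")
      case True
      then have "(\<Sum>j<Suc n. (norm (g' j \<omega>))\<^sup>2 * (P (Suc j) - P j)) \<le> E (Suc n) \<omega>"
        using IH by (simp add: g'_def E_def)
      then show ?thesis using True by simp
    next
      case False
      then show ?thesis using IH le by (simp add: g'_def)
    qed
  qed (use \<delta> in \<open>simp add: E_def\<close>)
  have g'i: "integrable M (\<lambda>\<omega>. (norm (g' j \<omega>))\<^sup>2)" if j: "j < m" for j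
  proof -
    obtain C where C: "\<And>\<omega>. \<omega> \<in> space M \<Longrightarrow> norm (g' j \<omega>) \<le> C" using ok'[OF j] by (auto simp: step_ok_def)
    have [measurable]: "g' j \<in> borel_measurable M" using ok'[OF j] meas_F by (auto simp: step_ok_def)
    show ?thesis by (rule integrable_const_bound[where B="C\<^sup>2"]) (auto intro!: AE_I2 power_mono C)
  qed
  have "(LINT \<omega>|M. (part_int P g' m \<omega>)\<^sup>2) = (LINT \<omega>|M. (\<Sum>j<m. (norm (g' j \<omega>))\<^sup>2 * (P (Suc j) - P j)))"
    using part_isometry[where P=P and g=g' and m=m, OF ok']
    by (subst Bochner_Integration.integral_sum) (auto simp: g'i mult.commute)
  also have "\<dots> \<le> (LINT \<omega>|M. \<delta>)"
    using E'n[of m] by (intro integral_mono Bochner_Integration.integrable_sum) (auto simp: g'i)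
  finally have I2: "(LINT \<omega>|M. (part_int P g' m \<omega>)\<^sup>2) \<le> \<delta>" by (simp add: prob_space)
  \<comment> \<open>Cauchy-Schwarz against the constant 1 turns the bound \<delta> on the second
    moment into the bound \<open>sqrt \<delta>\<close> on the first.\<close>
  have "(LINT \<omega>|M. \<bar>part_int P g' m \<omega>\<bar> * 1) \<le> sqrt (LINT \<omega>|M. (part_int P g' m \<omega>)\<^sup>2) * sqrt (LINT \<omega>|M. 1)"
    using l2_Cauchy_Schwarz[of M "\<lambda>\<omega>. \<bar>part_int P g' m \<omega>\<bar>" "\<lambda>_. 1"] l2' l2_one
    by (simp add: l2_def prob_space)
  then have I1: "(LINT \<omega>|M. \<bar>part_int P g' m \<omega>\<bar>) \<le> sqrt \<delta>"
    using I2 by (simp add: prob_space) (meson order_trans real_sqrt_le_iff)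
  have int: "integrable M (\<lambda>\<omega>. \<bar>part_int P g' m \<omega>\<bar>)"
    using l2_inner[OF l2' l2_one] by simp
  have [measurable]: "E m \<in> borel_measurable M"
    unfolding E_def by measurable
  have "(\<integral>\<^sup>+\<omega>. min (ennreal \<bar>part_int P g m \<omega>\<bar>) 1 \<partial>M) \<le> (\<integral>\<^sup>+\<omega>. ennreal \<bar>part_int P g' m \<omega>\<bar> + indicator {\<omega> \<in> space M. \<delta> < E m \<omega>} \<omega> \<partial>M)"
  proof (rule nn_integral_mono)
    fix \<omega> assume \<omega>: "\<omega> \<in> space M"
    show "min (ennreal \<bar>part_int P g m \<omega>\<bar>) 1 \<le> ennreal \<bar>part_int P g' m \<omega>\<bar> + indicator {\<omega> \<in> space M. \<delta> < E m \<omega>} \<omega>"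
    \<comment> \<open>On the event that the energy exceeds \<delta> the cap 1 is used; off it
      nothing was switched off, by monotonicity of the energy, and the two integrals
      coincide.\<close>
    proof (cases "\<delta> < E m \<omega>")
      case True then show ?thesis using \<omega> by (auto simp: min_le_iff_disj)
    next
      case False
      have "g' j \<omega> = g j \<omega>" if "j < m" for j
        using Emono[of "Suc j" m \<omega>] that False by (simp add: g'_def)
      then have "part_int P g' m \<omega> = part_int P g m \<omega>" by (simp add: part_int_def)
      then show ?thesis by (simp add: min_le_iff_disj)
    qed
  qed
  also have "\<dots> = (\<integral>\<^sup>+\<omega>. ennreal \<bar>part_int P g' m \<omega>\<bar> \<partial>M) + emeasure M {\<omega> \<in> space M. \<delta> < E m \<omega>}"
    using l2_measurable[OF l2'] by (subst nn_integral_add) auto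
  also have "\<dots> \<le> ennreal (sqrt \<delta>) + ennreal (measure M {\<omega> \<in> space M. \<delta> < E m \<omega>})"
    using I1 int by (intro add_mono) (auto simp: nn_integral_eq_integral emeasure_eq_measure intro!: ennreal_leI)
  finally show ?thesis using \<delta> by (simp add: E_def ennreal_plus)
qed

lemma progressive_joint_measurable:
  fixes H :: "real \<Rightarrow> 'w \<Rightarrow> 'b::{second_countable_topology, real_normed_vector}"
  assumes H: "progressive_upto F t H" and t: "0 \<le> t"
  shows "(\<lambda>z. indicator {0..t} (snd z) *\<^sub>R H (snd z) (fst z)) \<in> borel_measurable Q"
proof -
  have h: "(\<lambda>(s, \<omega>). H s \<omega>) \<in> borel_measurable (restrict_space borel {0..t} \<Otimes>\<^sub>M F t)"
    using H t by (auto simp: progressive_upto_def)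
  have id: "(\<lambda>\<omega>. \<omega>) \<in> measurable M (F t)"
    by (rule measurable_from_subalg[of M "F t"]) (auto simp: subalg_F)
  \<comment> \<open>Progressive measurability lives on \<open>{0..t}\<close> with time as the first
    coordinate. Clamping time into \<open>{0..t}\<close> gives a map from the whole product space,
    and the indicator hides the clamped values.\<close>
  have "(\<lambda>z::'w \<times> real. (max 0 (min t (snd z)), fst z)) \<in> measurable Q (restrict_space borel {0..t} \<Otimes>\<^sub>M F t)"
  proof (rule measurable_Pair)
    show "(\<lambda>z::'w \<times> real. max 0 (min t (snd z))) \<in> measurable Q (restrict_space borel {0..t})"
      using t by (intro measurable_restrict_space2) auto
    show "(\<lambda>z::'w \<times> real. fst z) \<in> measurable Q (F t)"
    proof -
      have "fst \<in> measurable Q M" by simp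
      from measurable_compose[OF this id] show ?thesis by simp
    qed
  qed
  from measurable_compose[OF this h]
  have [measurable]: "(\<lambda>z. H (max 0 (min t (snd z))) (fst z)) \<in> borel_measurable Q" by simp
  have "(\<lambda>z. indicator {0..t} (snd z) *\<^sub>R H (max 0 (min t (snd z))) (fst z)) \<in> borel_measurable Q"
    by measurable
  also have "(\<lambda>z. indicator {0..t} (snd z) *\<^sub>R H (max 0 (min t (snd z))) (fst z)) = (\<lambda>z. indicator {0..t} (snd z) *\<^sub>R H (snd z) (fst z))"
    by (auto simp: indicator_def fun_eq_iff)
  finally show ?thesis .
qed

text \<open>The definition gives convergence in probability only. As \<open>H\<close> is bounded by
  \<open>C\<close>, the approximating values are projected onto the ball of radius \<open>C\<close>:
  this does not increase their distance to row \<open>i\<close> of \<open>H\<close>, and for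
  uniformly bounded integrands convergence in probability implies convergence in mean square. The
  part \<open>d\<close> removed by the projection has vanishing energy, so its integrals vanish in
  probability and the projected integrals still tend to \<open>Y\<close>. By the isometry they are
  Cauchy in mean square, and Fatou's lemma along an almost surely convergent subsequence identifies
  their limit.\<close>

lemma has_ito_integral_imp_ito:
  assumes t: "0 \<le> t" and HY: "has_ito_integral M F B H t Y"
    and C: "0 \<le> C" and HC: "AE \<omega> in M. \<forall>s\<in>{0..t}. norm (H s \<omega>) \<le> C"
  shows "ito (\<lambda>s \<omega>. indicator {0..t} s *\<^sub>R (H s \<omega> $ i)) (\<lambda>\<omega>. Y \<omega> $ i)"
proof -
  have prog: "progressive_upto F t H" and Ym [measurable]: "Y \<in> borel_measurable M"
    using HY by (auto simp: has_ito_integral_def)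
  obtain m p \<eta> where simple: "\<And>k. simple_integrand F (m k) (p k) (\<eta> k)"
    and R0: "tends_to_0_in_prob M (\<lambda>k \<omega>. \<integral>\<^sup>+s\<in>{0..t}.
           ennreal ((norm (simple_value (m k) (p k) (\<eta> k) s \<omega> - H s \<omega>))\<^sup>2) \<partial>lborel)"
    and Y0: "tends_to_0_in_prob M (\<lambda>k \<omega>. ennreal (norm (simple_integral (m k) (p k) (\<eta> k) B t \<omega> - Y \<omega>)))"
    using HY unfolding has_ito_integral_def by blast
  define R where "R k \<omega> = (\<integral>\<^sup>+s\<in>{0..t}. ennreal ((norm (simple_value (m k) (p k) (\<eta> k) s \<omega> - H s \<omega>))\<^sup>2) \<partial>lborel)" for k \<omega>
  have R0: "tends_to_0_in_prob M R" using R0 by (simp add: R_def[abs_def])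
  have [measurable]: "R k \<in> borel_measurable M" for k using R0 by (simp add: tends_to_0_in_prob_def)
  define h where "h s \<omega> = indicator {0..t} s *\<^sub>R (H s \<omega> $ i)" for s \<omega>
  have h_alt: "h s \<omega> = (indicator {0..t} s *\<^sub>R H s \<omega>) $ i" for s \<omega> by (simp add: h_def)
  have hm [measurable]: "(\<lambda>z. h (snd z) (fst z)) \<in> borel_measurable Q"
  proof -
    have "(\<lambda>x::real^'n^'n. x $ i) \<in> borel_measurable borel"
      by (intro borel_measurable_continuous_onI continuous_intros)
    from measurable_compose[OF progressive_joint_measurable[OF prog t] this] show ?thesis
      by (simp add: h_alt)
  qed
  have hC: "AE \<omega> in M. \<forall>s. norm (h s \<omega>) \<le> C"
    using HC
  proof eventually_elim
    case (elim \<omega>)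
    show ?case
    proof
      fix s show "norm (h s \<omega>) \<le> C"
        using elim C Finite_Cartesian_Product.norm_nth_le[of "H s \<omega>" i] by (cases "s \<in> {0..t}") (auto simp: h_def intro: order_trans)
    qed
  qed
  \<comment> \<open>Partition points are cut at \<open>t\<close>. A value whose interval starts
    after \<open>t\<close> is set to 0: its interval has become empty, and the original value need
    not be known at time \<open>t\<close>.\<close>
  define P where "P k j = min (p k j) t" for k j
  define g where "g k j \<omega> = (if p k j \<le> t then \<eta> k j \<omega> $ i else 0)" for k j \<omega>
  \<comment> \<open>The nearest-point projection onto the ball: the identity on it, 1-Lipschitz, and
    continuous, so that adaptedness survives.\<close>
  define \<pi> :: "real^'n \<Rightarrow> real^'n" where "\<pi> = closest_point (cball 0 C)"
  have ne: "cball (0::real^'n) C \<noteq> {}" using C by auto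
  have \<pi>_in: "norm (\<pi> x) \<le> C" for x
    using closest_point_in_set[OF closed_cball ne, of x] by (simp add: \<pi>_def)
  have \<pi>_self: "\<pi> x = x" if "norm x \<le> C" for x
    using that by (simp add: \<pi>_def closest_point_self)
  have \<pi>_le: "norm (x - \<pi> x) \<le> norm (x - y)" if "norm y \<le> C" for x y
    using closest_point_le[OF closed_cball, of y 0 C x] that by (simp add: \<pi>_def dist_norm)
  have \<pi>_lip: "norm (\<pi> x - \<pi> y) \<le> norm (x - y)" for x y
    using closest_point_lipschitz[OF convex_cball closed_cball ne, of x y] by (simp add: \<pi>_def dist_norm)
  have \<pi>_cont: "continuous_on UNIV \<pi>"
    unfolding \<pi>_def by (rule continuous_on_closest_point[OF convex_cball closed_cball ne])
  have \<pi>_meas [measurable]: "\<pi> \<in> borel_measurable borel" using \<pi>_cont by (rule borel_measurable_continuous_onI)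
  have pnn: "0 \<le> p k j" if "j \<le> m k" for k j
    using that
  proof (induction j)
    case 0 then show ?case using simple[of k] by (simp add: simple_integrand_def)
  next
    case (Suc j)
    then have "0 \<le> p k j" "p k j \<le> p k (Suc j)" using simple[of k] by (auto simp: simple_integrand_def)
    then show ?case by simp
  qed
  have ok: "step_ok (P k j) (P k (Suc j)) (g k j)" if j: "j < m k" for k j
  proof -
    have s: "p k j \<le> p k (Suc j)" "\<eta> k j \<in> borel_measurable (F (p k j))" "\<exists>C. \<forall>\<omega>\<in>space M. norm (\<eta> k j \<omega>) \<le> C"
      using simple[of k] j by (auto simp: simple_integrand_def)
    have gm: "g k j \<in> borel_measurable (F (P k j))"
    proof (cases "p k j \<le> t")
      case True
      have "(\<lambda>x::real^'n^'n. x $ i) \<in> borel_measurable borel"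
        by (intro borel_measurable_continuous_onI continuous_intros)
      from measurable_compose[OF s(2) this] True show ?thesis by (simp add: g_def[abs_def] P_def)
    next
      case False then show ?thesis by (simp add: g_def[abs_def])
    qed
    obtain C' where C': "\<And>\<omega>. \<omega> \<in> space M \<Longrightarrow> norm (\<eta> k j \<omega>) \<le> C'" using s(3) by blast
    have "norm (g k j \<omega>) \<le> max 0 C'" if "\<omega> \<in> space M" for \<omega>
      using order_trans[OF Finite_Cartesian_Product.norm_nth_le[of "\<eta> k j \<omega>" i] C'[OF that]] by (auto simp: g_def le_max_iff_disj)
    then show ?thesis using s(1) gm pnn[of j k] j t by (auto simp: step_ok_def P_def)
  qed
  have Pmono: "P k j \<le> P k (Suc j)" if "j < m k" for k j using ok[OF that] by (simp add: step_ok_def)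
  define \<gamma> where "\<gamma> k j \<omega> = \<pi> (g k j \<omega>)" for k j \<omega>
  define d where "d k j \<omega> = g k j \<omega> - \<gamma> k j \<omega>" for k j \<omega>
  have ok\<gamma>: "step_ok (P k j) (P k (Suc j)) (\<gamma> k j)" if j: "j < m k" for k j
  proof -
    have "\<gamma> k j \<in> borel_measurable (F (P k j))"
      using ok[OF j] measurable_compose[OF _ \<pi>_meas, of "g k j" "F (P k j)"] by (simp add: step_ok_def \<gamma>_def[abs_def])
    then show ?thesis using ok[OF j] \<pi>_in by (auto simp: step_ok_def \<gamma>_def)
  qed
  have okd: "step_ok (P k j) (P k (Suc j)) (d k j)" if j: "j < m k" for k j
  proof -
    obtain C' where C': "\<And>\<omega>. \<omega> \<in> space M \<Longrightarrow> norm (g k j \<omega>) \<le> C'" using ok[OF j] by (auto simp: step_ok_def)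
    have "norm (d k j \<omega>) \<le> C' + C" if "\<omega> \<in> space M" for \<omega>
      using C'[OF that] \<pi>_in[of "g k j \<omega>"] norm_triangle_ineq4[of "g k j \<omega>" "\<gamma> k j \<omega>"] by (simp add: d_def \<gamma>_def)
    then show ?thesis using ok[OF j] ok\<gamma>[OF j] by (auto simp: step_ok_def d_def[abs_def])
  qed
  define DN where "DN k s \<omega> = (\<Sum>j<m k. indicator {P k j<..P k (Suc j)} s *\<^sub>R (norm (d k j \<omega>))\<^sup>2)" for k s \<omega>
  \<comment> \<open>At each time at most one interval is active. There the claims reduce to
    properties of \<pi>: it is Lipschitz and fixes \<open>h\<close>, which lies in the ball, and the
    projection of \<open>g\<close> is at least as close to \<open>g\<close> as \<open>h\<close> is.
    If no interval is active, the projected and removed parts vanish, and inside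
    \<open>{0..t}\<close> so does the simple integrand.\<close>
  have pt: "norm (part_val (P k) (\<gamma> k) (m k) s \<omega> - h s \<omega>) \<le> indicator {0..t} s * norm (simple_value (m k) (p k) (\<eta> k) s \<omega> - H s \<omega>)
     \<and> norm (part_val (P k) (d k) (m k) s \<omega>) \<le> indicator {0..t} s * norm (simple_value (m k) (p k) (\<eta> k) s \<omega> - H s \<omega>)
     \<and> (norm (part_val (P k) (d k) (m k) s \<omega>))\<^sup>2 = DN k s \<omega>
     \<and> norm (part_val (P k) (\<gamma> k) (m k) s \<omega>) \<le> C * indicator {0..t} s"
    if hb: "norm (h s \<omega>) \<le> C" for k s \<omega>
  proof (cases "\<exists>j<m k. P k j < s \<and> s \<le> P k (Suc j)")
    case True
    then obtain j where j: "j < m k" "P k j < s" "s \<le> P k (Suc j)" by blast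
    then have ps: "p k j < s" "s \<le> p k (Suc j)" "s \<le> t" "p k j \<le> t" "0 \<le> s" using pnn[of j k] t by (auto simp: P_def)
    have sv: "simple_value (m k) (p k) (\<eta> k) s \<omega> = \<eta> k j \<omega>"
      unfolding simple_value_def using simple[of k] j(1) ps
      by (intro sum_indicator_partition) (auto simp: simple_integrand_def)
    have v: "part_val (P k) x (m k) s \<omega> = x j \<omega>" for x :: "nat \<Rightarrow> 'w \<Rightarrow> real^'n"
      unfolding part_val_def using j Pmono by (intro sum_indicator_partition) auto
    have n: "DN k s \<omega> = (norm (d k j \<omega>))\<^sup>2"
      unfolding DN_def using j Pmono by (intro sum_indicator_partition) auto
    have hs: "h s \<omega> = H s \<omega> $ i" using ps by (simp add: h_def)
    have gs: "g k j \<omega> = \<eta> k j \<omega> $ i" using ps by (simp add: g_def)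
    have c: "norm (g k j \<omega> - h s \<omega>) \<le> norm (\<eta> k j \<omega> - H s \<omega>)"
      using Finite_Cartesian_Product.norm_nth_le[of "\<eta> k j \<omega> - H s \<omega>" i] by (simp add: hs gs)
    have "norm (\<gamma> k j \<omega> - h s \<omega>) \<le> norm (g k j \<omega> - h s \<omega>)"
      using \<pi>_lip[of "g k j \<omega>" "h s \<omega>"] \<pi>_self[OF hb] by (simp add: \<gamma>_def)
    moreover have "norm (d k j \<omega>) \<le> norm (g k j \<omega> - h s \<omega>)"
      using \<pi>_le[OF hb, of "g k j \<omega>"] by (simp add: \<gamma>_def d_def)
    ultimately show ?thesis using c \<pi>_in[of "g k j \<omega>"] ps by (simp add: v sv n \<gamma>_def)
  next
    case False
    then have z: "indicator {P k j<..P k (Suc j)} s = (0::real)" if "j < m k" for j using that by (auto simp: indicator_def)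
    have v: "part_val (P k) x (m k) s \<omega> = 0" for x :: "nat \<Rightarrow> 'w \<Rightarrow> real^'n"
      unfolding part_val_def using z by (intro sum.neutral) auto
    have n: "DN k s \<omega> = 0"
      unfolding DN_def using z by (intro sum.neutral) auto
    show ?thesis
    proof (cases "s \<in> {0..t}")
      case True
      have "simple_value (m k) (p k) (\<eta> k) s \<omega> = 0"
        unfolding simple_value_def
      proof (intro sum.neutral ballI)
        fix j assume j: "j \<in> {..<m k}"
        have "s \<notin> {p k j<..p k (Suc j)}"
          using z[of j] j True by (auto simp: P_def indicator_def split: if_splits)
        then show "indicator {p k j<..p k (Suc j)} s *\<^sub>R \<eta> k j \<omega> = 0" by simp
      qed
      then show ?thesis using True Finite_Cartesian_Product.norm_nth_le[of "H s \<omega>" i] C by (simp add: v n h_def)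
    next
      case False then show ?thesis by (simp add: v n h_def)
    qed
  qed
  let ?G = "\<lambda>k. part_val (P k) (\<gamma> k) (m k)" and ?I = "\<lambda>k. part_int (P k) (\<gamma> k) (m k)"
  have eG: "elem (?G k) (?I k)" for k by (rule part_elem) (rule ok\<gamma>)
  have lG: "l2 Q (\<lambda>z. ?G k (snd z) (fst z))" for k using elem_l2[OF eG] by blast
  have lI: "l2 M (?I k)" for k using elem_l2[OF eG] by blast
  have [measurable]: "(\<lambda>z. ?G k (snd z) (fst z)) \<in> borel_measurable Q" for k using l2_measurable[OF lG] .
  have hCQ: "AE z in Q. norm (h (snd z) (fst z)) \<le> C"
  proof -
    have "AE \<omega> in M. AE s in lborel. norm (h s \<omega>) \<le> C"
      using hC by eventually_elim auto
    moreover have "{z \<in> space Q. norm (h (snd z) (fst z)) \<le> C} \<in> sets Q" by measurable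
    ultimately show ?thesis using MQ.AE_pair_measure[of "\<lambda>z. norm (h (snd z) (fst z)) \<le> C"] by simp
  qed
  have lh: "l2 Q (\<lambda>z. h (snd z) (fst z))"
  proof (rule l2_dominated[where g="\<lambda>z. C\<^sup>2 * indicator (space M \<times> {0..t}) z"])
    show "integrable Q (\<lambda>z. C\<^sup>2 * indicator (space M \<times> {0..t}) z)"
      using t by (intro integrable_mult_right integrable_real_indicator)
        (auto simp: lborel.emeasure_pair_measure_Times emeasure_space_1)
    show "AE z in Q. (norm (h (snd z) (fst z)))\<^sup>2 \<le> C\<^sup>2 * indicator (space M \<times> {0..t}) z"
      using hCQ AE_space
    proof eventually_elim
      case (elim z)
      then show ?case by (cases "snd z \<in> {0..t}") (auto simp: h_def space_pair_measure indicator_def intro!: power_mono)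
    qed
  qed simp
  define a where "a k = (LINT z|Q. (norm (?G k (snd z) (fst z) - h (snd z) (fst z)))\<^sup>2)" for k
  have a_nn: "ennreal (a k) = (\<integral>\<^sup>+\<omega>. \<integral>\<^sup>+s. ennreal ((norm (?G k s \<omega> - h s \<omega>))\<^sup>2) \<partial>lborel \<partial>M)" for k
  proof -
    have "ennreal (a k) = (\<integral>\<^sup>+z. ennreal ((norm (?G k (snd z) (fst z) - h (snd z) (fst z)))\<^sup>2) \<partial>Q)"
      unfolding a_def by (rule nn_integral_eq_integral[symmetric]) (auto intro!: l2_norm[OF l2_diff] lG lh)
    also have "\<dots> = (\<integral>\<^sup>+\<omega>. \<integral>\<^sup>+s. ennreal ((norm (?G k s \<omega> - h s \<omega>))\<^sup>2) \<partial>lborel \<partial>M)"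
      by (subst lborel.nn_integral_fst[symmetric]) auto
    finally show ?thesis .
  qed
  \<comment> \<open>Both integrands are at most \<open>C\<close> on \<open>{0..t}\<close> and 0
    elsewhere, whence the cap \<open>(2 * C)\<^sup>2 * t\<close>; thanks to the cap, convergence in
    probability gives convergence of expectations.\<close>
  have a_le: "ennreal (a k) \<le> (\<integral>\<^sup>+\<omega>. min (R k \<omega>) (ennreal ((2 * C)\<^sup>2 * t)) \<partial>M)" for k
    unfolding a_nn
  proof (rule nn_integral_mono_AE, use hC in eventually_elim)
    case (elim \<omega>)
    have "(\<integral>\<^sup>+s. ennreal ((norm (?G k s \<omega> - h s \<omega>))\<^sup>2) \<partial>lborel) \<le> R k \<omega>"
      unfolding R_def
    proof (rule nn_integral_mono)
      fix s
      have "(norm (?G k s \<omega> - h s \<omega>))\<^sup>2 \<le> (indicator {0..t} s * norm (simple_value (m k) (p k) (\<eta> k) s \<omega> - H s \<omega>))\<^sup>2"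
        using pt[OF elim[rule_format], of k s] by (intro power_mono) auto
      then have "ennreal ((norm (?G k s \<omega> - h s \<omega>))\<^sup>2) \<le> ennreal ((indicator {0..t} s * norm (simple_value (m k) (p k) (\<eta> k) s \<omega> - H s \<omega>))\<^sup>2)"
        by (rule ennreal_leI)
      then show "ennreal ((norm (?G k s \<omega> - h s \<omega>))\<^sup>2) \<le> ennreal ((norm (simple_value (m k) (p k) (\<eta> k) s \<omega> - H s \<omega>))\<^sup>2) * indicator {0..t} s"
        by (cases "s \<in> {0..t}") auto
    qed
    moreover have "(\<integral>\<^sup>+s. ennreal ((norm (?G k s \<omega> - h s \<omega>))\<^sup>2) \<partial>lborel) \<le> ennreal ((2 * C)\<^sup>2 * t)"
    proof -
      have "(\<integral>\<^sup>+s. ennreal ((norm (?G k s \<omega> - h s \<omega>))\<^sup>2) \<partial>lborel) \<le> (\<integral>\<^sup>+s. ennreal ((2 * C)\<^sup>2) * indicator {0..t} s \<partial>lborel)"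
      proof (rule nn_integral_mono)
        fix s
        have "norm (?G k s \<omega> - h s \<omega>) \<le> norm (?G k s \<omega>) + norm (h s \<omega>)" by (rule norm_triangle_ineq4)
        also have "\<dots> \<le> 2 * C * indicator {0..t} s"
          using pt[OF elim[rule_format], of k s] elim[rule_format, of s] by (cases "s \<in> {0..t}") (auto simp: h_def)
        finally have "ennreal ((norm (?G k s \<omega> - h s \<omega>))\<^sup>2) \<le> ennreal ((2 * C * indicator {0..t} s)\<^sup>2)"
          by (intro ennreal_leI power_mono) auto
        then show "ennreal ((norm (?G k s \<omega> - h s \<omega>))\<^sup>2) \<le> ennreal ((2 * C)\<^sup>2) * indicator {0..t} s"
          by (cases "s \<in> {0..t}") auto
      qed
      also have "\<dots> = ennreal ((2 * C)\<^sup>2 * t)"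
        using t by (simp add: nn_integral_cmult_indicator ennreal_mult)
      finally show ?thesis .
    qed
    ultimately show ?case by simp
  qed
  have a0: "a \<longlonglongrightarrow> 0"
  proof -
    have T: "(\<lambda>k. \<integral>\<^sup>+\<omega>. min (R k \<omega>) (ennreal ((2 * C)\<^sup>2 * t)) \<partial>M) \<longlonglongrightarrow> 0"
      using t by (intro tends_to_0_in_prob_nn_integral_min[OF prob_space_axioms R0]) auto
    have "(\<lambda>k. ennreal (a k)) \<longlonglongrightarrow> 0"
      by (rule tendsto_sandwich[OF _ _ tendsto_const T]) (use a_le in auto)
    then show ?thesis
      by (subst (asm) ennreal_0[symmetric], subst (asm) tendsto_ennreal_iff) (auto simp: a_def)
  qed
  have conv1: "l2lim Q (\<lambda>k z. ?G k (snd z) (fst z)) (\<lambda>z. h (snd z) (fst z))"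
    using lG lh a0 by (simp add: l2lim_def a_def[abs_def])
  have conv2: "l2lim M ?I (\<lambda>\<omega>. Y \<omega> $ i)"
  proof -
    let ?Y = "\<lambda>\<omega>. Y \<omega> $ i"
    define D where "D k \<omega> = (\<Sum>j<m k. (norm (d k j \<omega>))\<^sup>2 * (P k (Suc j) - P k j))" for k \<omega>
    have dm: "d k j \<in> borel_measurable M" if "j < m k" for k j using okd[OF that] meas_F by (auto simp: step_ok_def)
    have [measurable]: "D k \<in> borel_measurable M" for k
      unfolding D_def using dm by (intro borel_measurable_sum) auto
    \<comment> \<open>\<open>D k\<close> is the time integral of the squared norm of the removed
      part, which by \<open>pt\<close> is dominated pointwise by the approximation error.\<close>
    have DR: "AE \<omega> in M. ennreal (D k \<omega>) \<le> R k \<omega>" for k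
      using hC
    proof eventually_elim
      case (elim \<omega>)
      have "ennreal (D k \<omega>) = (\<Sum>j<m k. ennreal ((norm (d k j \<omega>))\<^sup>2) * emeasure lborel {P k j<..P k (Suc j)})"
      proof -
        have "(\<Sum>j<m k. ennreal ((norm (d k j \<omega>))\<^sup>2) * emeasure lborel {P k j<..P k (Suc j)}) = (\<Sum>j<m k. ennreal ((norm (d k j \<omega>))\<^sup>2 * (P k (Suc j) - P k j)))"
          using Pmono[of _ k] by (intro sum.cong refl) (simp add: ennreal_mult)
        also have "\<dots> = ennreal (D k \<omega>)"
          unfolding D_def using Pmono[of _ k] by (intro sum_ennreal) simp
        finally show ?thesis by simp
      qed
      also have "\<dots> = (\<Sum>j<m k. \<integral>\<^sup>+s. ennreal ((norm (d k j \<omega>))\<^sup>2) * indicator {P k j<..P k (Suc j)} s \<partial>lborel)"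
        by (simp add: nn_integral_cmult_indicator)
      also have "\<dots> = (\<integral>\<^sup>+s. (\<Sum>j<m k. ennreal ((norm (d k j \<omega>))\<^sup>2) * indicator {P k j<..P k (Suc j)} s) \<partial>lborel)"
        by (rule nn_integral_sum[symmetric]) auto
      also have "\<dots> = (\<integral>\<^sup>+s. ennreal ((norm (part_val (P k) (d k) (m k) s \<omega>))\<^sup>2) \<partial>lborel)"
      proof (intro nn_integral_cong)
        fix s
        have "(norm (part_val (P k) (d k) (m k) s \<omega>))\<^sup>2 = (\<Sum>j<m k. (norm (d k j \<omega>))\<^sup>2 * indicator {P k j<..P k (Suc j)} s)"
          using pt[OF elim[rule_format], of k s] by (simp only: DN_def real_scaleR_def mult.commute)
        then show "(\<Sum>j<m k. ennreal ((norm (d k j \<omega>))\<^sup>2) * indicator {P k j<..P k (Suc j)} s) = ennreal ((norm (part_val (P k) (d k) (m k) s \<omega>))\<^sup>2)"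
        proof -
          have "(\<Sum>j<m k. ennreal ((norm (d k j \<omega>))\<^sup>2) * indicator {P k j<..P k (Suc j)} s) = (\<Sum>j<m k. ennreal ((norm (d k j \<omega>))\<^sup>2 * indicator {P k j<..P k (Suc j)} s))"
            by (intro sum.cong refl) (simp split: split_indicator)
          also have "\<dots> = ennreal (\<Sum>j<m k. (norm (d k j \<omega>))\<^sup>2 * indicator {P k j<..P k (Suc j)} s)"
            by (intro sum_ennreal) simp
          also have "\<dots> = ennreal ((norm (part_val (P k) (d k) (m k) s \<omega>))\<^sup>2)"
            by (simp only: \<open>(norm (part_val (P k) (d k) (m k) s \<omega>))\<^sup>2 = (\<Sum>j<m k. (norm (d k j \<omega>))\<^sup>2 * indicator {P k j<..P k (Suc j)} s)\<close>)
          finally show ?thesis .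
        qed
      qed
      also have "\<dots> \<le> R k \<omega>"
        unfolding R_def
      proof (rule nn_integral_mono)
        fix s
        have "(norm (part_val (P k) (d k) (m k) s \<omega>))\<^sup>2 \<le> (indicator {0..t} s * norm (simple_value (m k) (p k) (\<eta> k) s \<omega> - H s \<omega>))\<^sup>2"
          using pt[OF elim[rule_format], of k s] by (intro power_mono) auto
        then have "ennreal ((norm (part_val (P k) (d k) (m k) s \<omega>))\<^sup>2) \<le> ennreal ((indicator {0..t} s * norm (simple_value (m k) (p k) (\<eta> k) s \<omega> - H s \<omega>))\<^sup>2)"
          by (rule ennreal_leI)
        then show "ennreal ((norm (part_val (P k) (d k) (m k) s \<omega>))\<^sup>2) \<le> ennreal ((norm (simple_value (m k) (p k) (\<eta> k) s \<omega> - H s \<omega>))\<^sup>2) * indicator {0..t} s"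
          by (cases "s \<in> {0..t}") auto
      qed
      finally show ?case .
    qed
    \<comment> \<open>The energy level is \<open>e\<^sup>2\<close> because
      \<open>part_int_in_prob\<close> returns its square root.\<close>
    have dlim: "(\<lambda>k. \<integral>\<^sup>+\<omega>. min (ennreal \<bar>part_int (P k) (d k) (m k) \<omega>\<bar>) 1 \<partial>M) \<longlonglongrightarrow> 0"
    proof (rule ennreal_tendsto_0I)
      fix e :: real assume e: "0 < e"
      have le: "(\<integral>\<^sup>+\<omega>. min (ennreal \<bar>part_int (P k) (d k) (m k) \<omega>\<bar>) 1 \<partial>M) \<le> ennreal (e + measure M {\<omega> \<in> space M. ennreal (e\<^sup>2) < R k \<omega>})" for k
      proof -
        have "measure M {\<omega> \<in> space M. e\<^sup>2 < D k \<omega>} \<le> measure M {\<omega> \<in> space M. ennreal (e\<^sup>2) < R k \<omega>}"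
        proof (rule finite_measure_mono_AE)
          show "AE \<omega> in M. \<omega> \<in> {\<omega> \<in> space M. e\<^sup>2 < D k \<omega>} \<longrightarrow> \<omega> \<in> {\<omega> \<in> space M. ennreal (e\<^sup>2) < R k \<omega>}"
            using DR[of k]
          proof eventually_elim
            case (elim \<omega>)
            have "ennreal (e\<^sup>2) < ennreal (D k \<omega>)" if "e\<^sup>2 < D k \<omega>" using that by (intro ennreal_lessI) (auto intro: le_less_trans[OF zero_le_power2])
            then show ?case using elim by (auto intro: less_le_trans)
          qed
        qed measurable
        then have "ennreal (sqrt (e\<^sup>2) + measure M {\<omega> \<in> space M. e\<^sup>2 < D k \<omega>}) \<le> ennreal (e + measure M {\<omega> \<in> space M. ennreal (e\<^sup>2) < R k \<omega>})"
          using e by (intro ennreal_leI) simp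
        with part_int_in_prob[where P="P k" and g="d k" and m="m k" and \<delta>="e\<^sup>2", OF okd] e show ?thesis
          unfolding D_def by (meson order_trans zero_less_power)
      qed
      show "\<exists>b. b \<longlonglongrightarrow> 0 \<and> (\<forall>k. (\<integral>\<^sup>+\<omega>. min (ennreal \<bar>part_int (P k) (d k) (m k) \<omega>\<bar>) 1 \<partial>M) \<le> ennreal (e + b k))"
        using R0 e le by (intro exI[of _ "\<lambda>k. measure M {\<omega> \<in> space M. ennreal (e\<^sup>2) < R k \<omega>}"]) (auto simp: tends_to_0_in_prob_def)
    qed
    have gint: "part_int (P k) (g k) (m k) \<omega> = simple_integral (m k) (p k) (\<eta> k) B t \<omega> $ i" for k \<omega>
      unfolding part_int_def simple_integral_def sum_component
    proof (intro sum.cong refl)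
      fix j assume j: "j \<in> {..<m k}"
      show "g k j \<omega> \<bullet> (B (P k (Suc j)) \<omega> - B (P k j) \<omega>) = (\<eta> k j \<omega> *v (B (min (p k (Suc j)) t) \<omega> - B (min (p k j) t) \<omega>)) $ i"
      proof (cases "p k j \<le> t")
        case True
        then show ?thesis by (simp add: g_def P_def matrix_vector_mult_def inner_vec_def)
      next
        case False
        moreover have "p k j \<le> p k (Suc j)" using simple[of k] j by (simp add: simple_integrand_def)
        ultimately show ?thesis by (simp add: g_def P_def min_def)
      qed
    qed
    have Idiff: "?I k \<omega> = part_int (P k) (g k) (m k) \<omega> - part_int (P k) (d k) (m k) \<omega>" for k \<omega>
      by (simp add: part_int_def d_def sum_subtractf[symmetric] inner_diff_left)
    have [measurable]: "?I k \<in> borel_measurable M" for k using l2_measurable[OF lI] .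
    have [measurable]: "part_int (P k) (d k) (m k) \<in> borel_measurable M" for k
      using l2_measurable[OF elem_l2[OF part_elem[where P="P k" and g="d k" and m="m k", OF okd], THEN conjunct1]] .
    have [measurable]: "(\<lambda>\<omega>. ennreal (norm (simple_integral (m k) (p k) (\<eta> k) B t \<omega> - Y \<omega>))) \<in> borel_measurable M" for k
      using Y0 by (simp add: tends_to_0_in_prob_def)
    have ulim: "(\<lambda>k. \<integral>\<^sup>+\<omega>. ennreal (min \<bar>?I k \<omega> - ?Y \<omega>\<bar> 1) \<partial>M) \<longlonglongrightarrow> 0"
    proof (rule tendsto_sandwich[OF _ _ tendsto_const])
      let ?u = "\<lambda>k. (\<integral>\<^sup>+\<omega>. min (ennreal (norm (simple_integral (m k) (p k) (\<eta> k) B t \<omega> - Y \<omega>))) (ennreal 1) \<partial>M) + (\<integral>\<^sup>+\<omega>. min (ennreal \<bar>part_int (P k) (d k) (m k) \<omega>\<bar>) 1 \<partial>M)"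
      show "\<forall>\<^sub>F k in sequentially. (\<integral>\<^sup>+\<omega>. ennreal (min \<bar>?I k \<omega> - ?Y \<omega>\<bar> 1) \<partial>M) \<le> ?u k"
      proof (intro always_eventually allI)
        fix k
        have "(\<integral>\<^sup>+\<omega>. ennreal (min \<bar>?I k \<omega> - ?Y \<omega>\<bar> 1) \<partial>M) \<le> (\<integral>\<^sup>+\<omega>. min (ennreal (norm (simple_integral (m k) (p k) (\<eta> k) B t \<omega> - Y \<omega>))) (ennreal 1) + min (ennreal \<bar>part_int (P k) (d k) (m k) \<omega>\<bar>) 1 \<partial>M)"
        proof (rule nn_integral_mono)
          fix \<omega>
          let ?n = "norm (simple_integral (m k) (p k) (\<eta> k) B t \<omega> - Y \<omega>)" and ?d = "\<bar>part_int (P k) (d k) (m k) \<omega>\<bar>"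
          have "\<bar>part_int (P k) (g k) (m k) \<omega> - ?Y \<omega>\<bar> \<le> ?n"
            using component_le_norm_cart[of "simple_integral (m k) (p k) (\<eta> k) B t \<omega> - Y \<omega>" i] by (simp add: gint)
          then have "min \<bar>?I k \<omega> - ?Y \<omega>\<bar> 1 \<le> min ?n 1 + min ?d 1"
            unfolding Idiff by (auto simp: min_def)
          then have "ennreal (min \<bar>?I k \<omega> - ?Y \<omega>\<bar> 1) \<le> ennreal (min ?n 1 + min ?d 1)" by (rule ennreal_leI)
          also have "\<dots> = min (ennreal ?n) (ennreal 1) + min (ennreal ?d) 1"
            using min_of_mono[of ennreal ?n 1] min_of_mono[of ennreal ?d 1]
            by (subst ennreal_plus) (auto simp: monoI ennreal_leI)
          finally show "ennreal (min \<bar>?I k \<omega> - ?Y \<omega>\<bar> 1) \<le> min (ennreal ?n) (ennreal 1) + min (ennreal ?d) 1" .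
        qed
        also have "\<dots> = ?u k" by (rule nn_integral_add) auto
        finally show "(\<integral>\<^sup>+\<omega>. ennreal (min \<bar>?I k \<omega> - ?Y \<omega>\<bar> 1) \<partial>M) \<le> ?u k" .
      qed
      have "?u \<longlonglongrightarrow> 0 + 0"
        by (intro tendsto_add dlim tends_to_0_in_prob_nn_integral_min[OF prob_space_axioms Y0]) auto
      then show "?u \<longlonglongrightarrow> 0" by simp
    qed auto
    have ui: "integrable M (\<lambda>\<omega>. min \<bar>?I k \<omega> - ?Y \<omega>\<bar> 1)" for k
      by (rule integrable_const_bound[where B=1]) auto
    have "(\<lambda>k. ennreal (LINT \<omega>|M. norm (min \<bar>?I k \<omega> - ?Y \<omega>\<bar> 1))) \<longlonglongrightarrow> 0"
      using ulim ui by (simp add: nn_integral_eq_integral)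
    then have "(\<lambda>k. LINT \<omega>|M. norm (min \<bar>?I k \<omega> - ?Y \<omega>\<bar> 1)) \<longlonglongrightarrow> 0"
      by (subst (asm) ennreal_0[symmetric], subst (asm) tendsto_ennreal_iff) auto
    from tendsto_L1_AE_subseq[OF ui this] obtain r :: "nat \<Rightarrow> nat" where r: "strict_mono r"
      "AE \<omega> in M. (\<lambda>j. min \<bar>?I (r j) \<omega> - ?Y \<omega>\<bar> 1) \<longlonglongrightarrow> 0" by blast
    have rlim: "AE \<omega> in M. (\<lambda>j. ?I (r j) \<omega>) \<longlonglongrightarrow> ?Y \<omega>"
      using r(2)
    proof eventually_elim
      case (elim \<omega>)
      have "\<forall>\<^sub>F j in sequentially. min \<bar>?I (r j) \<omega> - ?Y \<omega>\<bar> 1 < 1"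
        using elim by (intro order_tendstoD(2)) auto
      then have "\<forall>\<^sub>F j in sequentially. min \<bar>?I (r j) \<omega> - ?Y \<omega>\<bar> 1 = \<bar>?I (r j) \<omega> - ?Y \<omega>\<bar>"
        by eventually_elim auto
      from Lim_transform_eventually[OF elim this] show ?case
        by (simp add: tendsto_rabs_zero_iff LIM_zero_iff)
    qed
    have I2: "(\<integral>\<^sup>+\<omega>. ennreal ((?I k \<omega> - ?I l \<omega>)\<^sup>2) \<partial>M) \<le> ennreal (2 * a k + 2 * a l)" for k l
    proof -
      note dI = l2_diff[OF lI[of k] lI[of l]]
      note dG = l2_diff[OF lG[of k] lG[of l]] and dk = l2_diff[OF lG[of k] lh] and dl = l2_diff[OF lG[of l] lh]
      have "(LINT \<omega>|M. (?I k \<omega> - ?I l \<omega>)\<^sup>2) = (LINT z|Q. (norm (?G k (snd z) (fst z) - ?G l (snd z) (fst z)))\<^sup>2)"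
        using elem_isometry[OF elem_diff[OF eG[of k] eG[of l]] elem_diff[OF eG[of k] eG[of l]]]
        by (simp add: power2_norm_eq_inner power2_eq_square[symmetric])
      also have "\<dots> \<le> (LINT z|Q. 2 * (norm (?G k (snd z) (fst z) - h (snd z) (fst z)))\<^sup>2 + 2 * (norm (?G l (snd z) (fst z) - h (snd z) (fst z)))\<^sup>2)"
      proof (rule integral_mono)
        fix z
        show "(norm (?G k (snd z) (fst z) - ?G l (snd z) (fst z)))\<^sup>2 \<le> 2 * (norm (?G k (snd z) (fst z) - h (snd z) (fst z)))\<^sup>2 + 2 * (norm (?G l (snd z) (fst z) - h (snd z) (fst z)))\<^sup>2"
          using power2_norm_add_le[of "?G k (snd z) (fst z) - h (snd z) (fst z)" "h (snd z) (fst z) - ?G l (snd z) (fst z)"]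
          by (simp add: norm_minus_commute)
      qed (use l2_norm[OF dG] l2_norm[OF dk] l2_norm[OF dl] in auto)
      also have "\<dots> = 2 * a k + 2 * a l"
        using l2_norm[OF dk] l2_norm[OF dl] by (simp add: a_def)
      finally have "(LINT \<omega>|M. (?I k \<omega> - ?I l \<omega>)\<^sup>2) \<le> 2 * a k + 2 * a l" .
      moreover have "integrable M (\<lambda>\<omega>. (?I k \<omega> - ?I l \<omega>)\<^sup>2)" using l2_norm[OF dI] by simp
      ultimately show ?thesis by (simp add: nn_integral_eq_integral ennreal_leI)
    qed
    \<comment> \<open>Fatou along the subsequence \<open>r\<close>: the integrals
      \<open>?I (r j)\<close> tend to \<open>?Y\<close> almost surely, and their mean-square
      distances from \<open>?I k\<close> are controlled by \<open>I2\<close>. Square integrability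
      of \<open>?Y\<close> comes out as a by-product.\<close>
    have IY: "(\<integral>\<^sup>+\<omega>. ennreal ((?I k \<omega> - ?Y \<omega>)\<^sup>2) \<partial>M) \<le> ennreal (2 * a k)" for k
    proof -
      have "(\<integral>\<^sup>+\<omega>. ennreal ((?I k \<omega> - ?Y \<omega>)\<^sup>2) \<partial>M) = (\<integral>\<^sup>+\<omega>. liminf (\<lambda>j. ennreal ((?I k \<omega> - ?I (r j) \<omega>)\<^sup>2)) \<partial>M)"
      proof (rule nn_integral_cong_AE, use rlim in eventually_elim)
        case (elim \<omega>)
        have "(\<lambda>j. ennreal ((?I k \<omega> - ?I (r j) \<omega>)\<^sup>2)) \<longlonglongrightarrow> ennreal ((?I k \<omega> - ?Y \<omega>)\<^sup>2)"
          by (intro tendsto_ennrealI tendsto_intros elim)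
        then show ?case by (intro lim_imp_Liminf[symmetric]) auto
      qed
      also have "\<dots> \<le> liminf (\<lambda>j. \<integral>\<^sup>+\<omega>. ennreal ((?I k \<omega> - ?I (r j) \<omega>)\<^sup>2) \<partial>M)"
        by (rule nn_integral_liminf) auto
      also have "\<dots> \<le> liminf (\<lambda>j. ennreal (2 * a k + 2 * a (r j)))"
        by (intro Liminf_mono always_eventually allI I2)
      also have "\<dots> = ennreal (2 * a k)"
      proof (rule lim_imp_Liminf)
        have "(\<lambda>j. 2 * a k + 2 * a (r j)) \<longlonglongrightarrow> 2 * a k + 2 * 0"
          using LIMSEQ_subseq_LIMSEQ[OF a0 r(1)] by (intro tendsto_intros) (simp add: o_def)
        then show "(\<lambda>j. ennreal (2 * a k + 2 * a (r j))) \<longlonglongrightarrow> ennreal (2 * a k)"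
          by (intro tendsto_ennrealI) simp
      qed simp
      finally show ?thesis .
    qed
    have iIY: "integrable M (\<lambda>\<omega>. (?I k \<omega> - ?Y \<omega>)\<^sup>2)" for k
    proof (rule integrableI_bounded)
      show "(\<integral>\<^sup>+\<omega>. ennreal (norm ((?I k \<omega> - ?Y \<omega>)\<^sup>2)) \<partial>M) < \<infinity>"
        using IY[of k] by (auto intro: le_less_trans)
    qed measurable
    have lY: "l2 M ?Y"
    proof -
      have "l2 M (\<lambda>\<omega>. ?I 0 \<omega> - ?Y \<omega>)" using iIY[of 0] by (simp add: l2_def)
      from l2_diff[OF lI[of 0] this] show ?thesis by simp
    qed
    have "(\<lambda>k. LINT \<omega>|M. (norm (?I k \<omega> - ?Y \<omega>))\<^sup>2) \<longlonglongrightarrow> 0"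
    proof (rule Lim_null_comparison)
      have a_nonneg: "0 \<le> a k" for k by (simp add: a_def)
      have "(LINT \<omega>|M. (?I k \<omega> - ?Y \<omega>)\<^sup>2) \<le> 2 * a k" for k
        using IY[of k] iIY[of k] a_nonneg[of k] by (simp add: nn_integral_eq_integral ennreal_le_iff)
      then show "\<forall>\<^sub>F k in sequentially. norm (LINT \<omega>|M. (norm (?I k \<omega> - ?Y \<omega>))\<^sup>2) \<le> 2 * a k" by simp
      show "(\<lambda>k. 2 * a k) \<longlonglongrightarrow> 0" using tendsto_mult_right_zero[OF a0] .
    qed
    then show ?thesis using lI lY by (simp add: l2lim_def)
  qed
  have "ito h (\<lambda>\<omega>. Y \<omega> $ i)"
    unfolding ito_def by (intro exI[of _ ?G] exI[of _ ?I] conjI allI eG conv1 conv2)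
  then show ?thesis by (simp add: h_def[abs_def])
qed

end

section \<open>Dynkin's formula for bounded Ito processes\<close>

text \<open>Rounding time down to multiples of \<open>1 / Suc k\<close> leaves countably many time
  points, each with a measurable slice; continuity of the paths lets the mesh go to 0.\<close>

lemma joint_measurable_continuous:
  fixes Z :: "real \<Rightarrow> 'w \<Rightarrow> 'b::{second_countable_topology, metric_space}"
  assumes Z: "\<And>t. Z t \<in> borel_measurable M" and c: "\<And>\<omega>. \<omega> \<in> space M \<Longrightarrow> continuous_on UNIV (\<lambda>t. Z t \<omega>)"
  shows "(\<lambda>z. Z (snd z) (fst z)) \<in> borel_measurable (M \<Otimes>\<^sub>M (lborel :: real measure))"
proof (rule borel_measurable_LIMSEQ_metric)
  fix k :: nat
  show "(\<lambda>z. Z (real_of_int \<lfloor>snd z * real (Suc k)\<rfloor> / real (Suc k)) (fst z)) \<in> borel_measurable (M \<Otimes>\<^sub>M (lborel :: real measure))"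
  proof (rule measurable_compose_countable[where f="\<lambda>i z. Z (real_of_int i / real (Suc k)) (fst z)" and g="\<lambda>z. \<lfloor>snd z * real (Suc k)\<rfloor>"])
    show "(\<lambda>z. Z (real_of_int i / real (Suc k)) (fst z)) \<in> borel_measurable (M \<Otimes>\<^sub>M (lborel :: real measure))" for i
      by (rule measurable_compose[OF measurable_fst Z])
  qed measurable
next
  fix z assume "z \<in> space (M \<Otimes>\<^sub>M (lborel :: real measure))"
  then have \<omega>: "fst z \<in> space M" by (auto simp: space_pair_measure)
  have "(\<lambda>k. real_of_int \<lfloor>snd z * real (Suc k)\<rfloor> / real (Suc k)) \<longlonglongrightarrow> snd z"
  proof (rule tendsto_sandwich)
    show "\<forall>\<^sub>F k in sequentially. snd z - 1 / real (Suc k) \<le> real_of_int \<lfloor>snd z * real (Suc k)\<rfloor> / real (Suc k)"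
    proof (intro always_eventually allI)
      fix k
      have "snd z * real (Suc k) - 1 \<le> real_of_int \<lfloor>snd z * real (Suc k)\<rfloor>" by linarith
      then have "(snd z * real (Suc k) - 1) / real (Suc k) \<le> real_of_int \<lfloor>snd z * real (Suc k)\<rfloor> / real (Suc k)"
        by (intro divide_right_mono) auto
      then show "snd z - 1 / real (Suc k) \<le> real_of_int \<lfloor>snd z * real (Suc k)\<rfloor> / real (Suc k)"
        by (simp add: diff_divide_distrib del: of_nat_Suc)
    qed
    show "\<forall>\<^sub>F k in sequentially. real_of_int \<lfloor>snd z * real (Suc k)\<rfloor> / real (Suc k) \<le> snd z"
    proof (intro always_eventually allI)
      fix k
      have "real_of_int \<lfloor>snd z * real (Suc k)\<rfloor> / real (Suc k) \<le> snd z * real (Suc k) / real (Suc k)"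
        by (intro divide_right_mono) auto
      then show "real_of_int \<lfloor>snd z * real (Suc k)\<rfloor> / real (Suc k) \<le> snd z" by (simp del: of_nat_Suc)
    qed
    have "(\<lambda>k. snd z - 1 / real (Suc k)) \<longlonglongrightarrow> snd z - 0"
      by (intro tendsto_intros LIMSEQ_Suc lim_1_over_n)
    then show "(\<lambda>k. snd z - 1 / real (Suc k)) \<longlonglongrightarrow> snd z" by simp
  qed auto
  from continuous_on_tendsto_compose[OF c[OF \<omega>] this]
  show "(\<lambda>k. Z (real_of_int \<lfloor>snd z * real (Suc k)\<rfloor> / real (Suc k)) (fst z)) \<longlonglongrightarrow> Z (snd z) (fst z)" by simp
qed

section \<open>Time integrals and uniform grids\<close>

abbreviation time_integral :: "real \<Rightarrow> real \<Rightarrow> (real \<Rightarrow> real) \<Rightarrow> real" where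
  "time_integral a b f \<equiv> LINT r:{a<..b}|lborel. f r"

lemma time_integrable:
  fixes f :: "real \<Rightarrow> real"
  assumes [measurable]: "f \<in> borel_measurable borel" and "\<And>r. \<bar>f r\<bar> \<le> C"
  shows "set_integrable lborel {a<..b} f"
  unfolding set_integrable_def
proof (rule integrableI_bounded_set_indicator[where B=C])
  show "emeasure lborel {a<..b} < \<infinity>" by (cases "a \<le> b") auto
qed (use assms(2) in auto)

lemma time_integral_bound:
  fixes f :: "real \<Rightarrow> real"
  assumes f: "f \<in> borel_measurable borel" "\<And>r. \<bar>f r\<bar> \<le> C" and ab: "a \<le> b"
    and c: "\<And>r. a < r \<Longrightarrow> r \<le> b \<Longrightarrow> \<bar>f r\<bar> \<le> c"
  shows "\<bar>time_integral a b f\<bar> \<le> c * (b - a)"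
proof -
  have i: "set_integrable lborel {a<..b} f" by (rule time_integrable[OF f])
  have "norm (time_integral a b f) \<le> (LINT r:{a<..b}|lborel. norm (f r))"
    by (rule set_integral_norm_bound[OF i])
  also have "\<dots> \<le> (LINT r:{a<..b}|lborel. c)"
  proof (rule set_integral_mono)
    show "set_integrable lborel {a<..b} (\<lambda>r. norm (f r))" using i by (rule set_integrable_norm)
    show "set_integrable lborel {a<..b} (\<lambda>r. c)" by (rule time_integrable[where C="\<bar>c\<bar>"]) auto
  qed (use c in auto)
  also have "\<dots> = c * (b - a)" using ab by (simp add: set_lebesgue_integral_def)
  finally show ?thesis by simp
qed

lemma time_integral_sum:
  fixes f :: "'i \<Rightarrow> real \<Rightarrow> real"
  assumes "\<And>i. i \<in> I \<Longrightarrow> set_integrable lborel {a<..b} (f i)"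
  shows "time_integral a b (\<lambda>r. \<Sum>i\<in>I. f i r) = (\<Sum>i\<in>I. time_integral a b (f i))"
    and "set_integrable lborel {a<..b} (\<lambda>r. \<Sum>i\<in>I. f i r)"
proof -
  note i = assms[unfolded set_integrable_def]
  show "time_integral a b (\<lambda>r. \<Sum>i\<in>I. f i r) = (\<Sum>i\<in>I. time_integral a b (f i))"
    unfolding set_lebesgue_integral_def scaleR_sum_right by (rule Bochner_Integration.integral_sum[OF i])
  show "set_integrable lborel {a<..b} (\<lambda>r. \<Sum>i\<in>I. f i r)"
    unfolding set_integrable_def scaleR_sum_right by (rule Bochner_Integration.integrable_sum[OF i])
qed

lemma time_integral_add:
  fixes f :: "real \<Rightarrow> real"
  assumes f: "f \<in> borel_measurable borel" "\<And>r. \<bar>f r\<bar> \<le> C" and "a \<le> b" "b \<le> c"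
  shows "time_integral a b f + time_integral b c f = time_integral a c f"
proof -
  have "{a<..c} = {a<..b} \<union> {b<..c}" using assms by auto
  then show ?thesis
    using set_integral_Un[of "{a<..b}" "{b<..c}" lborel f] time_integrable[OF f] by auto
qed

text \<open>\<open>n\<close> counts the interior points: there are \<open>Suc n\<close> equal
  pieces, so sums over the pieces run over \<open>k \<le> n\<close> and the last point has index
  \<open>Suc n\<close>.\<close>

definition grid :: "real \<Rightarrow> real \<Rightarrow> nat \<Rightarrow> nat \<Rightarrow> real" where
  "grid s t n k = s + real k * ((t - s) / real (Suc n))"

lemma grid_0 [simp]: "grid s t n 0 = s"
  by (simp add: grid_def)

lemma grid_last: "grid s t n (Suc n) = t"
  by (simp add: grid_def del: of_nat_Suc)

lemma grid_diff: "grid s t n (Suc k) - grid s t n k = (t - s) / real (Suc n)"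
  by (simp add: grid_def algebra_simps add_divide_distrib[symmetric] diff_divide_distrib[symmetric])

lemma grid_mono: "s \<le> t \<Longrightarrow> j \<le> k \<Longrightarrow> grid s t n j \<le> grid s t n k"
  by (simp add: grid_def mult_right_mono divide_right_mono)

lemma grid_ge: "s \<le> t \<Longrightarrow> s \<le> grid s t n k"
  using grid_mono[of s t 0 k n] by simp

lemma grid_le: "s \<le> t \<Longrightarrow> k \<le> Suc n \<Longrightarrow> grid s t n k \<le> t"
  using grid_mono[of s t k "Suc n" n] by (simp add: grid_last)

lemma time_integral_grid:
  fixes f :: "real \<Rightarrow> real"
  assumes f: "f \<in> borel_measurable borel" "\<And>r. \<bar>f r\<bar> \<le> C" and st: "s \<le> t"
  shows "(\<Sum>k\<le>n. time_integral (grid s t n k) (grid s t n (Suc k)) f) = time_integral s t f"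
proof -
  have "(\<Sum>k<m. time_integral (grid s t n k) (grid s t n (Suc k)) f) = time_integral s (grid s t n m) f" for m
  proof (induction m)
    case (Suc m)
    then show ?case
      using time_integral_add[OF f, of s "grid s t n m" "grid s t n (Suc m)"] grid_ge[OF st, of n m] grid_mono[OF st, of m "Suc m" n]
      by simp
  qed (simp add: set_lebesgue_integral_def)
  from this[of "Suc n"] show ?thesis by (simp only: grid_last lessThan_Suc_atMost)
qed

lemma grid_uniform:
  fixes f :: "real \<Rightarrow> 'b::metric_space"
  assumes f: "continuous_on {s..t} f" and st: "s \<le> t" and e: "0 < e"
  shows "\<forall>\<^sub>F n in sequentially. \<forall>k\<le>n. \<forall>r\<in>{grid s t n k..grid s t n (Suc k)}. dist (f r) (f (grid s t n k)) < e"
proof -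
  have "uniformly_continuous_on {s..t} f" using f by (intro compact_uniformly_continuous) auto
  then obtain d where d: "0 < d" "\<And>x x'. x \<in> {s..t} \<Longrightarrow> x' \<in> {s..t} \<Longrightarrow> dist x' x < d \<Longrightarrow> dist (f x') (f x) < e"
    using e unfolding uniformly_continuous_on_def by metis
  have "(\<lambda>n. (t - s) / real (Suc n)) \<longlonglongrightarrow> 0"
    using LIMSEQ_Suc[OF lim_const_over_n[of "t - s"]] .
  then have "\<forall>\<^sub>F n in sequentially. (t - s) / real (Suc n) < d" using d by (intro order_tendstoD(2)) auto
  then show ?thesis
  proof eventually_elim
    case (elim n)
    show ?case
    proof (intro allI impI ballI)
      fix k r assume k: "k \<le> n" and r: "r \<in> {grid s t n k..grid s t n (Suc k)}"
      have "grid s t n k \<in> {s..t}" "r \<in> {s..t}"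
        using grid_ge[OF st, of n k] grid_le[OF st, of k n] grid_le[OF st, of "Suc k" n] k r by auto
      moreover have "dist r (grid s t n k) < d"
        using r elim grid_diff[of s t n k] by (simp add: dist_real_def del: of_nat_Suc)
      ultimately show "dist (f r) (f (grid s t n k)) < e" using d(2) by blast
    qed
  qed
qed

text \<open>Of a bounded process with drift \<open>D\<close> and diffusion matrix \<open>A\<close>
  only two facts are kept: the compensated increment has conditional mean zero given
  \<open>F s\<close>, and the product of two of them has the same conditional mean as the integral
  of \<open>A\<close>. The stochastic integral itself no longer appears. Paths are frozen before
  time 0 so that continuity can be stated on the whole line.\<close>

locale bounded_ito_process = prob_space M for M :: "'w measure" +
  fixes F :: "real \<Rightarrow> 'w measure" and Z D :: "real \<Rightarrow> 'w \<Rightarrow> real^'n::finite" and A :: "real \<Rightarrow> 'w \<Rightarrow> real^'n^'n"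
    and R C :: real
  assumes subalg: "subalgebra M (F t)" and F_mono: "0 \<le> s \<Longrightarrow> s \<le> t \<Longrightarrow> subalgebra (F t) (F s)"
    and Z_adapted: "0 \<le> t \<Longrightarrow> Z t \<in> borel_measurable (F t)"
    and Z_neg: "t < 0 \<Longrightarrow> Z t = Z 0"
    and Z_bound: "\<omega> \<in> space M \<Longrightarrow> norm (Z t \<omega>) \<le> R"
    and Z_cont: "\<omega> \<in> space M \<Longrightarrow> continuous_on UNIV (\<lambda>t. Z t \<omega>)"
    and D_meas: "(\<lambda>z. D (snd z) (fst z)) \<in> borel_measurable (M \<Otimes>\<^sub>M lborel)"
    and D_bound: "\<omega> \<in> space M \<Longrightarrow> norm (D t \<omega>) \<le> C"
    and A_meas: "(\<lambda>z. A (snd z) (fst z) $ i $ j) \<in> borel_measurable (M \<Otimes>\<^sub>M lborel)"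
    and A_bound: "\<omega> \<in> space M \<Longrightarrow> \<bar>A t \<omega> $ i $ j\<bar> \<le> C"
    and drift: "\<And>s t \<xi> K i. 0 \<le> s \<Longrightarrow> s \<le> t \<Longrightarrow> \<xi> \<in> borel_measurable (F s) \<Longrightarrow> (\<And>\<omega>. \<omega> \<in> space M \<Longrightarrow> \<bar>\<xi> \<omega>\<bar> \<le> K) \<Longrightarrow>
      (LINT \<omega>|M. \<xi> \<omega> * ((Z t \<omega> - Z s \<omega>) $ i - time_integral s t (\<lambda>r. D r \<omega> $ i))) = 0"
    and covariation: "\<And>s t \<xi> K i j. 0 \<le> s \<Longrightarrow> s \<le> t \<Longrightarrow> \<xi> \<in> borel_measurable (F s) \<Longrightarrow> (\<And>\<omega>. \<omega> \<in> space M \<Longrightarrow> \<bar>\<xi> \<omega>\<bar> \<le> K) \<Longrightarrow>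
      (LINT \<omega>|M. \<xi> \<omega> * (((Z t \<omega> - Z s \<omega>) $ i - time_integral s t (\<lambda>r. D r \<omega> $ i)) * ((Z t \<omega> - Z s \<omega>) $ j - time_integral s t (\<lambda>r. D r \<omega> $ j))
         - time_integral s t (\<lambda>r. A r \<omega> $ i $ j))) = 0"
begin

section \<open>Bounded fields in time and bounded random variables\<close>

definition bounded_field :: "(real \<Rightarrow> 'w \<Rightarrow> real) \<Rightarrow> bool" where
  "bounded_field f \<longleftrightarrow> (\<lambda>z. f (snd z) (fst z)) \<in> borel_measurable (M \<Otimes>\<^sub>M lborel) \<and> (\<exists>K. \<forall>\<omega>\<in>space M. \<forall>r. \<bar>f r \<omega>\<bar> \<le> K)"

lemma meas_F: "f \<in> measurable (F t) N \<Longrightarrow> f \<in> measurable M N"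
  by (rule measurable_from_subalg[OF subalg])

lemma meas_F_mono: "f \<in> measurable (F s) N \<Longrightarrow> 0 \<le> s \<Longrightarrow> s \<le> t \<Longrightarrow> f \<in> measurable (F t) N"
  by (rule measurable_from_subalg[OF F_mono])

lemma Z_meas [measurable]: "Z t \<in> borel_measurable M"
  using meas_F[OF Z_adapted, of t] meas_F[OF Z_adapted, of 0] Z_neg[of t] by (cases "t < 0") auto

lemma Z_joint: "(\<lambda>z. Z (snd z) (fst z)) \<in> borel_measurable (M \<Otimes>\<^sub>M lborel)"
  by (rule joint_measurable_continuous[OF Z_meas Z_cont])

lemma C_nonneg: "0 \<le> C"
  using D_bound not_empty by (metis norm_ge_zero order_trans ex_in_conv)

lemma bounded_field_D: "bounded_field (\<lambda>r \<omega>. D r \<omega> $ i)"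
  unfolding bounded_field_def
  using D_bound component_le_norm_cart order_trans D_meas by (auto intro!: exI[of _ C]) blast

lemma bounded_field_A: "bounded_field (\<lambda>r \<omega>. A r \<omega> $ i $ j)"
  unfolding bounded_field_def using A_bound A_meas by (auto intro!: exI[of _ C])

lemma bounded_field_add: "bounded_field f \<Longrightarrow> bounded_field g \<Longrightarrow> bounded_field (\<lambda>r \<omega>. f r \<omega> + g r \<omega>)"
proof -
  assume a: "bounded_field f" "bounded_field g"
  then obtain K L where "\<forall>\<omega>\<in>space M. \<forall>r. \<bar>f r \<omega>\<bar> \<le> K" "\<forall>\<omega>\<in>space M. \<forall>r. \<bar>g r \<omega>\<bar> \<le> L" by (auto simp: bounded_field_def)
  then have "\<forall>\<omega>\<in>space M. \<forall>r. \<bar>f r \<omega> + g r \<omega>\<bar> \<le> K + L"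
    by (meson abs_triangle_ineq add_mono order_trans)
  with a show ?thesis unfolding bounded_field_def by auto
qed

lemma bounded_field_mult: "bounded_field f \<Longrightarrow> bounded_field g \<Longrightarrow> bounded_field (\<lambda>r \<omega>. f r \<omega> * g r \<omega>)"
proof -
  assume a: "bounded_field f" "bounded_field g"
  then obtain K L where KL: "\<forall>\<omega>\<in>space M. \<forall>r. \<bar>f r \<omega>\<bar> \<le> K" "\<forall>\<omega>\<in>space M. \<forall>r. \<bar>g r \<omega>\<bar> \<le> L" by (auto simp: bounded_field_def)
  have "\<forall>\<omega>\<in>space M. \<forall>r. \<bar>f r \<omega> * g r \<omega>\<bar> \<le> K * L"
  proof (intro ballI allI)
    fix \<omega> r assume "\<omega> \<in> space M"
    then have "\<bar>f r \<omega>\<bar> \<le> K" "\<bar>g r \<omega>\<bar> \<le> L" using KL by auto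
    then show "\<bar>f r \<omega> * g r \<omega>\<bar> \<le> K * L" unfolding abs_mult by (intro mult_mono) auto
  qed
  with a show ?thesis unfolding bounded_field_def by auto
qed

lemma bounded_field_const: "bounded_field (\<lambda>r \<omega>. c)"
  by (auto simp: bounded_field_def)

lemma bounded_field_Z:
  assumes g: "continuous_on UNIV (g :: real^'n \<Rightarrow> real)"
  shows "bounded_field (\<lambda>r \<omega>. g (Z r \<omega>))"
proof -
  have "compact (g ` cball 0 R)" using g by (intro compact_continuous_image continuous_on_subset[OF g]) auto
  then obtain K where K: "\<And>x. x \<in> cball 0 R \<Longrightarrow> \<bar>g x\<bar> \<le> K" using compact_imp_bounded bounded_iff by (metis image_eqI real_norm_def)
  have "g \<in> borel_measurable borel" using g by (rule borel_measurable_continuous_onI)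
  from measurable_compose[OF Z_joint this] show ?thesis
    unfolding bounded_field_def using K Z_bound by (auto intro!: exI[of _ K])
qed

lemma bounded_field_section:
  assumes f: "bounded_field f" and \<omega>: "\<omega> \<in> space M"
  shows "(\<lambda>r. f r \<omega>) \<in> borel_measurable borel"
proof -
  have m: "(\<lambda>z. f (snd z) (fst z)) \<in> borel_measurable (M \<Otimes>\<^sub>M lborel)" using f by (simp add: bounded_field_def)
  have "(\<lambda>r::real. (\<omega>, r)) \<in> measurable lborel (M \<Otimes>\<^sub>M lborel)" using \<omega> by (rule measurable_Pair1')
  from measurable_compose[OF this m] show ?thesis by simp
qed

lemma time_integral_meas:
  assumes "bounded_field f"
  shows "(\<lambda>\<omega>. time_integral a b (\<lambda>r. f r \<omega>)) \<in> borel_measurable M"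
proof -
  have [measurable]: "(\<lambda>z. f (snd z) (fst z)) \<in> borel_measurable (M \<Otimes>\<^sub>M lborel)" using assms by (simp add: bounded_field_def)
  have "(\<lambda>\<omega>. LINT r|lborel. indicator {a<..b} r *\<^sub>R f r \<omega>) \<in> borel_measurable M"
    by (rule lborel.borel_measurable_lebesgue_integral) (simp add: split_beta')
  then show ?thesis by (simp add: set_lebesgue_integral_def)
qed

lemma bounded_integrable:
  fixes f :: "'w \<Rightarrow> real"
  shows "f \<in> borel_measurable M \<Longrightarrow> (\<And>\<omega>. \<omega> \<in> space M \<Longrightarrow> \<bar>f \<omega>\<bar> \<le> K) \<Longrightarrow> integrable M f"
  by (rule integrable_const_bound[where B=K]) auto

definition bounded_rv :: "('w \<Rightarrow> real) \<Rightarrow> bool" where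
  "bounded_rv f \<longleftrightarrow> f \<in> borel_measurable M \<and> (\<exists>K. \<forall>\<omega>\<in>space M. \<bar>f \<omega>\<bar> \<le> K)"

lemma bounded_rv_integrable: "bounded_rv f \<Longrightarrow> integrable M f"
  unfolding bounded_rv_def using bounded_integrable by blast

lemma bounded_rv_const: "bounded_rv (\<lambda>_. c)"
  by (auto simp: bounded_rv_def)

lemma bounded_rv_add:
  assumes "bounded_rv f" "bounded_rv g" shows "bounded_rv (\<lambda>\<omega>. f \<omega> + g \<omega>)"
proof -
  obtain K L where KL: "\<And>\<omega>. \<omega> \<in> space M \<Longrightarrow> \<bar>f \<omega>\<bar> \<le> K" "\<And>\<omega>. \<omega> \<in> space M \<Longrightarrow> \<bar>g \<omega>\<bar> \<le> L" using assms by (auto simp: bounded_rv_def)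
  have "\<bar>f \<omega> + g \<omega>\<bar> \<le> K + L" if "\<omega> \<in> space M" for \<omega> using KL[OF that] by linarith
  with assms show ?thesis unfolding bounded_rv_def by (auto intro!: exI[of _ "K + L"])
qed

lemma bounded_rv_mult:
  assumes "bounded_rv f" "bounded_rv g" shows "bounded_rv (\<lambda>\<omega>. f \<omega> * g \<omega>)"
proof -
  obtain K L where KL: "\<And>\<omega>. \<omega> \<in> space M \<Longrightarrow> \<bar>f \<omega>\<bar> \<le> K" "\<And>\<omega>. \<omega> \<in> space M \<Longrightarrow> \<bar>g \<omega>\<bar> \<le> L" using assms by (auto simp: bounded_rv_def)
  have "\<bar>f \<omega> * g \<omega>\<bar> \<le> K * L" if "\<omega> \<in> space M" for \<omega> unfolding abs_mult using KL[OF that] by (intro mult_mono) auto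
  with assms show ?thesis unfolding bounded_rv_def by (auto intro!: exI[of _ "K * L"])
qed

lemma bounded_rv_diff:
  assumes "bounded_rv f" "bounded_rv g" shows "bounded_rv (\<lambda>\<omega>. f \<omega> - g \<omega>)"
  using bounded_rv_add[OF assms(1) bounded_rv_mult[OF bounded_rv_const[of "-1"] assms(2)]] by simp

lemma bounded_rv_sum: "(\<And>i. i \<in> I \<Longrightarrow> bounded_rv (f i)) \<Longrightarrow> bounded_rv (\<lambda>\<omega>. \<Sum>i\<in>I. f i \<omega>)"
  by (induction I rule: infinite_finite_induct) (auto intro: bounded_rv_const bounded_rv_add)

lemma bounded_rv_comp:
  assumes g: "continuous_on UNIV (g :: real^'n \<Rightarrow> real)" shows "bounded_rv (\<lambda>\<omega>. g (Z r \<omega>))"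
  using bounded_field_Z[OF g] measurable_compose[OF Z_meas borel_measurable_continuous_onI[OF g]]
  by (auto simp: bounded_rv_def bounded_field_def)

lemma bounded_rv_Z_nth: "bounded_rv (\<lambda>\<omega>. Z r \<omega> $ i)"
  by (rule bounded_rv_comp[of "\<lambda>x. x $ i"]) (intro continuous_intros)

lemma continuous_bounded_cball:
  assumes g: "continuous_on UNIV (g :: real^'n \<Rightarrow> real)"
  obtains K where "0 \<le> K" "\<And>\<omega> r. \<omega> \<in> space M \<Longrightarrow> \<bar>g (Z r \<omega>)\<bar> \<le> K"
proof -
  obtain K where K: "\<And>\<omega> r. \<omega> \<in> space M \<Longrightarrow> \<bar>g (Z r \<omega>)\<bar> \<le> K" using bounded_field_Z[OF g] by (auto simp: bounded_field_def)
  then have "\<And>\<omega> r. \<omega> \<in> space M \<Longrightarrow> \<bar>g (Z r \<omega>)\<bar> \<le> max 0 K" by (meson max.coboundedI2)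
  then show ?thesis using that[of "max 0 K"] by simp
qed

lemma field_bound:
  assumes "bounded_field f"
  obtains K where "0 \<le> K" "\<And>\<omega> r. \<omega> \<in> space M \<Longrightarrow> \<bar>f r \<omega>\<bar> \<le> K"
proof -
  obtain K where K: "\<And>\<omega> r. \<omega> \<in> space M \<Longrightarrow> \<bar>f r \<omega>\<bar> \<le> K" using assms by (auto simp: bounded_field_def)
  then have "\<And>\<omega> r. \<omega> \<in> space M \<Longrightarrow> \<bar>f r \<omega>\<bar> \<le> max 0 K" by (meson max.coboundedI2)
  then show ?thesis using that[of "max 0 K"] by simp
qed

lemma field_integrable:
  assumes f: "bounded_field f" and \<omega>: "\<omega> \<in> space M"
  shows "set_integrable lborel {a<..b} (\<lambda>r. f r \<omega>)"
proof -
  obtain K where "\<And>\<omega> r. \<omega> \<in> space M \<Longrightarrow> \<bar>f r \<omega>\<bar> \<le> K" using f by (auto simp: bounded_field_def)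
  from time_integrable[OF bounded_field_section[OF f \<omega>] this[OF \<omega>]] show ?thesis .
qed

lemma field_integral_bound:
  assumes f: "bounded_field f" and ab: "a \<le> b" and \<omega>: "\<omega> \<in> space M"
    and c: "\<And>r. a < r \<Longrightarrow> r \<le> b \<Longrightarrow> \<bar>f r \<omega>\<bar> \<le> c"
  shows "\<bar>time_integral a b (\<lambda>r. f r \<omega>)\<bar> \<le> c * (b - a)"
proof -
  obtain K where "\<And>\<omega> r. \<omega> \<in> space M \<Longrightarrow> \<bar>f r \<omega>\<bar> \<le> K" using f by (auto simp: bounded_field_def)
  from time_integral_bound[OF bounded_field_section[OF f \<omega>] this[OF \<omega>] ab c] show ?thesis .
qed

lemma bounded_rv_time_integral:
  assumes f: "bounded_field f" and ab: "a \<le> b"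
  shows "bounded_rv (\<lambda>\<omega>. time_integral a b (\<lambda>r. f r \<omega>))"
proof -
  obtain K where "\<And>\<omega> r. \<omega> \<in> space M \<Longrightarrow> \<bar>f r \<omega>\<bar> \<le> K" using f by (auto simp: bounded_field_def)
  then show ?thesis
    using time_integral_meas[OF f] field_integral_bound[OF f ab] by (auto simp: bounded_rv_def intro!: exI[of _ "K * (b - a)"])
qed

lemma D_integral_bound:
  assumes "a \<le> b" "\<omega> \<in> space M"
  shows "\<bar>time_integral a b (\<lambda>r. D r \<omega> $ i)\<bar> \<le> C * (b - a)"
  by (rule field_integral_bound[OF bounded_field_D assms]) (use D_bound[OF assms(2)] component_le_norm_cart order_trans in blast)

lemma A_integral_bound:
  assumes "a \<le> b" "\<omega> \<in> space M"
  shows "\<bar>time_integral a b (\<lambda>r. A r \<omega> $ i $ j)\<bar> \<le> C * (b - a)"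
  by (rule field_integral_bound[OF bounded_field_A assms]) (use A_bound[OF assms(2)] in blast)

lemma Z_diff_bound: "\<omega> \<in> space M \<Longrightarrow> norm (Z t \<omega> - Z s \<omega>) \<le> 2 * R"
  using norm_triangle_ineq4[of "Z t \<omega>" "Z s \<omega>"] Z_bound[of \<omega> t] Z_bound[of \<omega> s] by linarith

text \<open>A conditional second moment, the conditioning being expressed by the weight
  \<open>\<theta>\<close>. An increment is a compensated increment plus a drift integral. The square
  of the first has conditional mean at most \<open>C * (b - a)\<close>; the square of the second is
  at most \<open>(C * (b - a))\<^sup>2\<close>, where one factor \<open>b - a\<close> is absorbed
  into \<open>H\<close>. So the bound is linear in \<open>b - a\<close>.\<close>

lemma second_moment:
  assumes ab: "0 \<le> a" "a \<le> b" "b - a \<le> H" and \<theta>: "\<theta> \<in> borel_measurable (F a)" "\<And>\<omega>. \<omega> \<in> space M \<Longrightarrow> 0 \<le> \<theta> \<omega>" "\<And>\<omega>. \<omega> \<in> space M \<Longrightarrow> \<theta> \<omega> \<le> K"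
  shows "(LINT \<omega>|M. \<theta> \<omega> * (norm (Z b \<omega> - Z a \<omega>))\<^sup>2) \<le> real CARD('n) * (2 * C + 2 * C\<^sup>2 * H) * (b - a) * (LINT \<omega>|M. \<theta> \<omega>)"
proof -
  have [measurable]: "\<theta> \<in> borel_measurable M" using meas_F[OF \<theta>(1)] .
  note [measurable] = time_integral_meas[OF bounded_field_D] time_integral_meas[OF bounded_field_A]
  have \<theta>b: "\<omega> \<in> space M \<Longrightarrow> \<bar>\<theta> \<omega>\<bar> \<le> K" for \<omega> using \<theta>(2,3)[of \<omega>] by simp
  have K: "0 \<le> K" using \<theta>b not_empty by (metis abs_ge_zero order_trans ex_in_conv)
  have \<theta>i: "integrable M \<theta>" by (rule bounded_integrable[OF _ \<theta>b]) auto
  define \<beta> where "\<beta> i \<omega> = time_integral a b (\<lambda>r. D r \<omega> $ i)" for i \<omega>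
  define \<alpha> where "\<alpha> i \<omega> = time_integral a b (\<lambda>r. A r \<omega> $ i $ i)" for i \<omega>
  define N where "N i \<omega> = (Z b \<omega> - Z a \<omega>) $ i - \<beta> i \<omega>" for i \<omega>
  have [measurable]: "\<beta> i \<in> borel_measurable M" "\<alpha> i \<in> borel_measurable M" for i
    unfolding \<beta>_def \<alpha>_def by measurable
  have [measurable]: "N i \<in> borel_measurable M" for i unfolding N_def by measurable
  have \<beta>b: "\<bar>\<beta> i \<omega>\<bar> \<le> C * (b - a)" "\<bar>\<alpha> i \<omega>\<bar> \<le> C * (b - a)" if "\<omega> \<in> space M" for i \<omega>
    unfolding \<beta>_def \<alpha>_def by (rule D_integral_bound A_integral_bound; use ab that in simp)+
  have db: "\<bar>(Z b \<omega> - Z a \<omega>) $ i\<bar> \<le> 2 * R" if "\<omega> \<in> space M" for i \<omega>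
    using Z_diff_bound[OF that] component_le_norm_cart order_trans by blast
  have Nb: "\<bar>N i \<omega>\<bar> \<le> 2 * R + C * (b - a)" if "\<omega> \<in> space M" for i \<omega>
    using db[OF that, of i] \<beta>b(1)[OF that, of i] by (simp add: N_def)
  have NNi: "integrable M (\<lambda>\<omega>. \<theta> \<omega> * (N i \<omega>)\<^sup>2)" for i
  proof (rule bounded_integrable)
    fix \<omega> assume \<omega>: "\<omega> \<in> space M"
    have "(N i \<omega>)\<^sup>2 \<le> (2 * R + C * (b - a))\<^sup>2" using Nb[OF \<omega>, of i] power_mono[of "\<bar>N i \<omega>\<bar>" _ 2] by simp
    then show "\<bar>\<theta> \<omega> * (N i \<omega>)\<^sup>2\<bar> \<le> K * (2 * R + C * (b - a))\<^sup>2"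
      using \<theta>b[OF \<omega>] K by (auto simp: abs_mult intro!: mult_mono)
  qed measurable
  have \<alpha>i: "integrable M (\<lambda>\<omega>. \<theta> \<omega> * \<alpha> i \<omega>)" for i
  proof (rule bounded_integrable)
    fix \<omega> assume \<omega>: "\<omega> \<in> space M"
    then show "\<bar>\<theta> \<omega> * \<alpha> i \<omega>\<bar> \<le> K * (C * (b - a))"
      using \<theta>b[OF \<omega>] \<beta>b(2)[OF \<omega>, of i] K by (auto simp: abs_mult intro!: mult_mono)
  qed measurable
  have ENN: "(LINT \<omega>|M. \<theta> \<omega> * (N i \<omega>)\<^sup>2) \<le> C * (b - a) * (LINT \<omega>|M. \<theta> \<omega>)" for i
  proof -
    have "(LINT \<omega>|M. \<theta> \<omega> * (N i \<omega> * N i \<omega> - \<alpha> i \<omega>)) = 0"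
      using covariation[OF ab(1,2) \<theta>(1) \<theta>b, of i i] by (simp add: N_def \<beta>_def \<alpha>_def)
    then have "(LINT \<omega>|M. \<theta> \<omega> * (N i \<omega>)\<^sup>2) = (LINT \<omega>|M. \<theta> \<omega> * \<alpha> i \<omega>)"
      using NNi[of i] \<alpha>i[of i] by (simp add: right_diff_distrib power2_eq_square)
    also have "\<dots> \<le> (LINT \<omega>|M. \<theta> \<omega> * (C * (b - a)))"
      using \<beta>b(2) \<theta>(2) \<theta>i \<alpha>i by (intro integral_mono mult_left_mono) (auto simp: abs_le_iff)
    finally show ?thesis by (simp add: mult.commute)
  qed
  have di: "integrable M (\<lambda>\<omega>. \<theta> \<omega> * ((Z b \<omega> - Z a \<omega>) $ i)\<^sup>2)" for i
  proof (rule bounded_integrable)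
    fix \<omega> assume \<omega>: "\<omega> \<in> space M"
    have "((Z b \<omega> - Z a \<omega>) $ i)\<^sup>2 \<le> (2 * R)\<^sup>2" using power_mono[OF db[OF \<omega>, of i] abs_ge_zero, of 2] by simp
    then show "\<bar>\<theta> \<omega> * ((Z b \<omega> - Z a \<omega>) $ i)\<^sup>2\<bar> \<le> K * (2 * R)\<^sup>2"
      using \<theta>b[OF \<omega>] K unfolding abs_mult by (intro mult_mono) auto
  qed measurable
  have each: "(LINT \<omega>|M. \<theta> \<omega> * ((Z b \<omega> - Z a \<omega>) $ i)\<^sup>2) \<le> (2 * C + 2 * C\<^sup>2 * H) * (b - a) * (LINT \<omega>|M. \<theta> \<omega>)" for i
  proof -
    have "(LINT \<omega>|M. \<theta> \<omega> * ((Z b \<omega> - Z a \<omega>) $ i)\<^sup>2) \<le> (LINT \<omega>|M. 2 * (\<theta> \<omega> * (N i \<omega>)\<^sup>2) + 2 * (C\<^sup>2 * H * (b - a)) * \<theta> \<omega>)"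
    proof (rule integral_mono[OF di])
      fix \<omega> assume \<omega>: "\<omega> \<in> space M"
      have "(\<beta> i \<omega>)\<^sup>2 \<le> (C * (b - a))\<^sup>2" using \<beta>b(1)[OF \<omega>, of i] power_mono[of "\<bar>\<beta> i \<omega>\<bar>" _ 2] by simp
      also have "\<dots> = C\<^sup>2 * (b - a) * (b - a)" by (simp add: power_mult_distrib power2_eq_square)
      also have "\<dots> \<le> C\<^sup>2 * H * (b - a)" using ab by (intro mult_right_mono mult_left_mono) auto
      finally have "(\<beta> i \<omega>)\<^sup>2 \<le> C\<^sup>2 * H * (b - a)" .
      moreover have "((Z b \<omega> - Z a \<omega>) $ i)\<^sup>2 \<le> 2 * (N i \<omega>)\<^sup>2 + 2 * (\<beta> i \<omega>)\<^sup>2"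
        using power2_norm_add_le[of "N i \<omega>" "\<beta> i \<omega>"] by (simp add: N_def)
      ultimately have "((Z b \<omega> - Z a \<omega>) $ i)\<^sup>2 \<le> 2 * (N i \<omega>)\<^sup>2 + 2 * (C\<^sup>2 * H * (b - a))" by linarith
      from mult_left_mono[OF this \<theta>(2)[OF \<omega>]]
      show "\<theta> \<omega> * ((Z b \<omega> - Z a \<omega>) $ i)\<^sup>2 \<le> 2 * (\<theta> \<omega> * (N i \<omega>)\<^sup>2) + 2 * (C\<^sup>2 * H * (b - a)) * \<theta> \<omega>"
        by (simp add: algebra_simps)
    qed (use NNi \<theta>i in auto)
    also have "\<dots> = 2 * (LINT \<omega>|M. \<theta> \<omega> * (N i \<omega>)\<^sup>2) + 2 * (C\<^sup>2 * H * (b - a)) * (LINT \<omega>|M. \<theta> \<omega>)"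
      using NNi \<theta>i by simp
    also have "\<dots> \<le> 2 * (C * (b - a) * (LINT \<omega>|M. \<theta> \<omega>)) + 2 * (C\<^sup>2 * H * (b - a)) * (LINT \<omega>|M. \<theta> \<omega>)"
      using ENN[of i] by simp
    finally show ?thesis by (simp add: algebra_simps)
  qed
  have "(\<Sum>i\<in>UNIV. LINT \<omega>|M. \<theta> \<omega> * ((Z b \<omega> - Z a \<omega>) $ i)\<^sup>2) \<le> (\<Sum>i\<in>(UNIV::'n set). (2 * C + 2 * C\<^sup>2 * H) * (b - a) * (LINT \<omega>|M. \<theta> \<omega>))"
    by (rule sum_mono) (rule each)
  moreover have "(LINT \<omega>|M. \<theta> \<omega> * (norm (Z b \<omega> - Z a \<omega>))\<^sup>2) = (\<Sum>i\<in>UNIV. LINT \<omega>|M. \<theta> \<omega> * ((Z b \<omega> - Z a \<omega>) $ i)\<^sup>2)"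
  proof -
    have nrm: "(norm v)\<^sup>2 = (\<Sum>i\<in>UNIV. (v $ i)\<^sup>2)" for v :: "real^'n"
      unfolding power2_norm_eq_inner inner_vec_def by (simp add: power2_eq_square)
    have "(LINT \<omega>|M. \<theta> \<omega> * (norm (Z b \<omega> - Z a \<omega>))\<^sup>2) = (LINT \<omega>|M. (\<Sum>i\<in>UNIV. \<theta> \<omega> * ((Z b \<omega> - Z a \<omega>) $ i)\<^sup>2))"
      by (simp only: nrm sum_distrib_left)
    then show ?thesis using di by (simp only: Bochner_Integration.integral_sum)
  qed
  ultimately show ?thesis by (simp add: mult.assoc)
qed

section \<open>Increments along a grid and their quadratic variation\<close>

definition incr :: "real \<Rightarrow> real \<Rightarrow> nat \<Rightarrow> nat \<Rightarrow> 'w \<Rightarrow> real^'n" where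
  "incr s t n k \<omega> = Z (grid s t n (Suc k)) \<omega> - Z (grid s t n k) \<omega>"

definition drift_int :: "real \<Rightarrow> real \<Rightarrow> nat \<Rightarrow> nat \<Rightarrow> 'n \<Rightarrow> 'w \<Rightarrow> real" where
  "drift_int s t n k i \<omega> = time_integral (grid s t n k) (grid s t n (Suc k)) (\<lambda>r. D r \<omega> $ i)"

lemma incr_meas [measurable]: "incr s t n k \<in> borel_measurable M"
  unfolding incr_def by measurable

lemma drift_int_meas [measurable]: "drift_int s t n k i \<in> borel_measurable M"
  unfolding drift_int_def by (rule time_integral_meas[OF bounded_field_D])

text \<open>A mean-square bound uniform in the mesh, as Cauchy-Schwarz in
  \<open>remainder_limit\<close> demands. A step changes the square of the partial sum
  \<open>S\<close> by \<open>2 S q + q^2\<close>. Given the past, \<open>q\<close> has mean of the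
  order of the mesh, which handles the first term; the bound \<open>q \<le> L\<close> reduces the
  second one to the mean of \<open>q\<close>.\<close>

lemma quadratic_variation_bound:
  assumes st: "0 \<le> s" "s \<le> t"
  obtains c where "\<And>n. (LINT \<omega>|M. (\<Sum>k\<le>n. (norm (incr s t n k \<omega>))\<^sup>2)\<^sup>2) \<le> c"
proof -
  define c0 where "c0 = real CARD('n) * (2 * C + 2 * C\<^sup>2 * (t - s))"
  define L where "L = (2 * R)\<^sup>2"
  have c0: "0 \<le> c0" unfolding c0_def using C_nonneg st by simp
  have L: "0 \<le> L" by (simp add: L_def)
  show ?thesis
  proof (rule that)
    fix n
    define h where "h = (t - s) / real (Suc n)"
    have "(t - s) / real (Suc n) \<le> (t - s) / 1" using st by (intro divide_left_mono) auto
    then have h: "0 \<le> h" "h \<le> t - s" "real (Suc n) * h = t - s"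
      using st unfolding h_def by auto
    define q where "q k \<omega> = (norm (incr s t n k \<omega>))\<^sup>2" for k \<omega>
    define S where "S m \<omega> = (\<Sum>k<m. q k \<omega>)" for m \<omega>
    have [measurable]: "q k \<in> borel_measurable M" "S m \<in> borel_measurable M" for k m
      unfolding q_def S_def by measurable
    have q: "0 \<le> q k \<omega>" "q k \<omega> \<le> L" if "\<omega> \<in> space M" for k \<omega>
      unfolding q_def L_def incr_def using power_mono[OF Z_diff_bound[OF that] norm_ge_zero, of _ _ 2] by auto
    have Sb: "0 \<le> S m \<omega>" "S m \<omega> \<le> real m * L" if "\<omega> \<in> space M" for m \<omega>
      unfolding S_def using q[OF that] sum_nonneg[of "{..<m}" "\<lambda>k. q k \<omega>"] sum_bounded_above[of "{..<m}" "\<lambda>k. q k \<omega>" L] by auto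
    have Sm: "S m \<in> borel_measurable (F (grid s t n m))" for m
      unfolding S_def
    proof (rule borel_measurable_sum)
      fix k assume k: "k \<in> {..<m}"
      have g: "0 \<le> grid s t n k" "grid s t n k \<le> grid s t n m" "0 \<le> grid s t n (Suc k)" "grid s t n (Suc k) \<le> grid s t n m"
        using grid_ge[OF st(2), of n k] grid_ge[OF st(2), of n "Suc k"] st grid_mono[OF st(2), of k m n] grid_mono[OF st(2), of "Suc k" m n] k by auto
      have [measurable]: "Z (grid s t n k) \<in> borel_measurable (F (grid s t n m))" "Z (grid s t n (Suc k)) \<in> borel_measurable (F (grid s t n m))"
        using meas_F_mono[OF Z_adapted[OF g(1)] g(1,2)] meas_F_mono[OF Z_adapted[OF g(3)] g(3,4)] by auto
      show "q k \<in> borel_measurable (F (grid s t n m))" unfolding q_def incr_def by measurable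
    qed
    have mom: "(LINT \<omega>|M. \<theta> \<omega> * q m \<omega>) \<le> c0 * h * (LINT \<omega>|M. \<theta> \<omega>)"
      if "\<theta> \<in> borel_measurable (F (grid s t n m))" "\<And>\<omega>. \<omega> \<in> space M \<Longrightarrow> 0 \<le> \<theta> \<omega>" "\<And>\<omega>. \<omega> \<in> space M \<Longrightarrow> \<theta> \<omega> \<le> K" for \<theta> K m
      using second_moment[OF _ _ _ that, of "grid s t n (Suc m)" "t - s"] grid_ge[OF st(2), of n m] st grid_mono[OF st(2), of m "Suc m" n] h
      by (simp add: grid_diff q_def incr_def c0_def h_def)
    have Si: "integrable M (S m)" "integrable M (q m)" "integrable M (\<lambda>\<omega>. S m \<omega> * q m \<omega>)" "integrable M (\<lambda>\<omega>. (S m \<omega>)\<^sup>2)" "integrable M (\<lambda>\<omega>. (q m \<omega>)\<^sup>2)" for m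
    proof -
      have b: "\<bar>S m \<omega>\<bar> \<le> real m * L" "\<bar>q m \<omega>\<bar> \<le> L" if "\<omega> \<in> space M" for \<omega> using Sb[OF that, of m] q[OF that, of m] by auto
      show "integrable M (S m)" "integrable M (q m)" using b by (auto intro!: bounded_integrable)
      show "integrable M (\<lambda>\<omega>. S m \<omega> * q m \<omega>)"
        using b L by (intro bounded_integrable[where K="real m * L * L"]) (auto simp: abs_mult intro!: mult_mono)
      show "integrable M (\<lambda>\<omega>. (S m \<omega>)\<^sup>2)"
        using b L by (intro bounded_integrable[where K="(real m * L)\<^sup>2"]) (auto simp: abs_le_square_iff[symmetric])
      show "integrable M (\<lambda>\<omega>. (q m \<omega>)\<^sup>2)"
        using b L by (intro bounded_integrable[where K="L\<^sup>2"]) (auto simp: abs_le_square_iff[symmetric])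
    qed
    have ES: "(LINT \<omega>|M. S m \<omega>) \<le> real m * (c0 * h)" for m
    proof (induction m)
      case (Suc m)
      have "(LINT \<omega>|M. S (Suc m) \<omega>) = (LINT \<omega>|M. S m \<omega>) + (LINT \<omega>|M. q m \<omega>)"
      proof -
        have "S (Suc m) = (\<lambda>\<omega>. S m \<omega> + q m \<omega>)" by (auto simp: S_def fun_eq_iff)
        then show ?thesis using Si(1)[of m] Si(2)[of m] by simp
      qed
      also have "(LINT \<omega>|M. q m \<omega>) \<le> c0 * h"
        using mom[of "\<lambda>_. 1" m 1] by (simp add: prob_space)
      finally show ?case using Suc by (simp add: algebra_simps)
    qed (simp add: S_def)
    have ES2: "(LINT \<omega>|M. (S m \<omega>)\<^sup>2) \<le> real m * (2 * (c0 * h) * (c0 * (t - s)) + L * (c0 * h))" if "m \<le> Suc n" for m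
      using that
    proof (induction m)
      case (Suc m)
      have "(LINT \<omega>|M. (S (Suc m) \<omega>)\<^sup>2) = (LINT \<omega>|M. (S m \<omega>)\<^sup>2 + 2 * (S m \<omega> * q m \<omega>) + (q m \<omega>)\<^sup>2)"
        by (intro Bochner_Integration.integral_cong refl) (simp add: S_def power2_eq_square algebra_simps)
      also have "\<dots> = (LINT \<omega>|M. (S m \<omega>)\<^sup>2) + 2 * (LINT \<omega>|M. S m \<omega> * q m \<omega>) + (LINT \<omega>|M. (q m \<omega>)\<^sup>2)"
        using Si[of m] by simp
      finally have e: "(LINT \<omega>|M. (S (Suc m) \<omega>)\<^sup>2) = (LINT \<omega>|M. (S m \<omega>)\<^sup>2) + 2 * (LINT \<omega>|M. S m \<omega> * q m \<omega>) + (LINT \<omega>|M. (q m \<omega>)\<^sup>2)" .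
      \<comment> \<open>The partial sum is nonnegative, bounded and known at the left end point of
        step \<open>m\<close>, so it may serve as the weight in the conditional moment
        bound.\<close>
      have "(LINT \<omega>|M. S m \<omega> * q m \<omega>) \<le> c0 * h * (LINT \<omega>|M. S m \<omega>)"
        by (rule mom[OF Sm Sb])
      also have "\<dots> \<le> c0 * h * (real m * (c0 * h))"
        using ES[of m] c0 h by (intro mult_left_mono) auto
      also have "\<dots> \<le> c0 * h * (c0 * (t - s))"
      proof -
        have "real m * h \<le> real (Suc n) * h" using Suc.prems h by (intro mult_right_mono) auto
        then have "c0 * (real m * h) \<le> c0 * (t - s)" using h c0 by (intro mult_left_mono) auto
        then show ?thesis using h c0 by (intro mult_left_mono) (auto simp: mult_ac)
      qed
      finally have x: "(LINT \<omega>|M. S m \<omega> * q m \<omega>) \<le> c0 * h * (c0 * (t - s))" .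
      have "(LINT \<omega>|M. (q m \<omega>)\<^sup>2) \<le> (LINT \<omega>|M. L * q m \<omega>)"
        using Si q by (intro integral_mono) (auto simp: power2_eq_square intro!: mult_right_mono)
      also have "\<dots> \<le> L * (c0 * h)"
        using mom[of "\<lambda>_. 1" m 1] L by (simp add: prob_space mult_left_mono)
      finally have y: "(LINT \<omega>|M. (q m \<omega>)\<^sup>2) \<le> L * (c0 * h)" .
      show ?case using e x y Suc by (simp add: algebra_simps)
    qed (simp add: S_def)
    have "(LINT \<omega>|M. (S (Suc n) \<omega>)\<^sup>2) \<le> real (Suc n) * (2 * (c0 * h) * (c0 * (t - s)) + L * (c0 * h))" by (rule ES2) simp
    also have "\<dots> = 2 * c0 * (real (Suc n) * h) * (c0 * (t - s)) + L * c0 * (real (Suc n) * h)" by (simp add: algebra_simps)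
    also have "\<dots> = 2 * c0 * (t - s) * (c0 * (t - s)) + L * c0 * (t - s)" by (simp only: h(3))
    finally show "(LINT \<omega>|M. (\<Sum>k\<le>n. (norm (incr s t n k \<omega>))\<^sup>2)\<^sup>2) \<le> 2 * c0 * (t - s) * (c0 * (t - s)) + L * c0 * (t - s)"
      by (simp only: S_def q_def lessThan_Suc_atMost)
  qed
qed

lemma expectation_tendsto_0:
  assumes X: "\<And>n. X n \<in> borel_measurable M" "\<And>n \<omega>. \<omega> \<in> space M \<Longrightarrow> \<bar>X n \<omega>\<bar> \<le> K" "\<And>\<omega>. \<omega> \<in> space M \<Longrightarrow> (\<lambda>n. X n \<omega>) \<longlonglongrightarrow> (0::real)"
    and \<xi>: "\<xi> \<in> borel_measurable M" "\<And>\<omega>. \<omega> \<in> space M \<Longrightarrow> \<bar>\<xi> \<omega>\<bar> \<le> L"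
  shows "(\<lambda>n. LINT \<omega>|M. \<xi> \<omega> * X n \<omega>) \<longlonglongrightarrow> 0"
proof -
  have "(\<lambda>n. LINT \<omega>|M. \<xi> \<omega> * X n \<omega>) \<longlonglongrightarrow> (LINT \<omega>|M. 0)"
  proof (rule integral_dominated_convergence[where w="\<lambda>_. L * K"])
    show "AE \<omega> in M. (\<lambda>n. \<xi> \<omega> * X n \<omega>) \<longlonglongrightarrow> 0"
      using tendsto_mult_right_zero X(3) by (intro AE_I2) blast
    show "AE \<omega> in M. norm (\<xi> \<omega> * X n \<omega>) \<le> L * K" for n
    proof (intro AE_I2)
      fix \<omega> assume "\<omega> \<in> space M"
      then have "\<bar>\<xi> \<omega>\<bar> \<le> L" "\<bar>X n \<omega>\<bar> \<le> K" using X(2) \<xi>(2) by auto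
      then show "norm (\<xi> \<omega> * X n \<omega>) \<le> L * K" by (auto simp: abs_mult intro!: mult_mono)
    qed
  qed (use X(1) \<xi>(1) in auto)
  then show ?thesis by simp
qed

lemma grid_step_nonneg: "s \<le> t \<Longrightarrow> grid s t n k \<le> grid s t n (Suc k)"
  by (rule grid_mono) auto

lemma sum_grid_const: "(\<Sum>k\<le>n. c * (grid s t n (Suc k) - grid s t n k)) = c * (t - s)"
  by (simp add: grid_diff del: of_nat_Suc)

lemma incr_uniformly_small:
  assumes st: "s \<le> t" and \<omega>: "\<omega> \<in> space M" and e: "0 < e"
  shows "\<forall>\<^sub>F n in sequentially. \<forall>k\<le>n. norm (incr s t n k \<omega>) < e"
proof -
  have u: "continuous_on {s..t} (\<lambda>t. Z t \<omega>)" using continuous_on_subset[OF Z_cont[OF \<omega>]] by blast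
  show ?thesis
    using grid_uniform[OF u st e]
  proof eventually_elim
    case (elim n)
    show ?case
    proof (intro allI impI)
      fix k assume "k \<le> n"
      moreover have "grid s t n (Suc k) \<in> {grid s t n k..grid s t n (Suc k)}" using grid_step_nonneg[OF st] by simp
      ultimately show "norm (incr s t n k \<omega>) < e" using elim by (simp add: incr_def dist_norm)
    qed
  qed
qed

text \<open>Freezing \<phi> at the left end point of a grid piece costs at most its oscillation
  along the path over that piece. Paths are uniformly continuous on \<open>{s..t}\<close>, so the
  cost tends to 0 for each \<omega>, and dominated convergence passes to expectations.\<close>

lemma riemann_limit:
  fixes \<phi> :: "real^'n \<Rightarrow> real"
  assumes st: "0 \<le> s" "s \<le> t" and f: "bounded_field f" and \<phi>: "continuous_on UNIV \<phi>"
    and \<xi>: "\<xi> \<in> borel_measurable M" "\<And>\<omega>. \<omega> \<in> space M \<Longrightarrow> \<bar>\<xi> \<omega>\<bar> \<le> L"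
  shows "(\<lambda>n. LINT \<omega>|M. \<xi> \<omega> * ((\<Sum>k\<le>n. \<phi> (Z (grid s t n k) \<omega>) * time_integral (grid s t n k) (grid s t n (Suc k)) (\<lambda>r. f r \<omega>))
     - time_integral s t (\<lambda>r. f r \<omega> * \<phi> (Z r \<omega>)))) \<longlonglongrightarrow> 0"
proof -
  obtain Kf where Kf: "0 \<le> Kf" "\<And>\<omega> r. \<omega> \<in> space M \<Longrightarrow> \<bar>f r \<omega>\<bar> \<le> Kf" using field_bound[OF f] by blast
  obtain K\<phi> where K\<phi>: "0 \<le> K\<phi>" "\<And>\<omega> r. \<omega> \<in> space M \<Longrightarrow> \<bar>\<phi> (Z r \<omega>)\<bar> \<le> K\<phi>" using continuous_bounded_cball[OF \<phi>] by blast
  have f\<phi>: "bounded_field (\<lambda>r \<omega>. f r \<omega> * \<phi> (Z r \<omega>))" by (rule bounded_field_mult[OF f bounded_field_Z[OF \<phi>]])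
  have [measurable]: "(\<lambda>\<omega>. \<phi> (Z r \<omega>)) \<in> borel_measurable M" for r
    using measurable_compose[OF Z_meas borel_measurable_continuous_onI[OF \<phi>]] .
  note [measurable] = time_integral_meas[OF f] time_integral_meas[OF f\<phi>]
  let ?a = "\<lambda>n k. grid s t n k" and ?b = "\<lambda>n k. grid s t n (Suc k)"
  have g: "bounded_field (\<lambda>r \<omega>. (\<phi> (Z u \<omega>) - \<phi> (Z r \<omega>)) * f r \<omega>)" for u
  proof -
    have "bounded_field (\<lambda>r \<omega>. \<phi> (Z u \<omega>))"
      unfolding bounded_field_def using K\<phi> measurable_compose[OF measurable_fst, of "\<lambda>\<omega>. \<phi> (Z u \<omega>)"] by auto
    then have "bounded_field (\<lambda>r \<omega>. (\<phi> (Z u \<omega>) + (-1) * \<phi> (Z r \<omega>)) * f r \<omega>)"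
      by (intro bounded_field_mult[OF _ f] bounded_field_add bounded_field_const bounded_field_Z[OF \<phi>] bounded_field_mult[OF bounded_field_const])
    then show ?thesis by simp
  qed
  have rep: "(\<Sum>k\<le>n. \<phi> (Z (?a n k) \<omega>) * time_integral (?a n k) (?b n k) (\<lambda>r. f r \<omega>)) - time_integral s t (\<lambda>r. f r \<omega> * \<phi> (Z r \<omega>))
    = (\<Sum>k\<le>n. time_integral (?a n k) (?b n k) (\<lambda>r. (\<phi> (Z (?a n k) \<omega>) - \<phi> (Z r \<omega>)) * f r \<omega>))" if \<omega>: "\<omega> \<in> space M" for n \<omega>
  proof -
    have b: "\<bar>f r \<omega> * \<phi> (Z r \<omega>)\<bar> \<le> Kf * K\<phi>" for r
      using Kf(2)[OF \<omega>, of r] K\<phi>(2)[OF \<omega>, of r] Kf(1) K\<phi>(1) by (auto simp: abs_mult intro!: mult_mono)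
    have i: "set_integrable lborel {x<..y} (\<lambda>r. f r \<omega> * \<phi> (Z r \<omega>))" "set_integrable lborel {x<..y} (\<lambda>r. f r \<omega>)" for x y
      by (rule time_integrable[OF bounded_field_section[OF f\<phi> \<omega>] b], rule time_integrable[OF bounded_field_section[OF f \<omega>] Kf(2)[OF \<omega>]])
    have "time_integral s t (\<lambda>r. f r \<omega> * \<phi> (Z r \<omega>)) = (\<Sum>k\<le>n. time_integral (?a n k) (?b n k) (\<lambda>r. f r \<omega> * \<phi> (Z r \<omega>)))"
      by (rule time_integral_grid[OF bounded_field_section[OF f\<phi> \<omega>] b st(2), symmetric])
    moreover have "time_integral (?a n k) (?b n k) (\<lambda>r. (\<phi> (Z (?a n k) \<omega>) - \<phi> (Z r \<omega>)) * f r \<omega>) =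
      \<phi> (Z (?a n k) \<omega>) * time_integral (?a n k) (?b n k) (\<lambda>r. f r \<omega>) - time_integral (?a n k) (?b n k) (\<lambda>r. f r \<omega> * \<phi> (Z r \<omega>))" for k
    proof -
      have "time_integral (?a n k) (?b n k) (\<lambda>r. (\<phi> (Z (?a n k) \<omega>) - \<phi> (Z r \<omega>)) * f r \<omega>) = time_integral (?a n k) (?b n k) (\<lambda>r. \<phi> (Z (?a n k) \<omega>) * f r \<omega> - f r \<omega> * \<phi> (Z r \<omega>))"
        by (simp add: algebra_simps)
      also have "\<dots> = time_integral (?a n k) (?b n k) (\<lambda>r. \<phi> (Z (?a n k) \<omega>) * f r \<omega>) - time_integral (?a n k) (?b n k) (\<lambda>r. f r \<omega> * \<phi> (Z r \<omega>))"
        by (rule set_integral_diff(2)) (use i in auto)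
      finally show ?thesis by simp
    qed
    ultimately show ?thesis by (simp add: sum_subtractf)
  qed
  have "(\<lambda>n. LINT \<omega>|M. \<xi> \<omega> * (\<Sum>k\<le>n. time_integral (?a n k) (?b n k) (\<lambda>r. (\<phi> (Z (?a n k) \<omega>) - \<phi> (Z r \<omega>)) * f r \<omega>))) \<longlonglongrightarrow> 0"
  proof (rule expectation_tendsto_0[OF _ _ _ \<xi>])
    show "(\<lambda>\<omega>. \<Sum>k\<le>n. time_integral (?a n k) (?b n k) (\<lambda>r. (\<phi> (Z (?a n k) \<omega>) - \<phi> (Z r \<omega>)) * f r \<omega>)) \<in> borel_measurable M" for n
      by (intro borel_measurable_sum time_integral_meas[OF g])
    have bnd: "\<bar>\<Sum>k\<le>n. time_integral (?a n k) (?b n k) (\<lambda>r. (\<phi> (Z (?a n k) \<omega>) - \<phi> (Z r \<omega>)) * f r \<omega>)\<bar> \<le> c * Kf * (t - s)"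
      if \<omega>: "\<omega> \<in> space M" and c: "\<And>k r. k \<le> n \<Longrightarrow> r \<in> {?a n k..?b n k} \<Longrightarrow> \<bar>\<phi> (Z (?a n k) \<omega>) - \<phi> (Z r \<omega>)\<bar> \<le> c" and c0: "0 \<le> c" for n \<omega> c
    proof -
      have "\<bar>\<Sum>k\<le>n. time_integral (?a n k) (?b n k) (\<lambda>r. (\<phi> (Z (?a n k) \<omega>) - \<phi> (Z r \<omega>)) * f r \<omega>)\<bar> \<le> (\<Sum>k\<le>n. c * Kf * (?b n k - ?a n k))"
      proof (rule order_trans[OF sum_abs], rule sum_mono)
        fix k assume k: "k \<in> {..n}"
        show "\<bar>time_integral (?a n k) (?b n k) (\<lambda>r. (\<phi> (Z (?a n k) \<omega>) - \<phi> (Z r \<omega>)) * f r \<omega>)\<bar> \<le> c * Kf * (?b n k - ?a n k)"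
        proof (rule field_integral_bound[OF g grid_step_nonneg[OF st(2)] \<omega>])
          fix r assume "?a n k < r" "r \<le> ?b n k"
          then show "\<bar>(\<phi> (Z (?a n k) \<omega>) - \<phi> (Z r \<omega>)) * f r \<omega>\<bar> \<le> c * Kf"
            using c[of k r] k Kf(2)[OF \<omega>, of r] c0 unfolding abs_mult by (intro mult_mono) auto
        qed
      qed
      then show ?thesis by (simp only: sum_grid_const)
    qed
    show "\<bar>\<Sum>k\<le>n. time_integral (?a n k) (?b n k) (\<lambda>r. (\<phi> (Z (?a n k) \<omega>) - \<phi> (Z r \<omega>)) * f r \<omega>)\<bar> \<le> 2 * K\<phi> * Kf * (t - s)" if \<omega>: "\<omega> \<in> space M" for n \<omega>
    proof (rule bnd[OF \<omega>])
      fix k r show "\<bar>\<phi> (Z (?a n k) \<omega>) - \<phi> (Z r \<omega>)\<bar> \<le> 2 * K\<phi>"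
        using K\<phi>(2)[OF \<omega>, of r] K\<phi>(2)[OF \<omega>, of "?a n k"] by linarith
    qed (use K\<phi> in simp)
    fix \<omega> assume \<omega>: "\<omega> \<in> space M"
    show "(\<lambda>n. \<Sum>k\<le>n. time_integral (?a n k) (?b n k) (\<lambda>r. (\<phi> (Z (?a n k) \<omega>) - \<phi> (Z r \<omega>)) * f r \<omega>)) \<longlonglongrightarrow> 0"
    proof (rule tendstoI)
      fix e :: real assume e: "0 < e"
      \<comment> \<open>The summand 1 keeps the divisor of \<open>c\<close> positive when
        \<open>Kf * (t - s)\<close> is 0.\<close>
      define y where "y = Kf * (t - s) + 1"
      define c where "c = e / (2 * y)"
      have p: "0 < y" unfolding y_def using Kf(1) st by (intro add_nonneg_pos) auto
      have c: "0 < c" "c * Kf * (t - s) < e"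
      proof -
        show "0 < c" using e p by (simp add: c_def)
        have "c * Kf * (t - s) \<le> c * y" using \<open>0 < c\<close> by (simp add: algebra_simps y_def)
        also have "\<dots> = e / 2" using p by (simp add: c_def)
        finally show "c * Kf * (t - s) < e" using e by simp
      qed
      have cont: "continuous_on {s..t} (\<lambda>r. \<phi> (Z r \<omega>))"
        using continuous_on_compose2[OF \<phi> continuous_on_subset[OF Z_cont[OF \<omega>]]] by auto
      show "\<forall>\<^sub>F n in sequentially. dist (\<Sum>k\<le>n. time_integral (?a n k) (?b n k) (\<lambda>r. (\<phi> (Z (?a n k) \<omega>) - \<phi> (Z r \<omega>)) * f r \<omega>)) 0 < e"
        using grid_uniform[OF cont st(2) c(1)]
      proof eventually_elim
        case (elim n)
        have "\<bar>\<Sum>k\<le>n. time_integral (?a n k) (?b n k) (\<lambda>r. (\<phi> (Z (?a n k) \<omega>) - \<phi> (Z r \<omega>)) * f r \<omega>)\<bar> \<le> c * Kf * (t - s)"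
          by (rule bnd[OF \<omega>]) (use elim c in \<open>auto simp: dist_real_def abs_minus_commute less_imp_le\<close>)
        with c(2) show ?case by simp
      qed
    qed
  qed
  then show ?thesis
    by (simp add: rep cong: Bochner_Integration.integral_cong)
qed

text \<open>Replaces increments by compensated ones in the second-order sum. With drift integrals
  \<open>p\<close> and \<open>q\<close> the two products differ by
  \<open>p * y + q * x - p * q\<close>; drift integrals are of the order of the mesh, so the whole
  sum is at most a constant times the largest increment plus the mesh.\<close>

lemma cross_limit:
  fixes \<phi> :: "real^'n \<Rightarrow> real"
  assumes st: "0 \<le> s" "s \<le> t" and \<phi>: "continuous_on UNIV \<phi>"
    and \<xi>: "\<xi> \<in> borel_measurable M" "\<And>\<omega>. \<omega> \<in> space M \<Longrightarrow> \<bar>\<xi> \<omega>\<bar> \<le> L"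
  shows "(\<lambda>n. LINT \<omega>|M. \<xi> \<omega> * (\<Sum>k\<le>n. \<phi> (Z (grid s t n k) \<omega>) *
      (incr s t n k \<omega> $ i * incr s t n k \<omega> $ j - (incr s t n k \<omega> $ i - drift_int s t n k i \<omega>) * (incr s t n k \<omega> $ j - drift_int s t n k j \<omega>)))) \<longlonglongrightarrow> 0"
    (is "(\<lambda>n. LINT \<omega>|M. \<xi> \<omega> * ?X n \<omega>) \<longlonglongrightarrow> 0")
proof -
  obtain K\<phi> where K\<phi>: "0 \<le> K\<phi>" "\<And>\<omega> r. \<omega> \<in> space M \<Longrightarrow> \<bar>\<phi> (Z r \<omega>)\<bar> \<le> K\<phi>" using continuous_bounded_cball[OF \<phi>] by blast
  have [measurable]: "(\<lambda>\<omega>. \<phi> (Z r \<omega>)) \<in> borel_measurable M" for r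
    using measurable_compose[OF Z_meas borel_measurable_continuous_onI[OF \<phi>]] .
  have Xm: "?X n \<in> borel_measurable M" for n by measurable
  have bnd: "\<bar>?X n \<omega>\<bar> \<le> K\<phi> * C * (2 * c + C * ((t - s) / real (Suc n))) * (t - s)"
    if \<omega>: "\<omega> \<in> space M" and c: "\<And>k. k \<le> n \<Longrightarrow> norm (incr s t n k \<omega>) \<le> c" for n \<omega> c
  proof -
    define h where "h = (t - s) / real (Suc n)"
    have h: "0 \<le> h" using st by (simp add: h_def)
    have c0: "0 \<le> c" using c[of 0] norm_ge_zero order_trans by blast
    have "\<bar>?X n \<omega>\<bar> \<le> (\<Sum>k\<le>n. K\<phi> * C * (2 * c + C * h) * (grid s t n (Suc k) - grid s t n k))"
    proof (rule order_trans[OF sum_abs], rule sum_mono)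
      fix k assume k: "k \<in> {..n}"
      define x y p q where "x = incr s t n k \<omega> $ i" and "y = incr s t n k \<omega> $ j" and "p = drift_int s t n k i \<omega>" and "q = drift_int s t n k j \<omega>"
      have xy: "\<bar>x\<bar> \<le> c" "\<bar>y\<bar> \<le> c"
        using c[of k] k component_le_norm_cart[of "incr s t n k \<omega>" i] component_le_norm_cart[of "incr s t n k \<omega>" j] by (auto simp: x_def y_def)
      have pq: "\<bar>p\<bar> \<le> C * h" "\<bar>q\<bar> \<le> C * h"
        using D_integral_bound[OF grid_step_nonneg[OF st(2), of n k] \<omega>] by (auto simp: p_def q_def drift_int_def grid_diff h_def)
      have "\<bar>x * y - (x - p) * (y - q)\<bar> = \<bar>p * y + q * x - p * q\<bar>" by (simp add: algebra_simps)
      also have "\<dots> \<le> \<bar>p\<bar> * \<bar>y\<bar> + \<bar>q\<bar> * \<bar>x\<bar> + \<bar>p\<bar> * \<bar>q\<bar>" unfolding abs_mult[symmetric] by linarith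
      also have "\<dots> \<le> (C * h) * c + (C * h) * c + (C * h) * (C * h)"
        using xy pq c0 C_nonneg h by (intro add_mono mult_mono) auto
      also have "\<dots> = C * (2 * c + C * h) * h" by (simp add: algebra_simps)
      finally have "\<bar>\<phi> (Z (grid s t n k) \<omega>)\<bar> * \<bar>x * y - (x - p) * (y - q)\<bar> \<le> K\<phi> * (C * (2 * c + C * h) * h)"
        using K\<phi>(2)[OF \<omega>] K\<phi>(1) by (intro mult_mono) auto
      then show "\<bar>\<phi> (Z (grid s t n k) \<omega>) * (incr s t n k \<omega> $ i * incr s t n k \<omega> $ j - (incr s t n k \<omega> $ i - drift_int s t n k i \<omega>) * (incr s t n k \<omega> $ j - drift_int s t n k j \<omega>))\<bar>
        \<le> K\<phi> * C * (2 * c + C * h) * (grid s t n (Suc k) - grid s t n k)"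
        unfolding x_def[symmetric] y_def[symmetric] p_def[symmetric] q_def[symmetric] grid_diff h_def[symmetric] abs_mult by (simp only: mult.assoc)
    qed
    then show ?thesis by (simp only: sum_grid_const h_def)
  qed
  have hle: "(t - s) / real (Suc n) \<le> t - s" for n
  proof -
    have "(t - s) / real (Suc n) \<le> (t - s) / 1" using st by (intro divide_left_mono) auto
    then show ?thesis by simp
  qed
  have Xb: "\<bar>?X n \<omega>\<bar> \<le> K\<phi> * C * (2 * (2 * R) + C * (t - s)) * (t - s)" if \<omega>: "\<omega> \<in> space M" for n \<omega>
  proof (rule order_trans[OF bnd[OF \<omega>]])
    show "norm (incr s t n k \<omega>) \<le> 2 * R" for k unfolding incr_def by (rule Z_diff_bound[OF \<omega>])
    show "K\<phi> * C * (2 * (2 * R) + C * ((t - s) / real (Suc n))) * (t - s) \<le> K\<phi> * C * (2 * (2 * R) + C * (t - s)) * (t - s)"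
      using K\<phi>(1) C_nonneg st hle[of n] by (intro mult_right_mono mult_left_mono add_mono) auto
  qed
  have Xl: "(\<lambda>n. ?X n \<omega>) \<longlonglongrightarrow> 0" if \<omega>: "\<omega> \<in> space M" for \<omega>
  proof (rule tendstoI)
    fix e :: real assume e: "0 < e"
    define y where "y = K\<phi> * C * (2 + C) * (t - s) + 1"
    define c where "c = e / (2 * y)"
    have p: "0 < y" unfolding y_def using K\<phi>(1) C_nonneg st by (intro add_nonneg_pos) auto
    have c: "0 < c" using e p by (simp add: c_def)
    have cy: "c * (K\<phi> * C * (2 + C) * (t - s)) < e"
    proof -
      have "c * (K\<phi> * C * (2 + C) * (t - s)) \<le> c * y" using c by (simp add: y_def)
      also have "\<dots> = e / 2" using p by (simp add: c_def)
      finally show ?thesis using e by simp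
    qed
    have "(\<lambda>n. (t - s) / real (Suc n)) \<longlonglongrightarrow> 0"
      using LIMSEQ_Suc[OF lim_const_over_n[of "t - s"]] .
    then have "\<forall>\<^sub>F n in sequentially. (t - s) / real (Suc n) < c" using c by (intro order_tendstoD(2)) auto
    with incr_uniformly_small[OF st(2) \<omega> c]
    show "\<forall>\<^sub>F n in sequentially. dist (?X n \<omega>) 0 < e"
    proof eventually_elim
      case (elim n)
      have "\<bar>?X n \<omega>\<bar> \<le> K\<phi> * C * (2 * c + C * ((t - s) / real (Suc n))) * (t - s)"
        by (rule bnd[OF \<omega>]) (use elim in \<open>auto simp: less_imp_le\<close>)
      also have "\<dots> \<le> K\<phi> * C * (2 * c + C * c) * (t - s)"
        using K\<phi>(1) C_nonneg st elim by (intro mult_right_mono mult_left_mono add_mono) auto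
      also have "\<dots> = c * (K\<phi> * C * (2 + C) * (t - s))" by (simp add: algebra_simps)
      also have "\<dots> < e" by (rule cy)
      finally show ?case by simp
    qed
  qed
  show ?thesis by (rule expectation_tendsto_0[OF Xm Xb Xl \<xi>])
qed

text \<open>\<open>g1\<close> and \<open>g2\<close> stand for gradient and Hessian. They are free
  parameters because the limit argument uses only their continuity and the size of the Taylor
  remainder.\<close>

definition generator :: "('n \<Rightarrow> real^'n \<Rightarrow> real) \<Rightarrow> ('n \<Rightarrow> 'n \<Rightarrow> real^'n \<Rightarrow> real) \<Rightarrow> real \<Rightarrow> 'w \<Rightarrow> real" where
  "generator g1 g2 r \<omega> = (\<Sum>i\<in>UNIV. D r \<omega> $ i * g1 i (Z r \<omega>)) + (1/2) * (\<Sum>i\<in>UNIV. \<Sum>j\<in>UNIV. A r \<omega> $ i $ j * g2 i j (Z r \<omega>))"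

definition taylor_rem :: "(real^'n \<Rightarrow> real) \<Rightarrow> ('n \<Rightarrow> real^'n \<Rightarrow> real) \<Rightarrow> ('n \<Rightarrow> 'n \<Rightarrow> real^'n \<Rightarrow> real) \<Rightarrow> real^'n \<Rightarrow> real^'n \<Rightarrow> real" where
  "taylor_rem g g1 g2 y z = g z - g y - (\<Sum>i\<in>UNIV. g1 i y * (z - y) $ i) - (1/2) * (\<Sum>i\<in>UNIV. \<Sum>j\<in>UNIV. g2 i j y * ((z - y) $ i * (z - y) $ j))"

text \<open>The remainders sum to at most \<open>m n * Q n\<close>, the largest ratio of remainder
  to squared increment times the quadratic variation. The ratio is bounded and tends to 0 by
  continuity of the path, \<open>Q n\<close> is bounded in mean square, and Cauchy-Schwarz combines
  the two.\<close>

lemma remainder_limit: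
  assumes st: "0 \<le> s" "s \<le> t"
    and g: "continuous_on UNIV g" "\<And>i. continuous_on UNIV (g1 i)" "\<And>i j. continuous_on UNIV (g2 i j)"
    and T1: "\<And>e. 0 < e \<Longrightarrow> \<exists>\<delta>>0. \<forall>y\<in>cball 0 R. \<forall>z\<in>cball 0 R. norm (z - y) < \<delta> \<longrightarrow> \<bar>taylor_rem g g1 g2 y z\<bar> \<le> e * (norm (z - y))\<^sup>2"
    and T2: "\<And>y z. y \<in> cball 0 R \<Longrightarrow> z \<in> cball 0 R \<Longrightarrow> \<bar>taylor_rem g g1 g2 y z\<bar> \<le> KT * (norm (z - y))\<^sup>2"
    and \<xi>: "\<xi> \<in> borel_measurable M" "\<And>\<omega>. \<omega> \<in> space M \<Longrightarrow> \<bar>\<xi> \<omega>\<bar> \<le> L"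
  shows "(\<lambda>n. LINT \<omega>|M. \<xi> \<omega> * (\<Sum>k\<le>n. taylor_rem g g1 g2 (Z (grid s t n k) \<omega>) (Z (grid s t n (Suc k)) \<omega>))) \<longlonglongrightarrow> 0"
proof -
  \<comment> \<open>The ratio is set to 0 for a vanishing increment, where the remainder is 0
    too.\<close>
  define \<rho> where "\<rho> y z = (if y = z then 0 else \<bar>taylor_rem g g1 g2 y z\<bar> / (norm (z - y))\<^sup>2)" for y z
  have gm: "(\<lambda>\<omega>. \<phi> (Z r \<omega>)) \<in> borel_measurable M" if "continuous_on UNIV \<phi>" for r and \<phi> :: "real^'n \<Rightarrow> real"
    using measurable_compose[OF Z_meas borel_measurable_continuous_onI[OF that]] .
  note [measurable] = gm[OF g(1)] gm[OF g(2)] gm[OF g(3)]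
  have [measurable]: "(\<lambda>\<omega>. taylor_rem g g1 g2 (Z a \<omega>) (Z b \<omega>)) \<in> borel_measurable M" for a b
    unfolding taylor_rem_def by measurable
  have [measurable]: "(\<lambda>\<omega>. \<rho> (Z a \<omega>) (Z b \<omega>)) \<in> borel_measurable M" for a b
    unfolding \<rho>_def by measurable
  have Zb: "Z r \<omega> \<in> cball 0 R" if "\<omega> \<in> space M" for r \<omega> using Z_bound[OF that] by simp
  define K where "K = max 0 KT"
  have \<rho>b1: "0 \<le> \<rho> y z" for y z by (simp add: \<rho>_def)
  have \<rho>b2: "\<rho> y z \<le> K" if "y \<in> cball 0 R" "z \<in> cball 0 R" for y z
    using T2[OF that] by (auto simp: \<rho>_def K_def divide_le_eq le_max_iff_disj)
  have \<rho>b3: "\<bar>taylor_rem g g1 g2 y z\<bar> = \<rho> y z * (norm (z - y))\<^sup>2" for y z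
    by (simp add: \<rho>_def taylor_rem_def)
  define m where "m n \<omega> = Max ((\<lambda>k. \<rho> (Z (grid s t n k) \<omega>) (Z (grid s t n (Suc k)) \<omega>)) ` {..n})" for n \<omega>
  have [measurable]: "m n \<in> borel_measurable M" for n
    unfolding m_def by (rule borel_measurable_Max) auto
  have mb: "0 \<le> m n \<omega>" "m n \<omega> \<le> K" if \<omega>: "\<omega> \<in> space M" for n \<omega>
  proof -
    show "m n \<omega> \<le> K" unfolding m_def using \<rho>b2[OF Zb[OF \<omega>] Zb[OF \<omega>]] by (subst Max_le_iff) auto
    show "0 \<le> m n \<omega>" unfolding m_def by (rule order_trans[OF \<rho>b1 Max_ge]) (auto intro!: imageI)
  qed
  have m0: "(\<lambda>n. LINT \<omega>|M. (m n \<omega>)\<^sup>2) \<longlonglongrightarrow> 0"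
  proof -
    have "(\<lambda>n. LINT \<omega>|M. 1 * (m n \<omega>)\<^sup>2) \<longlonglongrightarrow> 0"
    proof (rule expectation_tendsto_0[where K="K\<^sup>2" and L=1])
      show "\<bar>(m n \<omega>)\<^sup>2\<bar> \<le> K\<^sup>2" if "\<omega> \<in> space M" for n \<omega> using mb[OF that, of n] by (simp add: power_mono)
      fix \<omega> assume \<omega>: "\<omega> \<in> space M"
      have "(\<lambda>n. m n \<omega>) \<longlonglongrightarrow> 0"
      proof (rule tendstoI)
        fix e :: real assume e: "0 < e"
        then obtain \<delta> where \<delta>: "0 < \<delta>" "\<And>y z. y \<in> cball 0 R \<Longrightarrow> z \<in> cball 0 R \<Longrightarrow> norm (z - y) < \<delta> \<Longrightarrow> \<bar>taylor_rem g g1 g2 y z\<bar> \<le> e / 2 * (norm (z - y))\<^sup>2"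
          using T1[of "e/2"] by auto
        show "\<forall>\<^sub>F n in sequentially. dist (m n \<omega>) 0 < e"
          using incr_uniformly_small[OF st(2) \<omega> \<delta>(1)]
        proof eventually_elim
          case (elim n)
          have "m n \<omega> \<le> e / 2"
            unfolding m_def
          proof (subst Max_le_iff)
            show "\<forall>a\<in>(\<lambda>k. \<rho> (Z (grid s t n k) \<omega>) (Z (grid s t n (Suc k)) \<omega>)) ` {..n}. a \<le> e / 2"
            proof (intro ballI)
              fix a assume "a \<in> (\<lambda>k. \<rho> (Z (grid s t n k) \<omega>) (Z (grid s t n (Suc k)) \<omega>)) ` {..n}"
              then obtain k where k: "k \<le> n" "a = \<rho> (Z (grid s t n k) \<omega>) (Z (grid s t n (Suc k)) \<omega>)" by auto
              then have "norm (Z (grid s t n (Suc k)) \<omega> - Z (grid s t n k) \<omega>) < \<delta>" using elim by (simp add: incr_def)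
              from \<delta>(2)[OF Zb[OF \<omega>] Zb[OF \<omega>] this] show "a \<le> e / 2"
                using e by (simp add: \<rho>_def divide_le_eq k)
            qed
          qed auto
          then show ?case using e mb(1)[OF \<omega>, of n] by simp
        qed
      qed
      then show "(\<lambda>n. (m n \<omega>)\<^sup>2) \<longlonglongrightarrow> 0" using tendsto_power[of "\<lambda>n. m n \<omega>" 0 sequentially 2] by simp
    qed auto
    then show ?thesis by simp
  qed
  obtain c where c: "\<And>n. (LINT \<omega>|M. (\<Sum>k\<le>n. (norm (incr s t n k \<omega>))\<^sup>2)\<^sup>2) \<le> c"
    using quadratic_variation_bound[OF st] by blast
  define Q where "Q n \<omega> = (\<Sum>k\<le>n. (norm (incr s t n k \<omega>))\<^sup>2)" for n \<omega>
  have [measurable]: "Q n \<in> borel_measurable M" for n unfolding Q_def by measurable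
  have Qb: "0 \<le> Q n \<omega>" "Q n \<omega> \<le> real (Suc n) * (2 * R)\<^sup>2" if \<omega>: "\<omega> \<in> space M" for n \<omega>
  proof -
    show "0 \<le> Q n \<omega>" unfolding Q_def by (intro sum_nonneg) auto
    have "Q n \<omega> \<le> of_nat (card {..n}) * (2 * R)\<^sup>2" unfolding Q_def
      by (rule sum_bounded_above) (use power_mono[OF Z_diff_bound[OF \<omega>] norm_ge_zero, of _ _ 2] in \<open>simp add: incr_def\<close>)
    then show "Q n \<omega> \<le> real (Suc n) * (2 * R)\<^sup>2" by simp
  qed
  have L0: "0 \<le> L" using \<xi>(2) not_empty by (metis abs_ge_zero order_trans ex_in_conv)
  have lm: "l2 M (m n)" for n
    unfolding l2_def
  proof
    show "integrable M (\<lambda>\<omega>. (norm (m n \<omega>))\<^sup>2)"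
      using mb by (intro bounded_integrable[where K="K\<^sup>2"]) (auto intro!: power_mono)
  qed simp
  have lQ: "l2 M (Q n)" for n
    unfolding l2_def
  proof
    show "integrable M (\<lambda>\<omega>. (norm (Q n \<omega>))\<^sup>2)"
      using power_mono[OF Qb(2) Qb(1), of _ n 2] by (intro bounded_integrable[where K="(real (Suc n) * (2 * R)\<^sup>2)\<^sup>2"]) auto
  qed simp
  let ?r = "\<lambda>n \<omega>. \<Sum>k\<le>n. taylor_rem g g1 g2 (Z (grid s t n k) \<omega>) (Z (grid s t n (Suc k)) \<omega>)"
  have rmQ: "\<bar>?r n \<omega>\<bar> \<le> m n \<omega> * Q n \<omega>" if \<omega>: "\<omega> \<in> space M" for n \<omega>
  proof -
    have "\<bar>?r n \<omega>\<bar> \<le> (\<Sum>k\<le>n. m n \<omega> * (norm (incr s t n k \<omega>))\<^sup>2)"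
    proof (rule order_trans[OF sum_abs], rule sum_mono)
      fix k assume "k \<in> {..n}"
      then show "\<bar>taylor_rem g g1 g2 (Z (grid s t n k) \<omega>) (Z (grid s t n (Suc k)) \<omega>)\<bar> \<le> m n \<omega> * (norm (incr s t n k \<omega>))\<^sup>2"
        unfolding \<rho>b3 incr_def m_def by (intro mult_right_mono Max_ge) auto
    qed
    then show ?thesis by (simp add: Q_def sum_distrib_left)
  qed
  show ?thesis
  proof (rule Lim_null_comparison)
    show "\<forall>\<^sub>F n in sequentially. norm (LINT \<omega>|M. \<xi> \<omega> * ?r n \<omega>) \<le> L * (sqrt (LINT \<omega>|M. (m n \<omega>)\<^sup>2) * sqrt c)"
    proof (intro always_eventually allI)
      fix n
      have imQ: "integrable M (\<lambda>\<omega>. m n \<omega> * Q n \<omega>)" using l2_inner[OF lm lQ] by simp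
      have pw: "\<bar>\<xi> \<omega> * ?r n \<omega>\<bar> \<le> L * (m n \<omega> * Q n \<omega>)" if "\<omega> \<in> space M" for \<omega>
        unfolding abs_mult using \<xi>(2)[OF that] rmQ[OF that] L0 by (intro mult_mono) auto
      have ir: "integrable M (\<lambda>\<omega>. \<xi> \<omega> * ?r n \<omega>)"
        by (rule Bochner_Integration.integrable_bound[OF integrable_mult_right[OF imQ, of L]])
           (use \<xi>(1) pw L0 in \<open>auto intro!: AE_I2 intro: order_trans[OF _ abs_ge_self]\<close>)
      have "norm (LINT \<omega>|M. \<xi> \<omega> * ?r n \<omega>) \<le> (LINT \<omega>|M. norm (\<xi> \<omega> * ?r n \<omega>))" by simp
      also have "\<dots> \<le> (LINT \<omega>|M. L * (m n \<omega> * Q n \<omega>))"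
        using ir imQ pw by (intro integral_mono) auto
      also have "\<dots> = L * (LINT \<omega>|M. m n \<omega> * Q n \<omega>)" by simp
      also have "\<dots> \<le> L * (sqrt (LINT \<omega>|M. (m n \<omega>)\<^sup>2) * sqrt (LINT \<omega>|M. (Q n \<omega>)\<^sup>2))"
        using l2_Cauchy_Schwarz[OF lm lQ, of n n] L0 by (intro mult_left_mono) auto
      also have "\<dots> \<le> L * (sqrt (LINT \<omega>|M. (m n \<omega>)\<^sup>2) * sqrt c)"
        using c[of n] L0 by (intro mult_left_mono) (auto simp: Q_def)
      finally show "norm (LINT \<omega>|M. \<xi> \<omega> * ?r n \<omega>) \<le> L * (sqrt (LINT \<omega>|M. (m n \<omega>)\<^sup>2) * sqrt c)" .
    qed
    have "(\<lambda>n. L * (sqrt (LINT \<omega>|M. (m n \<omega>)\<^sup>2) * sqrt c)) \<longlonglongrightarrow> L * (sqrt 0 * sqrt c)"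
      by (intro tendsto_intros m0)
    then show "(\<lambda>n. L * (sqrt (LINT \<omega>|M. (m n \<omega>)\<^sup>2) * sqrt c)) \<longlonglongrightarrow> 0" by simp
  qed
qed

text \<open>Ito's formula in expectation. On a grid, \<open>g\<close> is expanded to second order at
  left end points; increments are split into drift and compensated part, and products of increments
  into compensated products, covariation and an error. The compensated sums \<open>P1\<close> and
  \<open>P2\<close> have mean zero on every grid, all other terms tend to 0, and the expectation in
  question does not depend on the grid.\<close>

theorem dynkin:
  assumes st: "0 \<le> s" "s \<le> t"
    and g: "continuous_on UNIV g" "\<And>i. continuous_on UNIV (g1 i)" "\<And>i j. continuous_on UNIV (g2 i j)"
    and T1: "\<And>e. 0 < e \<Longrightarrow> \<exists>\<delta>>0. \<forall>y\<in>cball 0 R. \<forall>z\<in>cball 0 R. norm (z - y) < \<delta> \<longrightarrow> \<bar>taylor_rem g g1 g2 y z\<bar> \<le> e * (norm (z - y))\<^sup>2"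
    and T2: "\<And>y z. y \<in> cball 0 R \<Longrightarrow> z \<in> cball 0 R \<Longrightarrow> \<bar>taylor_rem g g1 g2 y z\<bar> \<le> KT * (norm (z - y))\<^sup>2"
    and \<xi>: "\<xi> \<in> borel_measurable (F s)" "\<And>\<omega>. \<omega> \<in> space M \<Longrightarrow> \<bar>\<xi> \<omega>\<bar> \<le> L"
  shows "(LINT \<omega>|M. \<xi> \<omega> * (g (Z t \<omega>) - g (Z s \<omega>) - time_integral s t (\<lambda>r. generator g1 g2 r \<omega>))) = 0"
proof -
  have \<xi>M [measurable]: "\<xi> \<in> borel_measurable M" using meas_F[OF \<xi>(1)] .
  have gm: "(\<lambda>\<omega>. \<phi> (Z r \<omega>)) \<in> borel_measurable M" if "continuous_on UNIV \<phi>" for r and \<phi> :: "real^'n \<Rightarrow> real"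
    using measurable_compose[OF Z_meas borel_measurable_continuous_onI[OF that]] .
  note [measurable] = gm[OF g(1)] gm[OF g(2)] gm[OF g(3)]
  let ?a = "\<lambda>n k. grid s t n k" and ?b = "\<lambda>n k. grid s t n (Suc k)"
  define N where "N n k i \<omega> = incr s t n k \<omega> $ i - drift_int s t n k i \<omega>" for n k i \<omega>
  define \<alpha> where "\<alpha> n k i j \<omega> = time_integral (?a n k) (?b n k) (\<lambda>r. A r \<omega> $ i $ j)" for n k i j \<omega>
  define rem where "rem n \<omega> = (\<Sum>k\<le>n. taylor_rem g g1 g2 (Z (?a n k) \<omega>) (Z (?b n k) \<omega>))" for n \<omega>
  define X where "X n i j \<omega> = (\<Sum>k\<le>n. g2 i j (Z (?a n k) \<omega>) * (incr s t n k \<omega> $ i * incr s t n k \<omega> $ j - N n k i \<omega> * N n k j \<omega>))" for n i j \<omega>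
  define S1 where "S1 n i \<omega> = (\<Sum>k\<le>n. g1 i (Z (?a n k) \<omega>) * drift_int s t n k i \<omega>) - time_integral s t (\<lambda>r. D r \<omega> $ i * g1 i (Z r \<omega>))" for n i \<omega>
  define S2 where "S2 n i j \<omega> = (\<Sum>k\<le>n. g2 i j (Z (?a n k) \<omega>) * \<alpha> n k i j \<omega>) - time_integral s t (\<lambda>r. A r \<omega> $ i $ j * g2 i j (Z r \<omega>))" for n i j \<omega>
  define P1 where "P1 n i \<omega> = (\<Sum>k\<le>n. g1 i (Z (?a n k) \<omega>) * N n k i \<omega>)" for n i \<omega>
  define P2 where "P2 n i j \<omega> = (\<Sum>k\<le>n. g2 i j (Z (?a n k) \<omega>) * (N n k i \<omega> * N n k j \<omega> - \<alpha> n k i j \<omega>))" for n i j \<omega>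
  have b1: "bounded_field (\<lambda>r \<omega>. D r \<omega> $ i * g1 i (Z r \<omega>))" for i
    by (rule bounded_field_mult[OF bounded_field_D bounded_field_Z[OF g(2)]])
  have b2: "bounded_field (\<lambda>r \<omega>. A r \<omega> $ i $ j * g2 i j (Z r \<omega>))" for i j
    by (rule bounded_field_mult[OF bounded_field_A bounded_field_Z[OF g(3)]])
  have l1: "(\<lambda>n. LINT \<omega>|M. \<xi> \<omega> * rem n \<omega>) \<longlonglongrightarrow> 0"
    unfolding rem_def by (rule remainder_limit[OF st g T1 T2 \<xi>M \<xi>(2)])
  have l2: "(\<lambda>n. LINT \<omega>|M. \<xi> \<omega> * X n i j \<omega>) \<longlonglongrightarrow> 0" for i j
    unfolding X_def N_def by (rule cross_limit[OF st g(3) \<xi>M \<xi>(2)])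
  have l3: "(\<lambda>n. LINT \<omega>|M. \<xi> \<omega> * S1 n i \<omega>) \<longlonglongrightarrow> 0" for i
    unfolding S1_def drift_int_def by (rule riemann_limit[OF st bounded_field_D g(2) \<xi>M \<xi>(2)])
  have l4: "(\<lambda>n. LINT \<omega>|M. \<xi> \<omega> * S2 n i j \<omega>) \<longlonglongrightarrow> 0" for i j
    unfolding S2_def \<alpha>_def by (rule riemann_limit[OF st bounded_field_A g(3) \<xi>M \<xi>(2)])
  have point: "g (Z t \<omega>) - g (Z s \<omega>) - time_integral s t (\<lambda>r. generator g1 g2 r \<omega>)
     = rem n \<omega> + (\<Sum>i\<in>UNIV. P1 n i \<omega> + S1 n i \<omega>) + (1/2) * (\<Sum>i\<in>UNIV. \<Sum>j\<in>UNIV. X n i j \<omega> + P2 n i j \<omega> + S2 n i j \<omega>)"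
    if \<omega>: "\<omega> \<in> space M" for n \<omega>
  proof -
    have tele: "g (Z t \<omega>) - g (Z s \<omega>) = (\<Sum>k\<le>n. g (Z (?b n k) \<omega>) - g (Z (?a n k) \<omega>))"
      using sum_telescope[of "\<lambda>k. - g (Z (?a n k) \<omega>)" n] by (simp add: grid_last del: of_nat_Suc)
    have "g (Z (?b n k) \<omega>) - g (Z (?a n k) \<omega>) = taylor_rem g g1 g2 (Z (?a n k) \<omega>) (Z (?b n k) \<omega>)
      + (\<Sum>i\<in>UNIV. g1 i (Z (?a n k) \<omega>) * incr s t n k \<omega> $ i)
      + (1/2) * (\<Sum>i\<in>UNIV. \<Sum>j\<in>UNIV. g2 i j (Z (?a n k) \<omega>) * (incr s t n k \<omega> $ i * incr s t n k \<omega> $ j))" for k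
      by (simp add: taylor_rem_def incr_def)
    then have "g (Z t \<omega>) - g (Z s \<omega>) = rem n \<omega> + (\<Sum>k\<le>n. \<Sum>i\<in>UNIV. g1 i (Z (?a n k) \<omega>) * incr s t n k \<omega> $ i)
      + (1/2) * (\<Sum>k\<le>n. \<Sum>i\<in>UNIV. \<Sum>j\<in>UNIV. g2 i j (Z (?a n k) \<omega>) * (incr s t n k \<omega> $ i * incr s t n k \<omega> $ j))"
      unfolding tele rem_def by (simp only: sum.distrib sum_distrib_left)
    also have "(\<Sum>k\<le>n. \<Sum>i\<in>UNIV. g1 i (Z (?a n k) \<omega>) * incr s t n k \<omega> $ i) = (\<Sum>i\<in>UNIV. P1 n i \<omega> + S1 n i \<omega> + time_integral s t (\<lambda>r. D r \<omega> $ i * g1 i (Z r \<omega>)))"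
      unfolding P1_def S1_def N_def by (subst sum.swap) (simp add: sum.distrib[symmetric] algebra_simps)
    also have "(\<Sum>k\<le>n. \<Sum>i\<in>UNIV. \<Sum>j\<in>UNIV. g2 i j (Z (?a n k) \<omega>) * (incr s t n k \<omega> $ i * incr s t n k \<omega> $ j))
      = (\<Sum>i\<in>UNIV. \<Sum>j\<in>UNIV. X n i j \<omega> + P2 n i j \<omega> + S2 n i j \<omega> + time_integral s t (\<lambda>r. A r \<omega> $ i $ j * g2 i j (Z r \<omega>)))"
    proof -
      have "(\<Sum>k\<le>n. \<Sum>i\<in>UNIV. \<Sum>j\<in>UNIV. g2 i j (Z (?a n k) \<omega>) * (incr s t n k \<omega> $ i * incr s t n k \<omega> $ j))
        = (\<Sum>i\<in>UNIV. \<Sum>j\<in>UNIV. \<Sum>k\<le>n. g2 i j (Z (?a n k) \<omega>) * (incr s t n k \<omega> $ i * incr s t n k \<omega> $ j))"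
        by (subst sum.swap, rule sum.cong[OF refl], rule sum.swap)
      also have "\<dots> = (\<Sum>i\<in>UNIV. \<Sum>j\<in>UNIV. X n i j \<omega> + P2 n i j \<omega> + S2 n i j \<omega> + time_integral s t (\<lambda>r. A r \<omega> $ i $ j * g2 i j (Z r \<omega>)))"
        unfolding X_def P2_def S2_def by (intro sum.cong refl) (simp add: sum.distrib[symmetric] right_diff_distrib)
      finally show ?thesis .
    qed
    finally have e: "g (Z t \<omega>) - g (Z s \<omega>) = rem n \<omega> + (\<Sum>i\<in>UNIV. P1 n i \<omega> + S1 n i \<omega> + time_integral s t (\<lambda>r. D r \<omega> $ i * g1 i (Z r \<omega>)))
      + (1/2) * (\<Sum>i\<in>UNIV. \<Sum>j\<in>UNIV. X n i j \<omega> + P2 n i j \<omega> + S2 n i j \<omega> + time_integral s t (\<lambda>r. A r \<omega> $ i $ j * g2 i j (Z r \<omega>)))" .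
    have i1: "set_integrable lborel {s<..t} (\<lambda>r. D r \<omega> $ i * g1 i (Z r \<omega>))" for i
      by (rule field_integrable[OF b1 \<omega>])
    have i2: "set_integrable lborel {s<..t} (\<lambda>r. A r \<omega> $ i $ j * g2 i j (Z r \<omega>))" for i j
      by (rule field_integrable[OF b2 \<omega>])
    note i3 = time_integral_sum(2)[where I=UNIV, OF i1] time_integral_sum(2)[where I=UNIV, OF time_integral_sum(2)[where I=UNIV, OF i2]]
    have "time_integral s t (\<lambda>r. generator g1 g2 r \<omega>) = (\<Sum>i\<in>UNIV. time_integral s t (\<lambda>r. D r \<omega> $ i * g1 i (Z r \<omega>)))
      + (1/2) * (\<Sum>i\<in>UNIV. \<Sum>j\<in>UNIV. time_integral s t (\<lambda>r. A r \<omega> $ i $ j * g2 i j (Z r \<omega>)))"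
      unfolding generator_def using i1 i2 i3
      by (subst set_integral_add(2)) (auto simp: time_integral_sum)
    then show ?thesis using e by (simp add: sum.distrib algebra_simps)
  qed
  have rv\<xi>: "bounded_rv \<xi>" using \<xi>M \<xi>(2) by (auto simp: bounded_rv_def)
  have rvN: "bounded_rv (N n k i)" if "k \<le> n" for n k i
    unfolding N_def incr_def drift_int_def
    by (intro bounded_rv_diff bounded_rv_Z_nth bounded_rv_time_integral[OF bounded_field_D] grid_step_nonneg[OF st(2)] | simp only: vector_minus_component)+
  have rvi: "bounded_rv (\<lambda>\<omega>. incr s t n k \<omega> $ i)" for n k i
    unfolding incr_def vector_minus_component by (intro bounded_rv_diff bounded_rv_Z_nth)
  have rv\<alpha>: "bounded_rv (\<alpha> n k i j)" for n k i j
    unfolding \<alpha>_def by (intro bounded_rv_time_integral[OF bounded_field_A] grid_step_nonneg[OF st(2)])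
  have rvd: "bounded_rv (drift_int s t n k i)" for n k i
    unfolding drift_int_def by (intro bounded_rv_time_integral[OF bounded_field_D] grid_step_nonneg[OF st(2)])
  note rvg = bounded_rv_comp[OF g(1)] bounded_rv_comp[OF g(2)] bounded_rv_comp[OF g(3)]
  have rvX: "bounded_rv (X n i j)" for n i j
    unfolding X_def by (intro bounded_rv_sum bounded_rv_mult bounded_rv_diff rvN rvi rvg) auto
  have rvP1: "bounded_rv (P1 n i)" for n i
    unfolding P1_def by (intro bounded_rv_sum bounded_rv_mult rvN rvg) auto
  have rvP2: "bounded_rv (P2 n i j)" for n i j
    unfolding P2_def by (intro bounded_rv_sum bounded_rv_mult bounded_rv_diff rvN rv\<alpha> rvg) auto
  have rvS1: "bounded_rv (S1 n i)" for n i
    unfolding S1_def by (intro bounded_rv_diff bounded_rv_sum bounded_rv_mult rvd rvg bounded_rv_time_integral[OF b1] st(2))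
  have rvS2: "bounded_rv (S2 n i j)" for n i j
    unfolding S2_def by (intro bounded_rv_diff bounded_rv_sum bounded_rv_mult rv\<alpha> rvg bounded_rv_time_integral[OF b2] st(2))
  have rvrem: "bounded_rv (rem n)" for n
    unfolding rem_def taylor_rem_def vector_minus_component
    by (intro bounded_rv_sum bounded_rv_diff bounded_rv_mult rvg bounded_rv_const bounded_rv_Z_nth)
  \<comment> \<open>On each piece, \<open>\<xi>\<close> times the value of \<open>g1\<close> at the
    left end point is bounded and known there, hence an admissible weight for the drift identity;
    \<open>E2\<close> does the same with the covariation identity.\<close>
  have E1: "(LINT \<omega>|M. \<xi> \<omega> * P1 n i \<omega>) = 0" for n i
  proof -
    have "(LINT \<omega>|M. \<xi> \<omega> * P1 n i \<omega>) = (LINT \<omega>|M. (\<Sum>k\<le>n. \<xi> \<omega> * (g1 i (Z (?a n k) \<omega>) * N n k i \<omega>)))"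
      by (simp add: P1_def sum_distrib_left)
    also have "\<dots> = (\<Sum>k\<le>n. LINT \<omega>|M. \<xi> \<omega> * (g1 i (Z (?a n k) \<omega>) * N n k i \<omega>))"
      by (intro Bochner_Integration.integral_sum bounded_rv_integrable bounded_rv_mult rv\<xi> rvg rvN) auto
    also have "\<dots> = 0"
    proof (intro sum.neutral ballI)
      fix k assume "k \<in> {..n}"
      have k: "0 \<le> ?a n k" "s \<le> ?a n k" "?a n k \<le> ?b n k"
        using grid_ge[OF st(2), of n k] st grid_step_nonneg[OF st(2), of n k] by auto
      obtain K where K: "\<And>\<omega>. \<omega> \<in> space M \<Longrightarrow> \<bar>\<xi> \<omega> * g1 i (Z (?a n k) \<omega>)\<bar> \<le> K"
        using bounded_rv_mult[OF rv\<xi> rvg(2)[of i "?a n k"]] by (auto simp: bounded_rv_def)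
      have m: "(\<lambda>\<omega>. \<xi> \<omega> * g1 i (Z (?a n k) \<omega>)) \<in> borel_measurable (F (?a n k))"
        by (intro borel_measurable_times meas_F_mono[OF \<xi>(1) st(1) k(2)] measurable_compose[OF Z_adapted[OF k(1)] borel_measurable_continuous_onI[OF g(2)]])
      show "(LINT \<omega>|M. \<xi> \<omega> * (g1 i (Z (?a n k) \<omega>) * N n k i \<omega>)) = 0"
        using drift[OF k(1) k(3) m K, of i] by (simp add: N_def incr_def drift_int_def mult.assoc)
    qed
    finally show ?thesis .
  qed
  have E2: "(LINT \<omega>|M. \<xi> \<omega> * P2 n i j \<omega>) = 0" for n i j
  proof -
    have "(LINT \<omega>|M. \<xi> \<omega> * P2 n i j \<omega>) = (LINT \<omega>|M. (\<Sum>k\<le>n. \<xi> \<omega> * (g2 i j (Z (?a n k) \<omega>) * (N n k i \<omega> * N n k j \<omega> - \<alpha> n k i j \<omega>))))"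
      by (simp add: P2_def sum_distrib_left)
    also have "\<dots> = (\<Sum>k\<le>n. LINT \<omega>|M. \<xi> \<omega> * (g2 i j (Z (?a n k) \<omega>) * (N n k i \<omega> * N n k j \<omega> - \<alpha> n k i j \<omega>)))"
      by (intro Bochner_Integration.integral_sum bounded_rv_integrable bounded_rv_mult bounded_rv_diff rv\<xi> rvg rvN rv\<alpha>) auto
    also have "\<dots> = 0"
    proof (intro sum.neutral ballI)
      fix k assume "k \<in> {..n}"
      have k: "0 \<le> ?a n k" "s \<le> ?a n k" "?a n k \<le> ?b n k"
        using grid_ge[OF st(2), of n k] st grid_step_nonneg[OF st(2), of n k] by auto
      obtain K where K: "\<And>\<omega>. \<omega> \<in> space M \<Longrightarrow> \<bar>\<xi> \<omega> * g2 i j (Z (?a n k) \<omega>)\<bar> \<le> K"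
        using bounded_rv_mult[OF rv\<xi> rvg(3)[of i j "?a n k"]] by (auto simp: bounded_rv_def)
      have m: "(\<lambda>\<omega>. \<xi> \<omega> * g2 i j (Z (?a n k) \<omega>)) \<in> borel_measurable (F (?a n k))"
        by (intro borel_measurable_times meas_F_mono[OF \<xi>(1) st(1) k(2)] measurable_compose[OF Z_adapted[OF k(1)] borel_measurable_continuous_onI[OF g(3)]])
      show "(LINT \<omega>|M. \<xi> \<omega> * (g2 i j (Z (?a n k) \<omega>) * (N n k i \<omega> * N n k j \<omega> - \<alpha> n k i j \<omega>))) = 0"
        using covariation[OF k(1) k(3) m K, of i j] by (simp add: N_def incr_def drift_int_def \<alpha>_def mult.assoc)
    qed
    finally show ?thesis .
  qed
  let ?E = "LINT \<omega>|M. \<xi> \<omega> * (g (Z t \<omega>) - g (Z s \<omega>) - time_integral s t (\<lambda>r. generator g1 g2 r \<omega>))"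
  have "?E = (LINT \<omega>|M. \<xi> \<omega> * rem n \<omega>) + (\<Sum>i\<in>UNIV. LINT \<omega>|M. \<xi> \<omega> * S1 n i \<omega>)
      + (1/2) * (\<Sum>i\<in>UNIV. \<Sum>j\<in>UNIV. (LINT \<omega>|M. \<xi> \<omega> * X n i j \<omega>) + (LINT \<omega>|M. \<xi> \<omega> * S2 n i j \<omega>))" for n
  proof -
    note I = bounded_rv_integrable[OF bounded_rv_mult[OF rv\<xi> rvrem[of n]]] bounded_rv_integrable[OF bounded_rv_mult[OF rv\<xi> rvP1[of n]]]
      bounded_rv_integrable[OF bounded_rv_mult[OF rv\<xi> rvS1[of n]]] bounded_rv_integrable[OF bounded_rv_mult[OF rv\<xi> rvX[of n]]]
      bounded_rv_integrable[OF bounded_rv_mult[OF rv\<xi> rvP2[of n]]] bounded_rv_integrable[OF bounded_rv_mult[OF rv\<xi> rvS2[of n]]]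
    have "?E = (LINT \<omega>|M. \<xi> \<omega> * rem n \<omega> + (\<Sum>i\<in>UNIV. \<xi> \<omega> * P1 n i \<omega> + \<xi> \<omega> * S1 n i \<omega>)
        + (1/2) * (\<Sum>i\<in>UNIV. \<Sum>j\<in>UNIV. \<xi> \<omega> * X n i j \<omega> + \<xi> \<omega> * P2 n i j \<omega> + \<xi> \<omega> * S2 n i j \<omega>))"
    proof (intro Bochner_Integration.integral_cong refl)
      fix \<omega> assume \<omega>: "\<omega> \<in> space M"
      show "\<xi> \<omega> * (g (Z t \<omega>) - g (Z s \<omega>) - time_integral s t (\<lambda>r. generator g1 g2 r \<omega>)) =
        \<xi> \<omega> * rem n \<omega> + (\<Sum>i\<in>UNIV. \<xi> \<omega> * P1 n i \<omega> + \<xi> \<omega> * S1 n i \<omega>)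
        + (1/2) * (\<Sum>i\<in>UNIV. \<Sum>j\<in>UNIV. \<xi> \<omega> * X n i j \<omega> + \<xi> \<omega> * P2 n i j \<omega> + \<xi> \<omega> * S2 n i j \<omega>)"
        unfolding point[OF \<omega>, of n] distrib_left[symmetric] sum_distrib_left[symmetric] by (simp add: distrib_left)
    qed
    also have "\<dots> = (LINT \<omega>|M. \<xi> \<omega> * rem n \<omega>) + (\<Sum>i\<in>UNIV. (LINT \<omega>|M. \<xi> \<omega> * P1 n i \<omega>) + (LINT \<omega>|M. \<xi> \<omega> * S1 n i \<omega>))
      + (1/2) * (\<Sum>i\<in>UNIV. \<Sum>j\<in>UNIV. (LINT \<omega>|M. \<xi> \<omega> * X n i j \<omega>) + (LINT \<omega>|M. \<xi> \<omega> * P2 n i j \<omega>) + (LINT \<omega>|M. \<xi> \<omega> * S2 n i j \<omega>))"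
      using I by simp
    finally show ?thesis by (simp add: E1 E2)
  qed
  moreover have "(\<lambda>n. (LINT \<omega>|M. \<xi> \<omega> * rem n \<omega>) + (\<Sum>i\<in>UNIV. LINT \<omega>|M. \<xi> \<omega> * S1 n i \<omega>)
      + (1/2) * (\<Sum>i\<in>UNIV. \<Sum>j\<in>UNIV. (LINT \<omega>|M. \<xi> \<omega> * X n i j \<omega>) + (LINT \<omega>|M. \<xi> \<omega> * S2 n i j \<omega>)))
    \<longlonglongrightarrow> 0 + (\<Sum>i\<in>(UNIV::'n set). 0) + (1/2) * (\<Sum>i\<in>(UNIV::'n set). \<Sum>j\<in>(UNIV::'n set). 0 + 0)"
    by (intro tendsto_add tendsto_mult tendsto_sum tendsto_const l1 l2 l3 l4)
  ultimately have "(\<lambda>n::nat. ?E) \<longlonglongrightarrow> 0" by simp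
  then show ?thesis by (simp add: LIMSEQ_const_iff)
qed

end

section \<open>The generator and its Lyapunov function\<close>

lemma Ck_differentiable: "Ck (Suc k) g \<Longrightarrow> g differentiable (at x)"
  by simp

lemma Ck_continuous: "Ck k g \<Longrightarrow> continuous_on UNIV g"
proof (cases k)
  case (Suc m)
  assume "Ck k g"
  then have "\<And>x. g differentiable (at x)" using Suc by simp
  then show ?thesis
    by (intro continuous_at_imp_continuous_on ballI differentiable_imp_continuous_within) auto
qed simp

lemma pd_has_derivative: "(g has_derivative g') (at x) \<Longrightarrow> pd i g x = g' (axis i 1)"
  unfolding pd_def by (simp add: frechet_derivative_at[symmetric])

lemma differentiable_has_derivative_pd:
  fixes g :: "real^'n::finite \<Rightarrow> real"
  assumes "g differentiable (at x)"
  shows "(g has_derivative (\<lambda>v. \<Sum>i\<in>UNIV. v $ i * pd i g x)) (at x)"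
proof -
  let ?g' = "frechet_derivative g (at x)"
  have d: "(g has_derivative ?g') (at x)" using assms by (simp add: frechet_derivative_works)
  have lin: "linear ?g'" using has_derivative_linear[OF d] .
  have "?g' v = (\<Sum>i\<in>UNIV. v $ i * pd i g x)" for v
  proof -
    have "?g' v = ?g' (\<Sum>i\<in>UNIV. (v $ i) *s axis i 1)" by (simp add: basis_expansion)
    also have "\<dots> = (\<Sum>i\<in>UNIV. v $ i * ?g' (axis i 1))"
      by (simp add: linear_sum[OF lin] scalar_mult_eq_scaleR linear_scale[OF lin])
    finally show ?thesis by (simp add: pd_def)
  qed
  then have "?g' = (\<lambda>v. \<Sum>i\<in>UNIV. v $ i * pd i g x)" by auto
  with d show ?thesis by simp
qed

lemma Ck2D:
  assumes "Ck 2 g"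
  shows "g differentiable (at x)" "pd i g differentiable (at x)" "continuous_on UNIV g" "continuous_on UNIV (pd i g)" "continuous_on UNIV (pd j (pd i g))"
proof -
  have c: "Ck (Suc (Suc 0)) g" using assms by (simp add: numeral_2_eq_2)
  then show "g differentiable (at x)" "pd i g differentiable (at x)" "continuous_on UNIV (pd j (pd i g))" by auto
  show "continuous_on UNIV g" by (rule Ck_continuous[OF c])
  have "Ck (Suc 0) (pd i g)" using c by simp
  then show "continuous_on UNIV (pd i g)" by (rule Ck_continuous)
qed

lemma Ck2I:
  assumes "\<And>x. g differentiable (at x)" "\<And>i x. pd i g differentiable (at x)" "\<And>i j. continuous_on UNIV (pd j (pd i g))"
  shows "Ck 2 g"
  using assms by (simp add: numeral_2_eq_2)

text \<open>Taylor's formula with Lagrange remainder on the segment from \<open>y\<close> to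
  \<open>z\<close>. The Hessian term at \<open>y\<close> stands on the left side, so that what
  remains is governed by the oscillation of the Hessian.\<close>

lemma taylor_rem_mean_value:
  fixes g :: "real^'n::finite \<Rightarrow> real"
  assumes g: "Ck 2 g"
  obtains \<theta> where "0 < \<theta>" "\<theta> < 1"
    "g z - g y - (\<Sum>i\<in>UNIV. pd i g y * (z - y) $ i) - (1/2) * (\<Sum>i\<in>UNIV. \<Sum>j\<in>UNIV. pd j (pd i g) y * ((z - y) $ i * (z - y) $ j))
     = (1/2) * (\<Sum>i\<in>UNIV. \<Sum>j\<in>UNIV. (pd j (pd i g) (y + \<theta> *\<^sub>R (z - y)) - pd j (pd i g) y) * ((z - y) $ i * (z - y) $ j))"
proof -
  define d where "d = z - y"
  define \<phi>0 where "\<phi>0 s = g (y + s *\<^sub>R d)" for s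
  define \<phi>1 where "\<phi>1 s = (\<Sum>i\<in>UNIV. pd i g (y + s *\<^sub>R d) * d $ i)" for s
  define \<phi>2 where "\<phi>2 s = (\<Sum>i\<in>UNIV. \<Sum>j\<in>UNIV. pd j (pd i g) (y + s *\<^sub>R d) * (d $ i * d $ j))" for s
  have line: "((\<lambda>s. y + s *\<^sub>R d) has_derivative (\<lambda>r. r *\<^sub>R d)) (at s)" for s
    by (auto intro!: derivative_eq_intros)
  have chain: "((\<lambda>s. f (y + s *\<^sub>R d)) has_real_derivative (\<Sum>i\<in>UNIV. pd i f (y + s *\<^sub>R d) * d $ i)) (at s)"
    if "f differentiable (at (y + s *\<^sub>R d))" for f s
  proof -
    have "((\<lambda>s. f (y + s *\<^sub>R d)) has_derivative (\<lambda>r. \<Sum>i\<in>UNIV. (r *\<^sub>R d) $ i * pd i f (y + s *\<^sub>R d))) (at s)"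
      using has_derivative_compose[OF line differentiable_has_derivative_pd[OF that]] by (simp add: o_def)
    moreover have "(\<lambda>r. \<Sum>i\<in>UNIV. (r *\<^sub>R d) $ i * pd i f (y + s *\<^sub>R d)) = (*) (\<Sum>i\<in>UNIV. pd i f (y + s *\<^sub>R d) * d $ i)"
      by (auto simp: fun_eq_iff sum_distrib_right sum_distrib_left algebra_simps intro!: sum.cong)
    ultimately show ?thesis by (simp add: has_field_derivative_def)
  qed
  define df where "df m = (if m = 0 then \<phi>0 else if m = 1 then \<phi>1 else \<phi>2)" for m :: nat
  have d0: "DERIV \<phi>0 s :> \<phi>1 s" for s unfolding \<phi>0_def \<phi>1_def by (rule chain[OF Ck2D(1)[OF g]])
  have d1: "DERIV \<phi>1 s :> \<phi>2 s" for s
  proof -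
    have "DERIV \<phi>1 s :> (\<Sum>i\<in>UNIV. (\<Sum>j\<in>UNIV. pd j (pd i g) (y + s *\<^sub>R d) * d $ j) * d $ i)"
      unfolding \<phi>1_def by (intro DERIV_sum DERIV_cmult_right chain[OF Ck2D(2)[OF g]])
    also have "(\<Sum>i\<in>UNIV. (\<Sum>j\<in>UNIV. pd j (pd i g) (y + s *\<^sub>R d) * d $ j) * d $ i) = \<phi>2 s"
      unfolding \<phi>2_def by (intro sum.cong refl) (simp add: sum_distrib_right sum_distrib_left mult_ac)
    finally show ?thesis .
  qed
  have "\<exists>t. 0 < t \<and> t < 1 \<and> \<phi>0 1 = (\<Sum>m<2. df m 0 / fact m * 1 ^ m) + df 2 t / fact 2 * 1 ^ 2"
    by (rule Maclaurin) (use d0 d1 in \<open>auto simp: df_def less_2_cases_iff\<close>)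
  then obtain t where t: "0 < t" "t < 1" "\<phi>0 1 = \<phi>0 0 + \<phi>1 0 + \<phi>2 t / 2"
    by (auto simp: df_def numeral_2_eq_2)
  show ?thesis
  proof (rule that[OF t(1,2)])
    have "(\<Sum>i\<in>UNIV. \<Sum>j\<in>UNIV. (pd j (pd i g) (y + t *\<^sub>R (z - y)) - pd j (pd i g) y) * ((z - y) $ i * (z - y) $ j)) = \<phi>2 t - \<phi>2 0"
      by (simp only: \<phi>2_def d_def sum_subtractf[symmetric] left_diff_distrib scale_zero_left add_0_right)
    moreover have "\<phi>0 1 = g z" "\<phi>0 0 = g y" "\<phi>1 0 = (\<Sum>i\<in>UNIV. pd i g y * (z - y) $ i)" "\<phi>2 0 = (\<Sum>i\<in>UNIV. \<Sum>j\<in>UNIV. pd j (pd i g) y * ((z - y) $ i * (z - y) $ j))"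
      by (auto simp: \<phi>0_def \<phi>1_def \<phi>2_def d_def)
    ultimately show "g z - g y - (\<Sum>i\<in>UNIV. pd i g y * (z - y) $ i) - (1/2) * (\<Sum>i\<in>UNIV. \<Sum>j\<in>UNIV. pd j (pd i g) y * ((z - y) $ i * (z - y) $ j))
     = (1/2) * (\<Sum>i\<in>UNIV. \<Sum>j\<in>UNIV. (pd j (pd i g) (y + t *\<^sub>R (z - y)) - pd j (pd i g) y) * ((z - y) $ i * (z - y) $ j))"
      using t(3) by simp
  qed
qed

definition gen_op :: "(real^'n::finite \<Rightarrow> real^'n^'n) \<Rightarrow> (real^'n \<Rightarrow> real^'n) \<Rightarrow> (real^'n \<Rightarrow> real) \<Rightarrow> real^'n \<Rightarrow> real" where
  "gen_op a \<beta> g x = (\<Sum>i\<in>UNIV. \<beta> x $ i * pd i g x) + (1/2) * (\<Sum>i\<in>UNIV. \<Sum>j\<in>UNIV. a x $ i $ j * pd j (pd i g) x)"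

text \<open>The Hessian difference is at most \<open>c\<close> in each of its
  \<open>CARD('n)\<^sup>2\<close> entries, and a product of two coordinates of \<open>z - y\<close>
  is at most its squared norm. Because \<open>c\<close> has to bound only points no farther from
  \<open>y\<close> than \<open>z\<close>, both the local and the global estimate follow.\<close>

lemma taylor_rem_bound:
  fixes g :: "real^'n::finite \<Rightarrow> real"
  assumes g: "Ck 2 g" and yz: "y \<in> cball 0 R" "z \<in> cball 0 R"
    and c: "\<And>w. w \<in> cball 0 R \<Longrightarrow> norm (w - y) \<le> norm (z - y) \<Longrightarrow> norm ((\<chi> i j. pd j (pd i g) w) - (\<chi> i j. pd j (pd i g) y) :: real^'n^'n) \<le> c"
  shows "\<bar>g z - g y - (\<Sum>i\<in>UNIV. pd i g y * (z - y) $ i) - (1/2) * (\<Sum>i\<in>UNIV. \<Sum>j\<in>UNIV. pd j (pd i g) y * ((z - y) $ i * (z - y) $ j))\<bar>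
    \<le> (real CARD('n))\<^sup>2 * c * (norm (z - y))\<^sup>2"
proof -
  obtain \<theta> where \<theta>: "0 < \<theta>" "\<theta> < 1" and e:
    "g z - g y - (\<Sum>i\<in>UNIV. pd i g y * (z - y) $ i) - (1/2) * (\<Sum>i\<in>UNIV. \<Sum>j\<in>UNIV. pd j (pd i g) y * ((z - y) $ i * (z - y) $ j))
     = (1/2) * (\<Sum>i\<in>UNIV. \<Sum>j\<in>UNIV. (pd j (pd i g) (y + \<theta> *\<^sub>R (z - y)) - pd j (pd i g) y) * ((z - y) $ i * (z - y) $ j))"
    using taylor_rem_mean_value[OF g] by blast
  define w where "w = y + \<theta> *\<^sub>R (z - y)"
  define d where "d = z - y"
  have w: "w = (1 - \<theta>) *\<^sub>R y + \<theta> *\<^sub>R z" by (simp add: w_def algebra_simps)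
  have wR: "w \<in> cball 0 R" unfolding w using yz \<theta> by (intro convexD) auto
  have "norm (w - y) = \<theta> * norm (z - y)" using \<theta> by (simp add: w_def)
  also have "\<dots> \<le> norm (z - y)" using \<theta> by (simp add: mult_left_le_one_le)
  finally have n: "norm ((\<chi> i j. pd j (pd i g) w) - (\<chi> i j. pd j (pd i g) y) :: real^'n^'n) \<le> c" using c[OF wR] by simp
  have c0: "0 \<le> c" using n norm_ge_zero order_trans by blast
  have el: "\<bar>pd j (pd i g) w - pd j (pd i g) y\<bar> \<le> c" for i j
  proof -
    let ?A = "(\<chi> i j. pd j (pd i g) w) - (\<chi> i j. pd j (pd i g) y) :: real^'n^'n"
    have "\<bar>?A $ i $ j\<bar> \<le> norm (?A $ i)" by (rule component_le_norm_cart)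
    also have "\<dots> \<le> norm ?A" by (rule Finite_Cartesian_Product.norm_nth_le)
    finally show ?thesis using n by simp
  qed
  have "\<bar>\<Sum>i\<in>UNIV. \<Sum>j\<in>UNIV. (pd j (pd i g) w - pd j (pd i g) y) * (d $ i * d $ j)\<bar> \<le> (\<Sum>i\<in>(UNIV::'n set). \<Sum>j\<in>(UNIV::'n set). c * (norm d)\<^sup>2)"
  proof (rule order_trans[OF sum_abs], rule sum_mono, rule order_trans[OF sum_abs], rule sum_mono)
    fix i j
    have "\<bar>d $ i * d $ j\<bar> \<le> (norm d)\<^sup>2" unfolding abs_mult power2_eq_square by (intro mult_mono component_le_norm_cart) auto
    then show "\<bar>(pd j (pd i g) w - pd j (pd i g) y) * (d $ i * d $ j)\<bar> \<le> c * (norm d)\<^sup>2"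
      unfolding abs_mult[of "pd j (pd i g) w - pd j (pd i g) y"] using el[of j i] c0 by (intro mult_mono) auto
  qed
  also have "\<dots> = (real CARD('n))\<^sup>2 * c * (norm d)\<^sup>2" by (simp add: power2_eq_square)
  finally have "\<bar>(1/2) * (\<Sum>i\<in>UNIV. \<Sum>j\<in>UNIV. (pd j (pd i g) w - pd j (pd i g) y) * (d $ i * d $ j))\<bar> \<le> (1/2) * ((real CARD('n))\<^sup>2 * c * (norm d)\<^sup>2)"
    unfolding abs_mult by (intro mult_mono) auto
  also have "\<dots> \<le> (real CARD('n))\<^sup>2 * c * (norm d)\<^sup>2" using c0 by simp
  finally show ?thesis unfolding d_def[symmetric] e[folded w_def, folded d_def] .
qed

lemma hessian_continuous:
  fixes g :: "real^'n::finite \<Rightarrow> real"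
  assumes "Ck 2 g"
  shows "continuous_on UNIV (\<lambda>x. (\<chi> i j. pd j (pd i g) x) :: real^'n^'n)"
  by (intro continuous_intros Ck2D(5)[OF assms])

text \<open>Uniform continuity of the Hessian on the compact ball makes \<delta> independent of the
  base point; dividing \<open>e\<close> by the squared dimension absorbs the constant of
  \<open>taylor_rem_bound\<close>.\<close>

lemma taylor_rem_little_o:
  fixes g :: "real^'n::finite \<Rightarrow> real"
  assumes g: "Ck 2 g" and e: "0 < e"
  shows "\<exists>\<delta>>0. \<forall>y\<in>cball 0 R. \<forall>z\<in>cball 0 R. norm (z - y) < \<delta> \<longrightarrow>
    \<bar>g z - g y - (\<Sum>i\<in>UNIV. pd i g y * (z - y) $ i) - (1/2) * (\<Sum>i\<in>UNIV. \<Sum>j\<in>UNIV. pd j (pd i g) y * ((z - y) $ i * (z - y) $ j))\<bar> \<le> e * (norm (z - y))\<^sup>2"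
proof -
  let ?G = "\<lambda>x. (\<chi> i j. pd j (pd i g) x) :: real^'n^'n"
  define c where "c = e / (real CARD('n))\<^sup>2"
  have c: "0 < c" "(real CARD('n))\<^sup>2 * c = e" using e by (auto simp: c_def)
  have "uniformly_continuous_on (cball 0 R) ?G"
    by (intro compact_uniformly_continuous continuous_on_subset[OF hessian_continuous[OF g]]) auto
  then obtain \<delta> where \<delta>: "0 < \<delta>" "\<And>x x'. x \<in> cball 0 R \<Longrightarrow> x' \<in> cball 0 R \<Longrightarrow> dist x' x < \<delta> \<Longrightarrow> dist (?G x') (?G x) < c"
    using c unfolding uniformly_continuous_on_def by metis
  show ?thesis
  proof (intro exI conjI ballI impI)
    show "0 < \<delta>" by fact
    fix y z :: "real^'n" assume yz: "y \<in> cball 0 R" "z \<in> cball 0 R" "norm (z - y) < \<delta>"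
    have "norm (?G w - ?G y) \<le> c" if "w \<in> cball 0 R" "norm (w - y) \<le> norm (z - y)" for w
      using \<delta>(2)[OF yz(1) that(1)] that(2) yz(3) unfolding dist_norm by linarith
    from taylor_rem_bound[OF g yz(1,2) this]
    show "\<bar>g z - g y - (\<Sum>i\<in>UNIV. pd i g y * (z - y) $ i) - (1/2) * (\<Sum>i\<in>UNIV. \<Sum>j\<in>UNIV. pd j (pd i g) y * ((z - y) $ i * (z - y) $ j))\<bar> \<le> e * (norm (z - y))\<^sup>2"
      unfolding c(2) .
  qed
qed

lemma taylor_rem_big_O:
  fixes g :: "real^'n::finite \<Rightarrow> real"
  assumes g: "Ck 2 g"
  obtains K where "\<And>y z. y \<in> cball 0 R \<Longrightarrow> z \<in> cball 0 R \<Longrightarrow>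
    \<bar>g z - g y - (\<Sum>i\<in>UNIV. pd i g y * (z - y) $ i) - (1/2) * (\<Sum>i\<in>UNIV. \<Sum>j\<in>UNIV. pd j (pd i g) y * ((z - y) $ i * (z - y) $ j))\<bar> \<le> K * (norm (z - y))\<^sup>2"
proof -
  let ?G = "\<lambda>x. (\<chi> i j. pd j (pd i g) x) :: real^'n^'n"
  have "compact (?G ` cball 0 R)"
    by (intro compact_continuous_image continuous_on_subset[OF hessian_continuous[OF g]]) auto
  then have "bounded (?G ` cball 0 R)" by (rule compact_imp_bounded)
  then obtain c where c': "\<And>A. A \<in> ?G ` cball 0 R \<Longrightarrow> norm A \<le> c" unfolding bounded_iff by blast
  have c: "norm (?G x) \<le> c" if "x \<in> cball 0 R" for x
    by (rule c') (use that in blast)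
  have b: "norm (?G w - ?G y) \<le> c + c" if "y \<in> cball 0 R" "w \<in> cball 0 R" for y w
    by (rule order_trans[OF norm_triangle_ineq4]) (intro add_mono c that)
  show ?thesis
  proof (rule that)
    fix y z :: "real^'n" assume yz: "y \<in> cball 0 R" "z \<in> cball 0 R"
    show "\<bar>g z - g y - (\<Sum>i\<in>UNIV. pd i g y * (z - y) $ i) - (1/2) * (\<Sum>i\<in>UNIV. \<Sum>j\<in>UNIV. pd j (pd i g) y * ((z - y) $ i * (z - y) $ j))\<bar> \<le> (real CARD('n))\<^sup>2 * (c + c) * (norm (z - y))\<^sup>2"
      by (rule taylor_rem_bound[OF g yz b[OF yz(1)]])
  qed
qed

theorem (in bounded_ito_process) dynkin_Ck:
  assumes st: "0 \<le> s" "s \<le> t" and g: "Ck 2 g"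
    and \<xi>: "\<xi> \<in> borel_measurable (F s)" "\<And>\<omega>. \<omega> \<in> space M \<Longrightarrow> \<bar>\<xi> \<omega>\<bar> \<le> L"
  shows "(LINT \<omega>|M. \<xi> \<omega> * (g (Z t \<omega>) - g (Z s \<omega>) - time_integral s t (\<lambda>r. generator (\<lambda>i. pd i g) (\<lambda>i j. pd j (pd i g)) r \<omega>))) = 0"
proof -
  obtain K where K: "\<And>y z. y \<in> cball 0 R \<Longrightarrow> z \<in> cball 0 R \<Longrightarrow>
    \<bar>g z - g y - (\<Sum>i\<in>UNIV. pd i g y * (z - y) $ i) - (1/2) * (\<Sum>i\<in>UNIV. \<Sum>j\<in>UNIV. pd j (pd i g) y * ((z - y) $ i * (z - y) $ j))\<bar> \<le> K * (norm (z - y))\<^sup>2"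
    using taylor_rem_big_O[OF g] by blast
  show ?thesis
  proof (rule dynkin[where ?g1.0="\<lambda>i. pd i g" and ?g2.0="\<lambda>i j. pd j (pd i g)" and KT=K, OF st Ck2D(3)[OF g] Ck2D(4)[OF g] Ck2D(5)[OF g] _ _ \<xi>])
    show "\<exists>\<delta>>0. \<forall>y\<in>cball 0 R. \<forall>z\<in>cball 0 R. norm (z - y) < \<delta> \<longrightarrow> \<bar>taylor_rem g (\<lambda>i. pd i g) (\<lambda>i j. pd j (pd i g)) y z\<bar> \<le> e * (norm (z - y))\<^sup>2" if "0 < e" for e
      unfolding taylor_rem_def by (rule taylor_rem_little_o[OF g that])
    show "\<bar>taylor_rem g (\<lambda>i. pd i g) (\<lambda>i j. pd j (pd i g)) y z\<bar> \<le> K * (norm (z - y))\<^sup>2" if "y \<in> cball 0 R" "z \<in> cball 0 R" for y z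
      unfolding taylor_rem_def by (rule K[OF that])
  qed
qed

lemma
  fixes q :: "real^'n::finite \<Rightarrow> real" and \<psi> \<psi>1 \<psi>2 :: "real \<Rightarrow> real"
  assumes q: "Ck 2 q" and d1: "\<And>s. (\<psi> has_real_derivative \<psi>1 s) (at s)" and d2: "\<And>s. (\<psi>1 has_real_derivative \<psi>2 s) (at s)"
    and c2: "continuous_on UNIV \<psi>2"
  shows pd_compose: "pd i (\<lambda>x. \<psi> (q x)) x = \<psi>1 (q x) * pd i q x"
    and pd2_compose: "pd j (pd i (\<lambda>x. \<psi> (q x))) x = \<psi>2 (q x) * pd j q x * pd i q x + \<psi>1 (q x) * pd j (pd i q) x"
    and Ck2_compose: "Ck 2 (\<lambda>x. \<psi> (q x))"
proof -
  have D: "((\<lambda>x. \<psi> (q x)) has_derivative (\<lambda>v. \<psi>1 (q x) * (\<Sum>i\<in>UNIV. v $ i * pd i q x))) (at x)" for x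
    using has_derivative_compose[OF differentiable_has_derivative_pd[OF Ck2D(1)[OF q]] d1[unfolded has_field_derivative_def]] .
  have ax: "(\<Sum>k\<in>UNIV. axis i (1::real) $ k * h k) = h i" for i :: 'n and h
    by (simp add: axis_def if_distrib[of "\<lambda>x. x * _"] cong: if_cong)
  have p1: "pd i (\<lambda>x. \<psi> (q x)) x = \<psi>1 (q x) * pd i q x" for i x
    using pd_has_derivative[OF D[of x], of i] by (simp add: ax)
  then have p1': "pd i (\<lambda>x. \<psi> (q x)) = (\<lambda>x. \<psi>1 (q x) * pd i q x)" for i by auto
  have D2: "((\<lambda>x. \<psi>1 (q x) * pd i q x) has_derivative (\<lambda>v. \<psi>1 (q x) * (\<Sum>j\<in>UNIV. v $ j * pd j (pd i q) x) + \<psi>2 (q x) * (\<Sum>j\<in>UNIV. v $ j * pd j q x) * pd i q x)) (at x)" for i x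
    by (intro has_derivative_mult has_derivative_compose[OF differentiable_has_derivative_pd[OF Ck2D(1)[OF q]] d2[unfolded has_field_derivative_def]]
        differentiable_has_derivative_pd[OF Ck2D(2)[OF q]])
  have p2: "pd j (pd i (\<lambda>x. \<psi> (q x))) x = \<psi>2 (q x) * pd j q x * pd i q x + \<psi>1 (q x) * pd j (pd i q) x" for i j x
    unfolding p1' using pd_has_derivative[OF D2[of i x], of j] by (simp add: ax)
  then have p2': "pd j (pd i (\<lambda>x. \<psi> (q x))) = (\<lambda>x. \<psi>2 (q x) * pd j q x * pd i q x + \<psi>1 (q x) * pd j (pd i q) x)" for i j by auto
  show "pd i (\<lambda>x. \<psi> (q x)) x = \<psi>1 (q x) * pd i q x" by (rule p1)
  show "pd j (pd i (\<lambda>x. \<psi> (q x))) x = \<psi>2 (q x) * pd j q x * pd i q x + \<psi>1 (q x) * pd j (pd i q) x" by (rule p2)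
  have c1: "continuous_on UNIV \<psi>1"
    using d2 by (intro continuous_at_imp_continuous_on ballI DERIV_isCont) auto
  show "Ck 2 (\<lambda>x. \<psi> (q x))"
  proof (rule Ck2I)
    show "(\<lambda>x. \<psi> (q x)) differentiable (at x)" for x using D by (auto simp: differentiable_def)
    show "pd i (\<lambda>x. \<psi> (q x)) differentiable (at x)" for i x unfolding p1' using D2 by (auto simp: differentiable_def)
    show "continuous_on UNIV (pd j (pd i (\<lambda>x. \<psi> (q x))))" for i j
      unfolding p2' by (intro continuous_intros Ck2D[OF q] continuous_on_compose2[OF c1 Ck2D(3)[OF q]] continuous_on_compose2[OF c2 Ck2D(3)[OF q]]) auto
  qed
qed

lemma
  fixes f g :: "real^'n::finite \<Rightarrow> real"
  assumes f: "Ck 2 f" and g: "Ck 2 g"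
  shows pd_diff: "pd i (\<lambda>x. f x - g x) x = pd i f x - pd i g x"
    and pd2_diff: "pd j (pd i (\<lambda>x. f x - g x)) x = pd j (pd i f) x - pd j (pd i g) x"
    and Ck2_diff: "Ck 2 (\<lambda>x. f x - g x)"
proof -
  have ax: "(\<Sum>k\<in>UNIV. axis i (1::real) $ k * h k) = h i" for i :: 'n and h
    by (simp add: axis_def if_distrib[of "\<lambda>x. x * _"] cong: if_cong)
  have p: "pd i (\<lambda>x. f x - g x) x = pd i f x - pd i g x" if "f differentiable (at x)" "g differentiable (at x)" for f g :: "real^'n \<Rightarrow> real" and i x
    using pd_has_derivative[OF has_derivative_diff[OF differentiable_has_derivative_pd[OF that(1)] differentiable_has_derivative_pd[OF that(2)]], of i] by (simp add: ax)
  show p1: "pd i (\<lambda>x. f x - g x) x = pd i f x - pd i g x" for i x by (rule p[OF Ck2D(1)[OF f] Ck2D(1)[OF g]])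
  then have p1': "pd i (\<lambda>x. f x - g x) = (\<lambda>x. pd i f x - pd i g x)" for i by auto
  show p2: "pd j (pd i (\<lambda>x. f x - g x)) x = pd j (pd i f) x - pd j (pd i g) x" for i j x
    unfolding p1' by (rule p[OF Ck2D(2)[OF f] Ck2D(2)[OF g]])
  then have p2': "pd j (pd i (\<lambda>x. f x - g x)) = (\<lambda>x. pd j (pd i f) x - pd j (pd i g) x)" for i j by auto
  show "Ck 2 (\<lambda>x. f x - g x)"
  proof (rule Ck2I)
    show "(\<lambda>x. f x - g x) differentiable (at x)" for x by (intro differentiable_diff Ck2D[OF f] Ck2D[OF g])
    show "pd i (\<lambda>x. f x - g x) differentiable (at x)" for i x unfolding p1' by (intro differentiable_diff Ck2D[OF f] Ck2D[OF g])
    show "continuous_on UNIV (pd j (pd i (\<lambda>x. f x - g x)))" for i j unfolding p2' by (intro continuous_intros Ck2D[OF f] Ck2D[OF g])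
  qed
qed

text \<open>An expansion around \<open>W\<close>. In the divergence term the derivatives of
  \<open>a\<close> supply, by symmetry of \<open>a\<close>, the correction that turns
  \<open>b\<close> into \<open>btilde\<close>. The two mixed terms of the quadratic part agree by
  symmetry of \<open>ah\<close>, which cancels the factor 1/2 and leaves the drift
  \<open>ah y *v grad W y\<close>. What remains is quadratic in the gradient of the
  difference.\<close>

lemma ergodic_op_difference:
  fixes a ah :: "real^'n::finite \<Rightarrow> real^'n^'n"
  assumes sym: "\<And>y. transpose (a y) = a y" "\<And>y. transpose (ah y) = ah y"
    and sa: "\<And>i j. smooth (\<lambda>y. a y $ i $ j)" and W': "Ck 2 W'" and W: "Ck 2 W"
  shows "ergodic_op a ah b V W' x - ergodic_op a ah b V W x
    = gen_op a (\<lambda>y. btilde a b y + ah y *v grad W y) (\<lambda>y. W' y - W y) x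
      + (1/2) * (grad (\<lambda>y. W' y - W y) x \<bullet> (ah x *v grad (\<lambda>y. W' y - W y) x))"
proof -
  have as: "a y $ i $ j = a y $ j $ i" "ah y $ i $ j = ah y $ j $ i" for i j y
  proof -
    have "a y $ i $ j = transpose (a y) $ i $ j" "ah y $ i $ j = transpose (ah y) $ i $ j" by (simp_all only: sym)
    then show "a y $ i $ j = a y $ j $ i" "ah y $ i $ j = ah y $ j $ i" by (simp_all add: transpose_def)
  qed
  have ax: "(\<Sum>k\<in>UNIV. axis i (1::real) $ k * h k) = h i" for i :: 'n and h
    by (simp add: axis_def if_distrib[of "\<lambda>x. x * _"] cong: if_cong)
  have ad: "(\<lambda>y. a y $ i $ j) differentiable (at x)" for i j
  proof -
    have "Ck (Suc 0) (\<lambda>y. a y $ i $ j)" using sa[of i j] unfolding smooth_def by blast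
    then show ?thesis by (rule Ck_differentiable)
  qed
  have div: "pd i (\<lambda>y. \<Sum>j\<in>UNIV. a y $ i $ j * pd j W y) x = (\<Sum>j\<in>UNIV. pd i (\<lambda>y. a y $ i $ j) x * pd j W x + a x $ i $ j * pd i (pd j W) x)"
    if W: "Ck 2 W" for W i
  proof -
    have "((\<lambda>y. \<Sum>j\<in>UNIV. a y $ i $ j * pd j W y) has_derivative (\<lambda>v. \<Sum>j\<in>UNIV. a x $ i $ j * (\<Sum>k\<in>UNIV. v $ k * pd k (pd j W) x) + (\<Sum>k\<in>UNIV. v $ k * pd k (\<lambda>y. a y $ i $ j) x) * pd j W x)) (at x)"
      by (intro has_derivative_sum has_derivative_mult differentiable_has_derivative_pd ad Ck2D(2)[OF W])
    from pd_has_derivative[OF this, of i] show ?thesis by (simp add: ax add.commute)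
  qed
  define p where "p = grad W x"
  define q where "q = grad (\<lambda>y. W' y - W y) x"
  have pq: "pd i W x = p $ i" "pd i W' x = p $ i + q $ i" "pd i (\<lambda>y. W' y - W y) x = q $ i" for i
    by (auto simp: p_def q_def grad_def pd_diff[OF W' W])
  \<comment> \<open>The primed sums are the unprimed ones with the roles of the two summation
    indices exchanged.\<close>
  define S1 where "S1 = (\<Sum>i\<in>UNIV. \<Sum>j\<in>UNIV. pd i (\<lambda>y. a y $ i $ j) x * q $ j)"
  define S1' where "S1' = (\<Sum>i\<in>UNIV. \<Sum>j\<in>UNIV. pd j (\<lambda>y. a y $ i $ j) x * q $ i)"
  define S2 where "S2 = (\<Sum>i\<in>UNIV. \<Sum>j\<in>UNIV. a x $ i $ j * (pd i (pd j W') x - pd i (pd j W) x))"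
  define S2' where "S2' = (\<Sum>i\<in>UNIV. \<Sum>j\<in>UNIV. a x $ i $ j * (pd j (pd i W') x - pd j (pd i W) x))"
  define S3 where "S3 = (\<Sum>i\<in>UNIV. \<Sum>j\<in>UNIV. ah x $ i $ j * (p $ i * q $ j))"
  define S3' where "S3' = (\<Sum>i\<in>UNIV. \<Sum>j\<in>UNIV. ah x $ i $ j * (q $ i * p $ j))"
  define S4 where "S4 = (\<Sum>i\<in>UNIV. \<Sum>j\<in>UNIV. ah x $ i $ j * (q $ i * q $ j))"
  have "S1 = (\<Sum>j\<in>UNIV. \<Sum>i\<in>UNIV. pd i (\<lambda>y. a y $ i $ j) x * q $ j)" unfolding S1_def by (rule sum.swap)
  also have "\<dots> = S1'" unfolding S1'_def by (intro sum.cong refl) (simp only: as(1))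
  finally have s1: "S1 = S1'" .
  have "S2 = (\<Sum>j\<in>UNIV. \<Sum>i\<in>UNIV. a x $ i $ j * (pd i (pd j W') x - pd i (pd j W) x))" unfolding S2_def by (rule sum.swap)
  also have "\<dots> = S2'" unfolding S2'_def by (intro sum.cong refl) (simp only: as(1))
  finally have s2: "S2 = S2'" .
  have "S3 = (\<Sum>j\<in>UNIV. \<Sum>i\<in>UNIV. ah x $ i $ j * (p $ i * q $ j))" unfolding S3_def by (rule sum.swap)
  also have "\<dots> = S3'" unfolding S3'_def by (intro sum.cong refl) (simp only: as(2)[of x] mult.commute)
  finally have s3: "S3 = S3'" .
  have bq: "b x \<bullet> grad W' x - b x \<bullet> grad W x = b x \<bullet> q"
  proof -
    have "grad W' x = p + q" by (simp add: vec_eq_iff grad_def pq)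
    then show ?thesis by (simp add: inner_add_right p_def)
  qed
  have o1: "(\<Sum>i\<in>UNIV. pd i (\<lambda>y. \<Sum>j\<in>UNIV. a y $ i $ j * pd j W' y) x) - (\<Sum>i\<in>UNIV. pd i (\<lambda>y. \<Sum>j\<in>UNIV. a y $ i $ j * pd j W y) x) = S1 + S2"
    unfolding div[OF W'] div[OF W] S1_def S2_def sum.distrib[symmetric] sum_subtractf[symmetric]
    by (intro sum.cong refl) (simp add: pq algebra_simps)
  have o2: "(\<Sum>i\<in>UNIV. \<Sum>j\<in>UNIV. ah x $ i $ j * pd i W' x * pd j W' x) - (\<Sum>i\<in>UNIV. \<Sum>j\<in>UNIV. ah x $ i $ j * pd i W x * pd j W x) = S3 + S3' + S4"
    unfolding S3_def S3'_def S4_def sum.distrib[symmetric] sum_subtractf[symmetric]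
    by (intro sum.cong refl) (simp add: pq algebra_simps)
  have "ergodic_op a ah b V W' x - ergodic_op a ah b V W x = (1/2) * (S1 + S2) + (1/2) * (S3 + S3' + S4) + b x \<bullet> q"
    unfolding ergodic_op_def o1[symmetric] o2[symmetric] bq[symmetric] by (simp add: algebra_simps)
  moreover have "gen_op a (\<lambda>y. btilde a b y + ah y *v grad W y) (\<lambda>y. W' y - W y) x = b x \<bullet> q + (1/2) * S1' + S3' + (1/2) * S2'"
  proof -
    have "(\<Sum>i\<in>UNIV. (btilde a b x + ah x *v grad W x) $ i * q $ i) = b x \<bullet> q + (1/2) * S1' + S3'"
    proof -
      have "b x \<bullet> q + (1/2) * S1' + S3' = (\<Sum>i\<in>UNIV. b x $ i * q $ i + (1/2) * (\<Sum>j\<in>UNIV. pd j (\<lambda>y. a y $ i $ j) x * q $ i) + (\<Sum>j\<in>UNIV. ah x $ i $ j * (q $ i * p $ j)))"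
        unfolding S1'_def S3'_def inner_vec_def inner_real_def by (simp only: sum.distrib sum_distrib_left)
      also have "\<dots> = (\<Sum>i\<in>UNIV. (btilde a b x + ah x *v grad W x) $ i * q $ i)"
        unfolding p_def[symmetric]
        by (intro sum.cong refl) (simp add: btilde_def matrix_vector_mult_def algebra_simps sum_distrib_right sum_distrib_left)
      finally show ?thesis by simp
    qed
    then show ?thesis unfolding gen_op_def S2'_def by (simp add: pq pd2_diff[OF W' W])
  qed
  moreover have "q \<bullet> (ah x *v q) = S4"
    unfolding S4_def inner_vec_def matrix_vector_mult_def by (simp add: sum_distrib_left mult_ac)
  ultimately show ?thesis unfolding q_def[symmetric] using s1 s2 s3 by (simp add: add_divide_distrib)
qed

text \<open>The term with \<open>\<psi>2\<close> is the Ito correction; for an exponential it is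
  again a multiple of the function itself.\<close>

lemma gen_op_compose:
  fixes q :: "real^'n::finite \<Rightarrow> real"
  assumes q: "Ck 2 q" and d: "\<And>s. (\<psi> has_real_derivative \<psi>1 s) (at s)" "\<And>s. (\<psi>1 has_real_derivative \<psi>2 s) (at s)" "continuous_on UNIV \<psi>2"
  shows "gen_op a \<beta> (\<lambda>y. \<psi> (q y)) x = \<psi>1 (q x) * gen_op a \<beta> q x + (1/2) * \<psi>2 (q x) * (grad q x \<bullet> (a x *v grad q x))"
proof -
  have "(\<Sum>i\<in>UNIV. \<Sum>j\<in>UNIV. a x $ i $ j * (\<psi>2 (q x) * pd j q x * pd i q x + \<psi>1 (q x) * pd j (pd i q) x))
    = \<psi>2 (q x) * (grad q x \<bullet> (a x *v grad q x)) + \<psi>1 (q x) * (\<Sum>i\<in>UNIV. \<Sum>j\<in>UNIV. a x $ i $ j * pd j (pd i q) x)"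
    unfolding grad_def inner_vec_def matrix_vector_mult_def
    by (simp add: sum_distrib_left sum.distrib[symmetric] algebra_simps)
  moreover have "(\<Sum>i\<in>UNIV. \<beta> x $ i * (\<psi>1 (q x) * pd i q x)) = \<psi>1 (q x) * (\<Sum>i\<in>UNIV. \<beta> x $ i * pd i q x)"
    by (simp add: sum_distrib_left mult_ac)
  ultimately show ?thesis
    unfolding gen_op_def pd_compose[OF q d] pd2_compose[OF q d] by (simp add: algebra_simps)
qed

theorem lyapunov_function:
  fixes a ah :: "real^'n::finite \<Rightarrow> real^'n^'n"
  assumes sym: "\<And>y. transpose (a y) = a y" "\<And>y. transpose (ah y) = ah y"
    and sa: "\<And>i j. smooth (\<lambda>y. a y $ i $ j)"
    and \<nu>: "0 < \<nu>2" "\<And>y \<xi>. \<xi> \<bullet> (a y *v \<xi>) \<le> \<nu>2 * (norm \<xi>)\<^sup>2"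
    and \<mu>: "0 < \<mu>1" "\<And>y \<xi>. \<mu>1 * (norm \<xi>)\<^sup>2 \<le> \<xi> \<bullet> (ah y *v \<xi>)"
    and W': "ergodic_solution a ah b V W' \<Lambda>'" and W: "ergodic_solution a ah b V W \<Lambda>" and less: "\<Lambda>' < \<Lambda>"
  obtains u \<kappa> where "Ck 2 u" "\<And>x. 0 < u x" "0 < \<kappa>" "\<And>x. gen_op a (\<lambda>y. btilde a b y + ah y *v grad W y) u x \<le> - \<kappa> * u x"
proof -
  let ?L = "gen_op a (\<lambda>y. btilde a b y + ah y *v grad W y)"
  \<comment> \<open>For the exponential of \<open>c \<phi>\<close> the generator gives
    \<open>c u\<close> times \<open>L \<phi> + (c/2) a(q, q)\<close>, with \<open>q\<close> the
    gradient of \<phi>. Passing from this quadratic term to \<open>(1/2) ah(q, q)\<close> is safe as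
    soon as \<open>c * \<nu>2 \<le> \<mu>1\<close>; equality is chosen.\<close>
  define c where "c = \<mu>1 / \<nu>2"
  have c: "0 < c" "c * \<nu>2 = \<mu>1" using \<nu> \<mu> by (auto simp: c_def)
  have C: "Ck 2 W'" "Ck 2 W" using W' W by (auto simp: ergodic_solution_def smooth_def)
  define \<phi> where "\<phi> y = W' y - W y" for y
  have C\<phi>: "Ck 2 \<phi>" unfolding \<phi>_def by (rule Ck2_diff[OF C])
  have d: "((\<lambda>s. exp (c * s)) has_real_derivative c * exp (c * s)) (at s)" "((\<lambda>s. c * exp (c * s)) has_real_derivative c * (c * exp (c * s))) (at s)" for s
    by (auto intro!: derivative_eq_intros)
  have cont: "continuous_on UNIV (\<lambda>s. c * (c * exp (c * s)))" by (intro continuous_intros)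
  show ?thesis
  proof (rule that[of "\<lambda>y. exp (c * \<phi> y)" "c * (\<Lambda> - \<Lambda>')"])
    show "Ck 2 (\<lambda>y. exp (c * \<phi> y))" by (rule Ck2_compose[OF C\<phi> d cont])
    show "0 < c * (\<Lambda> - \<Lambda>')" using c less by simp
    fix x
    let ?q = "grad \<phi> x"
    have "?L \<phi> x + (1/2) * (?q \<bullet> (ah x *v ?q)) = \<Lambda>' - \<Lambda>"
      using ergodic_op_difference[where a=a and ah=ah and b=b and V=V and x=x, OF sym sa C] W' W by (simp add: ergodic_solution_def \<phi>_def[abs_def])
    moreover have "c * (?q \<bullet> (a x *v ?q)) \<le> ?q \<bullet> (ah x *v ?q)"
    proof -
      have "c * (?q \<bullet> (a x *v ?q)) \<le> c * (\<nu>2 * (norm ?q)\<^sup>2)" using c \<nu>(2) by (intro mult_left_mono) auto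
      also have "\<dots> = \<mu>1 * (norm ?q)\<^sup>2" by (simp only: c(2)[symmetric] mult.assoc)
      also have "\<dots> \<le> ?q \<bullet> (ah x *v ?q)" by (rule \<mu>(2))
      finally show ?thesis .
    qed
    ultimately have "?L \<phi> x + (1/2) * (c * (?q \<bullet> (a x *v ?q))) \<le> - (\<Lambda> - \<Lambda>')" by linarith
    then have "c * exp (c * \<phi> x) * (?L \<phi> x + (1/2) * (c * (?q \<bullet> (a x *v ?q)))) \<le> c * exp (c * \<phi> x) * (- (\<Lambda> - \<Lambda>'))"
      using c by (intro mult_left_mono) auto
    then show "?L (\<lambda>y. exp (c * \<phi> y)) x \<le> - (c * (\<Lambda> - \<Lambda>')) * exp (c * \<phi> x)"
      unfolding gen_op_compose[OF C\<phi> d cont] by (simp add: algebra_simps)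
  qed simp
qed

text \<open>The cube is the smallest integer power of the positive part with a continuous second
  derivative, so a function cut off in this way stays twice continuously differentiable.\<close>

lemma cube_pos_part_derivatives:
  shows "((\<lambda>s::real. (max 0 s) ^ 3) has_real_derivative 3 * (max 0 s)\<^sup>2) (at s)"
    and "((\<lambda>s::real. 3 * (max 0 s)\<^sup>2) has_real_derivative 6 * max 0 s) (at s)"
proof -
  \<comment> \<open>At 0 the difference quotient itself is dominated by a power of the positive
    part; away from 0 the function is locally a monomial or 0.\<close>
  have z: "((\<lambda>s::real. (max 0 s) ^ Suc (Suc n)) has_real_derivative 0) (at 0)" for n
  proof -
    have "((\<lambda>h::real. ((max 0 (0 + h)) ^ Suc (Suc n) - (max 0 0) ^ Suc (Suc n)) / h) \<longlongrightarrow> 0) (at 0)"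
    proof (rule Lim_null_comparison)
      show "\<forall>\<^sub>F h in at 0. norm (((max 0 (0 + h)) ^ Suc (Suc n) - (max 0 0) ^ Suc (Suc n)) / h) \<le> (max 0 h) ^ Suc n"
        by (intro always_eventually allI) (auto simp: max_def field_simps)
      have "((\<lambda>h::real. (max 0 h) ^ Suc n) \<longlongrightarrow> (max 0 0) ^ Suc n) (at 0)" by (intro tendsto_intros)
      then show "((\<lambda>h::real. (max 0 h) ^ Suc n) \<longlongrightarrow> 0) (at 0)" by simp
    qed
    then show ?thesis by (simp add: DERIV_def)
  qed
  have gen: "((\<lambda>s::real. (max 0 s) ^ Suc (Suc n)) has_real_derivative (real (n + 2)) * (max 0 s) ^ Suc n) (at s)" for n s
  proof -
    consider "s = 0" | "0 < s" | "s < 0" by linarith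
    then show ?thesis
    proof cases
      case 1 then show ?thesis using z[of n] by simp
    next
      case 2
      have "((\<lambda>s::real. s ^ Suc (Suc n)) has_real_derivative (real (n + 2)) * (max 0 s) ^ Suc n) (at s)"
        using DERIV_pow[of "Suc (Suc n)" s] 2 by (simp add: max_def)
      then show ?thesis
        by (rule has_field_derivative_transform_within[where d=s]) (use 2 in \<open>auto simp: dist_real_def max_def\<close>)
    next
      case 3
      have "((\<lambda>s::real. 0) has_real_derivative (real (n + 2)) * (max 0 s) ^ Suc n) (at s)"
        using 3 by (auto simp: max_def)
      then show ?thesis
        by (rule has_field_derivative_transform_within[where d="-s"]) (use 3 in \<open>auto simp: dist_real_def max_def\<close>)
    qed
  qed
  show "((\<lambda>s::real. (max 0 s) ^ 3) has_real_derivative 3 * (max 0 s)\<^sup>2) (at s)"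
    using gen[of 1 s] by (simp add: numeral_3_eq_3 numeral_2_eq_2)
  show "((\<lambda>s::real. 3 * (max 0 s)\<^sup>2) has_real_derivative 6 * max 0 s) (at s)"
    using DERIV_cmult[OF gen[of 0 s], of 3] by (simp add: numeral_2_eq_2)
qed

lemma gen_op_continuous:
  fixes g :: "real^'n::finite \<Rightarrow> real"
  assumes "Ck 2 g" "\<And>i j. continuous_on UNIV (\<lambda>x. a x $ i $ j)" "\<And>i. continuous_on UNIV (\<lambda>x. \<beta> x $ i)"
  shows "continuous_on UNIV (gen_op a \<beta> g)"
  unfolding gen_op_def[abs_def]
  by (intro continuous_on_add continuous_on_sum continuous_on_mult continuous_on_const assms(2,3) Ck2D(4)[OF assms(1)] Ck2D(5)[OF assms(1)])

text \<open>The cubed positive part of 1 - |x|^2 / \<rho>^2. Radial monotonicity is recorded because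
  it makes superlevel sets of \<open>f\<close> balls. Derivatives up to order two vanish outside the
  ball, hence so does the generator.\<close>

lemma bump_function:
  fixes a :: "real^'n::finite \<Rightarrow> real^'n^'n"
  assumes \<rho>: "0 < \<rho>" and cont: "\<And>i j. continuous_on UNIV (\<lambda>x. a x $ i $ j)" "\<And>i. continuous_on UNIV (\<lambda>x. \<beta> x $ i)"
  obtains f c where "Ck 2 f" "\<And>x. 0 \<le> f x" "\<And>x. f x \<le> 1" "\<And>x. f x > 0 \<longleftrightarrow> norm x < \<rho>" "\<And>x y. norm x \<le> norm y \<Longrightarrow> f y \<le> f x"
    "0 \<le> c" "\<And>x. norm x \<le> \<rho> \<Longrightarrow> \<bar>gen_op a \<beta> f x\<bar> \<le> c" "\<And>x. \<rho> < norm x \<Longrightarrow> gen_op a \<beta> f x = 0"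
proof -
  define q where "q x = 1 - (x \<bullet> x) / \<rho>\<^sup>2" for x :: "real^'n"
  define \<psi> where "\<psi> s = (max 0 s) ^ 3" for s :: real
  define \<psi>1 where "\<psi>1 s = 3 * (max 0 s)\<^sup>2" for s :: real
  define \<psi>2 where "\<psi>2 s = 6 * max 0 s" for s :: real
  have d: "(\<psi> has_real_derivative \<psi>1 s) (at s)" "(\<psi>1 has_real_derivative \<psi>2 s) (at s)" for s
    using cube_pos_part_derivatives unfolding \<psi>_def[abs_def] \<psi>1_def[abs_def] \<psi>2_def by auto
  have c2: "continuous_on UNIV \<psi>2" unfolding \<psi>2_def[abs_def] by (intro continuous_intros)
  have Dq: "(q has_derivative (\<lambda>v. - (2 * (x \<bullet> v)) / \<rho>\<^sup>2)) (at x)" for x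
  proof -
    have "((\<lambda>x. 1 - (1 / \<rho>\<^sup>2) * (x \<bullet> x)) has_derivative (\<lambda>v. 0 - (1 / \<rho>\<^sup>2) * (x \<bullet> v + v \<bullet> x))) (at x)"
      by (intro has_derivative_diff has_derivative_const has_derivative_mult_right has_derivative_inner has_derivative_ident)
    then show ?thesis by (simp add: q_def[abs_def] inner_commute)
  qed
  have pq: "pd i q = (\<lambda>x. - (2 * x $ i) / \<rho>\<^sup>2)" for i
    using pd_has_derivative[OF Dq, of i] by (auto simp: inner_axis)
  have Dq2: "((\<lambda>x. - (2 * x $ i) / \<rho>\<^sup>2) has_derivative (\<lambda>v. - (2 * v $ i) / \<rho>\<^sup>2)) (at x)" for i and x :: "real^'n"
  proof -
    have "bounded_linear (\<lambda>v::real^'n. - (2 * v $ i) / \<rho>\<^sup>2)"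
      by (intro bounded_linear_divide[THEN bounded_linear_compose] bounded_linear_minus bounded_linear_const_mult bounded_linear_vec_nth)
    then show ?thesis by (rule bounded_linear_imp_has_derivative)
  qed
  have pq2: "pd j (pd i q) = (\<lambda>x. - (2 * (axis j 1 :: real^'n) $ i) / \<rho>\<^sup>2)" for i j
    unfolding pq using pd_has_derivative[OF Dq2, of j] by auto
  have q: "Ck 2 q"
  proof (rule Ck2I)
    show "q differentiable (at x)" for x using Dq by (auto simp: differentiable_def)
    show "pd i q differentiable (at x)" for i x unfolding pq using Dq2 by (auto simp: differentiable_def)
    show "continuous_on UNIV (pd j (pd i q))" for i j unfolding pq2 by (intro continuous_intros)
  qed
  define f where "f x = \<psi> (q x)" for x
  have f: "Ck 2 f" unfolding f_def by (rule Ck2_compose[OF q d c2])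
  have qle: "q x \<le> 1" for x using \<rho> by (simp add: q_def)
  have qn: "q x = 1 - (norm x / \<rho>)\<^sup>2" for x by (simp add: q_def power_divide power2_norm_eq_inner)
  have qpos: "0 < q x \<longleftrightarrow> norm x < \<rho>" for x
  proof -
    have "0 < q x \<longleftrightarrow> (norm x / \<rho>)\<^sup>2 < 1" by (simp add: qn)
    also have "\<dots> \<longleftrightarrow> norm x / \<rho> < 1" using \<rho> by (simp add: abs_square_less_1 del: power_divide)
    finally show ?thesis using \<rho> by simp
  qed
  obtain c where c: "\<And>x. x \<in> cball 0 \<rho> \<Longrightarrow> \<bar>gen_op a \<beta> f x\<bar> \<le> c"
  proof -
    have "compact (gen_op a \<beta> f ` cball 0 \<rho>)"
      by (intro compact_continuous_image continuous_on_subset[OF gen_op_continuous[OF f cont]]) auto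
    then have "bounded (gen_op a \<beta> f ` cball 0 \<rho>)" by (rule compact_imp_bounded)
    then show ?thesis using that unfolding bounded_iff by (metis image_eqI real_norm_def)
  qed
  show ?thesis
  proof (rule that[OF f])
    show "0 \<le> f x" for x by (simp add: f_def \<psi>_def)
    show "f x \<le> 1" for x unfolding f_def \<psi>_def using qle[of x] by (intro power_le_one) auto
    show "f x > 0 \<longleftrightarrow> norm x < \<rho>" for x unfolding qpos[symmetric] f_def \<psi>_def by (auto simp: max_def not_less)
    show "f y \<le> f x" if "norm x \<le> norm y" for x y
    proof -
      have "(norm x / \<rho>)\<^sup>2 \<le> (norm y / \<rho>)\<^sup>2" using that \<rho> by (intro power_mono divide_right_mono) auto
      then show ?thesis unfolding f_def \<psi>_def by (intro power_mono) (auto simp: qn max_def)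
    qed
    show "0 \<le> max 0 c" by simp
    show "\<bar>gen_op a \<beta> f x\<bar> \<le> max 0 c" if "norm x \<le> \<rho>" for x using c[of x] that by (simp add: le_max_iff_disj)
    show "gen_op a \<beta> f x = 0" if "\<rho> < norm x" for x
    proof -
      have "q x \<le> 0" using qpos[of x] that by (simp add: not_less[symmetric])
      then have "\<psi>1 (q x) = 0" "\<psi>2 (q x) = 0" by (auto simp: \<psi>1_def \<psi>2_def)
      then show ?thesis unfolding f_def gen_op_compose[OF q d c2] by simp
    qed
  qed
qed

section \<open>Upcrossings\<close>

text \<open>The state of Doob's betting strategy after seeing the values up to index
  \<open>k\<close>: a share is bought at a value of at most \<alpha> and sold at one of at least
  \<beta>. The state is decided before the increment from \<open>k\<close> to \<open>Suc k\<close>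
  that it is applied to.\<close>

fun holding :: "real \<Rightarrow> real \<Rightarrow> (nat \<Rightarrow> real) \<Rightarrow> nat \<Rightarrow> bool" where
  "holding \<alpha> \<beta> y 0 \<longleftrightarrow> y 0 \<le> \<alpha>"
| "holding \<alpha> \<beta> y (Suc k) \<longleftrightarrow> (if holding \<alpha> \<beta> y k then y (Suc k) < \<beta> else y (Suc k) \<le> \<alpha>)"

fun upcrossings :: "real \<Rightarrow> real \<Rightarrow> (nat \<Rightarrow> real) \<Rightarrow> nat \<Rightarrow> nat" where
  "upcrossings \<alpha> \<beta> y 0 = 0"
| "upcrossings \<alpha> \<beta> y (Suc k) = upcrossings \<alpha> \<beta> y k + (if holding \<alpha> \<beta> y k \<and> \<beta> \<le> y (Suc k) then 1 else 0)"

text \<open>Every completed upcrossing earns at least \<beta> - \<alpha>. A share still held at the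
  end was bought at no more than \<alpha>, so with nonnegative values it has lost at most
  \<alpha>.\<close>

lemma upcrossings_le_gain:
  assumes "0 \<le> \<alpha>" "\<alpha> < \<beta>" "\<And>k. 0 \<le> y k"
  shows "(\<beta> - \<alpha>) * real (upcrossings \<alpha> \<beta> y k) - \<alpha> \<le> (\<Sum>j<k. if holding \<alpha> \<beta> y j then y (Suc j) - y j else 0)"
proof -
  \<comment> \<open>The invariant for the induction: an open position is valued as if it had been
    bought at \<alpha>.\<close>
  have "(\<beta> - \<alpha>) * real (upcrossings \<alpha> \<beta> y k) + (if holding \<alpha> \<beta> y k then y k - \<alpha> else 0) \<le> (\<Sum>j<k. if holding \<alpha> \<beta> y j then y (Suc j) - y j else 0)"
  proof (induction k)
    case (Suc k)
    then show ?case using assms(2) by (auto simp: algebra_simps split: if_splits)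
  qed auto
  then show ?thesis using assms(1) assms(3)[of k] by (auto split: if_splits)
qed

lemma upcrossings_mono: "k \<le> l \<Longrightarrow> upcrossings \<alpha> \<beta> y k \<le> upcrossings \<alpha> \<beta> y l"
  by (induction l rule: dec_induct) auto

lemma holding_less: "\<alpha> < \<beta> \<Longrightarrow> holding \<alpha> \<beta> y k \<Longrightarrow> y k < \<beta>"
  by (cases k) (auto split: if_splits)

text \<open>At a value of at most \<alpha> the share is held, at one of at least \<beta> it cannot
  be; so a sale has been counted in between.\<close>

lemma upcrossings_step:
  assumes "\<alpha> < \<beta>" "k \<le> l" "y k \<le> \<alpha>" "\<beta> \<le> y l"
  shows "Suc (upcrossings \<alpha> \<beta> y k) \<le> upcrossings \<alpha> \<beta> y l"
proof -
  have h: "holding \<alpha> \<beta> y k" using assms(1,3) by (cases k) auto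
  have "holding \<alpha> \<beta> y l \<or> Suc (upcrossings \<alpha> \<beta> y k) \<le> upcrossings \<alpha> \<beta> y l"
    using assms(2)
  proof (induction l rule: dec_induct)
    case (step l)
    then show ?case by (auto simp: not_less upcrossings_mono le_SucI intro: le_trans[OF _ upcrossings_mono])
  qed (use h in simp)
  then show ?thesis using holding_less[OF assms(1), of y l] assms(4) by auto
qed

text \<open>Doob's inequality for \<open>f\<close> when \<open>U\<close> and \<open>f + U\<close>
  are supermartingales, in the sense of increments tested on past events. On the holding event the
  mean gain of \<open>f\<close> is at most the mean loss of \<open>U\<close> there; the mean loss of
  \<open>U\<close> on the complement is nonnegative and may be added. The losses telescope to at
  most the mean of \<open>U 0\<close>, whatever the number \<open>K\<close> of steps.\<close>

lemma (in prob_space) expected_upcrossings: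
  fixes f U :: "nat \<Rightarrow> 'a \<Rightarrow> real"
  assumes \<alpha>\<beta>: "0 \<le> \<alpha>" "\<alpha> < \<beta>"
    and sub: "\<And>k. subalgebra M (G k)" and mono: "\<And>j k. j \<le> k \<Longrightarrow> subalgebra (G k) (G j)"
    and f: "\<And>k. f k \<in> borel_measurable (G k)" "\<And>k. integrable M (f k)" "\<And>k \<omega>. 0 \<le> f k \<omega>"
    and U: "\<And>k. integrable M (U k)" "\<And>k \<omega>. 0 \<le> U k \<omega>"
    and dU: "\<And>k A. A \<in> sets (G k) \<Longrightarrow> (LINT \<omega>|M. indicator A \<omega> * (U (Suc k) \<omega> - U k \<omega>)) \<le> 0"
    and dfU: "\<And>k A. A \<in> sets (G k) \<Longrightarrow> (LINT \<omega>|M. indicator A \<omega> * (f (Suc k) \<omega> - f k \<omega> + (U (Suc k) \<omega> - U k \<omega>))) \<le> 0"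
  shows "(\<beta> - \<alpha>) * (LINT \<omega>|M. real (upcrossings \<alpha> \<beta> (\<lambda>k. f k \<omega>) K)) \<le> \<alpha> + (LINT \<omega>|M. U 0 \<omega>)"
    and "(\<lambda>\<omega>. real (upcrossings \<alpha> \<beta> (\<lambda>k. f k \<omega>) K)) \<in> borel_measurable M"
    and "integrable M (\<lambda>\<omega>. real (upcrossings \<alpha> \<beta> (\<lambda>k. f k \<omega>) K))"
proof -
  define A where "A k = {\<omega> \<in> space M. holding \<alpha> \<beta> (\<lambda>k. f k \<omega>) k}" for k
  have spG: "space (G k) = space M" for k using sub[of k] by (simp add: subalgebra_def)
  have A: "A k \<in> sets (G k)" for k
  proof (induction k)
    case 0
    have "A 0 = {\<omega> \<in> space (G 0). f 0 \<omega> \<le> \<alpha>}" by (simp add: A_def spG)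
    then show ?case using f(1)[of 0] by simp
  next
    case (Suc k)
    have "A k \<in> sets (G (Suc k))" using Suc mono[of k "Suc k"] by (auto simp: subalgebra_def)
    moreover have "{\<omega> \<in> space (G (Suc k)). f (Suc k) \<omega> < \<beta>} \<in> sets (G (Suc k))" "{\<omega> \<in> space (G (Suc k)). f (Suc k) \<omega> \<le> \<alpha>} \<in> sets (G (Suc k))"
      using f(1)[of "Suc k"] by measurable
    moreover have "A (Suc k) = (A k \<inter> {\<omega> \<in> space (G (Suc k)). f (Suc k) \<omega> < \<beta>}) \<union> ({\<omega> \<in> space (G (Suc k)). f (Suc k) \<omega> \<le> \<alpha>} - A k)"
      by (auto simp: A_def spG)
    ultimately show ?case by auto
  qed
  then have AM [measurable]: "A k \<in> sets M" for k using sub[of k] by (auto simp: subalgebra_def)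
  have [measurable]: "f k \<in> borel_measurable M" for k using f(2)[of k] by auto
  have cnt: "real (upcrossings \<alpha> \<beta> (\<lambda>k. f k \<omega>) k) = (\<Sum>j<k. indicator (A j \<inter> {\<omega> \<in> space M. \<beta> \<le> f (Suc j) \<omega>}) \<omega>)" if "\<omega> \<in> space M" for k \<omega>
    using that by (induction k) (auto simp: A_def indicator_def)
  show m: "(\<lambda>\<omega>. real (upcrossings \<alpha> \<beta> (\<lambda>k. f k \<omega>) K)) \<in> borel_measurable M"
    by (subst measurable_cong[OF cnt]) measurable
  have "real (upcrossings \<alpha> \<beta> y k) \<le> real k" for y k by (induction k) auto
  then show i: "integrable M (\<lambda>\<omega>. real (upcrossings \<alpha> \<beta> (\<lambda>k. f k \<omega>) K))"
    using m by (intro integrable_const_bound[where B="real K"]) auto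
  have ind: "integrable M (\<lambda>\<omega>. indicator S \<omega> * g \<omega>)" if "S \<in> sets M" "integrable M g" for S and g :: "'a \<Rightarrow> real"
    using integrable_mult_indicator[OF that] by simp
  let ?df = "\<lambda>k \<omega>. f (Suc k) \<omega> - f k \<omega>" and ?dU = "\<lambda>k \<omega>. U (Suc k) \<omega> - U k \<omega>"
  have idf: "integrable M (?df k)" "integrable M (?dU k)" for k using f(2) U(1) by auto
  have step: "(LINT \<omega>|M. indicator (A k) \<omega> * ?df k \<omega>) \<le> - (LINT \<omega>|M. ?dU k \<omega>)" for k
  proof -
    have "(LINT \<omega>|M. indicator (A k) \<omega> * ?df k \<omega>) + (LINT \<omega>|M. indicator (A k) \<omega> * ?dU k \<omega>) \<le> 0"
      using dfU[OF A[of k]] ind[OF AM idf(1), of k k] ind[OF AM idf(2), of k k] by (simp add: distrib_left del: Bochner_Integration.integral_diff)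
    moreover have "(LINT \<omega>|M. indicator (space M - A k) \<omega> * ?dU k \<omega>) \<le> 0"
    proof (rule dU)
      show "space M - A k \<in> sets (G k)" using A[of k] sets.compl_sets[of "A k" "G k"] by (simp add: spG)
    qed
    moreover have "(LINT \<omega>|M. ?dU k \<omega>) = (LINT \<omega>|M. indicator (A k) \<omega> * ?dU k \<omega> + indicator (space M - A k) \<omega> * ?dU k \<omega>)"
      by (intro Bochner_Integration.integral_cong refl) (auto simp: indicator_def)
    moreover have "\<dots> = (LINT \<omega>|M. indicator (A k) \<omega> * ?dU k \<omega>) + (LINT \<omega>|M. indicator (space M - A k) \<omega> * ?dU k \<omega>)"
      by (rule Bochner_Integration.integral_add) (auto intro!: ind idf)
    ultimately show ?thesis by linarith
  qed
  have "(LINT \<omega>|M. (\<beta> - \<alpha>) * real (upcrossings \<alpha> \<beta> (\<lambda>k. f k \<omega>) K) - \<alpha>) \<le> (LINT \<omega>|M. (\<Sum>k<K. indicator (A k) \<omega> * ?df k \<omega>))"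
  proof (rule integral_mono)
    fix \<omega> assume \<omega>: "\<omega> \<in> space M"
    have "(\<Sum>k<K. indicator (A k) \<omega> * ?df k \<omega>) = (\<Sum>j<K. if holding \<alpha> \<beta> (\<lambda>k. f k \<omega>) j then f (Suc j) \<omega> - f j \<omega> else 0)"
      by (intro sum.cong refl) (auto simp: A_def indicator_def \<omega>)
    show "(\<beta> - \<alpha>) * real (upcrossings \<alpha> \<beta> (\<lambda>k. f k \<omega>) K) - \<alpha> \<le> (\<Sum>k<K. indicator (A k) \<omega> * ?df k \<omega>)"
      unfolding \<open>(\<Sum>k<K. indicator (A k) \<omega> * ?df k \<omega>) = _\<close> by (rule upcrossings_le_gain[OF \<alpha>\<beta> f(3)])
  next
    show "integrable M (\<lambda>\<omega>. \<Sum>k<K. indicator (A k) \<omega> * ?df k \<omega>)"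
      by (intro Bochner_Integration.integrable_sum ind idf AM)
  qed (use i in simp)
  also have "\<dots> = (\<Sum>k<K. LINT \<omega>|M. indicator (A k) \<omega> * ?df k \<omega>)"
    by (intro Bochner_Integration.integral_sum ind idf AM)
  also have "\<dots> \<le> (\<Sum>k<K. - (LINT \<omega>|M. ?dU k \<omega>))" by (intro sum_mono step)
  also have "\<dots> = (LINT \<omega>|M. U 0 \<omega>) - (LINT \<omega>|M. U K \<omega>)"
    using U(1) by (induction K) auto
  also have "\<dots> \<le> (LINT \<omega>|M. U 0 \<omega>)" using U(2) by simp
  finally show "(\<beta> - \<alpha>) * (LINT \<omega>|M. real (upcrossings \<alpha> \<beta> (\<lambda>k. f k \<omega>) K)) \<le> \<alpha> + (LINT \<omega>|M. U 0 \<omega>)"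
    using i by (simp add: prob_space)
qed

text \<open>By Fatou the lower limit is integrable, hence finite almost surely. The conclusion
  denies eventual growth past every level because the later contradictions produce quantities that
  eventually exceed each \<open>N\<close>.\<close>

lemma (in prob_space) AE_finite_liminf_level:
  fixes V :: "nat \<Rightarrow> 'a \<Rightarrow> real"
  assumes V: "\<And>m. integrable M (V m)" "\<And>m \<omega>. 0 \<le> V m \<omega>" and c: "\<And>m. (LINT \<omega>|M. V m \<omega>) \<le> c"
  shows "AE \<omega> in M. \<exists>N::nat. \<not> (\<forall>\<^sub>F m in sequentially. real N \<le> V m \<omega>)"
proof -
  have "(\<integral>\<^sup>+\<omega>. liminf (\<lambda>m. ennreal (V m \<omega>)) \<partial>M) \<le> liminf (\<lambda>m. \<integral>\<^sup>+\<omega>. ennreal (V m \<omega>) \<partial>M)"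
    using V by (intro nn_integral_liminf) auto
  also have "\<dots> \<le> liminf (\<lambda>m. ennreal c)"
    using V c by (intro Liminf_mono always_eventually allI) (simp add: nn_integral_eq_integral ennreal_leI)
  also have "\<dots> = ennreal c" by (simp add: Liminf_const)
  finally have "(\<integral>\<^sup>+\<omega>. liminf (\<lambda>m. ennreal (V m \<omega>)) \<partial>M) < \<infinity>" using le_less_trans by fastforce
  moreover have "(\<lambda>\<omega>. liminf (\<lambda>m. ennreal (V m \<omega>))) \<in> borel_measurable M" using V(1) by measurable
  ultimately have "AE \<omega> in M. liminf (\<lambda>m. ennreal (V m \<omega>)) \<noteq> \<infinity>"
    by (intro nn_integral_PInf_AE) auto
  then show ?thesis
  proof eventually_elim
    case (elim \<omega>)
    then obtain N :: nat where N: "liminf (\<lambda>m. ennreal (V m \<omega>)) < ennreal (real N)"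
      by (metis ennreal_Ex_less_of_nat ennreal_of_nat_eq_real_of_nat infinity_ennreal_def top.not_eq_extremum)
    show ?case
    proof (intro exI notI)
      assume "\<forall>\<^sub>F m in sequentially. real N \<le> V m \<omega>"
      then have "ennreal (real N) \<le> liminf (\<lambda>m. ennreal (V m \<omega>))"
        by (intro Liminf_bounded) (auto elim!: eventually_mono intro: ennreal_leI)
      with N show False by simp
    qed
  qed
qed

lemma dyadic_dense:
  fixes a b :: real
  assumes "0 \<le> a" "a < b"
  obtains k m :: nat where "a < real k / 2 ^ m" "real k / 2 ^ m < b"
proof -
  obtain m :: nat where m: "1 / (b - a) < 2 ^ m" using real_arch_pow[of 2 "1 / (b - a)"] by auto
  define k where "k = nat (\<lfloor>a * 2 ^ m\<rfloor> + 1)"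
  have "0 \<le> a * 2 ^ m" using assms by simp
  then have k: "real k = of_int \<lfloor>a * 2 ^ m\<rfloor> + 1" by (simp add: k_def)
  have 1: "a * 2 ^ m < real k" unfolding k by linarith
  have "real k \<le> a * 2 ^ m + 1" unfolding k by linarith
  also have "\<dots> < a * 2 ^ m + (b - a) * 2 ^ m" using m assms by (simp add: field_simps)
  finally have 2: "real k < b * 2 ^ m" by (simp add: algebra_simps)
  show ?thesis by (rule that[of k m]) (use 1 2 in \<open>simp_all add: field_simps\<close>)
qed

text \<open>\<open>v m k\<close> approximates \<open>y\<close> at time \<open>k / 2^m\<close> and is
  exact on each initial piece for large \<open>m\<close>. Low and high values are open conditions,
  so by continuity they are also found at dyadic times. Finitely many of these lie on all fine
  grids, in the exact range, and before the horizon \<open>m\<close>, which is the time of index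
  \<open>m * 2^m\<close>.\<close>

lemma dyadic_upcrossings:
  fixes y :: "real \<Rightarrow> real" and v :: "nat \<Rightarrow> nat \<Rightarrow> real" and \<zeta> :: ereal
  assumes \<alpha>\<beta>: "\<alpha> < \<beta>" and \<zeta>: "0 < \<zeta>" and cont: "continuous_on {t. 0 \<le> t \<and> ereal t < \<zeta>} y"
    and osc: "\<And>T. 0 \<le> T \<Longrightarrow> ereal T < \<zeta> \<Longrightarrow> \<exists>r s. T < r \<and> r < s \<and> ereal s < \<zeta> \<and> y r < \<alpha> \<and> \<beta> < y s"
    and v: "\<And>t. 0 \<le> t \<Longrightarrow> ereal t < \<zeta> \<Longrightarrow> \<forall>\<^sub>F m in sequentially. \<forall>k. real k / 2 ^ m \<le> t \<longrightarrow> v m k = y (real k / 2 ^ m)"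
  shows "\<forall>\<^sub>F m in sequentially. N \<le> upcrossings \<alpha> \<beta> (v m) (m * 2 ^ m)"
proof -
  have near: "\<exists>k m. real k / 2 ^ m > T \<and> real k / 2 ^ m < b \<and> P (y (real k / 2 ^ m))"
    if P: "open (Collect P)" and t: "0 \<le> T" "T < t" "t < b" "ereal t < \<zeta>" "P (y t)" for P T t b
  proof -
    have "\<forall>\<^sub>F s in at t within {t. 0 \<le> t \<and> ereal t < \<zeta>}. y s \<in> Collect P"
      using cont t P unfolding continuous_on_def by (intro topological_tendstoD) auto
    then obtain d where d: "0 < d" "\<And>s. 0 \<le> s \<Longrightarrow> ereal s < \<zeta> \<Longrightarrow> s \<noteq> t \<Longrightarrow> dist s t < d \<Longrightarrow> P (y s)"
      unfolding eventually_at by auto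
    have "max T (t - d) < t" using t d by simp
    then obtain k m where km: "max T (t - d) < real k / 2 ^ m" "real k / 2 ^ m < t"
      using dyadic_dense[OF _ \<open>max T (t - d) < t\<close>] t by (metis max.coboundedI1)
    have "ereal (real k / 2 ^ m) < \<zeta>" using km t(4) by (meson ereal_less_eq(3) le_less_trans less_imp_le)
    then have "P (y (real k / 2 ^ m))" using d(2)[of "real k / 2 ^ m"] km by (auto simp: dist_real_def)
    then show ?thesis using km t by (intro exI[of _ k] exI[of _ m]) auto
  qed
  have refine: "real k / 2 ^ m = real (k * 2 ^ (m' - m)) / 2 ^ m'" if "m \<le> m'" for k m m' :: nat
  proof -
    have "(2::real) ^ m' = 2 ^ m * 2 ^ (m' - m)" using that by (simp add: power_add[symmetric])
    then show ?thesis by simp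
  qed
  \<comment> \<open>A stronger claim for the induction on \<open>N\<close>: one dyadic time before
    the lifetime, the same for all fine grids, by which \<open>N\<close> upcrossings have been
    counted.\<close>
  have "\<exists>k0 m0. ereal (real k0 / 2 ^ m0) < \<zeta> \<and> (\<forall>\<^sub>F m in sequentially. \<forall>k. real k / 2 ^ m = real k0 / 2 ^ m0 \<longrightarrow> N \<le> upcrossings \<alpha> \<beta> (v m) k)"
  proof (induction N)
    case 0
    show ?case using \<zeta> by (intro exI[of _ 0] exI[of _ 0]) (auto simp: zero_ereal_def)
  next
    case (Suc N)
    then obtain k0 m0 where q: "ereal (real k0 / 2 ^ m0) < \<zeta>"
      and IH: "\<forall>\<^sub>F m in sequentially. \<forall>k. real k / 2 ^ m = real k0 / 2 ^ m0 \<longrightarrow> N \<le> upcrossings \<alpha> \<beta> (v m) k" by blast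
    obtain r s where rs: "real k0 / 2 ^ m0 < r" "r < s" "ereal s < \<zeta>" "y r < \<alpha>" "\<beta> < y s" using osc[OF _ q] by auto
    have r\<zeta>: "ereal r < \<zeta>" using rs by (meson ereal_less_eq(3) le_less_trans less_imp_le)
    obtain k1 m1 where 1: "real k0 / 2 ^ m0 < real k1 / 2 ^ m1" "real k1 / 2 ^ m1 < s" "y (real k1 / 2 ^ m1) < \<alpha>"
      using near[of "\<lambda>z. z < \<alpha>" "real k0 / 2 ^ m0" r s] rs r\<zeta> by (auto simp: lessThan_def[symmetric])
    obtain b where b: "s < b" "ereal b < \<zeta>" using rs(3) by (metis ereal_dense2 ereal_less(2) less_ereal.simps(1))
    obtain k2 m2 where 2: "real k1 / 2 ^ m1 < real k2 / 2 ^ m2" "real k2 / 2 ^ m2 < b" "\<beta> < y (real k2 / 2 ^ m2)"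
      using near[of "\<lambda>z. \<beta> < z" "real k1 / 2 ^ m1" s b] rs 1 b by (auto simp: greaterThan_def[symmetric])
    have q2: "ereal (real k2 / 2 ^ m2) < \<zeta>" using 2(2) b(2) by (meson ereal_less_eq(3) le_less_trans less_imp_le)
    have "\<forall>\<^sub>F m in sequentially. \<forall>k. real k / 2 ^ m = real k2 / 2 ^ m2 \<longrightarrow> Suc N \<le> upcrossings \<alpha> \<beta> (v m) k"
      using IH v[OF _ q2, simplified] eventually_ge_at_top[of m0] eventually_ge_at_top[of m1]
    proof eventually_elim
      case (elim m)
      show ?case
      proof (intro allI impI)
        fix k assume k: "real k / 2 ^ m = real k2 / 2 ^ m2"
        define i where "i = k0 * 2 ^ (m - m0)"
        define j where "j = k1 * 2 ^ (m - m1)"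
        have ij: "real i / 2 ^ m = real k0 / 2 ^ m0" "real j / 2 ^ m = real k1 / 2 ^ m1"
          using refine[OF elim(3), of k0] refine[OF elim(4), of k1] by (auto simp: i_def j_def)
        have le: "i \<le> j" "j \<le> k"
        proof -
          have "real i / 2 ^ m \<le> real j / 2 ^ m" "real j / 2 ^ m \<le> real k / 2 ^ m" unfolding ij k using 1 2 by auto
          then show "i \<le> j" "j \<le> k" by (auto simp: divide_le_cancel)
        qed
        have vj: "v m j = y (real k1 / 2 ^ m1)" using elim(2)[rule_format, of j] 2(1) ij by simp
        have vk: "v m k = y (real k2 / 2 ^ m2)" using elim(2)[rule_format, of k] k by simp
        have "N \<le> upcrossings \<alpha> \<beta> (v m) i" using elim(1) ij by blast
        also have "\<dots> \<le> upcrossings \<alpha> \<beta> (v m) j" by (rule upcrossings_mono[OF le(1)])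
        finally have "Suc N \<le> Suc (upcrossings \<alpha> \<beta> (v m) j)" by simp
        also have "\<dots> \<le> upcrossings \<alpha> \<beta> (v m) k"
          using vj vk 1(3) 2(3) by (intro upcrossings_step[OF \<alpha>\<beta> le(2)]) auto
        finally show "Suc N \<le> upcrossings \<alpha> \<beta> (v m) k" .
      qed
    qed
    with q2 show ?case by blast
  qed
  then obtain k0 m0 where ev: "\<forall>\<^sub>F m in sequentially. \<forall>k. real k / 2 ^ m = real k0 / 2 ^ m0 \<longrightarrow> N \<le> upcrossings \<alpha> \<beta> (v m) k" by blast
  \<comment> \<open>The horizon \<open>m\<close> has to lie beyond the dyadic time just
    found.\<close>
  obtain m1 :: nat where m1: "real k0 / 2 ^ m0 \<le> real m1" using real_arch_simple by blast
  show ?thesis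
    using ev eventually_ge_at_top[of m0] eventually_ge_at_top[of m1]
  proof eventually_elim
    case (elim m)
    define i where "i = k0 * 2 ^ (m - m0)"
    have i: "real i / 2 ^ m = real k0 / 2 ^ m0" using refine[OF elim(2), of k0] by (simp add: i_def)
    have "N \<le> upcrossings \<alpha> \<beta> (v m) i" using elim(1) i by blast
    also have "\<dots> \<le> upcrossings \<alpha> \<beta> (v m) (m * 2 ^ m)"
    proof (rule upcrossings_mono)
      have "real i / 2 ^ m \<le> real m" unfolding i using m1 elim(3) by linarith
      then have "real i \<le> real (m * 2 ^ m)" by (simp add: field_simps)
      then show "i \<le> m * 2 ^ m" by (simp only: of_nat_le_iff)
    qed
    finally show ?case .
  qed
qed

section \<open>Transience of explosive diffusions\<close>

lemma continuous_on_components: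
  fixes f :: "'a::topological_space \<Rightarrow> 'b::topological_space^'n::finite"
  assumes "\<And>i. continuous_on S (\<lambda>x. f x $ i)"
  shows "continuous_on S f"
  using continuous_on_vec_lambda[of S "\<lambda>i x. f x $ i"] assms by simp

text \<open>The drift is an arbitrary continuous field here. The special form it has in the theorem
  enters through the Lyapunov function and through the final instance of this locale.\<close>

locale explosive_diffusion = bm_space M F B for M :: "'w measure" and F :: "real \<Rightarrow> 'w measure" and B :: "real \<Rightarrow> 'w \<Rightarrow> real^'n::finite" +
  fixes a \<sigma> :: "real^'n \<Rightarrow> real^'n^'n" and \<beta> :: "real^'n \<Rightarrow> real^'n" and x :: "real^'n"
    and X :: "real \<Rightarrow> 'w \<Rightarrow> real^'n" and \<zeta> :: "'w \<Rightarrow> ereal" and \<nu>1 \<nu>2 :: real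
  assumes sde: "sde_solution M F B \<beta> \<sigma> x X \<zeta>"
    and psd_sqrt: "\<And>y. is_psd_sqrt (a y) (\<sigma> y)"
    and elliptic: "0 < \<nu>1" "\<And>y \<xi>. \<nu>1 * (norm \<xi>)\<^sup>2 \<le> \<xi> \<bullet> (a y *v \<xi>)" "\<And>y \<xi>. \<xi> \<bullet> (a y *v \<xi>) \<le> \<nu>2 * (norm \<xi>)\<^sup>2"
    and a_cont: "\<And>i j. continuous_on UNIV (\<lambda>y. a y $ i $ j)"
    and \<beta>_cont: "\<And>i. continuous_on UNIV (\<lambda>y. \<beta> y $ i)"
begin

section \<open>Exit times and stopped paths\<close>

abbreviation S :: "nat \<Rightarrow> 'w \<Rightarrow> ereal" where "S \<equiv> exit_time X \<zeta>"

lemma life_SUP: "\<omega> \<in> space M \<Longrightarrow> \<zeta> \<omega> = (SUP n. S n \<omega>)"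
  and X_cont: "\<omega> \<in> space M \<Longrightarrow> continuous_on {t. 0 \<le> t \<and> ereal t < \<zeta> \<omega>} (\<lambda>t. X t \<omega>)"
  and X_start: "AE \<omega> in M. X 0 \<omega> = x"
  and X_adapted: "0 \<le> t \<Longrightarrow> E \<in> sets borel \<Longrightarrow> {\<omega> \<in> space M. ereal t < \<zeta> \<omega> \<and> X t \<omega> \<in> E} \<in> sets (F t)"
  using sde by (auto simp: sde_solution_def)

lemma S_nonneg: "0 \<le> S n \<omega>"
  unfolding exit_time_def by (rule Inf_greatest) auto

lemma S_less_life:
  assumes "S n \<omega> < \<infinity>" shows "S n \<omega> < \<zeta> \<omega>"
proof -
  have "{ereal t |t. 0 \<le> t \<and> ereal t < \<zeta> \<omega> \<and> real n \<le> norm (X t \<omega>)} \<noteq> {}"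
    using assms unfolding exit_time_def by (metis Inf_empty less_irrefl top_ereal_def)
  then obtain t where t: "0 \<le> t" "ereal t < \<zeta> \<omega>" "real n \<le> norm (X t \<omega>)" by auto
  have "S n \<omega> \<le> ereal t" unfolding exit_time_def using t by (intro Inf_lower) auto
  then show ?thesis using t by simp
qed

lemma S_le_life: "\<omega> \<in> space M \<Longrightarrow> S n \<omega> \<le> \<zeta> \<omega>"
  unfolding life_SUP by (rule SUP_upper) simp

lemma S_infinite: "\<omega> \<in> space M \<Longrightarrow> S n \<omega> = \<infinity> \<Longrightarrow> \<zeta> \<omega> = \<infinity>"
  using S_le_life[of \<omega> n] by simp

lemma le_S_less_life: "\<omega> \<in> space M \<Longrightarrow> ereal t \<le> S n \<omega> \<Longrightarrow> ereal t < \<zeta> \<omega>"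
  using S_less_life[of n \<omega>] S_infinite[of \<omega> n] by (cases "S n \<omega> = \<infinity>") (auto intro: le_less_trans)

lemma life_pos: "\<omega> \<in> space M \<Longrightarrow> 0 < \<zeta> \<omega>"
proof (rule ccontr)
  assume \<omega>: "\<omega> \<in> space M" and n: "\<not> 0 < \<zeta> \<omega>"
  have "S 0 \<omega> = \<infinity>"
  proof (rule ccontr)
    assume "S 0 \<omega> \<noteq> \<infinity>"
    then have "S 0 \<omega> < \<zeta> \<omega>" by (intro S_less_life) simp
    with S_nonneg[of 0 \<omega>] n show False by simp
  qed
  with S_infinite[OF \<omega>] n show False by simp
qed

lemma S_mono: "m \<le> n \<Longrightarrow> S m \<omega> \<le> S n \<omega>"
  unfolding exit_time_def by (rule Inf_superset_mono) (auto intro: order_trans)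

lemma before_exit:
  assumes "0 \<le> t" "ereal t < S n \<omega>" "\<omega> \<in> space M"
  shows "norm (X t \<omega>) < real n"
proof (rule ccontr)
  assume "\<not> norm (X t \<omega>) < real n"
  moreover have "ereal t < \<zeta> \<omega>" using le_S_less_life assms less_imp_le by blast
  ultimately have "S n \<omega> \<le> ereal t" unfolding exit_time_def using assms by (intro Inf_lower) auto
  with assms show False by simp
qed

text \<open>Before the exit the path is strictly inside; at the exit time the bound comes from the
  left limit. Time 0 has no left limit, hence the assumption on the start.\<close>

lemma until_exit:
  assumes t: "0 \<le> t" "ereal t \<le> S n \<omega>" and \<omega>: "\<omega> \<in> space M" and x: "X 0 \<omega> = x" "norm x \<le> real n"
  shows "norm (X t \<omega>) \<le> real n"
proof (cases "t = 0")
  case False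
  then have t0: "0 < t" using t by simp
  have t\<zeta>: "ereal t < \<zeta> \<omega>" using le_S_less_life[OF \<omega> t(2)] .
  have "continuous_on {0..t} (\<lambda>t. X t \<omega>)"
    by (rule continuous_on_subset[OF X_cont[OF \<omega>]]) (use t\<zeta> in \<open>auto intro: le_less_trans simp: ereal_less_eq(3)[symmetric] simp del: ereal_less_eq(3)\<close>)
  then have "((\<lambda>s. X s \<omega>) \<longlongrightarrow> X t \<omega>) (at_left t)" using t0 by (rule continuous_on_Icc_at_leftD)
  then have "((\<lambda>s. norm (X s \<omega>)) \<longlongrightarrow> norm (X t \<omega>)) (at_left t)" by (rule tendsto_norm)
  moreover have "\<forall>\<^sub>F s in at_left t. norm (X s \<omega>) \<le> real n"
    using eventually_at_left_real[OF t0]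
  proof eventually_elim
    case (elim s)
    then have "ereal s < S n \<omega>" using t(2) by (metis ereal_less(2) greaterThanLessThan_iff less_ereal.simps(1) less_le_trans)
    then show ?case using before_exit[of s n \<omega>] elim \<omega> by simp
  qed
  ultimately show ?thesis by (rule tendsto_upperbound) simp
qed (use x in simp)

text \<open>Exit times are extended reals, but their minimum with a real \<open>t \<ge> 0\<close> is
  real again. It lies strictly before the lifetime, so the value of \<open>X\<close> at this time is
  meaningful.\<close>

definition stop :: "nat \<Rightarrow> real \<Rightarrow> 'w \<Rightarrow> real" where
  "stop n t \<omega> = real_of_ereal (min (ereal t) (S n \<omega>))"

lemma
  assumes t: "0 \<le> t"
  shows stop_ereal: "ereal (stop n t \<omega>) = min (ereal t) (S n \<omega>)"
    and stop_nonneg: "0 \<le> stop n t \<omega>"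
    and stop_le: "stop n t \<omega> \<le> t"
    and stop_le_S: "ereal (stop n t \<omega>) \<le> S n \<omega>"
    and le_stop_iff: "r \<le> stop n t \<omega> \<longleftrightarrow> r \<le> t \<and> ereal r \<le> S n \<omega>"
proof -
  have "0 \<le> min (ereal t) (S n \<omega>)" "min (ereal t) (S n \<omega>) \<le> ereal t" using t S_nonneg[of n \<omega>] by auto
  then show e: "ereal (stop n t \<omega>) = min (ereal t) (S n \<omega>)"
    unfolding stop_def by (intro ereal_real') (cases "S n \<omega>"; auto simp: min_def split: if_splits)
  have "ereal 0 \<le> ereal (stop n t \<omega>)" unfolding e using t S_nonneg[of n \<omega>] by (simp add: zero_ereal_def)
  then show "0 \<le> stop n t \<omega>" by simp
  have "ereal (stop n t \<omega>) \<le> ereal t" unfolding e by simp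
  then show "stop n t \<omega> \<le> t" by simp
  show "ereal (stop n t \<omega>) \<le> S n \<omega>" unfolding e by simp
  have "ereal r \<le> ereal (stop n t \<omega>) \<longleftrightarrow> ereal r \<le> ereal t \<and> ereal r \<le> S n \<omega>" unfolding e by simp
  then show "r \<le> stop n t \<omega> \<longleftrightarrow> r \<le> t \<and> ereal r \<le> S n \<omega>" by simp
qed

lemma stop_eq: "0 \<le> t \<Longrightarrow> ereal t \<le> S n \<omega> \<Longrightarrow> stop n t \<omega> = t"
  using le_stop_iff[of t t n \<omega>] stop_le[of t n \<omega>] by simp

lemma stop_less_life: "0 \<le> t \<Longrightarrow> \<omega> \<in> space M \<Longrightarrow> ereal (stop n t \<omega>) < \<zeta> \<omega>"
  using stop_le_S le_S_less_life by blast

lemma stop_cont: "continuous_on UNIV (\<lambda>t. stop n (max 0 t) \<omega>)"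
proof (cases "S n \<omega>")
  case (real s)
  have "stop n u \<omega> = min u s" for u unfolding stop_def real by (simp add: min_def)
  then show ?thesis by (simp add: continuous_intros)
next
  case PInf
  have "stop n u \<omega> = u" for u unfolding stop_def PInf by simp
  then show ?thesis by (simp add: continuous_intros)
next
  case MInf
  then show ?thesis using S_nonneg[of n \<omega>] by simp
qed

text \<open>Paths with the wrong starting point form a null set and are replaced by the constant
  \<open>x\<close>; negative times are clamped to 0. Start, bound and continuity then hold for every
  \<omega> and on the whole line, as \<open>bounded_ito_process\<close> demands.\<close>

definition XS :: "nat \<Rightarrow> real \<Rightarrow> 'w \<Rightarrow> real^'n" where
  "XS n t \<omega> = (if X 0 \<omega> = x then X (stop n (max 0 t) \<omega>) \<omega> else x)"

lemma XS_eq: "0 \<le> t \<Longrightarrow> ereal t \<le> S n \<omega> \<Longrightarrow> X 0 \<omega> = x \<Longrightarrow> XS n t \<omega> = X t \<omega>"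
  by (simp add: XS_def stop_eq)

lemma XS_0: "XS n 0 \<omega> = x"
  using stop_nonneg[of 0 n \<omega>] stop_le[of 0 n \<omega>] by (simp add: XS_def)

lemma XS_bound: "\<omega> \<in> space M \<Longrightarrow> norm x \<le> real n \<Longrightarrow> norm (XS n t \<omega>) \<le> real n"
  using until_exit[of "stop n (max 0 t) \<omega>" n \<omega>] stop_nonneg[of "max 0 t" n \<omega>] stop_le_S[of "max 0 t" n \<omega>]
  by (auto simp: XS_def)

lemma XS_cont:
  assumes \<omega>: "\<omega> \<in> space M" shows "continuous_on UNIV (\<lambda>t. XS n t \<omega>)"
proof (cases "X 0 \<omega> = x")
  case True
  have "continuous_on UNIV (\<lambda>t. X (stop n (max 0 t) \<omega>) \<omega>)"
    by (rule continuous_on_compose2[OF X_cont[OF \<omega>] stop_cont]) (auto simp: stop_nonneg stop_less_life \<omega>)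
  then show ?thesis using True by (simp add: XS_def)
qed (simp add: XS_def)

section \<open>The stopped integrand, exit events and adaptedness\<close>

definition H :: "nat \<Rightarrow> real \<Rightarrow> 'w \<Rightarrow> real^'n^'n" where
  "H n s \<omega> = (if ereal s \<le> S n \<omega> then \<sigma> (X s \<omega>) else 0)"

definition Y :: "nat \<Rightarrow> real \<Rightarrow> 'w \<Rightarrow> real^'n" where
  "Y n t \<omega> = X (stop n t \<omega>) \<omega> - x - (LINT s:{0..stop n t \<omega>}|lborel. \<beta> (X s \<omega>))"

lemma HY: "0 \<le> t \<Longrightarrow> has_ito_integral M F B (H n) t (Y n t)"
  using sde unfolding sde_solution_def H_def[abs_def] Y_def[abs_def] stop_def Let_def by blast

lemma sigma_sq: "\<sigma> y ** \<sigma> y = a y" "transpose (\<sigma> y) = \<sigma> y"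
  using psd_sqrt[of y] by (auto simp: is_psd_sqrt_def)

lemma sigma_rows: "\<sigma> y $ i \<bullet> \<sigma> y $ j = a y $ i $ j"
proof -
  have "\<sigma> y $ k $ j = \<sigma> y $ j $ k" for k
    using arg_cong[OF sigma_sq(2)[of y], of "\<lambda>A. A $ k $ j"] by (simp add: transpose_def)
  then have "(\<sigma> y ** \<sigma> y) $ i $ j = \<sigma> y $ i \<bullet> \<sigma> y $ j"
    by (simp add: matrix_matrix_mult_def inner_vec_def)
  then show ?thesis by (simp add: sigma_sq)
qed

lemma a_diag: "a y $ i $ i = axis i 1 \<bullet> (a y *v axis i 1)"
  by (simp add: inner_axis matrix_vector_mult_basis column_def inner_commute[of "axis i 1"])

text \<open>The lower ellipticity bound makes the diagonal of \<open>a\<close> positive.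
  Consequently the integrand \<open>H n s\<close> is nonzero exactly while
  \<open>s \<le> S n\<close>, which is how exit events are recognised in
  \<open>exit_event\<close>.\<close>

lemma sigma_nonzero: "\<sigma> y \<noteq> 0"
proof
  assume "\<sigma> y = 0"
  then have "a y $ i $ i = 0" for i using sigma_rows[of y i i] by simp
  then show False using elliptic(1) elliptic(2)[of "axis undefined 1" y] by (simp add: a_diag[symmetric])
qed

lemma nu2_nonneg: "0 \<le> \<nu>2"
  using elliptic(1) elliptic(2)[of "axis undefined 1" undefined] elliptic(3)[of "axis undefined 1" undefined] by simp

lemma sigma_bound: "norm (\<sigma> y) \<le> real CARD('n) * \<nu>2 + 1"
proof -
  have "(norm (\<sigma> y))\<^sup>2 = (\<Sum>i\<in>UNIV. a y $ i $ i)"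
    by (simp add: power2_norm_eq_inner inner_vec_def[of "\<sigma> y"] sigma_rows)
  also have "\<dots> \<le> (\<Sum>i\<in>(UNIV::'n set). \<nu>2)"
    unfolding a_diag using elliptic(3)[of "axis _ 1" y] by (intro sum_mono) simp
  \<comment> \<open>Adding 1 before squaring makes the square dominate whether the trace bound is
    above or below 1, which keeps a square root out of the estimate.\<close>
  also have "\<dots> \<le> (real CARD('n) * \<nu>2 + 1)\<^sup>2"
    using nu2_nonneg by (simp add: power2_eq_square algebra_simps)
  finally show ?thesis
    by (rule power2_le_imp_le) (use nu2_nonneg in simp)
qed

text \<open>The filtration is not assumed complete or right continuous, so no general theorem on
  hitting times is invoked. The event is read off from the integrand of the equation, which is
  progressively measurable and vanishes only after the exit.\<close>

lemma exit_event:
  assumes s: "0 \<le> s" shows "{\<omega> \<in> space M. ereal s \<le> S n \<omega>} \<in> sets (F s)"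
proof -
  have "progressive_upto F s (H n)" using HY[OF s, of n] by (simp add: has_ito_integral_def)
  then have h: "(\<lambda>(r, \<omega>). H n r \<omega>) \<in> borel_measurable (restrict_space borel {0..s} \<Otimes>\<^sub>M F s)"
    using s by (auto simp: progressive_upto_def)
  have "(\<lambda>\<omega>. (s, \<omega>)) \<in> measurable (F s) (restrict_space borel {0..s} \<Otimes>\<^sub>M F s)"
    using s by (intro measurable_Pair1') (simp add: space_restrict_space)
  from measurable_compose[OF this h] have [measurable]: "H n s \<in> borel_measurable (F s)" by simp
  have "{\<omega> \<in> space M. ereal s \<le> S n \<omega>} = {\<omega> \<in> space (F s). H n s \<omega> \<in> - {0}}"
    using sigma_nonzero by (auto simp: H_def)
  also have "\<dots> \<in> sets (F s)" by measurable
  finally show ?thesis .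
qed

lemma S_measurable [measurable]: "S n \<in> borel_measurable M"
proof -
  have r: "{\<omega> \<in> space M. ereal c \<le> S n \<omega>} \<in> sets M" for c
  proof (cases "0 \<le> c")
    case True then show ?thesis using sets_F[OF exit_event[OF True]] by simp
  next
    case False
    then have "ereal c \<le> S n \<omega>" for \<omega> using S_nonneg[of n \<omega>] by (metis ereal_less_eq(5) linorder_le_cases order_trans)
    then show ?thesis by simp
  qed
  show ?thesis
    unfolding borel_measurable_iff_Ici_ereal
  proof
    fix c
    show "S n -` {c..} \<inter> space M \<in> sets M"
    proof (cases c)
      case (real c')
      have "S n -` {c..} \<inter> space M = {\<omega> \<in> space M. ereal c' \<le> S n \<omega>}" using real by auto
      then show ?thesis using r by simp
    next
      case PInf
      have "S n -` {c..} \<inter> space M = (\<Inter>k::nat. {\<omega> \<in> space M. ereal (real k) \<le> S n \<omega>})"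
      proof (intro equalityI subsetI)
        fix \<omega> assume "\<omega> \<in> (\<Inter>k::nat. {\<omega> \<in> space M. ereal (real k) \<le> S n \<omega>})"
        then have "\<omega> \<in> space M" "\<And>k. ereal (real k) \<le> S n \<omega>" by auto
        moreover have "S n \<omega> = \<infinity>"
          using \<open>\<And>k. ereal (real k) \<le> S n \<omega>\<close> by (intro ereal_top) (metis real_arch_simple ereal_less_eq(3) order_trans)
        ultimately show "\<omega> \<in> S n -` {c..} \<inter> space M" using PInf by simp
      qed (use PInf in auto)
      then show ?thesis using r by auto
    next
      case MInf
      then have "S n -` {c..} \<inter> space M = space M" by auto
      then show ?thesis by simp
    qed
  qed
qed

lemma stop_measurable:
  assumes t: "0 \<le> t" shows "stop n t \<in> borel_measurable (F t)"
  unfolding borel_measurable_iff_ge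
proof
  fix c
  show "{\<omega> \<in> space (F t). c \<le> stop n t \<omega>} \<in> sets (F t)"
  proof (cases "c \<le> 0")
    case True
    then have "c \<le> stop n t \<omega>" for \<omega> using stop_nonneg[OF t, of n \<omega>] by simp
    then have "{\<omega> \<in> space (F t). c \<le> stop n t \<omega>} = space (F t)" by auto
    then show ?thesis by (simp only: sets.top)
  next
    case False
    show ?thesis
    proof (cases "c \<le> t")
      case True
      have "{\<omega> \<in> space (F t). c \<le> stop n t \<omega>} = {\<omega> \<in> space M. ereal c \<le> S n \<omega>}"
        using le_stop_iff[OF t] True by auto
      then show ?thesis using sets_F_mono[OF True exit_event[of c n]] False by simp
    next
      case False
      then have "{\<omega> \<in> space (F t). c \<le> stop n t \<omega>} = {}" using le_stop_iff[OF t] by auto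
      then show ?thesis by (simp only: sets.empty_sets)
    qed
  qed
qed

text \<open>Adaptedness is given only on the event that the process is alive; sending dead paths to
  0 turns this into measurability of a random variable.\<close>

definition XK :: "real \<Rightarrow> 'w \<Rightarrow> real^'n" where
  "XK s \<omega> = (if ereal s < \<zeta> \<omega> then X s \<omega> else 0)"

lemma XK_measurable:
  assumes s: "0 \<le> s" shows "XK s \<in> borel_measurable (F s)"
proof (rule measurableI)
  fix E :: "(real^'n) set" assume E: "E \<in> sets borel"
  have "XK s -` E \<inter> space (F s) = {\<omega> \<in> space M. ereal s < \<zeta> \<omega> \<and> X s \<omega> \<in> E} \<union> (if 0 \<in> E then space (F s) - {\<omega> \<in> space M. ereal s < \<zeta> \<omega> \<and> X s \<omega> \<in> UNIV} else {})"
    by (auto simp: XK_def split: if_splits)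
  also have "\<dots> \<in> sets (F s)"
  proof -
    have "{\<omega> \<in> space M. ereal s < \<zeta> \<omega> \<and> X s \<omega> \<in> UNIV} \<in> sets (F s)" by (rule X_adapted[OF s]) simp
    from sets.compl_sets[OF this] show ?thesis using X_adapted[OF s E] by (simp add: sets.Un)
  qed
  finally show "XK s -` E \<inter> space (F s) \<in> sets (F s)" .
qed simp

lemma start_event: "{\<omega> \<in> space M. X 0 \<omega> = x} \<in> sets (F 0)"
proof -
  have "{\<omega> \<in> space M. X 0 \<omega> = x} = {\<omega> \<in> space M. ereal 0 < \<zeta> \<omega> \<and> X 0 \<omega> \<in> {x}}"
    using life_pos by (auto simp: zero_ereal_def[symmetric])
  then show ?thesis using X_adapted[of 0 "{x}"] by simp
qed

text \<open>The stopped time is rounded down to a grid. This keeps it below both \<open>t\<close>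
  and the lifetime, so only values of \<open>X\<close> known at time \<open>t\<close> are used; path
  continuity recovers the value at the stopped time itself.\<close>

lemma XS_adapted:
  assumes t: "0 \<le> t" shows "XS n t \<in> borel_measurable (F t)"
proof -
  have [measurable]: "stop n t \<in> borel_measurable (F t)" by (rule stop_measurable[OF t])
  have st [measurable]: "{\<omega> \<in> space (F t). X 0 \<omega> = x} \<in> sets (F t)" using sets_F_mono[OF t start_event] by simp
  have "(\<lambda>\<omega>. X (stop n t \<omega>) \<omega>) \<in> borel_measurable (F t)"
  proof (rule borel_measurable_LIMSEQ_metric)
    fix k :: nat
    \<comment> \<open>Clamping to \<open>{0..t}\<close> makes the value at every index measurable at
      time \<open>t\<close>, including indices that the rounded stopped time never takes.\<close>
    let ?q = "\<lambda>i::int. max 0 (min (real_of_int i / real (Suc k)) t)"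
    show "(\<lambda>\<omega>. XK (?q \<lfloor>stop n t \<omega> * real (Suc k)\<rfloor>) \<omega>) \<in> borel_measurable (F t)"
    proof (rule measurable_compose_countable[where f="\<lambda>i \<omega>. XK (?q i) \<omega>" and g="\<lambda>\<omega>. \<lfloor>stop n t \<omega> * real (Suc k)\<rfloor>"])
      show "XK (?q i) \<in> borel_measurable (F t)" for i
        by (rule meas_F_mono[OF XK_measurable]) (use t in auto)
    qed measurable
  next
    fix \<omega> assume "\<omega> \<in> space (F t)"
    then have \<omega>: "\<omega> \<in> space M" by simp
    let ?u = "stop n t \<omega>"
    let ?q = "\<lambda>k. max 0 (min (real_of_int \<lfloor>?u * real (Suc k)\<rfloor> / real (Suc k)) t)"
    have u: "0 \<le> ?u" "?u \<le> t" "ereal ?u < \<zeta> \<omega>" using stop_nonneg[OF t] stop_le[OF t] stop_less_life[OF t \<omega>] by auto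
    have up: "real_of_int \<lfloor>?u * real (Suc k)\<rfloor> / real (Suc k) \<le> ?u" for k
    proof -
      have "real_of_int \<lfloor>?u * real (Suc k)\<rfloor> / real (Suc k) \<le> ?u * real (Suc k) / real (Suc k)"
        by (intro divide_right_mono) auto
      then show ?thesis by (simp del: of_nat_Suc)
    qed
    have q: "0 \<le> ?q k" "?q k \<le> ?u" for k using up[of k] u by auto
    have qlow: "?u - 1 / real (Suc k) \<le> ?q k" for k
    proof -
      have "?u * real (Suc k) - 1 \<le> real_of_int \<lfloor>?u * real (Suc k)\<rfloor>" by linarith
      then have "(?u * real (Suc k) - 1) / real (Suc k) \<le> real_of_int \<lfloor>?u * real (Suc k)\<rfloor> / real (Suc k)"
        by (intro divide_right_mono) auto
      then have "?u - 1 / real (Suc k) \<le> real_of_int \<lfloor>?u * real (Suc k)\<rfloor> / real (Suc k)"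
        by (simp add: diff_divide_distrib del: of_nat_Suc)
      then show ?thesis using up[of k] u by (simp add: max_def min_def)
    qed
    have lim: "?q \<longlonglongrightarrow> ?u"
    proof (rule tendsto_sandwich)
      have "(\<lambda>k. ?u - 1 / real (Suc k)) \<longlonglongrightarrow> ?u - 0"
        by (intro tendsto_intros LIMSEQ_Suc lim_1_over_n)
      then show "(\<lambda>k. ?u - 1 / real (Suc k)) \<longlonglongrightarrow> ?u" by simp
      show "(\<lambda>_. ?u) \<longlonglongrightarrow> ?u" by simp
    qed (use q qlow in auto)
    have q\<zeta>: "ereal (?q k) < \<zeta> \<omega>" for k using q(2)[of k] u(3) by (meson ereal_less_eq(3) le_less_trans)
    have "(\<lambda>k. X (?q k) \<omega>) \<longlonglongrightarrow> X ?u \<omega>"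
      by (rule continuous_on_tendsto_compose[OF X_cont[OF \<omega>] lim]) (use u q(1) q\<zeta> in auto)
    then show "(\<lambda>k. XK (?q k) \<omega>) \<longlonglongrightarrow> X ?u \<omega>" using q\<zeta> by (simp add: XK_def)
  qed
  then have "(\<lambda>\<omega>. if X 0 \<omega> = x then X (stop n t \<omega>) \<omega> else x) \<in> borel_measurable (F t)"
    using st by (intro measurable_If) auto
  then show ?thesis using t by (simp add: XS_def[abs_def] max_def cong: if_cong)
qed

text \<open>The times at which the coefficients of the stopped process are switched on, the exit
  time included, as in the integrand \<open>H\<close>. Wrong starts are excluded because their path
  was replaced by a constant.\<close>

definition alive :: "nat \<Rightarrow> real \<Rightarrow> 'w \<Rightarrow> bool" where
  "alive n t \<omega> \<longleftrightarrow> 0 \<le> t \<and> ereal t \<le> S n \<omega> \<and> X 0 \<omega> = x"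

definition DS :: "nat \<Rightarrow> real \<Rightarrow> 'w \<Rightarrow> real^'n" where
  "DS n t \<omega> = (if alive n t \<omega> then \<beta> (XS n t \<omega>) else 0)"

definition AS :: "nat \<Rightarrow> real \<Rightarrow> 'w \<Rightarrow> real^'n^'n" where
  "AS n t \<omega> = (if alive n t \<omega> then a (XS n t \<omega>) else 0)"

lemma XS_meas_M: "XS n t \<in> borel_measurable M"
proof (cases "0 \<le> t")
  case True then show ?thesis using meas_F[OF XS_adapted] by blast
next
  case False
  then have "XS n t = XS n 0" by (simp add: XS_def[abs_def] max_def cong: if_cong)
  then show ?thesis using meas_F[OF XS_adapted[of 0]] by simp
qed

lemma XS_joint [measurable]: "(\<lambda>z. XS n (snd z) (fst z)) \<in> borel_measurable Q"
  by (rule joint_measurable_continuous[OF XS_meas_M XS_cont])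

lemma alive_joint [measurable]: "{z \<in> space Q. alive n (snd z) (fst z)} \<in> sets Q"
proof -
  have "{\<omega> \<in> space M. X 0 \<omega> = x} \<in> sets M" using sets_F[OF start_event] .
  then have "fst -` {\<omega> \<in> space M. X 0 \<omega> = x} \<inter> space Q \<in> sets Q" by (rule measurable_sets[OF measurable_fst])
  moreover have "{z \<in> space Q. 0 \<le> snd z \<and> ereal (snd z) \<le> S n (fst z)} \<in> sets Q" by measurable
  moreover have "{z \<in> space Q. alive n (snd z) (fst z)} = {z \<in> space Q. 0 \<le> snd z \<and> ereal (snd z) \<le> S n (fst z)} \<inter> (fst -` {\<omega> \<in> space M. X 0 \<omega> = x} \<inter> space Q)"
    by (auto simp: alive_def space_pair_measure)
  ultimately show ?thesis by simp
qed

lemma \<beta>_cont': "continuous_on UNIV \<beta>"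
  by (rule continuous_on_components[OF \<beta>_cont])

lemma a_cont': "continuous_on UNIV a"
proof (rule continuous_on_components)
  show "continuous_on UNIV (\<lambda>y. a y $ i)" for i by (rule continuous_on_components[OF a_cont])
qed

lemma \<beta>_meas [measurable]: "\<beta> \<in> borel_measurable borel"
  by (rule borel_measurable_continuous_onI[OF \<beta>_cont'])

lemma a_meas [measurable]: "(\<lambda>y. a y $ i $ j) \<in> borel_measurable borel"
  by (rule borel_measurable_continuous_onI[OF a_cont])

lemma DS_joint: "(\<lambda>z. DS n (snd z) (fst z)) \<in> borel_measurable Q"
  unfolding DS_def using alive_joint by (intro measurable_If measurable_compose[OF XS_joint \<beta>_meas]) auto

lemma AS_joint: "(\<lambda>z. AS n (snd z) (fst z) $ i $ j) \<in> borel_measurable Q"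
proof -
  have "(\<lambda>z. if alive n (snd z) (fst z) then a (XS n (snd z) (fst z)) $ i $ j else 0) \<in> borel_measurable Q"
    using alive_joint by (intro measurable_If measurable_compose[OF XS_joint a_meas]) auto
  also have "(\<lambda>z. if alive n (snd z) (fst z) then a (XS n (snd z) (fst z)) $ i $ j else 0) = (\<lambda>z. AS n (snd z) (fst z) $ i $ j)"
    by (auto simp: AS_def)
  finally show ?thesis .
qed

lemma coefficients_bounded:
  assumes n: "norm x \<le> real n"
  obtains C where "\<And>\<omega> t. \<omega> \<in> space M \<Longrightarrow> norm (DS n t \<omega>) \<le> C" "\<And>\<omega> t i j. \<omega> \<in> space M \<Longrightarrow> \<bar>AS n t \<omega> $ i $ j\<bar> \<le> C"
proof -
  have "compact (\<beta> ` cball 0 (real n))" "compact (a ` cball 0 (real n))"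
    by (intro compact_continuous_image continuous_on_subset[OF \<beta>_cont'] continuous_on_subset[OF a_cont']; simp)+
  then have "bounded (\<beta> ` cball 0 (real n))" "bounded (a ` cball 0 (real n))" by (auto intro: compact_imp_bounded)
  then obtain c d where c: "\<And>v. v \<in> \<beta> ` cball 0 (real n) \<Longrightarrow> norm v \<le> c" and d: "\<And>A. A \<in> a ` cball 0 (real n) \<Longrightarrow> norm A \<le> d"
    unfolding bounded_iff by blast
  have z: "XS n t \<omega> \<in> cball 0 (real n)" if "\<omega> \<in> space M" for t \<omega> using XS_bound[OF that n] by simp
  show ?thesis
  proof (rule that[of "max 0 (max c d)"])
    fix \<omega> t assume \<omega>: "\<omega> \<in> space M"
    show "norm (DS n t \<omega>) \<le> max 0 (max c d)"
      using c[OF imageI[OF z[OF \<omega>, of t]]] by (auto simp: DS_def le_max_iff_disj)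
    fix i j
    have "\<bar>a (XS n t \<omega>) $ i $ j\<bar> \<le> norm (a (XS n t \<omega>))"
      by (rule order_trans[OF component_le_norm_cart Finite_Cartesian_Product.norm_nth_le])
    also have "\<dots> \<le> d" by (rule d[OF imageI[OF z[OF \<omega>, of t]]])
    finally show "\<bar>AS n t \<omega> $ i $ j\<bar> \<le> max 0 (max c d)"
      by (auto simp: AS_def le_max_iff_disj)
  qed
qed

lemma ito_H:
  assumes t: "0 \<le> t"
  shows "ito (\<lambda>s \<omega>. indicator {0..t} s *\<^sub>R (H n s \<omega> $ i)) (\<lambda>\<omega>. Y n t \<omega> $ i)"
proof (rule has_ito_integral_imp_ito[OF t HY[OF t]])
  show "0 \<le> real CARD('n) * \<nu>2 + 1" using nu2_nonneg by simp
  show "AE \<omega> in M. \<forall>s\<in>{0..t}. norm (H n s \<omega>) \<le> real CARD('n) * \<nu>2 + 1"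
    using sigma_bound nu2_nonneg by (auto simp: H_def)
qed

lemma Y_increment:
  assumes st: "0 \<le> s" "s \<le> t" and n: "norm x \<le> real n"
  shows "AE \<omega> in M. Y n t \<omega> $ i - Y n s \<omega> $ i = (XS n t \<omega> - XS n s \<omega>) $ i - time_integral s t (\<lambda>r. DS n r \<omega> $ i)"
  using X_start AE_space
proof eventually_elim
  case (elim \<omega>)
  obtain C where C: "\<And>t. norm (DS n t \<omega>) \<le> C" using coefficients_bounded[OF n] elim by metis
  have Dm: "(\<lambda>r. DS n r \<omega>) \<in> borel_measurable borel"
  proof -
    have "(\<lambda>r::real. (\<omega>, r)) \<in> measurable lborel Q" using elim by (intro measurable_Pair1')
    from measurable_compose[OF this DS_joint] show ?thesis by simp
  qed
  have int: "(LINT r:{0..stop n u \<omega>}|lborel. \<beta> (X r \<omega>)) $ i = (LINT r:{0..u}|lborel. DS n r \<omega> $ i)" if u: "0 \<le> u" for u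
  proof -
    \<comment> \<open>Integrating \<beta> up to the stopped time equals integrating the switched-off
      drift \<open>DS\<close> up to \<open>u\<close>, so the random upper limit disappears.\<close>
    have e: "indicator {0..stop n u \<omega>} r *\<^sub>R \<beta> (X r \<omega>) = indicator {0..u} r *\<^sub>R DS n r \<omega>" for r
    proof (cases "0 \<le> r")
      case True
      then show ?thesis using le_stop_iff[OF u, of r n \<omega>] elim XS_eq[of r n \<omega>] by (auto simp: indicator_def DS_def alive_def)
    qed auto
    have i: "integrable lborel (\<lambda>r. indicator {0..u} r *\<^sub>R DS n r \<omega>)"
      by (rule integrableI_bounded_set_indicator[where B=C]) (use C Dm u in auto)
    have "(LINT r:{0..stop n u \<omega>}|lborel. \<beta> (X r \<omega>)) $ i = (LINT r|lborel. indicator {0..u} r *\<^sub>R DS n r \<omega>) $ i"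
      unfolding set_lebesgue_integral_def e ..
    also have "\<dots> = (LINT r|lborel. (indicator {0..u} r *\<^sub>R DS n r \<omega>) $ i)"
      by (rule integral_bounded_linear[OF bounded_linear_vec_nth i, symmetric])
    finally show ?thesis by (simp add: set_lebesgue_integral_def)
  qed
  have si: "set_integrable lborel {0..s} (\<lambda>r. DS n r \<omega> $ i)" "set_integrable lborel {s<..t} (\<lambda>r. DS n r \<omega> $ i)"
    unfolding set_integrable_def
    by (rule integrableI_bounded_set_indicator[where B=C]; use C Dm st component_le_norm_cart order_trans in \<open>auto; blast\<close>)+
  have "{0..t} = {0..s} \<union> {s<..t}" using st by auto
  then have "(LINT r:{0..t}|lborel. DS n r \<omega> $ i) = (LINT r:{0..s}|lborel. DS n r \<omega> $ i) + time_integral s t (\<lambda>r. DS n r \<omega> $ i)"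
  proof -
    have "{0..s} \<inter> {s<..t} = {}" by auto
    from set_integral_Un[OF this si] show ?thesis by (simp only: \<open>{0..t} = {0..s} \<union> {s<..t}\<close>)
  qed
  moreover have "XS n t \<omega> = X (stop n t \<omega>) \<omega>" "XS n s \<omega> = X (stop n s \<omega>) \<omega>"
    using elim st by (auto simp: XS_def max_absorb2)
  ultimately show ?case using int[of t] int[of s] st by (simp add: Y_def)
qed

text \<open>As a difference of the integrals up to \<open>t\<close> and up to \<open>s\<close>, its
  integrand vanishes up to time \<open>s\<close>, the condition under which \<open>ito_mult\<close>
  admits weights known at \<open>s\<close>.\<close>

lemma ito_increment:
  assumes st: "0 \<le> s" "s \<le> t" and n: "norm x \<le> real n"
  shows "ito (\<lambda>r \<omega>. indicator {s<..t} r *\<^sub>R (H n r \<omega> $ i)) (\<lambda>\<omega>. (XS n t \<omega> - XS n s \<omega>) $ i - time_integral s t (\<lambda>r. DS n r \<omega> $ i))"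
proof -
  have "ito (\<lambda>r \<omega>. indicator {0..t} r *\<^sub>R (H n r \<omega> $ i) - indicator {0..s} r *\<^sub>R (H n r \<omega> $ i)) (\<lambda>\<omega>. Y n t \<omega> $ i - Y n s \<omega> $ i)"
    using st by (intro ito_diff ito_H) auto
  also have "(\<lambda>r \<omega>. indicator {0..t} r *\<^sub>R (H n r \<omega> $ i) - indicator {0..s} r *\<^sub>R (H n r \<omega> $ i)) = (\<lambda>r \<omega>. indicator {s<..t} r *\<^sub>R (H n r \<omega> $ i))"
    using st by (auto simp: fun_eq_iff indicator_def)
  finally have I: "ito (\<lambda>r \<omega>. indicator {s<..t} r *\<^sub>R (H n r \<omega> $ i)) (\<lambda>\<omega>. Y n t \<omega> $ i - Y n s \<omega> $ i)" .
  show ?thesis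
  proof (rule ito_AE_cong[OF I Y_increment[OF st n]])
    have "(\<lambda>\<omega>. time_integral s t (\<lambda>r. DS n r \<omega> $ i)) \<in> borel_measurable M"
    proof -
      have [measurable]: "(\<lambda>z. DS n (snd z) (fst z)) \<in> borel_measurable Q" by (rule DS_joint)
      have "(\<lambda>\<omega>. LINT r|lborel. indicator {s<..t} r *\<^sub>R (DS n r \<omega> $ i)) \<in> borel_measurable M"
        by (rule lborel.borel_measurable_lebesgue_integral) (simp add: split_beta')
      then show ?thesis by (simp add: set_lebesgue_integral_def)
    qed
    then show "(\<lambda>\<omega>. (XS n t \<omega> - XS n s \<omega>) $ i - time_integral s t (\<lambda>r. DS n r \<omega> $ i)) \<in> borel_measurable M"
      using XS_meas_M by (intro borel_measurable_diff borel_measurable_vec_nth) auto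
  qed
qed

text \<open>The compensated increment in coordinate \<open>i\<close> is the Ito integral of row
  \<open>i\<close> of \<open>H\<close> over (s, t]. With a weight known at \<open>s\<close> it has
  mean zero, and the isometry for rows \<open>i\<close> and \<open>j\<close> produces inner products
  of rows of \<sigma>, that is, entries of \<open>a\<close>.\<close>

lemma XS_bounded_ito_process:
  assumes n: "norm x \<le> real n"
  obtains C where "bounded_ito_process M F (XS n) (DS n) (AS n) (real n) C"
proof -
  obtain C where C: "\<And>\<omega> t. \<omega> \<in> space M \<Longrightarrow> norm (DS n t \<omega>) \<le> C" "\<And>\<omega> t i j. \<omega> \<in> space M \<Longrightarrow> \<bar>AS n t \<omega> $ i $ j\<bar> \<le> C"
    using coefficients_bounded[OF n] by blast
  have "bounded_ito_process M F (XS n) (DS n) (AS n) (real n) C"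
  proof
    show "subalgebra M (F t)" for t by (rule subalg_F)
    show "subalgebra (F t) (F s)" if "s \<le> t" for s t using that by (auto simp: subalgebra_def sets_F_mono)
    show "XS n t \<in> borel_measurable (F t)" if "0 \<le> t" for t by (rule XS_adapted[OF that])
    show "XS n t = XS n 0" if "t < 0" for t using that by (simp add: XS_def[abs_def] max_def cong: if_cong)
    show "norm (XS n t \<omega>) \<le> real n" if "\<omega> \<in> space M" for \<omega> t by (rule XS_bound[OF that n])
    show "continuous_on UNIV (\<lambda>t. XS n t \<omega>)" if "\<omega> \<in> space M" for \<omega> by (rule XS_cont[OF that])
    show "(\<lambda>z. DS n (snd z) (fst z)) \<in> borel_measurable Q" by (rule DS_joint)
    show "norm (DS n t \<omega>) \<le> C" if "\<omega> \<in> space M" for \<omega> t by (rule C(1)[OF that])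
    show "(\<lambda>z. AS n (snd z) (fst z) $ i $ j) \<in> borel_measurable Q" for i j by (rule AS_joint)
    show "\<bar>AS n t \<omega> $ i $ j\<bar> \<le> C" if "\<omega> \<in> space M" for \<omega> t i j by (rule C(2)[OF that])
    fix s t :: real and \<xi> :: "'w \<Rightarrow> real" and K :: real and i assume st: "0 \<le> s" "s \<le> t" and \<xi>: "\<xi> \<in> borel_measurable (F s)" "\<And>\<omega>. \<omega> \<in> space M \<Longrightarrow> \<bar>\<xi> \<omega>\<bar> \<le> K"
    define N where "N i \<omega> = (XS n t \<omega> - XS n s \<omega>) $ i - time_integral s t (\<lambda>r. DS n r \<omega> $ i)" for i \<omega>
    define h where "h i r \<omega> = indicator {s<..t} r *\<^sub>R (H n r \<omega> $ i)" for i r \<omega>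
    have I: "ito (h i) (N i)" for i unfolding h_def N_def by (rule ito_increment[OF st n])
    have I\<xi>: "ito (\<lambda>r \<omega>. \<xi> \<omega> *\<^sub>R h i r \<omega>) (\<lambda>\<omega>. \<xi> \<omega> * N i \<omega>)" for i
      by (rule ito_mult[OF st(1) \<xi> I]) (simp_all add: h_def)
    show "(LINT \<omega>|M. \<xi> \<omega> * ((XS n t \<omega> - XS n s \<omega>) $ i - time_integral s t (\<lambda>r. DS n r \<omega> $ i))) = 0"
      using ito_mean[OF I\<xi>[of i]] by (simp only: N_def)
    fix j
    have [measurable]: "\<xi> \<in> borel_measurable M" by (rule meas_F[OF \<xi>(1)])
    have [measurable]: "(\<lambda>z. AS n (snd z) (fst z) $ i $ j) \<in> borel_measurable Q" for i j by (rule AS_joint)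
    have Tm: "(\<lambda>\<omega>. time_integral s t (\<lambda>r. AS n r \<omega> $ i $ j)) \<in> borel_measurable M"
    proof -
      have "(\<lambda>\<omega>. LINT r|lborel. indicator {s<..t} r *\<^sub>R (AS n r \<omega> $ i $ j)) \<in> borel_measurable M"
        by (rule lborel.borel_measurable_lebesgue_integral) (simp add: split_beta')
      then show ?thesis by (simp add: set_lebesgue_integral_def)
    qed
    have Tb: "\<bar>time_integral s t (\<lambda>r. AS n r \<omega> $ i $ j)\<bar> \<le> C * (t - s)" if \<omega>: "\<omega> \<in> space M" for \<omega>
    proof (rule time_integral_bound[OF _ C(2)[OF \<omega>] st(2) C(2)[OF \<omega>]])
      have "(\<lambda>r::real. (\<omega>, r)) \<in> measurable lborel Q" using \<omega> by (intro measurable_Pair1')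
      from measurable_compose[OF this AS_joint] show "(\<lambda>r. AS n r \<omega> $ i $ j) \<in> borel_measurable borel" by simp
    qed
    \<comment> \<open>The weight is attached to one factor only, so the isometry returns it to the
      first power.\<close>
    have "(LINT \<omega>|M. (\<xi> \<omega> * N i \<omega>) * N j \<omega>) = (LINT z|Q. (\<xi> (fst z) *\<^sub>R h i (snd z) (fst z)) \<bullet> h j (snd z) (fst z))"
      by (rule ito_isometry[OF I\<xi> I])
    also have "\<dots> = (LINT \<omega>|M. LINT r|lborel. (\<xi> \<omega> *\<^sub>R h i r \<omega>) \<bullet> h j r \<omega>)"
      by (subst MQ.integral_fst'[symmetric, OF l2_inner[OF ito_l2(2)[OF I\<xi>] ito_l2(2)[OF I]]]) simp
    also have "\<dots> = (LINT \<omega>|M. \<xi> \<omega> * time_integral s t (\<lambda>r. AS n r \<omega> $ i $ j))"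
    proof (rule integral_cong_AE)
      show "(\<lambda>\<omega>. LINT r|lborel. (\<xi> \<omega> *\<^sub>R h i r \<omega>) \<bullet> h j r \<omega>) \<in> borel_measurable M"
        using MQ.integrable_fst'[OF l2_inner[OF ito_l2(2)[OF I\<xi>[of i]] ito_l2(2)[OF I[of j]]]] by simp
      show "(\<lambda>\<omega>. \<xi> \<omega> * time_integral s t (\<lambda>r. AS n r \<omega> $ i $ j)) \<in> borel_measurable M" using Tm by simp
      show "AE \<omega> in M. (LINT r|lborel. (\<xi> \<omega> *\<^sub>R h i r \<omega>) \<bullet> h j r \<omega>) = \<xi> \<omega> * time_integral s t (\<lambda>r. AS n r \<omega> $ i $ j)"
        using X_start
      proof eventually_elim
        case (elim \<omega>)
        have "(\<xi> \<omega> *\<^sub>R h i r \<omega>) \<bullet> h j r \<omega> = \<xi> \<omega> * (indicator {s<..t} r *\<^sub>R AS n r \<omega> $ i $ j)" for r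
          using st elim XS_eq[of r n \<omega>] by (cases "r \<in> {s<..t}") (auto simp: h_def H_def AS_def alive_def sigma_rows)
        then show ?case by (simp only: set_lebesgue_integral_def integral_mult_right_zero)
      qed
    qed
    finally have e: "(LINT \<omega>|M. (\<xi> \<omega> * N i \<omega>) * N j \<omega>) = (LINT \<omega>|M. \<xi> \<omega> * time_integral s t (\<lambda>r. AS n r \<omega> $ i $ j))" .
    have i1: "integrable M (\<lambda>\<omega>. (\<xi> \<omega> * N i \<omega>) * N j \<omega>)"
      using l2_inner[OF ito_l2(1)[OF I\<xi>[of i]] ito_l2(1)[OF I[of j]]] by simp
    have i2: "integrable M (\<lambda>\<omega>. \<xi> \<omega> * time_integral s t (\<lambda>r. AS n r \<omega> $ i $ j))"
    proof (rule integrable_const_bound[where B="K * (C * (t - s))"])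
      show "AE \<omega> in M. norm (\<xi> \<omega> * time_integral s t (\<lambda>r. AS n r \<omega> $ i $ j)) \<le> K * (C * (t - s))"
      proof (intro AE_I2)
        fix \<omega> assume "\<omega> \<in> space M"
        from \<xi>(2)[OF this] Tb[OF this] show "norm (\<xi> \<omega> * time_integral s t (\<lambda>r. AS n r \<omega> $ i $ j)) \<le> K * (C * (t - s))"
          unfolding real_norm_def abs_mult by (intro mult_mono) auto
      qed
    qed (use Tm in simp)
    have "(LINT \<omega>|M. \<xi> \<omega> * (N i \<omega> * N j \<omega> - time_integral s t (\<lambda>r. AS n r \<omega> $ i $ j))) = (LINT \<omega>|M. (\<xi> \<omega> * N i \<omega>) * N j \<omega> - \<xi> \<omega> * time_integral s t (\<lambda>r. AS n r \<omega> $ i $ j))"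
      by (intro Bochner_Integration.integral_cong refl) (simp add: algebra_simps)
    also have "\<dots> = 0" using i1 i2 e by simp
    finally show "(LINT \<omega>|M. \<xi> \<omega> * (((XS n t \<omega> - XS n s \<omega>) $ i - time_integral s t (\<lambda>r. DS n r \<omega> $ i)) * ((XS n t \<omega> - XS n s \<omega>) $ j - time_integral s t (\<lambda>r. DS n r \<omega> $ j)) - time_integral s t (\<lambda>r. AS n r \<omega> $ i $ j))) = 0"
      by (simp only: N_def)
  qed
  then show ?thesis by (rule that)
qed

section \<open>Dynkin's formula and supermartingales for the stopped diffusion\<close>

definition GS :: "(real^'n \<Rightarrow> real) \<Rightarrow> nat \<Rightarrow> real \<Rightarrow> 'w \<Rightarrow> real" where
  "GS g n t \<omega> = (if alive n t \<omega> then gen_op a \<beta> g (XS n t \<omega>) else 0)"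

lemma dynkin_XS:
  assumes n: "norm x \<le> real n" and st: "0 \<le> s" "s \<le> t" and g: "Ck 2 g"
    and \<xi>: "\<xi> \<in> borel_measurable (F s)" "\<And>\<omega>. \<omega> \<in> space M \<Longrightarrow> \<bar>\<xi> \<omega>\<bar> \<le> L"
  shows "(LINT \<omega>|M. \<xi> \<omega> * (g (XS n t \<omega>) - g (XS n s \<omega>) - time_integral s t (\<lambda>r. GS g n r \<omega>))) = 0"
proof -
  obtain C where "bounded_ito_process M F (XS n) (DS n) (AS n) (real n) C" using XS_bounded_ito_process[OF n] by blast
  then interpret P: bounded_ito_process M F "XS n" "DS n" "AS n" "real n" C .
  have "P.generator (\<lambda>i. pd i g) (\<lambda>i j. pd j (pd i g)) r \<omega> = GS g n r \<omega>" for r \<omega>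
    by (simp add: P.generator_def GS_def gen_op_def DS_def AS_def)
  then show ?thesis using P.dynkin_Ck[OF st g \<xi>] by simp
qed

lemma XS_field_facts:
  assumes n: "norm x \<le> real n" and g: "continuous_on UNIV (g :: real^'n \<Rightarrow> real)"
  shows "integrable M (\<lambda>\<omega>. g (XS n t \<omega>))"
    and "s \<le> t \<Longrightarrow> integrable M (\<lambda>\<omega>. time_integral s t (\<lambda>r. if alive n r \<omega> then g (XS n r \<omega>) else 0))"
    and "\<omega> \<in> space M \<Longrightarrow> set_integrable lborel {s<..t} (\<lambda>r. if alive n r \<omega> then g (XS n r \<omega>) else 0)"
proof -
  obtain C where "bounded_ito_process M F (XS n) (DS n) (AS n) (real n) C" using XS_bounded_ito_process[OF n] by blast
  then interpret P: bounded_ito_process M F "XS n" "DS n" "AS n" "real n" C .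
  show "integrable M (\<lambda>\<omega>. g (XS n t \<omega>))" by (rule P.bounded_rv_integrable[OF P.bounded_rv_comp[OF g]])
  have b: "P.bounded_field (\<lambda>r \<omega>. if alive n r \<omega> then g (XS n r \<omega>) else 0)"
  proof -
    obtain K where K: "0 \<le> K" "\<And>\<omega> r. \<omega> \<in> space M \<Longrightarrow> \<bar>g (XS n r \<omega>)\<bar> \<le> K" using P.continuous_bounded_cball[OF g] by blast
    have "(\<lambda>z. if alive n (snd z) (fst z) then g (XS n (snd z) (fst z)) else 0) \<in> borel_measurable Q"
      using alive_joint by (intro measurable_If measurable_compose[OF XS_joint borel_measurable_continuous_onI[OF g]]) auto
    then show ?thesis unfolding P.bounded_field_def using K by (intro conjI exI[of _ K]) auto
  qed
  show "integrable M (\<lambda>\<omega>. time_integral s t (\<lambda>r. if alive n r \<omega> then g (XS n r \<omega>) else 0))" if "s \<le> t"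
    by (rule P.bounded_rv_integrable[OF P.bounded_rv_time_integral[OF b that]])
  show "set_integrable lborel {s<..t} (\<lambda>r. if alive n r \<omega> then g (XS n r \<omega>) else 0)" if "\<omega> \<in> space M"
    by (rule P.field_integrable[OF b that])
qed

text \<open>Dynkin's formula, weighted with the indicator of a past event, turns increments into
  time integrals of a nonpositive function. The two coefficients serve two uses:
  \<open>p = 0\<close> for a multiple of \<open>u\<close> alone, \<open>p = 1\<close> for the bump
  function compensated by \<open>u\<close>.\<close>

lemma supermartingale_XS:
  assumes n: "norm x \<le> real n" and st: "0 \<le> s" "s \<le> t" and f: "Ck 2 f" and g: "Ck 2 g"
    and neg: "\<And>y. p * gen_op a \<beta> f y + q * gen_op a \<beta> g y \<le> 0" and E: "E \<in> sets (F s)"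
  shows "(LINT \<omega>|M. indicator E \<omega> * (p * (f (XS n t \<omega>) - f (XS n s \<omega>)) + q * (g (XS n t \<omega>) - g (XS n s \<omega>)))) \<le> 0"
proof -
  have \<xi>: "indicator E \<in> borel_measurable (F s)" "\<And>\<omega>. \<omega> \<in> space M \<Longrightarrow> \<bar>indicator E \<omega> :: real\<bar> \<le> 1" using E by auto
  have EM: "E \<in> sets M" using sets_F[OF E] .
  have c: "continuous_on UNIV (gen_op a \<beta> h)" if "Ck 2 h" for h by (rule gen_op_continuous[OF that a_cont \<beta>_cont])
  have I: "integrable M (\<lambda>\<omega>. indicator E \<omega> * (h (XS n t \<omega>) - h (XS n s \<omega>)))"
    "integrable M (\<lambda>\<omega>. indicator E \<omega> * time_integral s t (\<lambda>r. GS h n r \<omega>))" if h: "Ck 2 h" for h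
  proof -
    have i: "integrable M (\<lambda>\<omega>. h (XS n t \<omega>) - h (XS n s \<omega>))"
      using XS_field_facts(1)[OF n Ck2D(3)[OF h]] by simp
    have j: "integrable M (\<lambda>\<omega>. time_integral s t (\<lambda>r. GS h n r \<omega>))"
      unfolding GS_def by (rule XS_field_facts(2)[OF n c[OF h] st(2)])
    show "integrable M (\<lambda>\<omega>. indicator E \<omega> * (h (XS n t \<omega>) - h (XS n s \<omega>)))"
      "integrable M (\<lambda>\<omega>. indicator E \<omega> * time_integral s t (\<lambda>r. GS h n r \<omega>))"
      using integrable_mult_indicator[OF EM i] integrable_mult_indicator[OF EM j] by simp_all
  qed
  have D: "(LINT \<omega>|M. indicator E \<omega> * (h (XS n t \<omega>) - h (XS n s \<omega>))) = (LINT \<omega>|M. indicator E \<omega> * time_integral s t (\<lambda>r. GS h n r \<omega>))" if h: "Ck 2 h" for h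
  proof -
    have "(LINT \<omega>|M. indicator E \<omega> * (h (XS n t \<omega>) - h (XS n s \<omega>) - time_integral s t (\<lambda>r. GS h n r \<omega>))) = 0"
      by (rule dynkin_XS[OF n st h \<xi>])
    also have "(LINT \<omega>|M. indicator E \<omega> * (h (XS n t \<omega>) - h (XS n s \<omega>) - time_integral s t (\<lambda>r. GS h n r \<omega>)))
      = (LINT \<omega>|M. indicator E \<omega> * (h (XS n t \<omega>) - h (XS n s \<omega>)) - indicator E \<omega> * time_integral s t (\<lambda>r. GS h n r \<omega>))"
      by (intro Bochner_Integration.integral_cong refl) (rule right_diff_distrib)
    also have "\<dots> = (LINT \<omega>|M. indicator E \<omega> * (h (XS n t \<omega>) - h (XS n s \<omega>))) - (LINT \<omega>|M. indicator E \<omega> * time_integral s t (\<lambda>r. GS h n r \<omega>))"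
      by (rule Bochner_Integration.integral_diff[OF I[OF h]])
    finally show ?thesis by simp
  qed
  have "(LINT \<omega>|M. indicator E \<omega> * (p * (f (XS n t \<omega>) - f (XS n s \<omega>)) + q * (g (XS n t \<omega>) - g (XS n s \<omega>))))
    = (LINT \<omega>|M. p * (indicator E \<omega> * (f (XS n t \<omega>) - f (XS n s \<omega>))) + q * (indicator E \<omega> * (g (XS n t \<omega>) - g (XS n s \<omega>))))"
    by (intro Bochner_Integration.integral_cong refl) (simp only: distrib_left mult.left_commute)
  also have "\<dots> = p * (LINT \<omega>|M. indicator E \<omega> * (f (XS n t \<omega>) - f (XS n s \<omega>))) + q * (LINT \<omega>|M. indicator E \<omega> * (g (XS n t \<omega>) - g (XS n s \<omega>)))"
    by (subst Bochner_Integration.integral_add) (use I[OF f] I[OF g] in \<open>auto intro!: integrable_mult_right\<close>)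
  also have "\<dots> = p * (LINT \<omega>|M. indicator E \<omega> * time_integral s t (\<lambda>r. GS f n r \<omega>)) + q * (LINT \<omega>|M. indicator E \<omega> * time_integral s t (\<lambda>r. GS g n r \<omega>))"
    by (simp only: D[OF f] D[OF g])
  also have "\<dots> = (LINT \<omega>|M. p * (indicator E \<omega> * time_integral s t (\<lambda>r. GS f n r \<omega>)) + q * (indicator E \<omega> * time_integral s t (\<lambda>r. GS g n r \<omega>)))"
    using I(2)[OF f] I(2)[OF g] by simp
  also have "\<dots> \<le> 0"
  proof -
    have pw: "p * (indicator E \<omega> * time_integral s t (\<lambda>r. GS f n r \<omega>)) + q * (indicator E \<omega> * time_integral s t (\<lambda>r. GS g n r \<omega>)) \<le> 0" if \<omega>: "\<omega> \<in> space M" for \<omega>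
    proof -
      have si: "set_integrable lborel {s<..t} (\<lambda>r. GS f n r \<omega>)" "set_integrable lborel {s<..t} (\<lambda>r. GS g n r \<omega>)"
        unfolding GS_def by (rule XS_field_facts(3)[OF n c[OF f] \<omega>], rule XS_field_facts(3)[OF n c[OF g] \<omega>])
      have "p * time_integral s t (\<lambda>r. GS f n r \<omega>) + q * time_integral s t (\<lambda>r. GS g n r \<omega>) = time_integral s t (\<lambda>r. p * GS f n r \<omega> + q * GS g n r \<omega>)"
        using si by (subst set_integral_add(2)) auto
      also have "\<dots> \<le> time_integral s t (\<lambda>r. 0)"
        using si neg time_integrable[of "\<lambda>_. 0" 0 s t] by (intro set_integral_mono set_integral_add set_integrable_mult_right) (auto simp: GS_def)
      finally have "p * time_integral s t (\<lambda>r. GS f n r \<omega>) + q * time_integral s t (\<lambda>r. GS g n r \<omega>) \<le> 0" by simp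
      then show ?thesis by (auto simp: indicator_def)
    qed
    have "0 \<le> (LINT \<omega>|M. - (p * (indicator E \<omega> * time_integral s t (\<lambda>r. GS f n r \<omega>)) + q * (indicator E \<omega> * time_integral s t (\<lambda>r. GS g n r \<omega>))))"
      by (intro integral_nonneg_AE AE_I2) (simp only: neg_0_le_iff_le pw)
    then show ?thesis by (simp only: Bochner_Integration.integral_minus)
  qed
  finally show ?thesis .
qed

text \<open>Dynkin's formula on \<open>[0, m]\<close> bounds the mean integral of
  \<open>- L u\<close>, and so that of \<open>\<kappa> * u\<close>, by \<open>u x\<close>, because
  the terminal value of \<open>u\<close> is positive. The bound is free of \<open>m\<close>, which
  is the horizon and, up to \<open>n0\<close>, the radius; \<open>n0\<close> keeps the start inside
  the ball.\<close>

lemma AE_finite_occupation: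
  assumes n0: "norm x \<le> real n0" and u: "Ck 2 u" "\<And>y. 0 < u y" and \<kappa>: "0 < \<kappa>" and Lu: "\<And>y. gen_op a \<beta> u y \<le> - \<kappa> * u y"
  shows "AE \<omega> in M. \<exists>N::nat. \<not> (\<forall>\<^sub>F m in sequentially. real N \<le> time_integral 0 (real m) (\<lambda>r. if alive (m + n0) r \<omega> then \<kappa> * u (XS (m + n0) r \<omega>) else 0))"
proof (rule AE_finite_liminf_level)
  have n: "norm x \<le> real (m + n0)" for m using n0 by simp
  have cu: "continuous_on UNIV (\<lambda>y. \<kappa> * u y)" by (intro continuous_intros Ck2D(3)[OF u(1)])
  have cL: "continuous_on UNIV (gen_op a \<beta> u)" by (rule gen_op_continuous[OF u(1) a_cont \<beta>_cont])
  let ?J = "\<lambda>m \<omega>. time_integral 0 (real m) (\<lambda>r. if alive (m + n0) r \<omega> then \<kappa> * u (XS (m + n0) r \<omega>) else 0)"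
  show iJ: "integrable M (?J m)" for m by (rule XS_field_facts(2)[OF n cu]) simp
  show "0 \<le> ?J m \<omega>" for m \<omega>
    unfolding set_lebesgue_integral_def using u(2) \<kappa> by (intro Bochner_Integration.integral_nonneg) (auto simp: less_imp_le)
  show "(LINT \<omega>|M. ?J m \<omega>) \<le> u x" for m
  proof -
    let ?G = "\<lambda>\<omega>. time_integral 0 (real m) (\<lambda>r. GS u (m + n0) r \<omega>)"
    have iG: "integrable M ?G" unfolding GS_def by (rule XS_field_facts(2)[OF n cL]) simp
    have iu: "integrable M (\<lambda>\<omega>. u (XS (m + n0) (real m) \<omega>))" by (rule XS_field_facts(1)[OF n Ck2D(3)[OF u(1)]])
    have "(LINT \<omega>|M. 1 * (u (XS (m + n0) (real m) \<omega>) - u (XS (m + n0) 0 \<omega>) - ?G \<omega>)) = 0"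
      by (rule dynkin_XS[OF n _ _ u(1), where L=1]) auto
    then have "(LINT \<omega>|M. u (XS (m + n0) (real m) \<omega>)) - u x = (LINT \<omega>|M. ?G \<omega>)"
      using iG iu by (simp add: XS_0 prob_space)
    moreover have "0 \<le> (LINT \<omega>|M. u (XS (m + n0) (real m) \<omega>))"
      using u(2) by (intro Bochner_Integration.integral_nonneg) (auto simp: less_imp_le)
    moreover have "(LINT \<omega>|M. ?J m \<omega>) \<le> (LINT \<omega>|M. - ?G \<omega>)"
    proof (rule integral_mono[OF iJ])
      show "integrable M (\<lambda>\<omega>. - ?G \<omega>)" using iG by simp
      fix \<omega> assume \<omega>: "\<omega> \<in> space M"
      have si: "set_integrable lborel {0<..real m} (\<lambda>r. GS u (m + n0) r \<omega>)"
        unfolding GS_def by (rule XS_field_facts(3)[OF n cL \<omega>])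
      have "?J m \<omega> \<le> time_integral 0 (real m) (\<lambda>r. - GS u (m + n0) r \<omega>)"
      proof (rule set_integral_mono[OF XS_field_facts(3)[OF n cu \<omega>]])
        show "set_integrable lborel {0<..real m} (\<lambda>r. - GS u (m + n0) r \<omega>)"
          using set_integrable_mult_right[of "-1", OF si] by simp
        show "(if alive (m + n0) r \<omega> then \<kappa> * u (XS (m + n0) r \<omega>) else 0) \<le> - GS u (m + n0) r \<omega>" for r
          using Lu[of "XS (m + n0) r \<omega>"] by (simp add: GS_def)
      qed
      also have "\<dots> = - ?G \<omega>"
        using set_integral_mult_right[of lborel "{0<..real m}" "-1" "\<lambda>r. GS u (m + n0) r \<omega>"] by simp
      finally show "?J m \<omega> \<le> - ?G \<omega>" .
    qed
    moreover have "(LINT \<omega>|M. - ?G \<omega>) = - (LINT \<omega>|M. ?G \<omega>)" by simp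
    ultimately show ?thesis by linarith
  qed
qed

text \<open>One index drives everything: radius \<open>m + n0\<close>, mesh \<open>1 / 2^m\<close>,
  and \<open>m * 2^m\<close> steps, that is, horizon \<open>m\<close>. The upcrossing bound depends
  only on the two levels and on \<open>q * u x\<close>.\<close>

lemma AE_finite_upcrossings:
  assumes n0: "norm x \<le> real n0" and f: "Ck 2 f" "\<And>y. 0 \<le> f y" and u: "Ck 2 u" "\<And>y. 0 < u y" and q: "0 \<le> q"
    and Lu: "\<And>y. gen_op a \<beta> u y \<le> 0" and Lf: "\<And>y. gen_op a \<beta> f y + q * gen_op a \<beta> u y \<le> 0"
    and lev: "0 \<le> \<alpha>" "\<alpha> < \<beta>'"
  shows "AE \<omega> in M. \<exists>N::nat. \<not> (\<forall>\<^sub>F m in sequentially. real N \<le> real (upcrossings \<alpha> \<beta>' (\<lambda>k. f (XS (m + n0) (real k / 2 ^ m) \<omega>)) (m * 2 ^ m)))"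
proof (rule AE_finite_liminf_level)
  have n: "norm x \<le> real (m + n0)" for m using n0 by simp
  fix m
  have grid: "0 \<le> real k / 2 ^ m" "real k / 2 ^ m \<le> real (Suc k) / 2 ^ m" for k by (auto simp: divide_right_mono)
  have sub: "subalgebra (F (real k / 2 ^ m)) (F (real j / 2 ^ m))" if "j \<le> k" for j k
    using sets_F_mono[of "real j / 2 ^ m" "real k / 2 ^ m"] that by (auto simp: subalgebra_def divide_right_mono)
  have fm: "(\<lambda>\<omega>. f (XS (m + n0) (real k / 2 ^ m) \<omega>)) \<in> borel_measurable (F (real k / 2 ^ m))" for k
    by (rule measurable_compose[OF XS_adapted[OF grid(1)] borel_measurable_continuous_onI[OF Ck2D(3)[OF f(1)]]])
  have fi: "integrable M (\<lambda>\<omega>. f (XS (m + n0) (real k / 2 ^ m) \<omega>))" for k by (rule XS_field_facts(1)[OF n Ck2D(3)[OF f(1)]])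
  have ui: "integrable M (\<lambda>\<omega>. q * u (XS (m + n0) (real k / 2 ^ m) \<omega>))" for k
    by (intro integrable_mult_right XS_field_facts(1)[OF n Ck2D(3)[OF u(1)]])
  have un: "0 \<le> q * u y" for y using q u(2)[of y] by simp
  have dU: "(LINT \<omega>|M. indicator E \<omega> * (q * u (XS (m + n0) (real (Suc k) / 2 ^ m) \<omega>) - q * u (XS (m + n0) (real k / 2 ^ m) \<omega>))) \<le> 0" if E: "E \<in> sets (F (real k / 2 ^ m))" for k E
    using supermartingale_XS[OF n grid u(1) u(1) _ E, of 0 q] Lu q by (simp add: right_diff_distrib mult_nonneg_nonpos)
  have dfU: "(LINT \<omega>|M. indicator E \<omega> * (f (XS (m + n0) (real (Suc k) / 2 ^ m) \<omega>) - f (XS (m + n0) (real k / 2 ^ m) \<omega>)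
      + (q * u (XS (m + n0) (real (Suc k) / 2 ^ m) \<omega>) - q * u (XS (m + n0) (real k / 2 ^ m) \<omega>)))) \<le> 0" if E: "E \<in> sets (F (real k / 2 ^ m))" for k E
    using supermartingale_XS[OF n grid f(1) u(1) _ E, of 1 q] Lf by (simp add: right_diff_distrib)
  note up = expected_upcrossings[where G="\<lambda>k. F (real k / 2 ^ m)" and f="\<lambda>k \<omega>. f (XS (m + n0) (real k / 2 ^ m) \<omega>)" and U="\<lambda>k \<omega>. q * u (XS (m + n0) (real k / 2 ^ m) \<omega>)" and K="m * 2 ^ m",
      OF lev subalg_F sub fm fi f(2) ui un dU dfU]
  show "integrable M (\<lambda>\<omega>. real (upcrossings \<alpha> \<beta>' (\<lambda>k. f (XS (m + n0) (real k / 2 ^ m) \<omega>)) (m * 2 ^ m)))" by (rule up(3))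
  have u0: "(LINT \<omega>|M. q * u (XS (m + n0) (real 0 / 2 ^ m) \<omega>)) = q * u x" by (simp add: XS_0 prob_space)
  have pos: "0 < \<beta>' - \<alpha>" using lev by simp
  show "(LINT \<omega>|M. real (upcrossings \<alpha> \<beta>' (\<lambda>k. f (XS (m + n0) (real k / 2 ^ m) \<omega>)) (m * 2 ^ m))) \<le> (\<alpha> + q * u x) / (\<beta>' - \<alpha>)"
    unfolding pos_le_divide_eq[OF pos] using up(1) unfolding u0 by (simp only: mult.commute)
qed simp

text \<open>The set whose infimum defines the exit time is empty. With \<open>S_infinite\<close>
  this excludes explosion of a bounded path.\<close>

lemma bounded_path_immortal:
  assumes \<omega>: "\<omega> \<in> space M" and b: "\<And>t. 0 \<le> t \<Longrightarrow> ereal t < \<zeta> \<omega> \<Longrightarrow> norm (X t \<omega>) < real n"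
  shows "S n \<omega> = \<infinity>"
proof -
  have "{ereal t |t. 0 \<le> t \<and> ereal t < \<zeta> \<omega> \<and> real n \<le> norm (X t \<omega>)} = {}"
    using b by (auto simp: not_le[symmetric])
  then show ?thesis unfolding exit_time_def by (simp only: Inf_empty top_ereal_def)
qed

lemma AE_escape:
  assumes u: "Ck 2 u" "\<And>y. 0 < u y" and \<kappa>: "0 < \<kappa>" and Lu: "\<And>y. gen_op a \<beta> u y \<le> - \<kappa> * u y"
  shows "AE \<omega> in M. \<exists>T\<ge>0. ereal T < \<zeta> \<omega> \<and> (\<forall>t\<ge>T. ereal t < \<zeta> \<omega> \<longrightarrow> real R < norm (X t \<omega>))"
proof -
  obtain n0 :: nat where n0: "norm x \<le> real n0" using real_arch_simple by blast
  \<comment> \<open>A margin of 1, so that \<open>f\<close> is bounded below by a positive number on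
    the ball of radius \<open>R\<close>.\<close>
  define \<rho> where "\<rho> = real R + 1"
  have \<rho>: "0 < \<rho>" by (simp add: \<rho>_def)
  obtain f c where f: "Ck 2 f" "\<And>x. 0 \<le> f x" "\<And>x. f x > 0 \<longleftrightarrow> norm x < \<rho>" "\<And>x y. norm x \<le> norm y \<Longrightarrow> f y \<le> f x"
    and c: "0 \<le> c" "\<And>x. norm x \<le> \<rho> \<Longrightarrow> \<bar>gen_op a \<beta> f x\<bar> \<le> c" "\<And>x. \<rho> < norm x \<Longrightarrow> gen_op a \<beta> f x = 0"
    using bump_function[OF \<rho> a_cont \<beta>_cont] by metis
  have "\<exists>y\<in>cball 0 \<rho>. \<forall>z\<in>cball 0 \<rho>. u y \<le> u z"
    using \<rho> by (intro continuous_attains_inf continuous_on_subset[OF Ck2D(3)[OF u(1)]]) auto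
  then obtain y0 where "\<forall>z\<in>cball 0 \<rho>. u y0 \<le> u z" by blast
  then have y0: "u y0 \<le> u z" if "norm z \<le> \<rho>" for z using that by simp
  \<comment> \<open>On the ball of radius \<rho> the minimum of \<open>u\<close> is
    \<open>u y0\<close>, so there \<open>q * (\<kappa> * u)\<close> dominates the bound
    \<open>c\<close> for the generator of \<open>f\<close>; outside, that generator is 0.\<close>
  define q where "q = c / (\<kappa> * u y0)"
  have \<kappa>u: "0 < \<kappa> * u y0" using \<kappa> u(2) by simp
  have q: "0 \<le> q" "q * (\<kappa> * u y0) = c" using c(1) \<kappa>u by (auto simp: q_def)
  have Lu0: "gen_op a \<beta> u y \<le> 0" for y
    using Lu[of y] mult_pos_pos[OF \<kappa> u(2)[of y]] by linarith
  have Lf: "gen_op a \<beta> f y + q * gen_op a \<beta> u y \<le> 0" for y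
  proof (cases "norm y \<le> \<rho>")
    case True
    have "\<kappa> * u y0 \<le> - gen_op a \<beta> u y" using Lu[of y] mult_left_mono[OF y0[OF True], of \<kappa>] \<kappa> by linarith
    then have "c \<le> q * (- gen_op a \<beta> u y)" unfolding q(2)[symmetric] using q(1) by (intro mult_left_mono) auto
    then show ?thesis using c(2)[OF True] by auto
  next
    case False
    then show ?thesis using c(3)[of y] Lu0[of y] q(1) by (simp add: mult_nonneg_nonpos)
  qed
  \<comment> \<open>A point on the sphere of radius \<open>R\<close>: by radial monotonicity the
    minimum \<open>b\<close> of \<open>f\<close> over the ball is attained there. Both upcrossing
    levels are placed strictly between 0 and \<open>b\<close>.\<close>
  define v0 :: "real^'n" where "v0 = real R *\<^sub>R axis undefined 1"
  have v0: "norm v0 = real R" by (simp add: v0_def)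
  define b where "b = f v0"
  have b: "0 < b" unfolding b_def f(3) v0 by (simp add: \<rho>_def)
  define \<alpha> where "\<alpha> = b / 3"
  define \<beta>' where "\<beta>' = 2 * b / 3"
  have lev: "0 < \<alpha>" "\<alpha> < \<beta>'" "\<beta>' < b" using b by (auto simp: \<alpha>_def \<beta>'_def)
  have fin: "\<beta>' < f y" if "norm y \<le> real R" for y using f(4)[of y v0] that v0 lev by (simp add: b_def)
  have e1: "AE \<omega> in M. \<exists>N::nat. \<not> (\<forall>\<^sub>F m in sequentially. real N \<le> real (upcrossings \<alpha> \<beta>' (\<lambda>k. f (XS (m + n0) (real k / 2 ^ m) \<omega>)) (m * 2 ^ m)))"
    by (rule AE_finite_upcrossings[OF n0 f(1,2) u q(1) Lu0 Lf]) (use lev in auto)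
  note e2 = AE_finite_occupation[OF n0 u \<kappa> Lu]
  show ?thesis
    using e1 e2 X_start AE_space
  proof eventually_elim
    case (elim \<omega>)
    then have \<omega>: "\<omega> \<in> space M" and X0: "X 0 \<omega> = x" by auto
    \<comment> \<open>Exit times increase to the lifetime, so a fixed time before it precedes the
      exit from all large balls, and the stopped path agrees with \<open>X\<close> up to it.\<close>
    have near: "\<forall>\<^sub>F m in sequentially. ereal t < S (m + n0) \<omega>" if t: "ereal t < \<zeta> \<omega>" for t
    proof -
      obtain m0 where m0: "ereal t < S m0 \<omega>" using t unfolding life_SUP[OF \<omega>] less_SUP_iff by blast
      show ?thesis using eventually_ge_at_top[of m0]
      proof eventually_elim
        case (elim m)
        then show ?case using m0 S_mono[of m0 "m + n0" \<omega>] by (simp add: less_le_trans)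
      qed
    qed
    \<comment> \<open>Otherwise after every time before the lifetime a low value of \<open>f\<close>
      is followed by a high one, and the upcrossing counts of the stopped paths eventually exceed
      every level.\<close>
    have "\<exists>T\<ge>0. ereal T < \<zeta> \<omega> \<and> (\<forall>r s. T < r \<longrightarrow> r < s \<longrightarrow> ereal s < \<zeta> \<omega> \<longrightarrow> \<not> (f (X r \<omega>) < \<alpha> \<and> \<beta>' < f (X s \<omega>)))"
    proof (rule ccontr)
      assume neg: "\<not> ?thesis"
      have "\<forall>\<^sub>F m in sequentially. N \<le> upcrossings \<alpha> \<beta>' (\<lambda>k. f (XS (m + n0) (real k / 2 ^ m) \<omega>)) (m * 2 ^ m)" for N
      proof (rule dyadic_upcrossings[where \<zeta>="\<zeta> \<omega>" and y="\<lambda>t. f (X t \<omega>)", OF lev(2) life_pos[OF \<omega>]])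
        show "continuous_on {t. 0 \<le> t \<and> ereal t < \<zeta> \<omega>} (\<lambda>t. f (X t \<omega>))"
          by (rule continuous_on_compose2[OF Ck2D(3)[OF f(1)] X_cont[OF \<omega>]]) simp
        show "\<exists>r s. T < r \<and> r < s \<and> ereal s < \<zeta> \<omega> \<and> f (X r \<omega>) < \<alpha> \<and> \<beta>' < f (X s \<omega>)" if "0 \<le> T" "ereal T < \<zeta> \<omega>" for T
          using neg that by blast
        show "\<forall>\<^sub>F m in sequentially. \<forall>k. real k / 2 ^ m \<le> t \<longrightarrow> f (XS (m + n0) (real k / 2 ^ m) \<omega>) = f (X (real k / 2 ^ m) \<omega>)" if t: "0 \<le> t" "ereal t < \<zeta> \<omega>" for t
          using near[OF t(2)]
        proof eventually_elim
          case (elim m)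
          show ?case
          proof (intro allI impI)
            fix k assume "real k / 2 ^ m \<le> t"
            then have "ereal (real k / 2 ^ m) \<le> S (m + n0) \<omega>" using elim by (meson ereal_less_eq(3) less_imp_le order_trans)
            then show "f (XS (m + n0) (real k / 2 ^ m) \<omega>) = f (X (real k / 2 ^ m) \<omega>)" using XS_eq[OF _ _ X0] by simp
          qed
        qed
      qed
      then show False using elim(1) by simp
    qed
    then obtain T0 where T0: "0 \<le> T0" "ereal T0 < \<zeta> \<omega>"
      and noup: "\<And>r s. T0 < r \<Longrightarrow> r < s \<Longrightarrow> ereal s < \<zeta> \<omega> \<Longrightarrow> \<not> (f (X r \<omega>) < \<alpha> \<and> \<beta>' < f (X s \<omega>))" by blast
    show ?case
    proof (rule ccontr)
      assume neg: "\<not> ?case"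
      have return: "\<exists>t\<ge>T. ereal t < \<zeta> \<omega> \<and> \<beta>' < f (X t \<omega>)" if T: "0 \<le> T" "ereal T < \<zeta> \<omega>" for T
      proof -
        obtain t where "T \<le> t" "ereal t < \<zeta> \<omega>" "norm (X t \<omega>) \<le> real R" using neg T by (auto simp: not_less)
        then show ?thesis using fin by blast
      qed
      \<comment> \<open>A value of \<open>f\<close> below \<alpha> after \<open>T0\<close> would be
        followed by another visit to the ball of radius \<open>R\<close>, where \<open>f\<close>
        exceeds \<open>\<beta>'\<close>: a forbidden upcrossing. So \<open>f\<close> stays positive,
        which traps the path in the ball of radius \<rho>.\<close>
      have inside: "norm (X r \<omega>) < \<rho>" if r: "T0 < r" "ereal r < \<zeta> \<omega>" for r
      proof -
        have "\<alpha> \<le> f (X r \<omega>)"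
        proof (rule ccontr)
          assume lt: "\<not> \<alpha> \<le> f (X r \<omega>)"
          \<comment> \<open>A time strictly after \<open>r\<close> but before the lifetime, because
            \<open>noup\<close> asks for \<open>r < s\<close>.\<close>
          obtain T where T: "r < T" "ereal T < \<zeta> \<omega>" using r(2) by (metis ereal_dense2 less_ereal.simps(1))
          obtain t where "T \<le> t" "ereal t < \<zeta> \<omega>" "\<beta>' < f (X t \<omega>)" using return[OF _ T(2)] T(1) r(1) T0(1) by auto
          then show False using noup[OF r(1), of t] lt T(1) by auto
        qed
        then show ?thesis using f(3)[of "X r \<omega>"] lev(1) by simp
      qed
      \<comment> \<open>The initial piece up to \<open>T0\<close> is bounded by compactness, the
        rest by \<open>inside\<close>; a bounded path has infinite lifetime.\<close>
      have "compact ((\<lambda>t. X t \<omega>) ` {0..T0})"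
      proof (rule compact_continuous_image)
        show "continuous_on {0..T0} (\<lambda>t. X t \<omega>)"
          by (rule continuous_on_subset[OF X_cont[OF \<omega>]]) (use T0 in \<open>auto intro: le_less_trans[of "ereal _" "ereal T0"]\<close>)
      qed simp
      then have "bounded ((\<lambda>t. X t \<omega>) ` {0..T0})" by (rule compact_imp_bounded)
      then obtain k where k: "\<And>t. t \<in> {0..T0} \<Longrightarrow> norm (X t \<omega>) \<le> k" unfolding bounded_iff by blast
      obtain n1 :: nat where n1: "max k \<rho> < real n1" using reals_Archimedean2 by blast
      have "norm (X t \<omega>) < real n1" if "0 \<le> t" "ereal t < \<zeta> \<omega>" for t
        using inside[of t] k[of t] that n1 by (cases "t \<le> T0") auto
      then have S1: "S n1 \<omega> = \<infinity>" by (rule bounded_path_immortal[OF \<omega>])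
      then have \<zeta>: "\<zeta> \<omega> = \<infinity>" by (rule S_infinite[OF \<omega>])
      \<comment> \<open>From time \<open>T0\<close> on the integrand is at least
        \<open>\<kappa> * u y0\<close>, so the occupation integral grows at least linearly in
        \<open>m\<close>. For \<open>m \<ge> n1\<close> the stopping has no effect on this
        path.\<close>
      have big: "\<kappa> * u y0 * (real m - T0) \<le> time_integral 0 (real m) (\<lambda>r. if alive (m + n0) r \<omega> then \<kappa> * u (XS (m + n0) r \<omega>) else 0)"
        if m: "n1 \<le> m" "T0 \<le> real m" for m
      proof -
        have Sm: "S (m + n0) \<omega> = \<infinity>" using S_mono[of n1 "m + n0" \<omega>] m(1) S1 by simp
        have nm: "norm x \<le> real (m + n0)" using n0 by simp
        have "\<kappa> * u y0 * (real m - T0) = (LINT r:{0<..real m}|lborel. indicator {T0<..real m} r * (\<kappa> * u y0))"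
        proof -
          have e: "(LINT r:{0<..real m}|lborel. indicator {T0<..real m} r * (\<kappa> * u y0)) = (LINT r|lborel. indicator {T0<..real m} r *\<^sub>R (\<kappa> * u y0))"
            unfolding set_lebesgue_integral_def using T0(1) by (intro Bochner_Integration.integral_cong refl) (auto simp: indicator_def)
          show ?thesis unfolding e using m(2) by simp
        qed
        also have "\<dots> \<le> time_integral 0 (real m) (\<lambda>r. if alive (m + n0) r \<omega> then \<kappa> * u (XS (m + n0) r \<omega>) else 0)"
        proof (rule set_integral_mono)
          show "set_integrable lborel {0<..real m} (\<lambda>r. indicator {T0<..real m} r * (\<kappa> * u y0))"
            by (rule time_integrable[where C="\<kappa> * u y0"]) (use \<kappa>u in \<open>auto simp: indicator_def\<close>)
          have "continuous_on UNIV (\<lambda>y. \<kappa> * u y)" by (intro continuous_intros Ck2D(3)[OF u(1)])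
          from XS_field_facts(3)[OF nm this \<omega>]
          show "set_integrable lborel {0<..real m} (\<lambda>r. if alive (m + n0) r \<omega> then \<kappa> * u (XS (m + n0) r \<omega>) else 0)" .
          fix r assume r: "r \<in> {0<..real m}"
          have al: "alive (m + n0) r \<omega>" using r Sm X0 by (simp add: alive_def)
          have eq: "XS (m + n0) r \<omega> = X r \<omega>" using r Sm X0 by (intro XS_eq) auto
          show "indicator {T0<..real m} r * (\<kappa> * u y0) \<le> (if alive (m + n0) r \<omega> then \<kappa> * u (XS (m + n0) r \<omega>) else 0)"
          proof (cases "T0 < r")
            case True
            then have "u y0 \<le> u (X r \<omega>)" using inside[of r] \<zeta> y0 by simp
            then show ?thesis using al eq \<kappa> True r by simp
          next
            case False
            then show ?thesis using al \<kappa> u(2)[of "XS (m + n0) r \<omega>"] by simp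
          qed
        qed
        finally show ?thesis .
      qed
      have "\<forall>\<^sub>F m in sequentially. real N \<le> time_integral 0 (real m) (\<lambda>r. if alive (m + n0) r \<omega> then \<kappa> * u (XS (m + n0) r \<omega>) else 0)" for N :: nat
      proof -
        obtain m2 :: nat where m2: "real N / (\<kappa> * u y0) + T0 \<le> real m2" using real_arch_simple by blast
        show ?thesis
          using eventually_ge_at_top[of n1] eventually_ge_at_top[of m2]
        proof eventually_elim
          case (elim m)
          have "real N / (\<kappa> * u y0) \<le> real m - T0" using m2 elim(2) by linarith
          then have N: "real N \<le> \<kappa> * u y0 * (real m - T0)" using \<kappa>u by (simp add: divide_le_eq mult.commute)
          have "0 \<le> real N / (\<kappa> * u y0)" using \<kappa>u by (intro divide_nonneg_pos) auto
          then have "T0 \<le> real m" using m2 elim(2) by linarith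
          from big[OF elim(1) this] N show ?case by linarith
        qed
      qed
      then show False using elim(2) by blast
    qed
  qed
qed

text \<open>Balls of integer radius exhaust all compact sets, so a single null set serves them all;
  this matters because \<open>transient\<close> quantifies over compact sets inside the almost sure
  statement.\<close>

theorem lyapunov_transient:
  assumes u: "Ck 2 u" "\<And>y. 0 < u y" and \<kappa>: "0 < \<kappa>" and Lu: "\<And>y. gen_op a \<beta> u y \<le> - \<kappa> * u y"
  shows "transient M X \<zeta>"
proof -
  have "AE \<omega> in M. \<forall>R::nat. \<exists>T\<ge>0. ereal T < \<zeta> \<omega> \<and> (\<forall>t\<ge>T. ereal t < \<zeta> \<omega> \<longrightarrow> real R < norm (X t \<omega>))"
    unfolding AE_all_countable using AE_escape[OF u \<kappa> Lu] by blast
  then show ?thesis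
    unfolding transient_def
  proof eventually_elim
    case (elim \<omega>)
    show ?case
    proof (intro allI impI)
      fix K :: "(real^'n) set" assume "compact K"
      then obtain r where r: "\<And>y. y \<in> K \<Longrightarrow> norm y \<le> r" using compact_imp_bounded bounded_iff by metis
      obtain R :: nat where R: "r \<le> real R" using real_arch_simple by blast
      from elim[rule_format, of R] obtain T where T: "0 \<le> T" "ereal T < \<zeta> \<omega>" "\<And>t. T \<le> t \<Longrightarrow> ereal t < \<zeta> \<omega> \<Longrightarrow> real R < norm (X t \<omega>)" by blast
      have "X t \<omega> \<notin> K" if "T \<le> t" "ereal t < \<zeta> \<omega>" for t
        using T(3)[OF that] r[of "X t \<omega>"] R by linarith
      then show "\<exists>T\<ge>0. ereal T < \<zeta> \<omega> \<and> (\<forall>t\<ge>T. ereal t < \<zeta> \<omega> \<longrightarrow> X t \<omega> \<notin> K)" using T by blast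
    qed
  qed
qed

end

lemma smooth_imp_Ck: "smooth f \<Longrightarrow> Ck k f"
  by (simp add: smooth_def)

lemma smooth_continuous: "smooth f \<Longrightarrow> continuous_on UNIV f"
  by (rule Ck_continuous[OF smooth_imp_Ck])

lemma smooth_pd_continuous: "smooth f \<Longrightarrow> continuous_on UNIV (pd i f)"
  using smooth_imp_Ck[of f "Suc 0"] by simp

theorem theorem3p2:
  fixes a ah \<sigma> :: "real^'n::finite \<Rightarrow> real^'n^'n"
    and b :: "real^'n \<Rightarrow> real^'n"
    and V W0 W :: "real^'n \<Rightarrow> real"
    and \<nu>1 \<nu>2 \<mu>1 \<mu>2 \<Lambda> \<Lambda>star :: real
    and M :: "'w measure" and F :: "real \<Rightarrow> 'w measure"
    and B X :: "real \<Rightarrow> 'w \<Rightarrow> real^'n"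
    and \<zeta> :: "'w \<Rightarrow> ereal" and x :: "real^'n"
  assumes "\<And>y. transpose (a y) = a y" and "\<And>y. transpose (ah y) = ah y"
    and "\<And>i j. smooth (\<lambda>y. a y $ i $ j)" and "\<And>i j. smooth (\<lambda>y. ah y $ i $ j)"
    and "\<And>i. smooth (\<lambda>y. b y $ i)" and "smooth V"
    and "0 < \<nu>1" "\<nu>1 < \<nu>2" "0 < \<mu>1" "\<mu>1 < \<mu>2"
    and "\<And>y \<xi>. \<nu>1 * (norm \<xi>)\<^sup>2 \<le> \<xi> \<bullet> (a y *v \<xi>) \<and> \<xi> \<bullet> (a y *v \<xi>) \<le> \<nu>2 * (norm \<xi>)\<^sup>2"
    and "\<And>y \<xi>. \<mu>1 * (norm \<xi>)\<^sup>2 \<le> \<xi> \<bullet> (ah y *v \<xi>) \<and> \<xi> \<bullet> (ah y *v \<xi>) \<le> \<mu>2 * (norm \<xi>)\<^sup>2"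
    and "smooth W0" and "filterlim (ergodic_op a ah b V W0) at_bot at_infinity"
    and "is_critical_value a ah b V \<Lambda>star"
    and "ergodic_solution a ah b V W \<Lambda>"
    and "\<And>y. is_psd_sqrt (a y) (\<sigma> y)"
    and "filtered_prob_space M F" and "brownian_motion M F B"
    and "sde_solution M F B (\<lambda>y. btilde a b y + ah y *v grad W y) \<sigma> x X \<zeta>"
    and "\<Lambda> > \<Lambda>star"
  shows "transient M X \<zeta>"
proof -
  note sym = assms(1,2) and sa = assms(3) and sah = assms(4) and sb = assms(5) and \<nu> = assms(7,8) and \<mu> = assms(9)
    and ell = assms(11) and ellh = assms(12) and crit = assms(15) and W = assms(16) and sq = assms(17)
    and filt = assms(18) and bm = assms(19) and sde = assms(20) and less = assms(21)
  let ?\<beta> = "\<lambda>y. btilde a b y + ah y *v grad W y"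
  obtain Ws where Ws: "ergodic_solution a ah b V Ws \<Lambda>star" using crit by (auto simp: is_critical_value_def)
  have \<nu>2: "0 < \<nu>2" using \<nu> by linarith
  obtain u \<kappa> where u: "Ck 2 u" "\<And>x. 0 < u x" "0 < \<kappa>" "\<And>x. gen_op a ?\<beta> u x \<le> - \<kappa> * u x"
    using lyapunov_function[OF sym sa \<nu>2 conjunct2[OF ell] \<mu> conjunct1[OF ellh] Ws W less] by blast
  have sW: "smooth W" using W by (simp add: ergodic_solution_def)
  \<comment> \<open>First derivatives of \<open>a\<close> and of \<open>W\<close> enter the drift;
    smoothness makes it continuous, hence bounded on each ball as the stopping argument
    requires.\<close>
  have "continuous_on UNIV (\<lambda>y. ?\<beta> y $ i)" for i
  proof -
    have "continuous_on UNIV (\<lambda>y. b y $ i + (1/2) * (\<Sum>j\<in>UNIV. pd j (\<lambda>y. a y $ i $ j) y) + (\<Sum>j\<in>UNIV. ah y $ i $ j * pd j W y))"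
      by (intro continuous_on_add continuous_on_mult continuous_on_sum continuous_on_const smooth_pd_continuous sa sW
          smooth_continuous sb sah)
    then show ?thesis by (simp add: btilde_def matrix_vector_mult_def grad_def)
  qed
  moreover have "prob_space M" using filt by (simp add: filtered_prob_space_def)
  ultimately interpret explosive_diffusion M F B a \<sigma> ?\<beta> x X \<zeta> \<nu>1 \<nu>2
    using filt bm sde sq \<nu> ell smooth_continuous[OF sa]
    by (intro explosive_diffusion.intro bm_space.intro bm_space_axioms.intro explosive_diffusion_axioms.intro) auto
  show ?thesis by (rule lyapunov_transient[OF u])
qed

end
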